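(* Let $j\colon \Gamma_3\times\mathbb{R}\to\mathbb{R}$ satisfy: (a) $j(\cdot,r)$ is measurable on $\Gamma_3$ for all $r\in\mathbb{R}$; (b) $j(x,\cdot)$ is locally Lipschitz for a.e. $x\in\Gamma_3$; (c) there exist $c_0,c_1\ge 0$ such that $|\partial j(x,r)|\le c_0+c_1|r|$ for all $r\in\mathbb{R}$, a.e. $x\in\Gamma_3$; (d) there is a constant $b\in\mathbb{R}$ such that $j^0(x,r;b-r)\le 0$ for all $r\in\mathbb{R}$, a.e. $x\in\Gamma_3$. Let $f\in V_0^*$ and $\alpha>0$. Then there exists $u\in V_0$ such that $$a(u,v)+\alpha\int_{\Gamma_3} j^0(x,u(x);v(x))\,d\Gamma\ \ge\ f(v)\quad\text{for all } v\in V_0 .$$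
   Context: Setting: $\Omega\subset\mathbb{R}^d$ is a bounded domain with regular boundary $\Gamma$ (in particular Lipschitz, so that the trace operator $\gamma\colon H^1(\Omega)\to L^2(\Gamma)$ is defined, bounded and compact). $\Gamma$ is the union of three disjoint measurable portions $\Gamma_1,\Gamma_2,\Gamma_3$, each of positive $(d-1)$-dimensional Hausdorff measure. $V=H^1(\Omega)$ and $V_0=\{v\in V: v=0 \text{ on }\Gamma_1\}$ (trace sense), with norms $\|v\|_V=(\|v\|^2_{L^2(\Omega)}+\|\nabla v\|^2_{L^2(\Omega;\mathbb{R}^d)})^{1/2}$ and $\|v\|_{V_0}=\|\nabla v\|_{L^2(\Omega;\mathbb{R}^d)}$, which are equivalent on $V_0$. $V_0^*$ is the dual of $V_0$. $a(u,v)=\int_\Omega \nabla u\cdot\nabla v\,dx$. In boundary integrals a function of $V$ is identified with its trace. Clarke calculus: for a locally Lipschitz $\varphi\colon\mathbb{R}\to\mathbb{R}$, the generalized directional derivative is $\varphi^0(r;s)=\limsup_{y\to r,\ \lambda\to0^+}\frac{\varphi(y+\lambda s)-\varphi(y)}{\lambda}$, and the generalized gradient is $\partial\varphi(r)=\{\zeta\in\mathbb{R}:\varphi^0(r;s)\ge\zeta s\ \text{for all } s\in\mathbb{R}\}$. For $j$ these are taken in the second variable, written $j^0(x,r;s)$ and $\partial j(x,r)$. The bound $|\partial j(x,r)|\le C$ means $|\zeta|\le C$ for every $\zeta\in\partial j(x,r)$. "For all $r\in\mathbb{R}$, a.e. $x\in\Gamma_3$" means: for a.e. $x\in\Gamma_3$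 the condition holds for all $r\in\mathbb{R}$. *)

theory Defs
  imports "HOL-Analysis.Analysis"
begin

subsection \<open>Hausdorff measure\<close>

text \<open>The constant \<open>unit_ball_vol k / 2 ^ k\<close> makes the measure coincide with Lebesgue measure on
  \<open>k\<close>-dimensional space. Covering sets are required to be bounded because \<^const>\<open>diameter\<close> is
  meaningful for bounded sets only. The case distinction matters for \<open>k = 0\<close> only, where the
  empty set must not contribute.\<close>

definition hausdorff_pre :: "nat \<Rightarrow> real \<Rightarrow> 'a::metric_space set \<Rightarrow> ennreal" where
  "hausdorff_pre k \<delta> A =
     (INF E \<in> {E :: nat \<Rightarrow> 'a set. A \<subseteq> (\<Union>i. E i) \<and> (\<forall>i. bounded (E i) \<and> diameter (E i) \<le> \<delta>)}.
        \<Sum>i. if E i = {} then 0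
            else ennreal (unit_ball_vol (real k) / 2 ^ k * diameter (E i) ^ k))"

definition hausdorff_outer :: "nat \<Rightarrow> 'a::metric_space set \<Rightarrow> ennreal" where
  "hausdorff_outer k A = (SUP \<delta> \<in> {0<..}. hausdorff_pre k \<delta> A)"

text \<open>The measurable sets are those of Caratheodory, so that the measure is complete.\<close>

definition hausdorff_measure :: "nat \<Rightarrow> 'a::metric_space measure" where
  "hausdorff_measure k =
     measure_of UNIV (lambda_system UNIV UNIV (hausdorff_outer k)) (hausdorff_outer k)"

definition surface_measure :: "'a::euclidean_space set \<Rightarrow> 'a measure" where
  "surface_measure \<Omega> = restrict_space (hausdorff_measure (DIM('a) - 1)) (frontier \<Omega>)"


subsection \<open>Lipschitz boundary\<close>

text \<open>Near each boundary point, in an orthonormal frame whose last vector is \<open>e\<close>, the set is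
  the region strictly above the graph of a Lipschitz function \<open>\<psi>\<close> of the remaining coordinates,
  i.e. of the orthogonal projection onto the hyperplane \<open>{y. y \<bullet> e = 0}\<close>.\<close>

definition lipschitz_boundary :: "'a::euclidean_space set \<Rightarrow> bool" where
  "lipschitz_boundary \<Omega> \<longleftrightarrow>
     (\<forall>p \<in> frontier \<Omega>. \<exists>r > 0. \<exists>e. \<exists>\<psi> :: 'a \<Rightarrow> real. \<exists>L.
        norm e = 1 \<and> L-lipschitz_on {y. y \<bullet> e = 0} \<psi> \<and>
        \<Omega> \<inter> ball p r = {x \<in> ball p r. x \<bullet> e > \<psi> (x - (x \<bullet> e) *\<^sub>R e)})"


subsection \<open>Smooth functions and weak gradients\<close>

text \<open>\<open>D bs\<close> is the iterated partial derivative along the basis vectors in \<open>bs\<close>: infinite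
  differentiability means that all of these exist and are again differentiable.\<close>

definition smooth :: "('a::euclidean_space \<Rightarrow> real) \<Rightarrow> bool" where
  "smooth \<phi> \<longleftrightarrow>
     (\<exists>D :: 'a list \<Rightarrow> 'a \<Rightarrow> real. D [] = \<phi> \<and>
        (\<forall>bs x. set bs \<subseteq> Basis \<longrightarrow>
           (D bs has_derivative (\<lambda>h. \<Sum>b\<in>Basis. (h \<bullet> b) * D (b # bs) x)) (at x)))"

definition gradient :: "('a::euclidean_space \<Rightarrow> real) \<Rightarrow> 'a \<Rightarrow> 'a" where
  "gradient \<phi> x = (\<Sum>b\<in>Basis. frechet_derivative \<phi> (at x) b *\<^sub>R b)"

definition test_function :: "'a::euclidean_space set \<Rightarrow> ('a \<Rightarrow> real) \<Rightarrow> bool" where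
  "test_function \<Omega> \<phi> \<longleftrightarrow>
     smooth \<phi> \<and> compact (closure {x. \<phi> x \<noteq> 0}) \<and> closure {x. \<phi> x \<noteq> 0} \<subseteq> \<Omega>"

definition locally_integrable ::
  "'a::euclidean_space set \<Rightarrow> ('a \<Rightarrow> 'b::{banach, second_countable_topology}) \<Rightarrow> bool" where
  "locally_integrable \<Omega> u \<longleftrightarrow> (\<forall>K. compact K \<and> K \<subseteq> \<Omega> \<longrightarrow> set_integrable lebesgue K u)"

definition has_weak_gradient ::
  "'a::euclidean_space set \<Rightarrow> ('a \<Rightarrow> real) \<Rightarrow> ('a \<Rightarrow> 'a) \<Rightarrow> bool" where
  "has_weak_gradient \<Omega> u G \<longleftrightarrow>
     locally_integrable \<Omega> u \<and> locally_integrable \<Omega> G \<and>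
     (\<forall>\<phi>. test_function \<Omega> \<phi> \<longrightarrow>
        (\<integral>x. u x *\<^sub>R gradient \<phi> x \<partial>lebesgue_on \<Omega>) = - (\<integral>x. \<phi> x *\<^sub>R G x \<partial>lebesgue_on \<Omega>))"

text \<open>Unique up to a null set of \<open>\<Omega>\<close>.\<close>

definition weak_gradient :: "'a::euclidean_space set \<Rightarrow> ('a \<Rightarrow> real) \<Rightarrow> 'a \<Rightarrow> 'a" where
  "weak_gradient \<Omega> u = (SOME G. has_weak_gradient \<Omega> u G)"


subsection \<open>Sobolev space and traces\<close>

text \<open>Elements of \<open>L\<^sup>2\<close> and \<open>H\<^sup>1\<close> are represented by functions rather than by classes modulo
  equality almost everywhere.\<close>

definition square_integrable :: "'a measure \<Rightarrow> ('a \<Rightarrow> 'b::euclidean_space) \<Rightarrow> bool" where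
  "square_integrable M f \<longleftrightarrow> f \<in> borel_measurable M \<and> integrable M (\<lambda>x. (norm (f x))\<^sup>2)"

definition l2_norm :: "'a measure \<Rightarrow> ('a \<Rightarrow> 'b::euclidean_space) \<Rightarrow> real" where
  "l2_norm M f = sqrt (\<integral>x. (norm (f x))\<^sup>2 \<partial>M)"

definition H1 :: "'a::euclidean_space set \<Rightarrow> ('a \<Rightarrow> real) set" where
  "H1 \<Omega> = {u. square_integrable (lebesgue_on \<Omega>) u \<and>
              (\<exists>G. has_weak_gradient \<Omega> u G \<and> square_integrable (lebesgue_on \<Omega>) G)}"

definition H1_norm :: "'a::euclidean_space set \<Rightarrow> ('a \<Rightarrow> real) \<Rightarrow> real" where
  "H1_norm \<Omega> u =
     sqrt ((l2_norm (lebesgue_on \<Omega>) u)\<^sup>2 + (l2_norm (lebesgue_on \<Omega>) (weak_gradient \<Omega> u))\<^sup>2)"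

text \<open>The trace is the extension by continuity of the restriction map \<open>\<phi> \<mapsto> \<phi>|\<^sub>\<Gamma>\<close> on functions
  smooth up to the boundary. On a bounded domain with Lipschitz boundary every \<open>u \<in> H1 \<Omega>\<close> has
  a trace, unique up to a null set of the boundary.\<close>

definition has_trace :: "'a::euclidean_space set \<Rightarrow> ('a \<Rightarrow> real) \<Rightarrow> ('a \<Rightarrow> real) \<Rightarrow> bool" where
  "has_trace \<Omega> u g \<longleftrightarrow>
     square_integrable (surface_measure \<Omega>) g \<and>
     (\<exists>\<Phi> :: nat \<Rightarrow> 'a \<Rightarrow> real. (\<forall>n. smooth (\<Phi> n)) \<and>
        (\<lambda>n. H1_norm \<Omega> (\<lambda>x. \<Phi> n x - u x)) \<longlonglongrightarrow> 0 \<and>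
        (\<lambda>n. l2_norm (surface_measure \<Omega>) (\<lambda>x. \<Phi> n x - g x)) \<longlonglongrightarrow> 0)"

definition boundary_trace :: "'a::euclidean_space set \<Rightarrow> ('a \<Rightarrow> real) \<Rightarrow> 'a \<Rightarrow> real" where
  "boundary_trace \<Omega> u = (SOME g. has_trace \<Omega> u g)"

definition V0 :: "'a::euclidean_space set \<Rightarrow> 'a set \<Rightarrow> ('a \<Rightarrow> real) set" where
  "V0 \<Omega> \<Gamma>\<^sub>1 = {v \<in> H1 \<Omega>. \<exists>g. has_trace \<Omega> v g \<and>
                              (AE x in restrict_space (surface_measure \<Omega>) \<Gamma>\<^sub>1. g x = 0)}"

definition V0_norm :: "'a::euclidean_space set \<Rightarrow> ('a \<Rightarrow> real) \<Rightarrow> real" where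
  "V0_norm \<Omega> v = l2_norm (lebesgue_on \<Omega>) (weak_gradient \<Omega> v)"

text \<open>Continuity forces a functional to respect equality almost everywhere, so this is the dual of
  the space of classes.\<close>

definition V0_dual :: "'a::euclidean_space set \<Rightarrow> 'a set \<Rightarrow> (('a \<Rightarrow> real) \<Rightarrow> real) set" where
  "V0_dual \<Omega> \<Gamma>\<^sub>1 = {f.
     (\<forall>v \<in> V0 \<Omega> \<Gamma>\<^sub>1. \<forall>w \<in> V0 \<Omega> \<Gamma>\<^sub>1. f (\<lambda>x. v x + w x) = f v + f w) \<and>
     (\<forall>v \<in> V0 \<Omega> \<Gamma>\<^sub>1. \<forall>c. f (\<lambda>x. c * v x) = c * f v) \<and>
     (\<exists>C. \<forall>v \<in> V0 \<Omega> \<Gamma>\<^sub>1. \<bar>f v\<bar> \<le> C * V0_norm \<Omega> v)}"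

definition dirichlet_form :: "'a::euclidean_space set \<Rightarrow> ('a \<Rightarrow> real) \<Rightarrow> ('a \<Rightarrow> real) \<Rightarrow> real" where
  "dirichlet_form \<Omega> u v =
     (\<integral>x. weak_gradient \<Omega> u x \<bullet> weak_gradient \<Omega> v x \<partial>lebesgue_on \<Omega>)"


subsection \<open>Clarke calculus\<close>

definition locally_lipschitz :: "(real \<Rightarrow> real) \<Rightarrow> bool" where
  "locally_lipschitz \<phi> \<longleftrightarrow> (\<forall>r. \<exists>\<epsilon> > 0. \<exists>L. L-lipschitz_on (cball r \<epsilon>) \<phi>)"

text \<open>The upper limit is taken in the extended reals; it is finite for locally Lipschitz \<open>\<phi>\<close>.
  The filter lets \<open>(y, t)\<close> tend to \<open>(r, 0+)\<close>, with \<open>y = r\<close> allowed.\<close>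

definition clarke_deriv :: "(real \<Rightarrow> real) \<Rightarrow> real \<Rightarrow> real \<Rightarrow> real" where
  "clarke_deriv \<phi> r s =
     real_of_ereal (Limsup (nhds r \<times>\<^sub>F at_right 0)
       (\<lambda>(y, t). ereal ((\<phi> (y + t * s) - \<phi> y) / t)))"

definition clarke_gradient :: "(real \<Rightarrow> real) \<Rightarrow> real \<Rightarrow> real set" where
  "clarke_gradient \<phi> r = {\<zeta>. \<forall>s. clarke_deriv \<phi> r s \<ge> \<zeta> * s}"

end

theory Submission
  imports Defs "HOL-Complex_Analysis.Great_Picard"
begin

text \<open>Condition (d) forces \<open>b\<close> to be a global minimiser of \<open>j x\<close>, by the mean value property of the
  Clarke derivative. Hence the energy \<open>a(v, v) / 2 - f v + \<alpha> \<integral> (j(x, v) - j(x, b)) d\<Gamma>\<close> is coercive and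
  bounded below on \<open>V\<^sub>0\<close>. Minimising sequences have traces that converge in \<open>L\<^sup>2(\<Gamma>)\<close>, where the
  nonconvex term is lower semicontinuous, while the remaining part is convex; so a minimiser \<open>u\<close> exists.
  Dividing \<open>E(u + t v) \<ge> E(u)\<close> by \<open>t\<close> and letting \<open>t\<close> tend to 0 bounds the limit of the difference
  quotients of \<open>j\<close> by its generalized directional derivative.

  Traces are handled through averages over a cone of directions pointing into the domain. Translating
  along these directions transports surface measure into Lebesgue measure with a bounded density, so the
  trace inequality, compactness of traces and Poincare's inequality all follow from one estimate for the
  sum of Lebesgue and surface measure.\<close>

section \<open>Hausdorff measure\<close>

text \<open>No chart, partition of unity, extension operator or density theorem enters.
  \<open>has_trace\<close> supplies smooth approximants as part of its definition, so every estimate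
  is proved for functions smooth on the whole space and carried over through \<open>approx\<close>.
  The obstacle is then the boundary: \<open>surface_measure\<close> is a Caratheodory measure
  without a parametrisation. Only upper bounds for it are required, and these follow by counting
  balls: two nearby boundary points cannot differ by a short vector inside the open cone, for
  otherwise one of them would lie in \<open>\<Omega>\<close>.

  That (d) makes \<open>b\<close> a minimiser fixes the sign of the nonconvex term. Coercivity then
  comes from the quadratic part alone, whatever the sizes of \<open>\<alpha>\<close> and of the
  growth constants, and Fatou's lemma gives lower semicontinuity. The derivative of the nonconvex
  term is never computed: the Clarke derivative only has to dominate difference quotients with base
  point \<open>u(x)\<close>, and the positive part of the excess vanishes in the limit by dominated
  convergence.\<close>

lemma metric_outer_measure_closed:
  fixes \<mu> :: "'a::metric_space set \<Rightarrow> ennreal"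
  assumes mono: "\<And>A B. A \<subseteq> B \<Longrightarrow> \<mu> A \<le> \<mu> B"
    and empty: "\<mu> {} = 0"
    and csub: "\<And>A :: nat \<Rightarrow> 'a set. \<mu> (\<Union>i. A i) \<le> (\<Sum>i. \<mu> (A i))"
    and sep: "\<And>A B d. d > 0 \<Longrightarrow> (\<And>x y. x \<in> A \<Longrightarrow> y \<in> B \<Longrightarrow> d \<le> dist x y) \<Longrightarrow> \<mu> A + \<mu> B \<le> \<mu> (A \<union> B)"
    and F: "closed F"
  shows "\<mu> (A \<inter> F) + \<mu> (A - F) \<le> \<mu> A"
proof (cases "F = {} \<or> \<mu> A = \<infinity>")
  case True
  then show ?thesis by (auto simp: empty)
next
  case False
  then have Fne: "F \<noteq> {}" and fin: "\<mu> A < \<infinity>" by (auto simp: less_top)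
  define g where "g x = infdist x F" for x
  define a where "a k = 1 / (real k + 1)" for k :: nat
  have apos: "a k > 0" and adec: "a (Suc k) < a k" for k
    by (auto simp: a_def field_simps)
  have amono: "a k \<le> a l" if "l \<le> k" for k l
    using that by (auto simp: a_def field_simps)
  \<comment> \<open>Shells around \<open>F\<close>. Two different shells of equal parity have a
    further shell between them and so a positive distance; \<open>sep\<close> then makes each parity
    class sum to at most \<open>\<mu> A\<close>. The sum over all shells is thus finite and its tail
    small.\<close>
  define Rg where "Rg k = {x \<in> A. a (Suc k) \<le> g x \<and> g x < a k}" for k
  define An where "An n = {x \<in> A. a n \<le> g x}" for n
  have gdist: "g x - g y \<le> dist x y" for x y
    unfolding g_def using infdist_triangle[of x F y] by (simp add: dist_commute)
  have un2: "\<mu> (X \<union> Y) \<le> \<mu> X + \<mu> Y" for X Y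
  proof -
    have "\<mu> (X \<union> Y) \<le> \<mu> (\<Union>i. binaryset X Y i)"
      by (intro mono) (simp add: UN_binaryset_eq)
    also have "\<dots> \<le> (\<Sum>i. \<mu> (binaryset X Y i))" by (rule csub)
    also have "\<dots> = \<mu> X + \<mu> Y"
      by (rule suminf_binaryset_eq) (rule empty)
    finally show ?thesis .
  qed
  have parity: "(\<Sum>k<n. \<mu> (Rg (2 * k + p))) \<le> \<mu> (\<Union>k<n. Rg (2 * k + p))" for n p
  proof (induction n)
    case (Suc n)
    have "(\<Sum>k<Suc n. \<mu> (Rg (2 * k + p))) \<le> \<mu> (\<Union>k<n. Rg (2 * k + p)) + \<mu> (Rg (2 * n + p))"
      using Suc by (simp add: add_right_mono)
    also have "\<dots> \<le> \<mu> ((\<Union>k<n. Rg (2 * k + p)) \<union> Rg (2 * n + p))"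
    proof (cases "n = 0")
      case True
      then show ?thesis by (simp add: empty)
    next
      case n: False
      show ?thesis
      proof (rule sep)
        show "a (2 * n + p - 1) - a (2 * n + p) > 0"
          using adec[of "2 * n + p - 1"] n by simp
        fix x y assume x: "x \<in> (\<Union>k<n. Rg (2 * k + p))" and y: "y \<in> Rg (2 * n + p)"
        from x obtain k where k: "k < n" "a (Suc (2 * k + p)) \<le> g x" by (auto simp: Rg_def)
        have "a (2 * n + p - 1) \<le> a (Suc (2 * k + p))" by (rule amono) (use k in auto)
        with k y gdist[of x y] show "a (2 * n + p - 1) - a (2 * n + p) \<le> dist x y"
          by (auto simp: Rg_def)
      qed
    qed
    also have "(\<Union>k<n. Rg (2 * k + p)) \<union> Rg (2 * n + p) = (\<Union>k<Suc n. Rg (2 * k + p))"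
      by (auto simp: less_Suc_eq)
    finally show ?case .
  qed (simp add: empty)
  have parA: "(\<Sum>k<n. \<mu> (Rg (2 * k + p))) \<le> \<mu> A" for n p
    by (rule order.trans[OF parity mono]) (auto simp: Rg_def)
  have split: "(\<Sum>k<2*n. \<mu> (Rg k)) = (\<Sum>k<n. \<mu> (Rg (2 * k + 0))) + (\<Sum>k<n. \<mu> (Rg (2 * k + 1)))" for n
    by (induction n) (simp_all add: ac_simps)
  have "(\<Sum>k<n. \<mu> (Rg k)) \<le> \<mu> A + \<mu> A" for n
  proof -
    have "(\<Sum>k<n. \<mu> (Rg k)) \<le> (\<Sum>k<2*n. \<mu> (Rg k))"
      by (rule sum_mono2) auto
    also have "\<dots> \<le> \<mu> A + \<mu> A" unfolding split by (intro add_mono parA)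
    finally show ?thesis .
  qed
  then have "(\<Sum>k. \<mu> (Rg k)) \<le> \<mu> A + \<mu> A"
    by (simp add: suminf_eq_SUP SUP_least)
  also have "\<dots> < \<infinity>" using fin by simp
  finally have sumfin: "(\<Sum>k. \<mu> (Rg k)) < \<infinity>" .
  define s where "s k = enn2real (\<mu> (Rg k))" for k
  have s: "\<mu> (Rg k) = ennreal (s k)" for k
  proof -
    have "\<mu> (Rg k) \<le> \<mu> A" by (rule mono) (auto simp: Rg_def)
    with fin have "\<mu> (Rg k) < \<infinity>" by (rule le_less_trans[rotated])
    then show ?thesis by (simp add: s_def)
  qed
  have s0: "s k \<ge> 0" for k by (simp add: s_def)
  have sums: "summable s"
    by (rule summable_suminf_not_top[of s]) (use s0 sumfin s in auto)
  show ?thesis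
  proof (rule ennreal_le_epsilon)
    fix e :: real assume e: "0 < e"
    obtain N where N: "norm (\<Sum>i. s (i + N)) < e"
      using suminf_exist_split[OF e sums] by blast
    have sumsN: "summable (\<lambda>i. s (i + N))" using sums by (simp add: summable_iff_shift)
    have tail: "(\<Sum>i. \<mu> (Rg (i + N))) \<le> ennreal e"
    proof -
      have "(\<Sum>i. \<mu> (Rg (i + N))) = ennreal (\<Sum>i. s (i + N))"
        unfolding s by (rule suminf_ennreal2[OF _ sumsN]) (rule s0)
      also have "\<dots> \<le> ennreal e" using N by (intro ennreal_leI) auto
      finally show ?thesis .
    qed
    \<comment> \<open>\<open>F\<close> is closed, so a point outside it has positive distance and
      falls either into \<open>An N\<close> or into a shell of index at least
      \<open>N\<close>.\<close>
    have "A - F \<subseteq> An N \<union> (\<Union>i. Rg (i + N))"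
    proof
      fix x assume x: "x \<in> A - F"
      have gpos: "g x > 0"
        using x F Fne unfolding g_def by (simp add: infdist_pos_not_in_closed)
      show "x \<in> An N \<union> (\<Union>i. Rg (i + N))"
      proof (cases "a N \<le> g x")
        case True then show ?thesis using x by (auto simp: An_def)
      next
        case lt: False
        obtain m where m: "1 / (real m + 1) < g x" using gpos
          by (metis inverse_eq_divide of_nat_Suc reals_Archimedean add.commute)
        then have ex: "a m \<le> g x" by (simp add: a_def)
        define k where "k = (LEAST k. a k \<le> g x)"
        have k: "a k \<le> g x" unfolding k_def using ex by (rule LeastI)
        have kN: "k > N" using k lt amono[of k N] by (meson not_less order.trans)
        then obtain i where i: "k = Suc (i + N)" by (metis add.commute less_iff_Suc_add)
        have "\<not> a (i + N) \<le> g x"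
          using not_less_Least[of "i + N" "\<lambda>k. a k \<le> g x"] i unfolding k_def by simp
        with k i x have "x \<in> Rg (i + N)" by (auto simp: Rg_def)
        then show ?thesis by blast
      qed
    qed
    then have "\<mu> (A - F) \<le> \<mu> (An N \<union> (\<Union>i. Rg (i + N)))" by (rule mono)
    also have "\<dots> \<le> \<mu> (An N) + (\<Sum>i. \<mu> (Rg (i + N)))"
      by (rule order.trans[OF un2 add_left_mono[OF csub]])
    also have "\<dots> \<le> \<mu> (An N) + ennreal e" using tail by (rule add_left_mono)
    finally have 1: "\<mu> (A - F) \<le> \<mu> (An N) + ennreal e" .
    have "\<mu> (A \<inter> F) + \<mu> (An N) \<le> \<mu> (A \<inter> F \<union> An N)"
    proof (rule sep)
      show "a N > 0" by (rule apos)
      fix x y assume "x \<in> A \<inter> F" "y \<in> An N"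
      then show "a N \<le> dist x y" using gdist[of y x]
        by (auto simp: An_def g_def dist_commute)
    qed
    also have "\<dots> \<le> \<mu> A" by (rule mono) (auto simp: An_def)
    finally have 2: "\<mu> (A \<inter> F) + \<mu> (An N) \<le> \<mu> A" .
    have "\<mu> (A \<inter> F) + \<mu> (A - F) \<le> \<mu> (A \<inter> F) + (\<mu> (An N) + ennreal e)"
      using 1 by (rule add_left_mono)
    also have "\<dots> \<le> \<mu> A + ennreal e"
      using 2 by (metis add.assoc add_right_mono)
    finally show "\<mu> (A \<inter> F) + \<mu> (A - F) \<le> \<mu> A + ennreal e" .
  qed
qed

section \<open>Hausdorff outer measure, ball coverings and Caratheodory measurability\<close>

context
  fixes k :: nat
begin

private definition hw :: "'a::metric_space set \<Rightarrow> ennreal" where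
  "hw E = (if E = {} then 0 else ennreal (unit_ball_vol (real k) / 2 ^ k * diameter E ^ k))"

private lemma hausdorff_pre_le:
  assumes "A \<subseteq> (\<Union>i. E i)" "\<And>i. bounded (E i)" "\<And>i. diameter (E i) \<le> \<delta>"
  shows "hausdorff_pre k \<delta> A \<le> (\<Sum>i. hw (E i))"
  unfolding hausdorff_pre_def hw_def by (rule INF_lower) (use assms in auto)

private lemma hausdorff_pre_lessE:
  assumes "hausdorff_pre k \<delta> A < c"
  obtains E :: "nat \<Rightarrow> 'a::metric_space set" where "A \<subseteq> (\<Union>i. E i)" "\<And>i. bounded (E i)" "\<And>i. diameter (E i) \<le> \<delta>"
    "(\<Sum>i. hw (E i)) < c"
  using assms unfolding hausdorff_pre_def hw_def INF_less_iff by auto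

private lemma hausdorff_pre_mono: "A \<subseteq> B \<Longrightarrow> hausdorff_pre k \<delta> A \<le> hausdorff_pre k \<delta> B"
  unfolding hausdorff_pre_def by (rule INF_superset_mono) auto

private lemma hausdorff_pre_antimono: "\<delta> \<le> \<delta>' \<Longrightarrow> hausdorff_pre k \<delta>' A \<le> hausdorff_pre k \<delta> A"
  unfolding hausdorff_pre_def by (rule INF_superset_mono) (auto intro: order.trans)

private lemma hausdorff_pre_csub:
  fixes A :: "nat \<Rightarrow> 'a::metric_space set"
  shows "hausdorff_pre k \<delta> (\<Union>i. A i) \<le> (\<Sum>i. hausdorff_pre k \<delta> (A i))"
proof (rule ennreal_le_epsilon)
  fix e :: real assume "0 < e" "(\<Sum>n. hausdorff_pre k \<delta> (A n)) < top"
  then have *: "hausdorff_pre k \<delta> (A n) < hausdorff_pre k \<delta> (A n) + e * (1/2)^Suc n" for n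
    by (auto simp add: less_top dest!: ennreal_suminf_lessD)
  have "\<exists>E. A n \<subseteq> (\<Union>i. E i) \<and> (\<forall>i. bounded (E i)) \<and> (\<forall>i. diameter (E i) \<le> \<delta>) \<and>
    (\<Sum>i. hw (E i)) \<le> hausdorff_pre k \<delta> (A n) + e * (1/2)^Suc n" for n
    using hausdorff_pre_lessE[OF *[of n]] by (metis less_imp_le)
  then obtain B where B: "\<And>n. A n \<subseteq> (\<Union>i. B n i)" "\<And>n i. bounded (B n i)" "\<And>n i. diameter (B n i) \<le> \<delta>"
    and Ble: "\<And>n. (\<Sum>i. hw (B n i)) \<le> hausdorff_pre k \<delta> (A n) + e * (1/2)^Suc n"
    by metis
  \<comment> \<open>The covers of all \<open>A n\<close>, each optimal up to
    \<open>e / 2 ^ (n + 1)\<close>, are merged into one sequence through the pairing of natural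
    numbers.\<close>
  define C where "C = case_prod B o prod_decode"
  have A_C: "(\<Union>i. A i) \<subseteq> (\<Union>i. C i)"
    using B(1) by (auto simp add: C_def subset_eq) (metis prod.case prod_encode_inverse)
  have "hausdorff_pre k \<delta> (\<Union>i. A i) \<le> (\<Sum>i. hw (C i))"
    by (rule hausdorff_pre_le[OF A_C]) (auto simp: C_def B split: prod.split)
  also have "\<dots> = (\<Sum>n. \<Sum>i. hw (B n i))"
    unfolding C_def comp_def by (intro suminf_ennreal_2dimen) auto
  also have "\<dots> \<le> (\<Sum>n. hausdorff_pre k \<delta> (A n) + e * (1/2) ^ Suc n)"
    by (intro suminf_le suminf_nonneg allI Ble) auto
  also have "... = (\<Sum>n. hausdorff_pre k \<delta> (A n)) + (\<Sum>n. ennreal e * ennreal ((1/2) ^ Suc n))"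
    using \<open>0 < e\<close> by (subst suminf_add[symmetric])
                     (auto simp del: ennreal_suminf_cmult simp add: ennreal_mult[symmetric])
  also have "\<dots> = (\<Sum>n. hausdorff_pre k \<delta> (A n)) + e"
    unfolding ennreal_suminf_cmult
    by (subst suminf_ennreal_eq[OF zero_le_power power_half_series]) auto
  finally show "hausdorff_pre k \<delta> (\<Union>i. A i) \<le> (\<Sum>n. hausdorff_pre k \<delta> (A n)) + e" .
qed

text \<open>A covering set of diameter at most \<open>\<delta> < d\<close> cannot meet both
  \<open>A\<close> and \<open>B\<close>, so each cover of the union splits into a cover of
  \<open>A\<close> and one of \<open>B\<close>.\<close>

private lemma hausdorff_pre_sep:
  fixes A B :: "'a::metric_space set"
  assumes d: "\<delta> < d" "\<And>x y. x \<in> A \<Longrightarrow> y \<in> B \<Longrightarrow> d \<le> dist x y"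
  shows "hausdorff_pre k \<delta> A + hausdorff_pre k \<delta> B \<le> hausdorff_pre k \<delta> (A \<union> B)"
proof -
  have "hausdorff_pre k \<delta> A + hausdorff_pre k \<delta> B \<le> (\<Sum>i. hw (E i))"
    if E: "A \<union> B \<subseteq> (\<Union>i. E i)" "\<And>i. bounded (E i)" "\<And>i. diameter (E i) \<le> \<delta>" for E :: "nat \<Rightarrow> 'a set"
  proof -
    define part where "part X i = (if E i \<inter> X = {} then {} else E i)" for X i
    have "0 \<le> \<delta>" using E(3)[of 0] diameter_ge_0[OF E(2)[of 0]] by simp
    have le: "hausdorff_pre k \<delta> X \<le> (\<Sum>i. hw (part X i))" if "X \<subseteq> (\<Union>i. E i)" for X
    proof (rule hausdorff_pre_le)
      show "X \<subseteq> (\<Union>i. part X i)"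
      proof
        fix x assume "x \<in> X"
        with that obtain i where "x \<in> E i" by blast
        then have "x \<in> part X i" using \<open>x \<in> X\<close> by (auto simp: part_def)
        then show "x \<in> (\<Union>i. part X i)" by blast
      qed
    qed (use E \<open>0 \<le> \<delta>\<close> in \<open>auto simp: part_def\<close>)
    have disj: "E i \<inter> A = {} \<or> E i \<inter> B = {}" for i
    proof (rule ccontr)
      assume "\<not> ?thesis"
      then obtain x y where xy: "x \<in> E i" "x \<in> A" "y \<in> E i" "y \<in> B" by blast
      have "dist x y \<le> diameter (E i)" using xy E(2) by (intro diameter_bounded_bound)
      with E(3)[of i] d(1) d(2)[OF xy(2,4)] show False by linarith
    qed
    have "hausdorff_pre k \<delta> A + hausdorff_pre k \<delta> B \<le> (\<Sum>i. hw (part A i)) + (\<Sum>i. hw (part B i))"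
      by (intro add_mono le) (use E in auto)
    also have "\<dots> = (\<Sum>i. hw (part A i) + hw (part B i))" by (rule suminf_add) auto
    also have "\<dots> \<le> (\<Sum>i. hw (E i))"
    proof (intro suminf_le allI)
      fix i
      show "hw (part A i) + hw (part B i) \<le> hw (E i)"
        using disj[of i] by (auto simp: part_def hw_def)
    qed auto
    finally show ?thesis .
  qed
  then show ?thesis
    unfolding hausdorff_pre_def[of _ _ "A \<union> B"] hw_def[symmetric] by (intro INF_greatest) auto
qed

private lemma pre_le_outer: "\<delta> > 0 \<Longrightarrow> hausdorff_pre k \<delta> A \<le> hausdorff_outer k A"
  unfolding hausdorff_outer_def by (rule SUP_upper) auto

lemma hausdorff_outer_mono: "A \<subseteq> B \<Longrightarrow> hausdorff_outer k A \<le> hausdorff_outer k B"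
  unfolding hausdorff_outer_def by (intro SUP_mono) (auto intro: hausdorff_pre_mono)

lemma hausdorff_outer_empty: "hausdorff_outer k ({} :: 'a::metric_space set) = 0"
proof -
  have "hausdorff_pre k \<delta> ({} :: 'a set) = 0" if "\<delta> > 0" for \<delta>
  proof -
    have "hausdorff_pre k \<delta> ({} :: 'a set) \<le> (\<Sum>i. hw ((\<lambda>_. {} :: 'a set) i))"
      by (rule hausdorff_pre_le[of _ "\<lambda>_. {}"]) (use that in auto)
    then show ?thesis by (simp add: hw_def)
  qed
  then show ?thesis by (simp add: hausdorff_outer_def)
qed

lemma hausdorff_outer_csub:
  fixes A :: "nat \<Rightarrow> 'a::metric_space set"
  shows "hausdorff_outer k (\<Union>i. A i) \<le> (\<Sum>i. hausdorff_outer k (A i))"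
  unfolding hausdorff_outer_def[of _ "\<Union>i. A i"]
  by (intro SUP_least order.trans[OF hausdorff_pre_csub] suminf_le) (auto intro: pre_le_outer)

lemma hausdorff_outer_sep:
  fixes A B :: "'a::metric_space set"
  assumes d: "d > 0" "\<And>x y. x \<in> A \<Longrightarrow> y \<in> B \<Longrightarrow> d \<le> dist x y"
  shows "hausdorff_outer k A + hausdorff_outer k B \<le> hausdorff_outer k (A \<union> B)"
proof -
  have *: "hausdorff_pre k \<delta> A + hausdorff_pre k \<delta>' B \<le> hausdorff_outer k (A \<union> B)"
    if "\<delta> > 0" "\<delta>' > 0" for \<delta> \<delta>'
  proof -
    \<comment> \<open>At a scale below \<open>d\<close> every cover splits, and passing to a smaller
      scale only enlarges \<open>hausdorff_pre\<close>.\<close>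
    let ?m = "min (min \<delta> \<delta>') (d/2)"
    have "hausdorff_pre k \<delta> A + hausdorff_pre k \<delta>' B \<le> hausdorff_pre k ?m A + hausdorff_pre k ?m B"
      by (intro add_mono hausdorff_pre_antimono) auto
    also have "\<dots> \<le> hausdorff_pre k ?m (A \<union> B)"
      by (rule hausdorff_pre_sep[of _ d]) (use d in auto)
    also have "\<dots> \<le> hausdorff_outer k (A \<union> B)"
      by (rule pre_le_outer) (use that d in auto)
    finally show ?thesis .
  qed
  have "hausdorff_pre k \<delta> A + hausdorff_outer k B \<le> hausdorff_outer k (A \<union> B)" if "\<delta> > 0" for \<delta>
    unfolding hausdorff_outer_def[of _ B]
    by (subst ennreal_SUP_add_right) (use that * in \<open>auto intro!: SUP_least\<close>)
  then show ?thesis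
    unfolding hausdorff_outer_def[of _ A]
    by (subst ennreal_SUP_add_left[symmetric]) (auto intro!: SUP_least)
qed

text \<open>All upper bounds for the surface measure are obtained from this: it suffices to count
  balls at every small radius. A ball of radius \<open>\<epsilon>\<close> has diameter
  \<open>2 * \<epsilon>\<close>, which cancels the \<open>2 ^ k\<close> in the
  normalisation.\<close>

lemma hausdorff_outer_covering:
  fixes A :: "'a::euclidean_space set"
  assumes "\<And>\<epsilon>. 0 < \<epsilon> \<Longrightarrow> \<epsilon> < \<epsilon>0 \<Longrightarrow> \<exists>P. finite P \<and> A \<subseteq> (\<Union>x\<in>P. cball x \<epsilon>) \<and> real (card P) * \<epsilon> ^ k \<le> C"
    and "\<epsilon>0 > 0"
  shows "hausdorff_outer k A \<le> ennreal (unit_ball_vol (real k) * C)"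
  unfolding hausdorff_outer_def
proof (rule SUP_least)
  fix \<delta> :: real assume "\<delta> \<in> {0<..}"
  define \<epsilon> where "\<epsilon> = min (\<epsilon>0/2) (\<delta>/2)"
  have \<epsilon>: "0 < \<epsilon>" "\<epsilon> < \<epsilon>0" "2 * \<epsilon> \<le> \<delta>" using \<open>\<delta> \<in> {0<..}\<close> assms(2) by (auto simp: \<epsilon>_def)
  obtain P where P: "finite P" "A \<subseteq> (\<Union>x\<in>P. cball x \<epsilon>)" "real (card P) * \<epsilon> ^ k \<le> C"
    using assms(1)[OF \<epsilon>(1,2)] by blast
  obtain f where f: "bij_betw f {..<card P} P"
    using ex_bij_betw_nat_finite[OF P(1)] by (auto simp: atLeast0LessThan)
  define E where "E i = (if i < card P then cball (f i) \<epsilon> else {})" for i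
  have diam: "diameter (cball x \<epsilon>) = 2 * \<epsilon>" for x :: 'a
    using \<epsilon> by simp
  have "hausdorff_pre k \<delta> A \<le> (\<Sum>i. hw (E i))"
  proof (rule hausdorff_pre_le)
    show "A \<subseteq> (\<Union>i. E i)"
    proof
      fix x assume "x \<in> A"
      then obtain p where "p \<in> P" "x \<in> cball p \<epsilon>" using P by auto
      then have "p \<in> f ` {..<card P}" using f by (simp add: bij_betw_def)
      then obtain i where "i < card P" "f i = p" by auto
      then have "x \<in> E i" using \<open>x \<in> cball p \<epsilon>\<close> by (simp add: E_def)
      then show "x \<in> (\<Union>i. E i)" by blast
    qed
    show "bounded (E i)" for i by (simp add: E_def)
    show "diameter (E i) \<le> \<delta>" for i using diam[of "f i"] \<epsilon> by (auto simp: E_def)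
  qed
  also have "\<dots> = (\<Sum>i<card P. hw (E i))"
    by (rule suminf_finite) (auto simp: E_def hw_def)
  also have "\<dots> \<le> (\<Sum>i<card P. ennreal (unit_ball_vol (real k) * \<epsilon> ^ k))"
  proof (rule sum_mono)
    fix i assume i: "i \<in> {..<card P}"
    have "diameter (E i) ^ k \<le> (2 * \<epsilon>) ^ k"
      using diam[of "f i"] i \<epsilon> by (intro power_mono) (auto simp: E_def)
    then have "unit_ball_vol (real k) / 2 ^ k * diameter (E i) ^ k \<le> unit_ball_vol (real k) / 2 ^ k * (2 * \<epsilon>) ^ k"
      by (rule mult_left_mono) auto
    also have "\<dots> = unit_ball_vol (real k) * \<epsilon> ^ k" by (simp add: power_mult_distrib)
    finally show "hw (E i) \<le> ennreal (unit_ball_vol (real k) * \<epsilon> ^ k)"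
      by (auto simp: hw_def intro!: ennreal_leI)
  qed
  also have "\<dots> = ennreal (real (card P) * (unit_ball_vol (real k) * \<epsilon> ^ k))"
    using \<epsilon> by (simp add: ennreal_of_nat_eq_real_of_nat ennreal_mult' unit_ball_vol_nonneg)
  also have "\<dots> \<le> ennreal (unit_ball_vol (real k) * C)"
    using mult_left_mono[OF P(3), of "unit_ball_vol (real k)"]
    by (intro ennreal_leI) (simp add: ac_simps)
  finally show "hausdorff_pre k \<delta> A \<le> ennreal (unit_ball_vol (real k) * C)" .
qed

lemma hausdorff_outer_measure_space:
  "outer_measure_space UNIV (hausdorff_outer k :: 'a::metric_space set \<Rightarrow> ennreal)"
  unfolding outer_measure_space_def positive_def increasing_def countably_subadditive_def
  by (auto simp: hausdorff_outer_empty intro: hausdorff_outer_mono hausdorff_outer_csub)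

lemma
  shows space_hausdorff_measure [simp]: "space (hausdorff_measure k :: 'a::metric_space measure) = UNIV"
    and sets_hausdorff_measure:
      "sets (hausdorff_measure k :: 'a measure) = lambda_system UNIV UNIV (hausdorff_outer k)"
    and emeasure_hausdorff_measure:
      "A \<in> sets (hausdorff_measure k :: 'a measure) \<Longrightarrow> emeasure (hausdorff_measure k) A = hausdorff_outer k A"
proof -
  have "measure_space (UNIV :: 'a set) (lambda_system UNIV UNIV (hausdorff_outer k)) (hausdorff_outer k)"
    using sigma_algebra.caratheodory_lemma[OF sigma_algebra_Pow[of UNIV]] hausdorff_outer_measure_space
    by simp
  then have sa: "sigma_algebra (UNIV :: 'a set) (lambda_system UNIV UNIV (hausdorff_outer k))"
    and pos: "positive (lambda_system UNIV UNIV (hausdorff_outer k)) (hausdorff_outer k :: 'a set \<Rightarrow> ennreal)"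
    and ca: "countably_additive (lambda_system UNIV UNIV (hausdorff_outer k)) (hausdorff_outer k :: 'a set \<Rightarrow> ennreal)"
    by (auto simp: measure_space_def)
  interpret sigma_algebra "UNIV :: 'a set" "lambda_system UNIV UNIV (hausdorff_outer k)" by (rule sa)
  show "space (hausdorff_measure k :: 'a measure) = UNIV" by (simp add: hausdorff_measure_def)
  show *: "sets (hausdorff_measure k :: 'a measure) = lambda_system UNIV UNIV (hausdorff_outer k)"
    by (simp add: hausdorff_measure_def)
  show "A \<in> sets (hausdorff_measure k :: 'a measure) \<Longrightarrow> emeasure (hausdorff_measure k) A = hausdorff_outer k A"
    unfolding hausdorff_measure_def by (rule emeasure_measure_of_sigma[OF sa pos ca])
       (simp add: *[unfolded hausdorff_measure_def])
qed

text \<open>Subadditivity provides the other half of Caratheodory's condition.\<close>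

lemma hausdorff_measurable_iff:
  "A \<in> sets (hausdorff_measure k :: 'a::metric_space measure) \<longleftrightarrow>
   (\<forall>X. hausdorff_outer k (X \<inter> A) + hausdorff_outer k (X - A) \<le> hausdorff_outer k X)"
proof -
  have "hausdorff_outer k X \<le> hausdorff_outer k (X \<inter> A) + hausdorff_outer k (X - A)" for X
  proof -
    have "hausdorff_outer k X \<le> hausdorff_outer k (\<Union>i. binaryset (X \<inter> A) (X - A) i)"
      by (intro hausdorff_outer_mono) (auto simp: UN_binaryset_eq)
    also have "\<dots> \<le> (\<Sum>i. hausdorff_outer k (binaryset (X \<inter> A) (X - A) i))" by (rule hausdorff_outer_csub)
    also have "\<dots> = hausdorff_outer k (X \<inter> A) + hausdorff_outer k (X - A)"
      by (rule suminf_binaryset_eq) (rule hausdorff_outer_empty)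
    finally show ?thesis .
  qed
  then show ?thesis
    unfolding sets_hausdorff_measure lambda_system_def
    by (auto simp: Int_commute Diff_eq intro: antisym)
qed

lemma borel_sets_hausdorff: "sets (borel :: 'a::metric_space measure) \<subseteq> sets (hausdorff_measure k)"
proof -
  have "F \<in> sets (hausdorff_measure k)" if "closed F" for F :: "'a set"
    unfolding hausdorff_measurable_iff
    by (intro allI metric_outer_measure_closed that hausdorff_outer_mono hausdorff_outer_empty
        hausdorff_outer_csub hausdorff_outer_sep) auto
  then have "sigma_sets UNIV (Collect closed) \<subseteq> sets (hausdorff_measure k :: 'a measure)"
    using sets.sigma_sets_subset[of "Collect closed" "hausdorff_measure k :: 'a measure"] by auto
  then show ?thesis by (simp add: borel_eq_closed)
qed

text \<open>A subset of a null set contributes nothing to either side of Caratheodory's condition.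
  Completeness later allows integrands to be changed on null sets without losing
  measurability.\<close>

lemma complete_measure_hausdorff: "complete_measure (hausdorff_measure k :: 'a::metric_space measure)"
proof
  fix A B :: "'a set" assume "B \<subseteq> A" and A: "A \<in> null_sets (hausdorff_measure k)"
  then have "hausdorff_outer k A = 0" by (auto simp: emeasure_hausdorff_measure null_sets_def)
  then have "hausdorff_outer k (X \<inter> B) \<le> 0" for X
    using hausdorff_outer_mono[of "X \<inter> B" A] \<open>B \<subseteq> A\<close> by auto
  then have "hausdorff_outer k (X \<inter> B) = 0" for X by simp
  then show "B \<in> sets (hausdorff_measure k)"
    unfolding hausdorff_measurable_iff by (auto intro: hausdorff_outer_mono)
qed

end

section \<open>Square integrable functions\<close>

lemma square_integrable_measurable:
  "square_integrable M f \<Longrightarrow> f \<in> borel_measurable M"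
  by (simp add: square_integrable_def)

lemma square_integrable_integrable: "square_integrable M f \<Longrightarrow> integrable M (\<lambda>x. (norm (f x))\<^sup>2)"
  by (simp add: square_integrable_def)

lemma l2_norm_nonneg [simp]: "0 \<le> l2_norm M f"
  by (simp add: l2_norm_def)

lemma l2_norm_power2: "(l2_norm M f)\<^sup>2 = (\<integral>x. (norm (f x))\<^sup>2 \<partial>M)"
  by (simp add: l2_norm_def)

lemma nn_integral_l2_norm:
  "square_integrable M f \<Longrightarrow> (\<integral>\<^sup>+x. ennreal ((norm (f x))\<^sup>2) \<partial>M) = ennreal ((l2_norm M f)\<^sup>2)"
  unfolding l2_norm_power2 by (intro nn_integral_eq_integral square_integrable_integrable) auto

lemma square_integrableI_nn:
  assumes "f \<in> borel_measurable M" "(\<integral>\<^sup>+x. ennreal ((norm (f x))\<^sup>2) \<partial>M) < \<infinity>"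
  shows "square_integrable M f"
  unfolding square_integrable_def using assms by (auto intro!: integrableI_bounded)

lemma square_integrableI_nn_le:
  assumes "f \<in> borel_measurable M" "(\<integral>\<^sup>+x. ennreal ((norm (f x))\<^sup>2) \<partial>M) \<le> ennreal (c\<^sup>2)" "c \<ge> 0"
  shows "square_integrable M f" "l2_norm M f \<le> c"
proof -
  show *: "square_integrable M f"
    using assms by (intro square_integrableI_nn) (auto intro: le_less_trans)
  have "(l2_norm M f)\<^sup>2 \<le> c\<^sup>2"
    using assms(2) unfolding nn_integral_l2_norm[OF *] by (subst (asm) ennreal_le_iff) auto
  then show "l2_norm M f \<le> c" using assms(3) by (rule power2_le_imp_le)
qed

lemma inner_integrable:
  assumes "square_integrable M f" "square_integrable M g"
  shows "integrable M (\<lambda>x. f x \<bullet> g x)"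
proof (rule Bochner_Integration.integrable_bound)
  show "integrable M (\<lambda>x. (norm (f x))\<^sup>2 + (norm (g x))\<^sup>2)"
    using assms by (intro Bochner_Integration.integrable_add square_integrable_integrable)
  show "(\<lambda>x. f x \<bullet> g x) \<in> borel_measurable M"
    using assms[THEN square_integrable_measurable] by (intro borel_measurable_inner)
  show "AE x in M. norm (f x \<bullet> g x) \<le> norm ((norm (f x))\<^sup>2 + (norm (g x))\<^sup>2)"
  proof (rule AE_I2)
    fix x
    have "\<bar>f x \<bullet> g x\<bar> \<le> norm (f x) * norm (g x)" by (rule Cauchy_Schwarz_ineq2)
    also have "\<dots> \<le> (norm (f x))\<^sup>2 + (norm (g x))\<^sup>2"
      using sum_squares_bound[of "norm (f x)" "norm (g x)"]
        mult_nonneg_nonneg[OF norm_ge_zero[of "f x"] norm_ge_zero[of "g x"]] by linarith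
    finally show "norm (f x \<bullet> g x) \<le> norm ((norm (f x))\<^sup>2 + (norm (g x))\<^sup>2)" by simp
  qed
qed

lemma square_integrable_add:
  assumes "square_integrable M f" "square_integrable M g"
  shows "square_integrable M (\<lambda>x. f x + g x)"
proof -
  have "integrable M (\<lambda>x. (f x \<bullet> f x + g x \<bullet> g x) + 2 * (f x \<bullet> g x))"
    by (intro Bochner_Integration.integrable_add integrable_mult_right inner_integrable assms)
  moreover have "(\<lambda>x. (f x \<bullet> f x + g x \<bullet> g x) + 2 * (f x \<bullet> g x)) = (\<lambda>x. (norm (f x + g x))\<^sup>2)"
    by (auto simp: power2_norm_eq_inner algebra_simps inner_commute)
  ultimately show ?thesis
    using assms[THEN square_integrable_measurable] by (simp add: square_integrable_def)
qed

lemma square_integrable_scaleR: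
  "square_integrable M f \<Longrightarrow> square_integrable M (\<lambda>x. c *\<^sub>R f x)"
  by (auto simp: square_integrable_def power_mult_distrib)

lemma square_integrable_cmult:
  "square_integrable M f \<Longrightarrow> square_integrable M (\<lambda>x. c * f x :: real)"
  using square_integrable_scaleR[of M f c] by simp

lemma square_integrable_minus:
  "square_integrable M f \<Longrightarrow> square_integrable M (\<lambda>x. - f x)"
  by (simp add: square_integrable_def)

lemma square_integrable_diff:
  assumes "square_integrable M f" "square_integrable M g"
  shows "square_integrable M (\<lambda>x. f x - g x)"
  using square_integrable_add[OF assms(1) square_integrable_minus[OF assms(2)]] by simp

lemma square_integrable_const:
  "finite_measure M \<Longrightarrow> square_integrable M (\<lambda>_. c)"
  by (simp add: square_integrable_def finite_measure.integrable_const)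

lemma square_integrable_cong_AE:
  assumes "square_integrable M f" "g \<in> borel_measurable M" "AE x in M. f x = g x"
  shows "square_integrable M g"
proof -
  have [measurable]: "f \<in> borel_measurable M" using assms by (simp add: square_integrable_def)
  have "integrable M (\<lambda>x. (norm (f x))\<^sup>2) \<longleftrightarrow> integrable M (\<lambda>x. (norm (g x))\<^sup>2)"
    by (rule integrable_cong_AE) (use assms in auto)
  with assms show ?thesis by (auto simp: square_integrable_def)
qed

lemma l2_norm_cong_AE:
  assumes "f \<in> borel_measurable M" "g \<in> borel_measurable M" "AE x in M. f x = g x"
  shows "l2_norm M f = l2_norm M g"
  unfolding l2_norm_def by (intro arg_cong[where f = sqrt] integral_cong_AE) (use assms in auto)

lemma l2_norm_diff_commute: "l2_norm M (\<lambda>x. f x - g x) = l2_norm M (\<lambda>x. g x - f x)"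
  by (simp add: l2_norm_def norm_minus_commute)

lemma l2_norm_scaleR: "l2_norm M (\<lambda>x. c *\<^sub>R f x) = \<bar>c\<bar> * l2_norm M f"
  by (simp add: l2_norm_def power_mult_distrib real_sqrt_mult)

lemma l2_norm_cmult: "l2_norm M (\<lambda>x. c * f x :: real) = \<bar>c\<bar> * l2_norm M f"
  using l2_norm_scaleR[of M c f] by simp

lemma l2_norm_zero [simp]: "l2_norm M (\<lambda>x. 0) = 0"
  by (simp add: l2_norm_def)

lemma l2_norm_const: "finite_measure M \<Longrightarrow> l2_norm M (\<lambda>_. c) = norm c * sqrt (measure M (space M))"
  by (simp add: l2_norm_def real_sqrt_mult)

text \<open>A quadratic polynomial in \<open>t\<close>. Its nonnegativity gives the Cauchy-Schwarz
  inequality, and with gradients for \<open>f\<close> and \<open>g\<close> it describes the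
  Dirichlet energy along a line.\<close>

lemma integral_norm_add_power2:
  assumes "square_integrable M f" "square_integrable M g"
  shows "(l2_norm M (\<lambda>x. f x + t *\<^sub>R g x))\<^sup>2 = (l2_norm M f)\<^sup>2 + 2 * t * (\<integral>x. f x \<bullet> g x \<partial>M) + t\<^sup>2 * (l2_norm M g)\<^sup>2"
proof -
  have "(l2_norm M (\<lambda>x. f x + t *\<^sub>R g x))\<^sup>2 = (\<integral>x. (f x \<bullet> f x + 2 * t * (f x \<bullet> g x)) + t\<^sup>2 * (g x \<bullet> g x) \<partial>M)"
    unfolding l2_norm_power2
    by (intro Bochner_Integration.integral_cong refl, unfold power2_norm_eq_inner)
       (simp add: algebra_simps inner_commute power2_eq_square)
  also have "\<dots> = (\<integral>x. f x \<bullet> f x \<partial>M) + 2 * t * (\<integral>x. f x \<bullet> g x \<partial>M) + t\<^sup>2 * (\<integral>x. g x \<bullet> g x \<partial>M)"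
    using inner_integrable[OF assms(1) assms(1)] inner_integrable[OF assms] inner_integrable[OF assms(2) assms(2)]
    by simp
  finally show ?thesis by (simp add: l2_norm_power2 power2_norm_eq_inner)
qed

lemma l2_Cauchy_Schwarz:
  assumes f: "square_integrable M f" and g: "square_integrable M g"
  shows "\<bar>\<integral>x. f x \<bullet> g x \<partial>M\<bar> \<le> l2_norm M f * l2_norm M g"
proof -
  define a b c where "a = (l2_norm M f)\<^sup>2" and "b = (\<integral>x. f x \<bullet> g x \<partial>M)" and "c = (l2_norm M g)\<^sup>2"
  have pos: "0 \<le> a + 2 * t * b + t\<^sup>2 * c" for t
    using integral_norm_add_power2[OF f g, of t] unfolding a_def b_def c_def by (metis zero_le_power2)
  have "b\<^sup>2 \<le> a * c"
  proof (cases "c = 0")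
    case True
    have "b = 0"
    proof (rule ccontr)
      assume "b \<noteq> 0"
      \<comment> \<open>With \<open>c = 0\<close> the polynomial is affine, and this argument gives
        it the value \<open>-1\<close>.\<close>
      then show False using pos[of "- (a + 1) / (2 * b)"] True by (simp add: field_simps)
    qed
    then show ?thesis using True by simp
  next
    case False
    then have "c > 0" by (simp add: c_def less_le)
    \<comment> \<open>The vertex of the parabola.\<close>
    then show ?thesis using pos[of "- b / c"]
      by (simp add: field_simps power2_eq_square)
  qed
  then have "\<bar>b\<bar>\<^sup>2 \<le> (l2_norm M f * l2_norm M g)\<^sup>2"
    by (simp add: a_def c_def power_mult_distrib)
  then show ?thesis unfolding b_def by (rule power2_le_imp_le) simp
qed

lemma l2_norm_triangle:
  assumes f: "square_integrable M f" and g: "square_integrable M g"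
  shows "l2_norm M (\<lambda>x. f x + g x) \<le> l2_norm M f + l2_norm M g"
proof (rule power2_le_imp_le)
  show "(l2_norm M (\<lambda>x. f x + g x))\<^sup>2 \<le> (l2_norm M f + l2_norm M g)\<^sup>2"
    using integral_norm_add_power2[OF f g, of 1] l2_Cauchy_Schwarz[OF f g]
    by (simp add: power2_sum)
qed simp

lemma l2_norm_triangle_diff:
  assumes f: "square_integrable M f" and g: "square_integrable M g" and h: "square_integrable M h"
  shows "l2_norm M (\<lambda>x. f x - h x) \<le> l2_norm M (\<lambda>x. f x - g x) + l2_norm M (\<lambda>x. g x - h x)"
  using l2_norm_triangle[OF square_integrable_diff[OF f g] square_integrable_diff[OF g h]] by simp

lemma l2_norm_le_add_diff:
  assumes f: "square_integrable M f" and g: "square_integrable M g"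
  shows "l2_norm M f \<le> l2_norm M g + l2_norm M (\<lambda>x. f x - g x)"
  using l2_norm_triangle[OF g square_integrable_diff[OF f g]] by simp

lemma l2_norm_eq_0:
  assumes "square_integrable M f" "l2_norm M f = 0"
  shows "AE x in M. f x = 0"
proof -
  have "(\<integral>x. (norm (f x))\<^sup>2 \<partial>M) = 0" using assms(2) by (simp flip: l2_norm_power2)
  then have "AE x in M. (norm (f x))\<^sup>2 = 0"
    by (subst (asm) integral_nonneg_eq_0_iff_AE) (use assms in \<open>auto simp: square_integrable_def\<close>)
  then show ?thesis by simp
qed

lemma l2_imp_integrable:
  assumes "finite_measure M" "square_integrable M f"
  shows "integrable M f"
proof (rule Bochner_Integration.integrable_bound)
  interpret finite_measure M by fact
  show "integrable M (\<lambda>x. 1 + (norm (f x))\<^sup>2)"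
    using assms by (intro Bochner_Integration.integrable_add square_integrable_integrable integrable_const)
  show "f \<in> borel_measurable M" using assms by (simp add: square_integrable_def)
  show "AE x in M. norm (f x) \<le> norm (1 + (norm (f x))\<^sup>2)"
  proof (rule AE_I2)
    fix x show "norm (f x) \<le> norm (1 + (norm (f x))\<^sup>2)"
      using order.trans[OF _ sum_squares_bound[of 1 "norm (f x)"], of "norm (f x)"] by simp
  qed
qed

lemma l1_le_l2:
  assumes "finite_measure M" "square_integrable M f"
  shows "(\<integral>x. norm (f x) \<partial>M) \<le> sqrt (measure M (space M)) * l2_norm M f"
proof -
  have "square_integrable M (\<lambda>x. norm (f x))" using assms by (auto simp: square_integrable_def)
  from l2_Cauchy_Schwarz[OF square_integrable_const[OF assms(1), of "1::real"] this]
  show ?thesis by (simp add: l2_norm_const[OF assms(1)] l2_norm_def)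
qed

text \<open>Since the measure is finite, the sequence is also Cauchy in \<open>L^1\<close>, so a
  subsequence converges almost everywhere. Fatou's lemma along it turns the Cauchy bound into a
  bound for the distance to the pointwise limit.\<close>

lemma l2_complete:
  fixes F :: "nat \<Rightarrow> 'a \<Rightarrow> 'b::euclidean_space"
  assumes fin: "finite_measure M" and F: "\<And>n. square_integrable M (F n)"
    and cauchy: "\<And>e. e > 0 \<Longrightarrow> \<exists>N. \<forall>m\<ge>N. \<forall>n\<ge>N. l2_norm M (\<lambda>x. F m x - F n x) < e"
  obtains f where "square_integrable M f" "(\<lambda>n. l2_norm M (\<lambda>x. F n x - f x)) \<longlonglongrightarrow> 0"
proof -
  have [measurable]: "F n \<in> borel_measurable M" for n using F by (simp add: square_integrable_def)
  have "\<exists>N. \<forall>i\<ge>N. \<forall>j\<ge>N. (LINT x|M. norm (F i x - F j x)) < e" if e: "e > 0" for e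
  proof -
    define c where "c = sqrt (measure M (space M)) + 1"
    have c: "c > 0" by (simp add: c_def add_nonneg_pos)
    obtain N where N: "\<forall>m\<ge>N. \<forall>n\<ge>N. l2_norm M (\<lambda>x. F m x - F n x) < e / c"
      using cauchy[of "e / c"] e c by auto
    have "(LINT x|M. norm (F i x - F j x)) < e" if "i \<ge> N" "j \<ge> N" for i j
    proof -
      have "(LINT x|M. norm (F i x - F j x)) \<le> sqrt (measure M (space M)) * l2_norm M (\<lambda>x. F i x - F j x)"
        by (rule l1_le_l2[OF fin square_integrable_diff[OF F F]])
      also have "\<dots> \<le> c * l2_norm M (\<lambda>x. F i x - F j x)"
        by (rule mult_right_mono) (auto simp: c_def)
      also have "\<dots> < e" using N that c by (simp add: field_simps)
      finally show ?thesis .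
    qed
    then show ?thesis by blast
  qed
  then obtain r where r: "strict_mono r" "AE x in M. Cauchy (\<lambda>i. F (r i) x)"
    using cauchy_L1_AE_cauchy_subseq[of M F] l2_imp_integrable[OF fin F] by metis
  define f where "f x = lim (\<lambda>i. F (r i) x)" for x
  have [measurable]: "f \<in> borel_measurable M" unfolding f_def by measurable
  have ae: "AE x in M. (\<lambda>i. F (r i) x) \<longlonglongrightarrow> f x"
    using r(2) by eventually_elim (simp add: f_def Cauchy_convergent_iff convergent_LIMSEQ_iff)
  have main: "\<exists>N. \<forall>n\<ge>N. square_integrable M (\<lambda>x. F n x - f x) \<and> l2_norm M (\<lambda>x. F n x - f x) \<le> e"
    if e: "e > 0" for e
  proof -
    obtain N where N: "\<forall>m\<ge>N. \<forall>n\<ge>N. l2_norm M (\<lambda>x. F m x - F n x) < e"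
      using cauchy[OF e] by blast
    have "(\<integral>\<^sup>+x. ennreal ((norm (F n x - f x))\<^sup>2) \<partial>M) \<le> ennreal (e\<^sup>2)" if n: "n \<ge> N" for n
    proof -
      have "(\<integral>\<^sup>+x. ennreal ((norm (F n x - f x))\<^sup>2) \<partial>M)
          = (\<integral>\<^sup>+x. liminf (\<lambda>i. ennreal ((norm (F n x - F (r i) x))\<^sup>2)) \<partial>M)"
      proof (rule nn_integral_cong_AE, use ae in eventually_elim)
        fix x assume "(\<lambda>i. F (r i) x) \<longlonglongrightarrow> f x"
        then have "(\<lambda>i. ennreal ((norm (F n x - F (r i) x))\<^sup>2)) \<longlonglongrightarrow> ennreal ((norm (F n x - f x))\<^sup>2)"
          by (intro tendsto_ennrealI tendsto_intros)
        then show "ennreal ((norm (F n x - f x))\<^sup>2) = liminf (\<lambda>i. ennreal ((norm (F n x - F (r i) x))\<^sup>2))"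
          by (metis lim_imp_Liminf sequentially_bot)
      qed
      also have "\<dots> \<le> liminf (\<lambda>i. \<integral>\<^sup>+x. ennreal ((norm (F n x - F (r i) x))\<^sup>2) \<partial>M)"
        by (rule nn_integral_liminf) measurable
      also have "\<dots> \<le> ennreal (e\<^sup>2)"
      proof (rule Liminf_le)
        show "\<forall>\<^sub>F i in sequentially. (\<integral>\<^sup>+x. ennreal ((norm (F n x - F (r i) x))\<^sup>2) \<partial>M) \<le> ennreal (e\<^sup>2)"
          using eventually_ge_at_top[of N]
        proof eventually_elim
          fix i assume "i \<ge> N"
          then have "r i \<ge> N" using seq_suble[OF r(1), of i] by linarith
          then have "l2_norm M (\<lambda>x. F n x - F (r i) x) < e" using N n by blast
          then show "(\<integral>\<^sup>+x. ennreal ((norm (F n x - F (r i) x))\<^sup>2) \<partial>M) \<le> ennreal (e\<^sup>2)"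
            unfolding nn_integral_l2_norm[OF square_integrable_diff[OF F F]]
            by (intro ennreal_leI power_mono) auto
        qed
      qed simp
      finally show ?thesis .
    qed
    moreover have "(\<lambda>x. F n x - f x) \<in> borel_measurable M" for n by measurable
    ultimately show ?thesis
      using square_integrableI_nn_le[of "\<lambda>x. F n x - f x" M e for n] e by (intro exI[of _ N]) auto
  qed
  obtain N where "square_integrable M (\<lambda>x. F N x - f x)" using main[of 1] by auto
  from square_integrable_diff[OF F[of N] this] have "square_integrable M f" by simp
  moreover have "(\<lambda>n. l2_norm M (\<lambda>x. F n x - f x)) \<longlonglongrightarrow> 0"
  proof (rule LIMSEQ_I)
    fix e :: real assume "e > 0"
    then obtain N where "\<forall>n\<ge>N. l2_norm M (\<lambda>x. F n x - f x) \<le> e / 2" using main[of "e/2"] by auto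
    then have "\<forall>n\<ge>N. norm (l2_norm M (\<lambda>x. F n x - f x) - 0) < e"
      using \<open>e > 0\<close> by fastforce
    then show "\<exists>no. \<forall>n\<ge>no. norm (l2_norm M (\<lambda>x. F n x - f x) - 0) < e" ..
  qed
  ultimately show ?thesis by (rule that)
qed

lemma l2_tendsto_AE_subseq:
  fixes F :: "nat \<Rightarrow> 'a \<Rightarrow> 'b::euclidean_space"
  assumes fin: "finite_measure M" and F: "\<And>n. square_integrable M (F n)" and f: "square_integrable M f"
    and lim: "(\<lambda>n. l2_norm M (\<lambda>x. F n x - f x)) \<longlonglongrightarrow> 0"
  obtains r where "strict_mono r" "AE x in M. (\<lambda>n. F (r n) x) \<longlonglongrightarrow> f x"
proof -
  have sq: "square_integrable M (\<lambda>x. F n x - f x)" for n by (rule square_integrable_diff[OF F f])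
  have "(\<lambda>n. \<integral>x. norm (F n x - f x) \<partial>M) \<longlonglongrightarrow> 0"
  proof (rule tendsto_sandwich[OF _ _ tendsto_const])
    show "(\<lambda>n. sqrt (measure M (space M)) * l2_norm M (\<lambda>x. F n x - f x)) \<longlonglongrightarrow> 0"
      using tendsto_mult_right_zero[OF lim] by simp
  qed (use l1_le_l2[OF fin sq] in auto)
  then obtain r where r: "strict_mono r" "AE x in M. (\<lambda>n. F (r n) x - f x) \<longlonglongrightarrow> 0"
    using tendsto_L1_AE_subseq[of M "\<lambda>n x. F n x - f x"] l2_imp_integrable[OF fin sq] by auto
  from r(2) have "AE x in M. (\<lambda>n. F (r n) x) \<longlonglongrightarrow> f x"
    by eventually_elim (simp add: LIM_zero_iff)
  with r(1) show ?thesis by (rule that)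
qed

lemma l2_tendsto_unique:
  fixes F :: "nat \<Rightarrow> 'a \<Rightarrow> 'b::euclidean_space"
  assumes F: "\<And>n. square_integrable M (F n)" and f: "square_integrable M f" and g: "square_integrable M g"
    and lim: "(\<lambda>n. l2_norm M (\<lambda>x. F n x - f x)) \<longlonglongrightarrow> 0" "(\<lambda>n. l2_norm M (\<lambda>x. F n x - g x)) \<longlonglongrightarrow> 0"
  shows "AE x in M. f x = g x"
proof -
  have "l2_norm M (\<lambda>x. f x - g x) \<le> l2_norm M (\<lambda>x. F n x - f x) + l2_norm M (\<lambda>x. F n x - g x)" for n
    using l2_norm_triangle_diff[OF f F g, of n] l2_norm_diff_commute[of M f "F n"] by simp
  then have "l2_norm M (\<lambda>x. f x - g x) \<le> 0"
    using LIMSEQ_le_const[OF tendsto_add[OF lim]] by auto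
  then have "l2_norm M (\<lambda>x. f x - g x) = 0" by (simp add: antisym)
  from l2_norm_eq_0[OF square_integrable_diff[OF f g] this] show ?thesis by simp
qed

lemma l2_norm_tendsto:
  fixes F :: "nat \<Rightarrow> 'a \<Rightarrow> 'b::euclidean_space"
  assumes F: "\<And>n. square_integrable M (F n)" and f: "square_integrable M f"
    and lim: "(\<lambda>n. l2_norm M (\<lambda>x. F n x - f x)) \<longlonglongrightarrow> 0"
  shows "(\<lambda>n. l2_norm M (F n)) \<longlonglongrightarrow> l2_norm M f"
proof -
  have "\<bar>l2_norm M (F n) - l2_norm M f\<bar> \<le> l2_norm M (\<lambda>x. F n x - f x)" for n
    using l2_norm_le_add_diff[OF F f, of n] l2_norm_le_add_diff[OF f F, of n] l2_norm_diff_commute[of M f "F n"]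
    by (simp add: abs_le_iff)
  then have "(\<lambda>n. l2_norm M (F n) - l2_norm M f) \<longlonglongrightarrow> 0"
    by (intro Lim_null_comparison[OF _ lim]) auto
  then show ?thesis by (simp add: LIM_zero_iff)
qed

lemma square_integrable_restrict:
  assumes "square_integrable M f" "S \<in> sets M"
  shows "square_integrable (restrict_space M S) f" "l2_norm (restrict_space M S) f \<le> l2_norm M f"
proof -
  have [measurable]: "f \<in> borel_measurable M" using assms by (simp add: square_integrable_def)
  have *: "f \<in> borel_measurable (restrict_space M S)" by (rule measurable_restrict_space1) measurable
  have "(\<integral>\<^sup>+x. ennreal ((norm (f x))\<^sup>2) \<partial>restrict_space M S) \<le> (\<integral>\<^sup>+x. ennreal ((norm (f x))\<^sup>2) \<partial>M)"
    using assms(2) by (subst nn_integral_restrict_space) (auto intro!: nn_integral_mono simp: indicator_def)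
  also have "\<dots> = ennreal ((l2_norm M f)\<^sup>2)" by (rule nn_integral_l2_norm[OF assms(1)])
  finally show "square_integrable (restrict_space M S) f" "l2_norm (restrict_space M S) f \<le> l2_norm M f"
    using square_integrableI_nn_le[OF *] by auto
qed

section \<open>Smooth functions\<close>

lemma has_derivative_gradient_unique:
  assumes "(\<phi> has_derivative (\<lambda>h. G \<bullet> h)) (at x)"
  shows "gradient \<phi> x = G"
proof -
  have "frechet_derivative \<phi> (at x) = (\<lambda>h. G \<bullet> h)"
    using frechet_derivative_at[OF assms] by simp
  then show ?thesis by (simp add: gradient_def euclidean_representation)
qed

text \<open>One further order of differentiability makes the partial derivatives continuous.\<close>

lemma smoothE:
  assumes "smooth (\<phi> :: 'a::euclidean_space \<Rightarrow> real)"
  obtains D where "\<And>x. gradient \<phi> x = (\<Sum>b\<in>Basis. D b x *\<^sub>R b)"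
    "\<And>b x. b \<in> Basis \<Longrightarrow> isCont (D b) x" "\<And>x. (\<phi> has_derivative (\<lambda>h. gradient \<phi> x \<bullet> h)) (at x)"
proof -
  obtain D where D: "D [] = \<phi>" "\<And>bs x. set bs \<subseteq> Basis \<Longrightarrow>
      (D bs has_derivative (\<lambda>h. \<Sum>b\<in>Basis. (h \<bullet> b) * D (b # bs) x)) (at x)"
    using assms unfolding smooth_def by blast
  have eq: "(\<lambda>h. \<Sum>b\<in>Basis. (h \<bullet> b) * D [b] x) = (\<lambda>h. (\<Sum>b\<in>Basis. D [b] x *\<^sub>R b) \<bullet> h)" for x
    by (auto simp: inner_sum_right inner_commute mult.commute)
  have d: "(\<phi> has_derivative (\<lambda>h. (\<Sum>b\<in>Basis. D [b] x *\<^sub>R b) \<bullet> h)) (at x)" for x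
    using D(2)[of "[]" x] D(1) unfolding eq by simp
  show ?thesis
  proof (rule that[of "\<lambda>b. D [b]"])
    show g: "gradient \<phi> x = (\<Sum>b\<in>Basis. D [b] x *\<^sub>R b)" for x
      by (rule has_derivative_gradient_unique[OF d])
    show "(\<phi> has_derivative (\<lambda>h. gradient \<phi> x \<bullet> h)) (at x)" for x
      unfolding g by (rule d)
    show "isCont (D [b]) x" if "b \<in> Basis" for b x
      using D(2)[of "[b]" x] that by (auto intro: has_derivative_continuous)
  qed
qed

lemma smooth_has_derivative:
  "smooth \<phi> \<Longrightarrow> (\<phi> has_derivative (\<lambda>h. gradient \<phi> x \<bullet> h)) (at x)"
  by (rule smoothE)

lemma smooth_continuous: "smooth \<phi> \<Longrightarrow> continuous_on S \<phi>"
  by (meson smooth_has_derivative has_derivative_continuous continuous_at_imp_continuous_on)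

lemma smooth_gradient_continuous:
  assumes "smooth (\<phi> :: 'a::euclidean_space \<Rightarrow> real)" shows "continuous_on S (gradient \<phi>)"
proof -
  obtain D where D: "\<And>x. gradient \<phi> x = (\<Sum>b\<in>Basis. D b x *\<^sub>R b)"
    "\<And>b x. b \<in> Basis \<Longrightarrow> isCont (D b) x" using smoothE[OF assms] by metis
  have "gradient \<phi> = (\<lambda>x. \<Sum>b\<in>Basis. D b x *\<^sub>R b)" using D(1) by auto
  then show ?thesis
    using D(2) by (auto intro!: continuous_intros continuous_at_imp_continuous_on)
qed

lemma smooth_measurable:
  assumes "smooth \<phi>"
  shows "\<phi> \<in> borel_measurable borel" "gradient \<phi> \<in> borel_measurable borel"
  using assms by (auto intro: borel_measurable_continuous_onI smooth_continuous smooth_gradient_continuous)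

lemma smooth_lincomb:
  assumes "smooth \<phi>" "smooth \<psi>"
  shows "smooth (\<lambda>x. \<phi> x + c * \<psi> x)"
proof -
  obtain D where D: "D [] = \<phi>" "\<And>bs x. set bs \<subseteq> Basis \<Longrightarrow>
      (D bs has_derivative (\<lambda>h. \<Sum>b\<in>Basis. (h \<bullet> b) * D (b # bs) x)) (at x)"
    using assms unfolding smooth_def by blast
  obtain E where E: "E [] = \<psi>" "\<And>bs x. set bs \<subseteq> Basis \<Longrightarrow>
      (E bs has_derivative (\<lambda>h. \<Sum>b\<in>Basis. (h \<bullet> b) * E (b # bs) x)) (at x)"
    using assms unfolding smooth_def by blast
  show ?thesis unfolding smooth_def
  proof (intro exI[of _ "\<lambda>bs x. D bs x + c * E bs x"] conjI allI impI)
    fix bs :: "'a list" and x assume bs: "set bs \<subseteq> Basis"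
    have "((\<lambda>x. D bs x + c * E bs x) has_derivative
      (\<lambda>h. (\<Sum>b\<in>Basis. (h \<bullet> b) * D (b # bs) x) + c * (\<Sum>b\<in>Basis. (h \<bullet> b) * E (b # bs) x))) (at x)"
      by (intro has_derivative_add has_derivative_mult_right D E bs)
    then show "((\<lambda>x. D bs x + c * E bs x) has_derivative
      (\<lambda>h. \<Sum>b\<in>Basis. (h \<bullet> b) * (D (b # bs) x + c * E (b # bs) x))) (at x)"
      by (simp add: sum_distrib_left sum.distrib algebra_simps)
  qed (simp add: D E)
qed

lemma gradient_lincomb:
  assumes "smooth \<phi>" "smooth \<psi>"
  shows "gradient (\<lambda>x. \<phi> x + c * \<psi> x) x = gradient \<phi> x + c *\<^sub>R gradient \<psi> x"
proof (rule has_derivative_gradient_unique)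
  have "((\<lambda>x. \<phi> x + c * \<psi> x) has_derivative (\<lambda>h. gradient \<phi> x \<bullet> h + c * (gradient \<psi> x \<bullet> h))) (at x)"
    by (intro has_derivative_add has_derivative_mult_right smooth_has_derivative assms)
  then show "((\<lambda>x. \<phi> x + c * \<psi> x) has_derivative (\<lambda>h. (gradient \<phi> x + c *\<^sub>R gradient \<psi> x) \<bullet> h)) (at x)"
    by (simp add: inner_add_left)
qed

lemma smooth_diff:
  assumes "smooth \<phi>" "smooth \<psi>"
  shows "smooth (\<lambda>x. \<phi> x - \<psi> x)" "gradient (\<lambda>x. \<phi> x - \<psi> x) x = gradient \<phi> x - gradient \<psi> x"
  using smooth_lincomb[OF assms, of "-1"] gradient_lincomb[OF assms, of "-1"] by simp_all

text \<open>Fundamental theorem of calculus along the segment, followed by Cauchy-Schwarz; the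
  factor \<open>t\<close> is the length of the interval. The form in extended nonnegative reals
  allows integration over \<open>a\<close> and \<open>y\<close> by Tonelli's theorem.\<close>

lemma smooth_segment:
  fixes \<phi> :: "'a::euclidean_space \<Rightarrow> real"
  assumes \<phi>: "smooth \<phi>" and t: "0 \<le> t"
  shows "ennreal ((\<phi> (a + t *\<^sub>R y) - \<phi> a)\<^sup>2) \<le>
    ennreal ((norm y)\<^sup>2 * t) * (\<integral>\<^sup>+s. ennreal ((norm (gradient \<phi> (a + s *\<^sub>R y)))\<^sup>2) * indicator {0..t} s \<partial>lborel)"
proof -
  define M where "M = restrict_space lborel {0..t}"
  define F where "F s = norm (gradient \<phi> (a + s *\<^sub>R y))" for s
  interpret finite_measure M
    by rule (use t in \<open>simp add: M_def space_restrict_space emeasure_restrict_space\<close>)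
  have contF: "continuous_on S F" for S unfolding F_def
    by (intro continuous_intros continuous_on_compose2[OF smooth_gradient_continuous[OF \<phi>, of UNIV]]) auto
  have sqF: "square_integrable M F"
  proof -
    have "continuous_on {0..t} (\<lambda>s. (F s)\<^sup>2)" by (intro continuous_intros contF)
    then have "integrable M (\<lambda>s. (F s)\<^sup>2)" unfolding M_def
      by (subst integrable_restrict_space) (auto dest: borel_integrable_compact[OF compact_Icc])
    moreover have "F \<in> borel_measurable M" unfolding M_def
      by (intro measurable_restrict_space1) (simp add: borel_measurable_continuous_onI contF)
    ultimately show ?thesis by (simp add: square_integrable_def)
  qed
  have "((\<lambda>s. \<phi> (a + s *\<^sub>R y)) has_vector_derivative gradient \<phi> (a + s *\<^sub>R y) \<bullet> y) (at s within {0..t})" for s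
  proof -
    have "((\<lambda>s. \<phi> (a + s *\<^sub>R y)) has_derivative (\<lambda>h. gradient \<phi> (a + s *\<^sub>R y) \<bullet> (h *\<^sub>R y))) (at s)"
      by (rule has_derivative_compose[OF _ smooth_has_derivative[OF \<phi>]]) (auto intro!: derivative_eq_intros)
    then show ?thesis
      unfolding has_vector_derivative_def by (auto intro: has_derivative_at_withinI simp: mult.commute)
  qed
  then have "(\<integral>s. indicator {0..t} s *\<^sub>R (gradient \<phi> (a + s *\<^sub>R y) \<bullet> y) \<partial>lborel) = \<phi> (a + t *\<^sub>R y) - \<phi> (a + 0 *\<^sub>R y)"
    by (intro integral_FTC_Icc[OF t])
      (auto intro!: continuous_intros continuous_on_compose2[OF smooth_gradient_continuous[OF \<phi>, of UNIV]])
  then have eq: "\<phi> (a + t *\<^sub>R y) - \<phi> a = (\<integral>s. gradient \<phi> (a + s *\<^sub>R y) \<bullet> y \<partial>M)"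
    by (simp add: M_def integral_restrict_space)
  have "\<bar>\<phi> (a + t *\<^sub>R y) - \<phi> a\<bar> \<le> (\<integral>s. F s * norm y \<partial>M)"
    unfolding eq
  proof (rule order.trans[OF integral_abs_bound integral_mono'])
    show "integrable M (\<lambda>s. F s * norm y)"
      using l2_imp_integrable[OF finite_measure_axioms sqF] by simp
  qed (auto simp: F_def Cauchy_Schwarz_ineq2)
  also have "\<dots> = (\<integral>s. norm (F s) \<partial>M) * norm y" by (simp add: F_def)
  also have "\<dots> \<le> (sqrt t * l2_norm M F) * norm y"
    using l1_le_l2[OF finite_measure_axioms sqF] t
    by (intro mult_right_mono) (auto simp: M_def space_restrict_space measure_restrict_space)
  finally have "(\<phi> (a + t *\<^sub>R y) - \<phi> a)\<^sup>2 \<le> ((sqrt t * l2_norm M F) * norm y)\<^sup>2"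
    by (rule abs_le_square_iff[THEN iffD1, OF order.trans]) (simp add: t)
  also have "\<dots> = (norm y)\<^sup>2 * t * (l2_norm M F)\<^sup>2" using t by (simp add: power_mult_distrib)
  finally have "ennreal ((\<phi> (a + t *\<^sub>R y) - \<phi> a)\<^sup>2) \<le> ennreal ((norm y)\<^sup>2 * t) * ennreal ((l2_norm M F)\<^sup>2)"
    using t by (subst ennreal_mult[symmetric]) (auto intro!: ennreal_leI)
  also have "ennreal ((l2_norm M F)\<^sup>2) = (\<integral>\<^sup>+s. ennreal ((F s)\<^sup>2) * indicator {0..t} s \<partial>lborel)"
    using nn_integral_l2_norm[OF sqF] by (simp add: M_def nn_integral_restrict_space)
  finally show ?thesis by (simp add: F_def)
qed

section \<open>Bump functions\<close>

text \<open>Each order is treated separately, which makes closure under products an induction on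
  \<open>k\<close>. \<open>iter_differentiable_sequence\<close> afterwards assembles the derivatives
  of all orders.\<close>

fun iter_differentiable :: "nat \<Rightarrow> (real \<Rightarrow> real) \<Rightarrow> bool" where
  "iter_differentiable 0 f \<longleftrightarrow> True"
| "iter_differentiable (Suc k) f \<longleftrightarrow>
    (\<exists>f'. (\<forall>x. (f has_real_derivative f' x) (at x)) \<and> iter_differentiable k f')"

lemma iter_differentiable_Suc: "iter_differentiable (Suc k) f \<Longrightarrow> iter_differentiable k f"
  by (induction k arbitrary: f) auto

lemma iter_differentiable_add:
  "iter_differentiable k f \<Longrightarrow> iter_differentiable k g \<Longrightarrow> iter_differentiable k (\<lambda>x. f x + g x)"
proof (induction k arbitrary: f g)
  case (Suc k)
  then obtain f' g' where "\<forall>x. (f has_real_derivative f' x) (at x)" "iter_differentiable k f'"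
    "\<forall>x. (g has_real_derivative g' x) (at x)" "iter_differentiable k g'" by auto
  with Suc.IH[of f' g'] show ?case
    by (auto intro!: exI[of _ "\<lambda>x. f' x + g' x"] DERIV_add)
qed simp

lemma iter_differentiable_mult:
  "iter_differentiable k f \<Longrightarrow> iter_differentiable k g \<Longrightarrow> iter_differentiable k (\<lambda>x. f x * g x)"
proof (induction k arbitrary: f g)
  case (Suc k)
  then obtain f' g' where *: "\<forall>x. (f has_real_derivative f' x) (at x)" "iter_differentiable k f'"
    "\<forall>x. (g has_real_derivative g' x) (at x)" "iter_differentiable k g'" by auto
  have "iter_differentiable k (\<lambda>x. f' x * g x + g' x * f x)"
    by (intro iter_differentiable_add Suc.IH * Suc.prems[THEN iter_differentiable_Suc])
  then show ?case
    using * by (auto intro!: exI[of _ "\<lambda>x. f' x * g x + g' x * f x"] DERIV_mult)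
qed simp

lemma iter_differentiable_const: "iter_differentiable k (\<lambda>x. c)"
  by (induction k arbitrary: c) (auto intro!: exI[of _ "\<lambda>_. 0"])

lemma iter_differentiable_affine:
  "iter_differentiable k f \<Longrightarrow> iter_differentiable k (\<lambda>x. f (c * x + d))"
proof (induction k arbitrary: f)
  case (Suc k)
  then obtain f' where *: "\<forall>x. (f has_real_derivative f' x) (at x)" "iter_differentiable k f'" by auto
  have "((\<lambda>x. f (c * x + d)) has_real_derivative f' (c * x + d) * c) (at x)" for x
    by (rule DERIV_chain2[of f]) (use * in \<open>auto intro!: derivative_eq_intros\<close>)
  moreover have "iter_differentiable k (\<lambda>x. f' (c * x + d) * c)"
    by (intro iter_differentiable_mult iter_differentiable_const Suc.IH *)
  ultimately show ?case unfolding iter_differentiable.simps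
    by (intro exI[of _ "\<lambda>x. f' (c * x + d) * c"]) blast
qed simp

lemma iter_differentiable_sequence:
  assumes "\<And>k. iter_differentiable k f"
  obtains D where "D 0 = f" "\<And>k x. (D k has_real_derivative D (Suc k) x) (at x)"
proof -
  have *: "iter_differentiable m ((deriv ^^ k) f)" for k m
  proof (induction k arbitrary: m)
    case (Suc k)
    from Suc[of "Suc m"] obtain f' where f': "\<forall>x. ((deriv ^^ k) f has_real_derivative f' x) (at x)" "iter_differentiable m f'"
      by auto
    then have "deriv ((deriv ^^ k) f) = f'" using DERIV_imp_deriv by blast
    with f' show ?case by simp
  qed (simp add: assms)
  show ?thesis
  proof (rule that[of "\<lambda>k. (deriv ^^ k) f"])
    fix k x
    from *[of 1 k] obtain f' where "\<forall>x. ((deriv ^^ k) f has_real_derivative f' x) (at x)" by auto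
    then show "((deriv ^^ k) f has_real_derivative (deriv ^^ Suc k) f x) (at x)"
      using DERIV_imp_deriv[of "(deriv ^^ k) f" "f' x" x] by simp
  qed simp
qed

text \<open>Derivatives of \<open>exp (- 1 / t)\<close>, extended by 0, are again of this form with another polynomial
  in \<open>1 / t\<close>.\<close>

definition flat :: "real poly \<Rightarrow> real \<Rightarrow> real" where
  "flat p t = (if t > 0 then poly p (1 / t) * exp (- (1 / t)) else 0)"

lemma poly_exp_tendsto_0: "((\<lambda>u. poly p u * exp (- u)) \<longlongrightarrow> (0::real)) at_top"
proof -
  have "((\<lambda>u. \<Sum>i\<le>degree p. coeff p i * (u ^ i / exp u)) \<longlongrightarrow> (\<Sum>i\<le>degree p. coeff p i * 0)) at_top"
    by (intro tendsto_intros tendsto_power_div_exp_0)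
  moreover have "(\<Sum>i\<le>degree p. coeff p i * (u ^ i / exp u)) = poly p u * exp (- u)" for u :: real
    by (simp add: poly_altdef sum_distrib_right exp_minus divide_inverse mult.assoc)
  ultimately show ?thesis by simp
qed

lemma flat_has_derivative:
  "(flat p has_real_derivative flat ([:0, 0, 1:] * (p - pderiv p)) x) (at x)"
proof -
  consider "x > 0" | "x < 0" | "x = 0" by linarith
  then show ?thesis
  proof cases
    case 1
    \<comment> \<open>Both factors contribute \<open>1 / t ^ 2\<close>: differentiating the
      exponential yields \<open>p\<close>, differentiating the polynomial yields
      \<open>- pderiv p\<close>.\<close>
    have "((\<lambda>t. poly p (1 / t) * exp (- (1 / t))) has_real_derivative flat ([:0, 0, 1:] * (p - pderiv p)) x) (at x)"
      using 1 by (auto intro!: derivative_eq_intros DERIV_chain2[OF poly_DERIV] simp: flat_def field_simps power2_eq_square)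
    then show ?thesis
    proof (rule DERIV_cong_ev[OF refl _ refl, THEN iffD2, rotated])
      show "\<forall>\<^sub>F t in nhds x. flat p t = poly p (1 / t) * exp (- (1 / t))"
        using eventually_nhds_in_open[of "{0<..}" x] 1 by (auto elim!: eventually_mono simp: flat_def)
    qed
  next
    case 2
    have "((\<lambda>t. 0) has_real_derivative flat ([:0, 0, 1:] * (p - pderiv p)) x) (at x)"
      using 2 by (auto simp: flat_def)
    then show ?thesis
    proof (rule DERIV_cong_ev[OF refl _ refl, THEN iffD2, rotated])
      show "\<forall>\<^sub>F t in nhds x. flat p t = 0"
        using eventually_nhds_in_open[of "{..<0}" x] 2 by (auto elim!: eventually_mono simp: flat_def)
    qed
  next
    case 3
    have "((\<lambda>t. flat p t / t) \<longlongrightarrow> 0) (at_right 0)"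
    proof -
      \<comment> \<open>Dividing by \<open>t\<close> multiplies the polynomial by its variable
        (\<open>pCons 0 p\<close>), so the quotient is again a polynomial times an exponential,
        taken at \<open>u = 1 / t\<close>.\<close>
      have "((\<lambda>t. poly (pCons 0 p) (inverse t) * exp (- inverse t)) \<longlongrightarrow> 0) (at_right (0::real))"
        by (rule filterlim_compose[OF poly_exp_tendsto_0 filterlim_inverse_at_top_right])
      then show ?thesis
        by (rule Lim_transform_eventually)
          (auto simp: eventually_at_right_less flat_def field_simps intro!: eventually_mono[OF eventually_at_right_less])
    qed
    moreover have "((\<lambda>t. flat p t / t) \<longlongrightarrow> 0) (at_left 0)"
      by (rule tendsto_eventually) (auto simp: eventually_at_left_field flat_def intro!: exI[of _ "-1"])
    ultimately have "((\<lambda>t. flat p t / t) \<longlongrightarrow> 0) (at 0)"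
      by (rule filterlim_split_at[rotated])
    then show ?thesis using 3 by (simp add: DERIV_def flat_def)
  qed
qed

lemma iter_differentiable_flat: "iter_differentiable k (flat p)"
  by (induction k arbitrary: p) (auto intro!: flat_has_derivative)

lemma smooth_prod:
  fixes g :: "'a::euclidean_space \<Rightarrow> real \<Rightarrow> real"
  assumes "\<And>b k. b \<in> Basis \<Longrightarrow> iter_differentiable k (g b)"
  shows "smooth (\<lambda>x. \<Prod>b\<in>Basis. g b (x \<bullet> b))"
proof -
  have "\<exists>D. \<forall>b\<in>Basis. D b 0 = g b \<and> (\<forall>k x. (D b k has_real_derivative D b (Suc k) x) (at x))"
    by (rule bchoice) (meson assms iter_differentiable_sequence)
  then obtain D where D0: "\<And>b. b \<in> Basis \<Longrightarrow> D b 0 = g b"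
    and D: "\<And>b k x. b \<in> Basis \<Longrightarrow> (D b k has_real_derivative D b (Suc k) x) (at x)" by blast
  show ?thesis unfolding smooth_def
  \<comment> \<open>Iterated partial derivatives of a product of functions of single coordinates
    differentiate the factor of \<open>b\<close> as often as \<open>b\<close> occurs in the
    list.\<close>
  proof (intro exI[of _ "\<lambda>bs x. \<Prod>b\<in>Basis. D b (count_list bs b) (x \<bullet> b)"] conjI allI impI)
    show "(\<lambda>x. \<Prod>b\<in>Basis. D b (count_list [] b) (x \<bullet> b)) = (\<lambda>x. \<Prod>b\<in>Basis. g b (x \<bullet> b))"
      using D0 by simp
    fix bs :: "'a list" and x :: 'a
    have "((\<lambda>x. D b (count_list bs b) (x \<bullet> b)) has_derivative
        (\<lambda>h. (h \<bullet> b) * D b (Suc (count_list bs b)) (x \<bullet> b))) (at x)" if "b \<in> Basis" for b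
      using has_derivative_compose[OF bounded_linear_imp_has_derivative[OF bounded_linear_inner_left]
         D[OF that, unfolded has_field_derivative_def]] by (simp add: mult.commute)
    then have "((\<lambda>x. \<Prod>b\<in>Basis. D b (count_list bs b) (x \<bullet> b)) has_derivative
        (\<lambda>h. \<Sum>b\<in>Basis. ((h \<bullet> b) * D b (Suc (count_list bs b)) (x \<bullet> b)) *
              (\<Prod>c\<in>Basis - {b}. D c (count_list bs c) (x \<bullet> c)))) (at x)"
      by (intro has_derivative_prod) auto
    moreover have "(h \<bullet> b) * D b (Suc (count_list bs b)) (x \<bullet> b) * (\<Prod>c\<in>Basis - {b}. D c (count_list bs c) (x \<bullet> c))
        = (h \<bullet> b) * (\<Prod>c\<in>Basis. D c (count_list (b # bs) c) (x \<bullet> c))" if "b \<in> Basis" for b h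
    proof -
      have "(\<Prod>c\<in>Basis. D c (count_list (b # bs) c) (x \<bullet> c))
         = D b (Suc (count_list bs b)) (x \<bullet> b) * (\<Prod>c\<in>Basis - {b}. D c (count_list (b # bs) c) (x \<bullet> c))"
        using that by (subst prod.remove[of _ b]) auto
      also have "(\<Prod>c\<in>Basis - {b}. D c (count_list (b # bs) c) (x \<bullet> c)) = (\<Prod>c\<in>Basis - {b}. D c (count_list bs c) (x \<bullet> c))"
        by (intro prod.cong) auto
      finally show ?thesis by simp
    qed
    ultimately show "((\<lambda>x. \<Prod>b\<in>Basis. D b (count_list bs b) (x \<bullet> b)) has_derivative
      (\<lambda>h. \<Sum>b\<in>Basis. (h \<bullet> b) * (\<Prod>c\<in>Basis. D c (count_list (b # bs) c) (x \<bullet> c)))) (at x)"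
      by (simp cong: sum.cong)
  qed
qed

text \<open>Each face of the box contributes a factor \<open>exp (- 1 / (N * s))\<close>, with
  \<open>s\<close> the distance to the face and \<open>N = Suc n\<close>; it tends to 1 inside the
  box and is replaced by 0 beyond the face. Boxes are enough to test with, so this takes the place
  of mollification.\<close>

lemma box_indicator_approximation:
  fixes a c :: "'a::euclidean_space"
  obtains \<phi> :: "nat \<Rightarrow> 'a \<Rightarrow> real" where "\<And>n. smooth (\<phi> n)" "\<And>n x. 0 \<le> \<phi> n x" "\<And>n x. \<phi> n x \<le> 1"
    "\<And>n x. x \<notin> box a c \<Longrightarrow> \<phi> n x = 0" "\<And>x. x \<in> box a c \<Longrightarrow> (\<lambda>n. \<phi> n x) \<longlonglongrightarrow> 1"
proof -
  define h where "h = flat 1"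
  define g where "g n b t = h (real (Suc n) * t + - real (Suc n) * (a \<bullet> b)) * h (- real (Suc n) * t + real (Suc n) * (c \<bullet> b))"
    for n b t
  define \<phi> where "\<phi> n x = (\<Prod>b\<in>Basis. g n b (x \<bullet> b))" for n x
  have h01: "0 \<le> h t" "h t \<le> 1" for t by (auto simp: h_def flat_def)
  have g01: "0 \<le> g n b t" "g n b t \<le> 1" for n b t
    using h01 by (auto simp: g_def intro: mult_le_one)
  show ?thesis
  proof (rule that[of \<phi>])
    show "smooth (\<phi> n)" for n unfolding \<phi>_def
      by (rule smooth_prod) (auto simp: g_def h_def intro!: iter_differentiable_mult
          iter_differentiable_affine[where f = "flat 1"] iter_differentiable_flat)
    show "0 \<le> \<phi> n x" for n x unfolding \<phi>_def by (intro prod_nonneg g01 ballI)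
    show "\<phi> n x \<le> 1" for n x unfolding \<phi>_def by (intro prod_le_1 conjI g01)
    show "\<phi> n x = 0" if "x \<notin> box a c" for n x
    proof -
      from that obtain b where b: "b \<in> Basis" "\<not> (a \<bullet> b < x \<bullet> b \<and> x \<bullet> b < c \<bullet> b)" by (auto simp: mem_box)
      have "g n b (x \<bullet> b) = 0"
      proof (cases "a \<bullet> b < x \<bullet> b")
        case True
        then have "real (Suc n) * (c \<bullet> b - x \<bullet> b) \<le> 0" using b by (intro mult_nonneg_nonpos) auto
        then show ?thesis by (simp add: g_def h_def flat_def algebra_simps)
      next
        case False
        then have "real (Suc n) * (x \<bullet> b - a \<bullet> b) \<le> 0" by (intro mult_nonneg_nonpos) auto
        then show ?thesis by (simp add: g_def h_def flat_def algebra_simps)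
      qed
      with b show ?thesis unfolding \<phi>_def by auto
    qed
    show "(\<lambda>n. \<phi> n x) \<longlonglongrightarrow> 1" if x: "x \<in> box a c" for x
    proof -
      have h1: "(\<lambda>n. h (real (Suc n) * s)) \<longlonglongrightarrow> 1" if s: "s > 0" for s
      proof -
        have "(\<lambda>n. exp (- (inverse (real (Suc n)) * inverse s))) \<longlonglongrightarrow> exp (- (0 * inverse s))"
          by (intro tendsto_intros LIMSEQ_inverse_real_of_nat)
        moreover have "h (real (Suc n) * s) = exp (- (inverse (real (Suc n)) * inverse s))" for n
          using s by (simp add: h_def flat_def divide_inverse del: of_nat_Suc)
        ultimately show ?thesis by simp
      qed
      have "(\<lambda>n. g n b (x \<bullet> b)) \<longlonglongrightarrow> 1 * 1" if "b \<in> Basis" for b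
      proof -
        have e: "g n b (x \<bullet> b) = h (real (Suc n) * (x \<bullet> b - a \<bullet> b)) * h (real (Suc n) * (c \<bullet> b - x \<bullet> b))" for n
          unfolding g_def by (intro arg_cong2[where f = "(*)"] arg_cong[where f = h]) (simp_all add: algebra_simps)
        show ?thesis unfolding e
          by (intro tendsto_mult h1) (use x that in \<open>auto simp: mem_box\<close>)
      qed
      then have "(\<lambda>n. \<phi> n x) \<longlonglongrightarrow> (\<Prod>b\<in>(Basis :: 'a set). 1)"
        unfolding \<phi>_def by (intro tendsto_prod) auto
      then show ?thesis by simp
    qed
  qed
qed

section \<open>Weak gradients\<close>

lemma test_functionE:
  fixes \<Omega> :: "'a::euclidean_space set"
  assumes "test_function \<Omega> \<phi>"
  obtains K where "compact K" "K \<subseteq> \<Omega>" "\<And>x. x \<notin> K \<Longrightarrow> \<phi> x = 0" "\<And>x. x \<notin> K \<Longrightarrow> gradient \<phi> x = 0"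
proof -
  define K where "K = closure {x. \<phi> x \<noteq> 0}"
  have z: "\<phi> x = 0" if "x \<notin> K" for x using that closure_subset[of "{x. \<phi> x \<noteq> 0}"] by (auto simp: K_def)
  have g: "gradient \<phi> x = 0" if x: "x \<notin> K" for x
  proof (rule has_derivative_gradient_unique)
    have "((\<lambda>_. 0) has_derivative (\<lambda>h. 0 \<bullet> h)) (at x)" by simp
    then show "(\<phi> has_derivative (\<lambda>h. 0 \<bullet> h)) (at x)"
    proof (rule has_derivative_transform_within_open)
      show "open (- K)" by (simp add: K_def open_Compl)
    qed (use x z in auto)
  qed
  have "compact K" "K \<subseteq> \<Omega>" using assms by (simp_all add: K_def test_function_def)
  from that[OF this z g] show ?thesis .
qed

text \<open>The bilinear map is arbitrary so that products of a scalar and a vector in either order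
  and of two reals are all instances. Outside \<open>K\<close> the product vanishes, and on
  \<open>K\<close> the factor \<open>w\<close> is bounded.\<close>

lemma integrable_continuous_mult:
  fixes w :: "'a::euclidean_space \<Rightarrow> 'b::euclidean_space" and u :: "'a \<Rightarrow> 'c::euclidean_space"
    and m :: "'b \<Rightarrow> 'c \<Rightarrow> 'd::euclidean_space"
  assumes \<Omega>: "open \<Omega>" and K: "compact K" "K \<subseteq> \<Omega>" and u: "locally_integrable \<Omega> u"
    and w: "continuous_on UNIV w" "\<And>x. x \<notin> K \<Longrightarrow> w x = 0" and m: "bounded_bilinear m"
  shows "integrable (lebesgue_on \<Omega>) (\<lambda>x. m (w x) (u x))"
proof -
  interpret bounded_bilinear m by fact
  obtain C where C: "\<And>a b. norm (m a b) \<le> norm a * norm b * C" "C \<ge> 0"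
    using nonneg_bounded by blast
  have "compact (w ` K)" using w K by (intro compact_continuous_image continuous_on_subset[OF w(1)]) auto
  then obtain B where B: "\<And>x. x \<in> K \<Longrightarrow> norm (w x) \<le> B"
    by (meson compact_imp_bounded bounded_iff imageI)
  have int: "integrable lebesgue (\<lambda>x. indicator K x *\<^sub>R u x)"
    using u K by (auto simp: locally_integrable_def set_integrable_def)
  have eq: "indicator \<Omega> x *\<^sub>R m (w x) (u x) = m (w x) (indicator K x *\<^sub>R u x)" for x
    using K w(2) by (auto simp: indicator_def zero_left)
  have [measurable]: "w \<in> borel_measurable lebesgue"
    using w(1) by (intro measurable_completion) (simp add: borel_measurable_continuous_onI)
  have "continuous_on UNIV (\<lambda>p. m (fst p) (snd p))"
    by (intro continuous_on continuous_intros)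
  then have meas: "(\<lambda>x. m (w x) (indicator K x *\<^sub>R u x)) \<in> borel_measurable lebesgue"
    using int by (intro borel_measurable_continuous_Pair[where H = m]) auto
  have "integrable lebesgue (\<lambda>x. m (w x) (indicator K x *\<^sub>R u x))"
  proof (rule Bochner_Integration.integrable_bound[OF _ meas])
    show "integrable lebesgue (\<lambda>x. (B * C) *\<^sub>R (indicator K x *\<^sub>R u x))"
      using int by (rule integrable_scaleR_right)
    show "AE x in lebesgue. norm (m (w x) (indicator K x *\<^sub>R u x)) \<le> norm ((B * C) *\<^sub>R (indicator K x *\<^sub>R u x))"
    proof (rule AE_I2)
      fix x
      show "norm (m (w x) (indicator K x *\<^sub>R u x)) \<le> norm ((B * C) *\<^sub>R (indicator K x *\<^sub>R u x))"
      proof (cases "x \<in> K")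
        case True
        have "norm (m (w x) (u x)) \<le> norm (w x) * norm (u x) * C" by (rule C)
        also have "\<dots> \<le> B * norm (u x) * C" by (intro mult_right_mono B True C) auto
        also have "\<dots> \<le> \<bar>B * C\<bar> * norm (u x)"
          by (metis abs_ge_self mult.assoc mult.commute mult_right_mono norm_ge_zero)
        finally show ?thesis using True by simp
      qed (simp add: zero_right)
    qed
  qed
  then show ?thesis using \<Omega> by (subst integrable_restrict_space) (auto simp: eq)
qed

lemma locally_integrable_l2:
  fixes u :: "'a::euclidean_space \<Rightarrow> 'b::euclidean_space"
  assumes "open \<Omega>" "bounded \<Omega>" "square_integrable (lebesgue_on \<Omega>) u"
  shows "locally_integrable \<Omega> u"
proof -
  have "finite_measure (lebesgue_on \<Omega>)"
    using assms by (intro finite_measure_lebesgue_on bounded_set_imp_lmeasurable) auto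
  then have "integrable (lebesgue_on \<Omega>) u" by (rule l2_imp_integrable[OF _ assms(3)])
  then have "set_integrable lebesgue \<Omega> u"
    using assms(1) by (subst (asm) integrable_restrict_space) (auto simp: set_integrable_def)
  then show ?thesis
    unfolding locally_integrable_def using set_integrable_subset by (blast intro: lmeasurable_compact fmeasurableD)
qed

lemma locally_integrable_continuous:
  fixes w :: "'a::euclidean_space \<Rightarrow> 'b::euclidean_space"
  assumes "continuous_on UNIV w"
  shows "locally_integrable \<Omega> w"
  unfolding locally_integrable_def set_integrable_def
proof (intro allI impI)
  fix C assume "compact C \<and> C \<subseteq> \<Omega>"
  then have "integrable lborel (\<lambda>x. indicator C x *\<^sub>R w x)"
    by (intro borel_integrable_compact continuous_on_subset[OF assms]) auto
  then show "integrable lebesgue (\<lambda>x. indicator C x *\<^sub>R w x)"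
    by (subst integrable_completion) auto
qed

text \<open>Translation invariance makes every difference quotient integrate to 0, and the quotients
  converge to the derivative. Dominated convergence applies because the mean value theorem writes a
  quotient as a value of the derivative on a segment.\<close>

lemma integral_directional_derivative_zero:
  fixes F :: "'a::euclidean_space \<Rightarrow> real"
  assumes F: "\<And>x. (F has_derivative F' x) (at x)" and cont: "continuous_on UNIV (\<lambda>x. F' x v)"
    and K: "compact K" "\<And>x. x \<notin> K \<Longrightarrow> F x = 0"
  shows "(\<integral>x. F' x v \<partial>lborel) = 0"
proof -
  have contF: "continuous_on UNIV F"
    using F by (meson has_derivative_continuous continuous_at_imp_continuous_on)
  have [measurable]: "F \<in> borel_measurable borel" using contF by (rule borel_measurable_continuous_onI)
  have [measurable]: "(\<lambda>x. F' x v) \<in> borel_measurable borel" using cont by (rule borel_measurable_continuous_onI)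
  have z: "F' x v = 0" if x: "x \<notin> K" for x
  proof -
    have "((\<lambda>_. 0) has_derivative (\<lambda>_. 0)) (at x)" by simp
    then have "(F has_derivative (\<lambda>_. 0)) (at x)"
    proof (rule has_derivative_transform_within_open)
      show "open (- K)" using K(1) by (simp add: compact_imp_closed open_Compl)
    qed (use x K in auto)
    from has_derivative_unique[OF F this] show ?thesis by simp
  qed
  have der: "((\<lambda>s. F (x + s *\<^sub>R v)) has_real_derivative F' (x + t *\<^sub>R v) v) (at t)" for x t
  proof -
    have "((\<lambda>s. F (x + s *\<^sub>R v)) has_derivative (\<lambda>h. F' (x + t *\<^sub>R v) (h *\<^sub>R v))) (at t)"
      by (rule has_derivative_compose[of "\<lambda>s. x + s *\<^sub>R v" "\<lambda>h. h *\<^sub>R v" t UNIV F "F' (x + t *\<^sub>R v)"])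
        (auto intro!: derivative_eq_intros simp: F)
    moreover have "(\<lambda>h. F' (x + t *\<^sub>R v) (h *\<^sub>R v)) = (*) (F' (x + t *\<^sub>R v) v)"
      by (auto simp: linear_scale[OF has_derivative_linear[OF F]] mult.commute)
    ultimately show ?thesis by (simp add: has_field_derivative_def)
  qed
  have "compact ((\<lambda>x. F' x v) ` K)" by (intro compact_continuous_image K continuous_on_subset[OF cont]) auto
  then obtain B where "\<And>x. x \<in> K \<Longrightarrow> norm (F' x v) \<le> B"
    by (meson compact_imp_bounded bounded_iff imageI)
  then have B: "norm (F' x v) \<le> max B 0" for x
    using z[of x] by (cases "x \<in> K") (auto simp: le_max_iff_disj)
  \<comment> \<open>Contains the supports of all difference quotients with step at most 1.\<close>
  define K' where "K' = (\<lambda>(x, s). x - s *\<^sub>R v) ` (K \<times> {0..1})"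
  have K': "compact K'" unfolding K'_def
    by (intro compact_continuous_image compact_Times K) (auto intro!: continuous_intros simp: split_def)
  define q where "q k x = real (Suc k) * (F (x + (1 / real (Suc k)) *\<^sub>R v) - F x)" for k x
  have intF: "integrable lborel F"
  proof -
    have e: "indicator K x *\<^sub>R F x = F x" for x using K(2) by (cases "x \<in> K") auto
    show ?thesis using borel_integrable_compact[OF K(1) continuous_on_subset[OF contF subset_UNIV]] unfolding e .
  qed
  have shift: "integrable lborel (\<lambda>x. F (x + c)) \<and> (\<integral>x. F (x + c) \<partial>lborel) = (\<integral>x. F x \<partial>lborel)" for c
  proof -
    have "integrable (distr lborel borel ((+) c)) F" unfolding lborel_distr_plus by (rule intF)
    then have "integrable lborel (\<lambda>x. F (c + x))" by (subst (asm) integrable_distr_eq) auto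
    moreover have "(\<integral>x. F x \<partial>distr lborel borel ((+) c)) = (\<integral>x. F (c + x) \<partial>lborel)"
      by (subst integral_distr) auto
    ultimately show ?thesis unfolding lborel_distr_plus by (simp add: add.commute)
  qed
  have q0: "(\<integral>x. q k x \<partial>lborel) = 0" for k
    unfolding q_def using shift[of "(1 / real (Suc k)) *\<^sub>R v"] intF by simp
  have "(\<lambda>k. \<integral>x. q k x \<partial>lborel) \<longlonglongrightarrow> (\<integral>x. F' x v \<partial>lborel)"
  proof (rule integral_dominated_convergence)
    show "integrable lborel (\<lambda>x. indicator K' x *\<^sub>R max B 0)"
      by (rule borel_integrable_compact[OF K']) simp
    show "AE x in lborel. (\<lambda>k. q k x) \<longlonglongrightarrow> F' x v"
    proof (rule AE_I2)
      fix x
      have "((\<lambda>s. (F (x + s *\<^sub>R v) - F x) / s) \<longlongrightarrow> F' x v) (at 0)"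
        using der[of x 0] by (simp add: DERIV_def)
      moreover have "filterlim (\<lambda>k. 1 / real (Suc k)) (at 0) sequentially"
        unfolding filterlim_at using LIMSEQ_inverse_real_of_nat by (simp add: inverse_eq_divide)
      ultimately have "(\<lambda>k. (F (x + (1 / real (Suc k)) *\<^sub>R v) - F x) / (1 / real (Suc k))) \<longlonglongrightarrow> F' x v"
        by (rule filterlim_compose)
      then show "(\<lambda>k. q k x) \<longlonglongrightarrow> F' x v" by (simp add: q_def mult.commute)
    qed
    show "AE x in lborel. norm (q k x) \<le> indicator K' x *\<^sub>R max B 0" for k
    proof (rule AE_I2)
      fix x
      define s where "s = 1 / real (Suc k)"
      have s: "0 < s" "s \<le> 1" by (auto simp: s_def)
      obtain t where t: "0 < t" "t < s" "F (x + s *\<^sub>R v) - F (x + 0 *\<^sub>R v) = (s - 0) * F' (x + t *\<^sub>R v) v"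
        using MVT2[OF s(1), of "\<lambda>t. F (x + t *\<^sub>R v)" "\<lambda>t. F' (x + t *\<^sub>R v) v"] der[of x] by metis
      have qe: "q k x = F' (x + t *\<^sub>R v) v"
      proof -
        have "q k x = real (Suc k) * (F (x + s *\<^sub>R v) - F x)" by (simp only: q_def s_def)
        also have "\<dots> = (real (Suc k) * s) * F' (x + t *\<^sub>R v) v" using t(3) by (simp del: of_nat_Suc)
        also have "real (Suc k) * s = 1" by (simp add: s_def)
        finally show ?thesis by simp
      qed
      show "norm (q k x) \<le> indicator K' x *\<^sub>R max B 0"
      proof (cases "x \<in> K'")
        case True then show ?thesis using B by (simp add: qe)
      next
        case False
        have "x + t *\<^sub>R v \<notin> K"
        proof
          assume "x + t *\<^sub>R v \<in> K"
          then have "(x + t *\<^sub>R v) - t *\<^sub>R v \<in> K'" unfolding K'_def using t s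
            by (intro image_eqI[of _ _ "(x + t *\<^sub>R v, t)"]) auto
          with False show False by simp
        qed
        then show ?thesis using z qe by simp
      qed
    qed
  qed (auto simp: q_def)
  then show ?thesis unfolding q0 by (simp add: LIMSEQ_const_iff)
qed

text \<open>The product of the two functions has compact support inside \<open>\<Omega>\<close>, so
  its directional derivatives integrate to 0 over the whole space, and integration over
  \<open>\<Omega>\<close> gives the same value.\<close>

lemma smooth_integration_by_parts:
  fixes \<Phi> :: "'a::euclidean_space \<Rightarrow> real"
  assumes \<Omega>: "open \<Omega>" and \<Phi>: "smooth \<Phi>" and \<phi>: "test_function \<Omega> \<phi>"
  shows "(\<integral>x. \<Phi> x *\<^sub>R gradient \<phi> x \<partial>lebesgue_on \<Omega>) = - (\<integral>x. \<phi> x *\<^sub>R gradient \<Phi> x \<partial>lebesgue_on \<Omega>)"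
proof -
  have s\<phi>: "smooth \<phi>" using \<phi> by (simp add: test_function_def)
  obtain K where K: "compact K" "K \<subseteq> \<Omega>" "\<And>x. x \<notin> K \<Longrightarrow> \<phi> x = 0" "\<And>x. x \<notin> K \<Longrightarrow> gradient \<phi> x = 0"
    using test_functionE[OF \<phi>] by blast
  have i1: "integrable (lebesgue_on \<Omega>) (\<lambda>x. \<Phi> x *\<^sub>R gradient \<phi> x)"
    by (rule integrable_continuous_mult[OF \<Omega> K(1,2) locally_integrable_continuous smooth_gradient_continuous[OF s\<phi>] K(4), of \<Phi> "\<lambda>a b. b *\<^sub>R a"])
       (auto intro: smooth_continuous \<Phi> bounded_bilinear.flip[OF bounded_bilinear_scaleR])
  have i2: "integrable (lebesgue_on \<Omega>) (\<lambda>x. \<phi> x *\<^sub>R gradient \<Phi> x)"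
    by (rule integrable_continuous_mult[OF \<Omega> K(1,2) locally_integrable_continuous smooth_continuous[OF s\<phi>] K(3) bounded_bilinear_scaleR])
       (auto intro: smooth_gradient_continuous \<Phi>)
  have "(\<integral>x. \<Phi> x *\<^sub>R gradient \<phi> x + \<phi> x *\<^sub>R gradient \<Phi> x \<partial>lebesgue_on \<Omega>) = 0"
  proof (rule euclidean_eqI)
    fix b :: 'a
    define F' where "F' x h = \<Phi> x * (gradient \<phi> x \<bullet> h) + (gradient \<Phi> x \<bullet> h) * \<phi> x" for x h
    have "((\<lambda>x. \<Phi> x * \<phi> x) has_derivative F' x) (at x)" for x
      unfolding F'_def by (intro has_derivative_mult smooth_has_derivative \<Phi> s\<phi>)
    moreover have contF': "continuous_on UNIV (\<lambda>x. F' x b)" unfolding F'_def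
      by (intro continuous_intros smooth_gradient_continuous smooth_continuous \<Phi> s\<phi>)
    ultimately have "(\<integral>x. F' x b \<partial>lborel) = 0"
      by (rule integral_directional_derivative_zero[OF _ _ K(1)]) (simp add: K)
    also have "(\<integral>x. F' x b \<partial>lborel) = (\<integral>x. F' x b \<partial>lebesgue)"
      by (rule integral_completion[symmetric]) (simp add: borel_measurable_continuous_onI contF')
    also have "\<dots> = (\<integral>x. indicator \<Omega> x *\<^sub>R F' x b \<partial>lebesgue)"
    proof (rule Bochner_Integration.integral_cong[OF refl])
      fix x show "F' x b = indicator \<Omega> x *\<^sub>R F' x b"
        using K(2) K(3)[of x] K(4)[of x] by (cases "x \<in> K") (auto simp: F'_def)
    qed
    also have "\<dots> = (\<integral>x. F' x b \<partial>lebesgue_on \<Omega>)"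
      using \<Omega> by (subst integral_restrict_space) auto
    also have "\<dots> = (\<integral>x. (\<Phi> x *\<^sub>R gradient \<phi> x + \<phi> x *\<^sub>R gradient \<Phi> x) \<bullet> b \<partial>lebesgue_on \<Omega>)"
      by (simp add: F'_def inner_add_left mult.commute)
    also have "\<dots> = (\<integral>x. \<Phi> x *\<^sub>R gradient \<phi> x + \<phi> x *\<^sub>R gradient \<Phi> x \<partial>lebesgue_on \<Omega>) \<bullet> b"
      by (rule integral_inner_left) (intro Bochner_Integration.integrable_add i1 i2)
    finally show "(\<integral>x. \<Phi> x *\<^sub>R gradient \<phi> x + \<phi> x *\<^sub>R gradient \<Phi> x \<partial>lebesgue_on \<Omega>) \<bullet> b = 0 \<bullet> b" by simp
  qed
  then show ?thesis
    by (subst (asm) Bochner_Integration.integral_add[OF i1 i2]) (simp add: eq_neg_iff_add_eq_0)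
qed

lemma has_weak_gradient_smooth:
  fixes \<Phi> :: "'a::euclidean_space \<Rightarrow> real"
  assumes \<Omega>: "open \<Omega>" and \<Phi>: "smooth \<Phi>"
  shows "has_weak_gradient \<Omega> \<Phi> (gradient \<Phi>)"
  unfolding has_weak_gradient_def
  by (intro conjI allI impI smooth_integration_by_parts[OF assms] locally_integrable_continuous
      smooth_continuous[OF \<Phi>] smooth_gradient_continuous[OF \<Phi>])

lemma test_integrable:
  fixes \<Omega> :: "'a::euclidean_space set"
  assumes \<Omega>: "open \<Omega>" and \<phi>: "test_function \<Omega> \<phi>"
  shows "locally_integrable \<Omega> u \<Longrightarrow> integrable (lebesgue_on \<Omega>) (\<lambda>x. u x *\<^sub>R gradient \<phi> x)"
    and "locally_integrable \<Omega> G \<Longrightarrow> integrable (lebesgue_on \<Omega>) (\<lambda>x. \<phi> x *\<^sub>R (G x :: 'a))"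
proof -
  have s\<phi>: "smooth \<phi>" using \<phi> by (simp add: test_function_def)
  obtain K where K: "compact K" "K \<subseteq> \<Omega>" "\<And>x. x \<notin> K \<Longrightarrow> \<phi> x = 0" "\<And>x. x \<notin> K \<Longrightarrow> gradient \<phi> x = 0"
    using test_functionE[OF \<phi>] by blast
  show "locally_integrable \<Omega> u \<Longrightarrow> integrable (lebesgue_on \<Omega>) (\<lambda>x. u x *\<^sub>R gradient \<phi> x)"
    by (rule integrable_continuous_mult[OF \<Omega> K(1,2) _ smooth_gradient_continuous[OF s\<phi>] K(4), of u "\<lambda>a b. b *\<^sub>R a"])
       (auto intro: bounded_bilinear.flip[OF bounded_bilinear_scaleR])
  show "locally_integrable \<Omega> G \<Longrightarrow> integrable (lebesgue_on \<Omega>) (\<lambda>x. \<phi> x *\<^sub>R G x)"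
    by (rule integrable_continuous_mult[OF \<Omega> K(1,2) _ smooth_continuous[OF s\<phi>] K(3) bounded_bilinear_scaleR])
qed

lemma locally_integrable_lincomb:
  fixes u v :: "'a::euclidean_space \<Rightarrow> 'b::euclidean_space"
  assumes "locally_integrable \<Omega> u" "locally_integrable \<Omega> v"
  shows "locally_integrable \<Omega> (\<lambda>x. u x + c *\<^sub>R v x)"
  using assms by (auto simp: locally_integrable_def)

lemma has_weak_gradient_lincomb:
  assumes \<Omega>: "open \<Omega>" and u: "has_weak_gradient \<Omega> u G" and v: "has_weak_gradient \<Omega> v H"
  shows "has_weak_gradient \<Omega> (\<lambda>x. u x + c * v x) (\<lambda>x. G x + c *\<^sub>R H x)"
  unfolding has_weak_gradient_def
proof (intro conjI allI impI)
  have lu: "locally_integrable \<Omega> u" "locally_integrable \<Omega> G" and lv: "locally_integrable \<Omega> v" "locally_integrable \<Omega> H"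
    using u v by (auto simp: has_weak_gradient_def)
  show "locally_integrable \<Omega> (\<lambda>x. u x + c * v x)" "locally_integrable \<Omega> (\<lambda>x. G x + c *\<^sub>R H x)"
    using locally_integrable_lincomb[OF lu(1) lv(1), of c] locally_integrable_lincomb[OF lu(2) lv(2), of c] by simp_all
  fix \<phi> assume \<phi>: "test_function \<Omega> \<phi>"
  note i = test_integrable[OF \<Omega> \<phi>]
  have "(\<integral>x. (u x + c * v x) *\<^sub>R gradient \<phi> x \<partial>lebesgue_on \<Omega>)
      = (\<integral>x. u x *\<^sub>R gradient \<phi> x + c *\<^sub>R (v x *\<^sub>R gradient \<phi> x) \<partial>lebesgue_on \<Omega>)"
    by (simp add: scaleR_add_left)
  also have "\<dots> = (\<integral>x. u x *\<^sub>R gradient \<phi> x \<partial>lebesgue_on \<Omega>) + c *\<^sub>R (\<integral>x. v x *\<^sub>R gradient \<phi> x \<partial>lebesgue_on \<Omega>)"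
    using i(1)[OF lu(1)] i(1)[OF lv(1)] by (subst Bochner_Integration.integral_add) (auto simp del: scaleR_scaleR)
  also have "\<dots> = - ((\<integral>x. \<phi> x *\<^sub>R G x \<partial>lebesgue_on \<Omega>) + c *\<^sub>R (\<integral>x. \<phi> x *\<^sub>R H x \<partial>lebesgue_on \<Omega>))"
    using u v \<phi> by (simp add: has_weak_gradient_def)
  also have "(\<integral>x. \<phi> x *\<^sub>R G x \<partial>lebesgue_on \<Omega>) + c *\<^sub>R (\<integral>x. \<phi> x *\<^sub>R H x \<partial>lebesgue_on \<Omega>)
      = (\<integral>x. \<phi> x *\<^sub>R G x + c *\<^sub>R (\<phi> x *\<^sub>R H x) \<partial>lebesgue_on \<Omega>)"
    using i(2)[OF lu(2)] i(2)[OF lv(2)] by (subst Bochner_Integration.integral_add) (auto simp del: scaleR_scaleR)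
  also have "\<dots> = (\<integral>x. \<phi> x *\<^sub>R (G x + c *\<^sub>R H x) \<partial>lebesgue_on \<Omega>)"
    by (simp add: scaleR_add_right mult.commute)
  finally show "(\<integral>x. (u x + c * v x) *\<^sub>R gradient \<phi> x \<partial>lebesgue_on \<Omega>)
      = - (\<integral>x. \<phi> x *\<^sub>R (G x + c *\<^sub>R H x) \<partial>lebesgue_on \<Omega>)" .
qed

text \<open>Testing with approximations of box indicators makes the integrals of \<open>G\<close>
  over all boxes in \<open>\<Omega>\<close> vanish. Lebesgue's differentiation theorem on shrinking
  cubes then gives \<open>G = 0\<close> almost everywhere in a box, and countably many boxes exhaust
  \<open>\<Omega>\<close>.\<close>

lemma AE_zero_if_test_integrals_zero:
  fixes G :: "'a::euclidean_space \<Rightarrow> 'a"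
  assumes \<Omega>: "open \<Omega>" and G: "locally_integrable \<Omega> G"
    and zero: "\<And>\<phi>. test_function \<Omega> \<phi> \<Longrightarrow> (\<integral>x. \<phi> x *\<^sub>R G x \<partial>lebesgue_on \<Omega>) = 0"
  shows "AE x in lebesgue_on \<Omega>. G x = 0"
proof -
  have intbox: "integral (cbox a c) G = 0" if ac: "cbox a c \<subseteq> \<Omega>" for a c
  proof -
    obtain \<phi> where \<phi>: "\<And>n. smooth (\<phi> n)" "\<And>n x. 0 \<le> \<phi> n x" "\<And>n x. \<phi> n x \<le> 1"
      "\<And>n x. x \<notin> box a c \<Longrightarrow> \<phi> n x = 0" "\<And>x. x \<in> box a c \<Longrightarrow> (\<lambda>n. \<phi> n x) \<longlonglongrightarrow> 1"
      using box_indicator_approximation[of a c] by blast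
    have int: "integrable lebesgue (\<lambda>x. indicator (cbox a c) x *\<^sub>R G x)"
      using G ac by (auto simp: locally_integrable_def set_integrable_def)
    have cl: "closure {x. \<phi> n x \<noteq> 0} \<subseteq> cbox a c" for n
      by (rule closure_minimal) (use \<phi>(4) box_subset_cbox in blast)+
    have test: "test_function \<Omega> (\<phi> n)" for n
      unfolding test_function_def
    proof (intro conjI)
      show "compact (closure {x. \<phi> n x \<noteq> 0})"
        using bounded_subset[OF bounded_cbox cl[of n]] by (simp add: compact_eq_bounded_closed)
    qed (use \<phi>(1) cl[of n] ac in auto)
    have meas: "\<phi> n \<in> borel_measurable lebesgue" for n
      using smooth_measurable(1)[OF \<phi>(1)] by (intro measurable_completion) simp
    have eq: "\<phi> n x *\<^sub>R (indicator (cbox a c) x *\<^sub>R G x) = indicator \<Omega> x *\<^sub>R (\<phi> n x *\<^sub>R G x)" for n x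
      using \<phi>(4)[of x n] ac box_subset_cbox[of a c] by (cases "x \<in> cbox a c"; cases "x \<in> \<Omega>") auto
    have "(\<lambda>n. \<integral>x. \<phi> n x *\<^sub>R (indicator (cbox a c) x *\<^sub>R G x) \<partial>lebesgue) \<longlonglongrightarrow>
        (\<integral>x. indicator (box a c) x *\<^sub>R (indicator (cbox a c) x *\<^sub>R G x) \<partial>lebesgue)"
    proof (rule integral_dominated_convergence[where w = "\<lambda>x. norm (indicator (cbox a c) x *\<^sub>R G x)"])
      show "(\<lambda>x. indicat_real (box a c) x *\<^sub>R indicat_real (cbox a c) x *\<^sub>R G x) \<in> borel_measurable lebesgue"
        by (rule borel_measurable_scaleR[OF borel_measurable_indicator borel_measurable_integrable[OF int]]) simp
      show "(\<lambda>x. \<phi> n x *\<^sub>R indicat_real (cbox a c) x *\<^sub>R G x) \<in> borel_measurable lebesgue" for n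
        by (rule borel_measurable_scaleR[OF meas borel_measurable_integrable[OF int]])
      show "integrable lebesgue (\<lambda>x. norm (indicat_real (cbox a c) x *\<^sub>R G x))" using int by (rule integrable_norm)
      show "AE x in lebesgue. (\<lambda>n. \<phi> n x *\<^sub>R indicat_real (cbox a c) x *\<^sub>R G x) \<longlonglongrightarrow> indicat_real (box a c) x *\<^sub>R indicat_real (cbox a c) x *\<^sub>R G x"
      proof (rule AE_I2)
        fix x show "(\<lambda>n. \<phi> n x *\<^sub>R indicat_real (cbox a c) x *\<^sub>R G x) \<longlonglongrightarrow> indicat_real (box a c) x *\<^sub>R indicat_real (cbox a c) x *\<^sub>R G x"
        proof (cases "x \<in> box a c")
          case True
          then show ?thesis
            using tendsto_scaleR[OF \<phi>(5)[OF True] tendsto_const[of "indicat_real (cbox a c) x *\<^sub>R G x"]] by simp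
        qed (simp add: \<phi>(4))
      qed
      show "AE x in lebesgue. norm (\<phi> n x *\<^sub>R indicat_real (cbox a c) x *\<^sub>R G x) \<le> norm (indicat_real (cbox a c) x *\<^sub>R G x)" for n
      proof (rule AE_I2)
        fix x show "norm (\<phi> n x *\<^sub>R indicat_real (cbox a c) x *\<^sub>R G x) \<le> norm (indicat_real (cbox a c) x *\<^sub>R G x)"
          using \<phi>(2,3)[of n x] mult_right_mono[OF \<phi>(3)[of n x], of "norm (indicat_real (cbox a c) x *\<^sub>R G x)"] by simp
      qed
    qed
    moreover have "(\<integral>x. \<phi> n x *\<^sub>R (indicator (cbox a c) x *\<^sub>R G x) \<partial>lebesgue) = 0" for n
      unfolding eq using zero[OF test[of n]] \<Omega> by (subst (asm) integral_restrict_space) auto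
    ultimately have 0: "(\<integral>x. indicator (box a c) x *\<^sub>R (indicator (cbox a c) x *\<^sub>R G x) \<partial>lebesgue) = 0"
      by (simp add: LIMSEQ_const_iff)
    have e: "indicator (box a c) x *\<^sub>R (indicator (cbox a c) x *\<^sub>R G x) = indicator (box a c) x *\<^sub>R G x" for x
      using box_subset_cbox[of a c] by (auto simp: indicator_def)
    have "set_integrable lebesgue (box a c) G"
      by (rule set_integrable_subset[of _ "cbox a c"]) (use int box_subset_cbox in \<open>auto simp: set_integrable_def\<close>)
    from has_integral_set_lebesgue[OF this] have "(G has_integral 0) (box a c)"
      using 0 unfolding e set_lebesgue_integral_def by simp
    then show ?thesis using integral_open_interval[of a c G] integral_unique by metis
  qed
  have boxAE: "AE x in lebesgue. x \<in> cbox a c \<longrightarrow> G x = 0" if ac: "cbox a c \<subseteq> \<Omega>" for a c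
  proof -
    \<comment> \<open>The cutoff makes \<open>f\<close> integrable on every box of the whole space,
      as the differentiation theorem requires.\<close>
    define f where "f x = indicator (cbox a c) x *\<^sub>R G x" for x
    have "integrable lebesgue (\<lambda>x. indicator (cbox a c) x *\<^sub>R G x)"
      using G ac by (auto simp: locally_integrable_def set_integrable_def)
    then have "integrable lebesgue f" by (simp add: f_def[abs_def])
    then have "f integrable_on cbox u v" for u v
      using integrable_on_lebesgue integrable_on_subcbox by blast
    then obtain N where N: "negligible N" "\<And>x e. \<lbrakk>x \<notin> N; 0 < e\<rbrakk> \<Longrightarrow>
        \<exists>d>0. \<forall>h. 0 < h \<and> h < d \<longrightarrow> norm (integral (cbox x (x + h *\<^sub>R One)) f /\<^sub>R h ^ DIM('a) - f x) < e"
      using integrable_ccontinuous_explicit[of f] by blast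
    have "G x = 0" if x: "x \<in> box a c" "x \<notin> N" for x
    proof (rule ccontr)
      assume nz: "G x \<noteq> 0"
      have fx: "f x = G x" using x box_subset_cbox[of a c] by (auto simp: f_def)
      obtain d where d: "d > 0" "\<forall>h. 0 < h \<and> h < d \<longrightarrow> norm (integral (cbox x (x + h *\<^sub>R One)) f /\<^sub>R h ^ DIM('a) - f x) < norm (G x)"
        using N(2)[OF x(2), of "norm (G x)"] nz by auto
      have "open (box a c)" by (rule open_box)
      then obtain \<epsilon> where \<epsilon>: "\<epsilon> > 0" "cball x \<epsilon> \<subseteq> box a c" using x open_contains_cball by metis
      define h where "h = min (d / 2) (\<epsilon> / norm (One :: 'a))"
      have One: "norm (One :: 'a) > 0" 
      proof -
        have "(One :: 'a) \<noteq> 0" using inner_sum_Basis[OF SOME_Basis, where 'a = 'a] by (metis inner_zero_left zero_neq_one)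
        then show ?thesis by simp
      qed
      have h: "0 < h" "h < d" "h * norm (One :: 'a) \<le> \<epsilon>" using d \<epsilon> One
        by (auto simp: h_def min_def field_simps)
      have sub: "cbox x (x + h *\<^sub>R One) \<subseteq> cbox a c"
      proof -
        have "x + h *\<^sub>R One \<in> cball x \<epsilon>" using h by (simp add: dist_norm)
        then have "x + h *\<^sub>R One \<in> cbox a c" "x \<in> cbox a c" using \<epsilon> x box_subset_cbox[of a c] by auto
        then show ?thesis by (simp add: subset_box mem_box)
      qed
      have "integral (cbox x (x + h *\<^sub>R One)) f = integral (cbox x (x + h *\<^sub>R One)) G"
        by (rule integral_cong) (use sub in \<open>auto simp: f_def\<close>)
      also have "\<dots> = 0" using intbox sub ac by blast
      finally show False using d(2) h fx by auto
    qed
    then have "{x. \<not> (x \<in> cbox a c \<longrightarrow> G x = 0)} \<subseteq> N \<union> (cbox a c - box a c)" by blast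
    then have "negligible {x. \<not> (x \<in> cbox a c \<longrightarrow> G x = 0)}"
      using negligible_subset[OF negligible_Un[OF N(1) negligible_frontier_interval]] by blast
    then show ?thesis by (simp add: negligible_iff_null_sets completion.AE_iff_null_sets)
  qed
  obtain \<D> where \<D>: "countable \<D>" "\<D> \<subseteq> Pow \<Omega>" "\<And>X. X \<in> \<D> \<Longrightarrow> \<exists>a b. X = cbox a b" "\<Union>\<D> = \<Omega>"
    using open_countable_Union_open_cbox[OF \<Omega>] by metis
  have "AE x in lebesgue. \<forall>X\<in>\<D>. x \<in> X \<longrightarrow> G x = 0"
  proof (rule AE_ball_countable'[OF _ \<D>(1)])
    fix X assume X: "X \<in> \<D>"
    then obtain a c where "X = cbox a c" using \<D> by blast
    with boxAE[of a c] X \<D>(2) show "AE x in lebesgue. x \<in> X \<longrightarrow> G x = 0" by auto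
  qed
  then have "AE x in lebesgue. x \<in> \<Omega> \<longrightarrow> G x = 0"
    by eventually_elim (use \<D>(4) in blast)
  then show ?thesis using \<Omega> by (subst AE_restrict_space_iff) auto
qed

text \<open>This is why the choice made by \<open>weak_gradient\<close> does not matter.\<close>

lemma weak_gradient_unique:
  fixes u :: "'a::euclidean_space \<Rightarrow> real"
  assumes \<Omega>: "open \<Omega>" and G: "has_weak_gradient \<Omega> u G" and H: "has_weak_gradient \<Omega> u H"
  shows "AE x in lebesgue_on \<Omega>. G x = H x"
proof -
  have lG: "locally_integrable \<Omega> G" and lH: "locally_integrable \<Omega> H"
    using G H by (auto simp: has_weak_gradient_def)
  have "locally_integrable \<Omega> (\<lambda>x. G x - H x)"
    using locally_integrable_lincomb[OF lG lH, of "-1"] by simp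
  moreover have "(\<integral>x. \<phi> x *\<^sub>R (G x - H x) \<partial>lebesgue_on \<Omega>) = 0" if \<phi>: "test_function \<Omega> \<phi>" for \<phi>
  proof -
    have "(\<integral>x. \<phi> x *\<^sub>R (G x - H x) \<partial>lebesgue_on \<Omega>)
       = (\<integral>x. \<phi> x *\<^sub>R G x \<partial>lebesgue_on \<Omega>) - (\<integral>x. \<phi> x *\<^sub>R H x \<partial>lebesgue_on \<Omega>)"
      unfolding scaleR_diff_right by (rule Bochner_Integration.integral_diff test_integrable(2)[OF \<Omega> \<phi>] lG lH)+
    also have "(\<integral>x. \<phi> x *\<^sub>R G x \<partial>lebesgue_on \<Omega>) = - (\<integral>x. u x *\<^sub>R gradient \<phi> x \<partial>lebesgue_on \<Omega>)"
      using G \<phi> by (simp add: has_weak_gradient_def)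
    also have "(\<integral>x. \<phi> x *\<^sub>R H x \<partial>lebesgue_on \<Omega>) = - (\<integral>x. u x *\<^sub>R gradient \<phi> x \<partial>lebesgue_on \<Omega>)"
      using H \<phi> by (simp add: has_weak_gradient_def)
    finally show ?thesis by simp
  qed
  ultimately have "AE x in lebesgue_on \<Omega>. G x - H x = 0"
    by (rule AE_zero_if_test_integrals_zero[OF \<Omega>])
  then show ?thesis by simp
qed

lemma l2_tendsto_inner_integral:
  fixes F :: "nat \<Rightarrow> 'a \<Rightarrow> 'b::euclidean_space"
  assumes F: "\<And>n. square_integrable M (F n)" and f: "square_integrable M f" and g: "square_integrable M g"
    and lim: "(\<lambda>n. l2_norm M (\<lambda>x. F n x - f x)) \<longlonglongrightarrow> 0"
  shows "(\<lambda>n. \<integral>x. F n x \<bullet> g x \<partial>M) \<longlonglongrightarrow> (\<integral>x. f x \<bullet> g x \<partial>M)"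
proof -
  have "norm ((\<integral>x. F n x \<bullet> g x \<partial>M) - (\<integral>x. f x \<bullet> g x \<partial>M)) \<le> l2_norm M (\<lambda>x. F n x - f x) * l2_norm M g" for n
    using l2_Cauchy_Schwarz[OF square_integrable_diff[OF F f] g, of n]
    by (simp add: inner_diff_left inner_integrable[OF F g] inner_integrable[OF f g])
  then have "(\<lambda>n. (\<integral>x. F n x \<bullet> g x \<partial>M) - (\<integral>x. f x \<bullet> g x \<partial>M)) \<longlonglongrightarrow> 0"
    by (intro Lim_null_comparison[OF always_eventually tendsto_mult_left_zero[OF lim]]) blast
  then show ?thesis by (simp add: LIM_zero_iff)
qed

text \<open>Coordinatewise, both sides of the defining identity are \<open>L^2\<close> pairings with
  a fixed test function, and such pairings pass to the limit.\<close>

lemma has_weak_gradient_limit: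
  fixes \<Omega> :: "'a::euclidean_space set"
  assumes \<Omega>: "open \<Omega>" "bounded \<Omega>" and wg: "\<And>n. has_weak_gradient \<Omega> (F n) (G n)"
    and F: "\<And>n. square_integrable (lebesgue_on \<Omega>) (F n)" and G: "\<And>n. square_integrable (lebesgue_on \<Omega>) (G n)"
    and u: "square_integrable (lebesgue_on \<Omega>) u" and H: "square_integrable (lebesgue_on \<Omega>) H"
    and limu: "(\<lambda>n. l2_norm (lebesgue_on \<Omega>) (\<lambda>x. F n x - u x)) \<longlonglongrightarrow> 0"
    and limH: "(\<lambda>n. l2_norm (lebesgue_on \<Omega>) (\<lambda>x. G n x - H x)) \<longlonglongrightarrow> 0"
  shows "has_weak_gradient \<Omega> u H"
  unfolding has_weak_gradient_def
proof (intro conjI allI impI)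
  show lu: "locally_integrable \<Omega> u" and lH: "locally_integrable \<Omega> H"
    by (rule locally_integrable_l2[OF \<Omega>] u H)+
  fix \<phi> assume \<phi>: "test_function \<Omega> \<phi>"
  then have s\<phi>: "smooth \<phi>" by (simp add: test_function_def)
  obtain K where K: "compact K" "K \<subseteq> \<Omega>" "\<And>x. x \<notin> K \<Longrightarrow> \<phi> x = 0" "\<And>x. x \<notin> K \<Longrightarrow> gradient \<phi> x = 0"
    using test_functionE[OF \<phi>] by blast
  have sq: "square_integrable (lebesgue_on \<Omega>) w" if w: "continuous_on UNIV w" "\<And>x. x \<notin> K \<Longrightarrow> w x = 0" for w :: "'a \<Rightarrow> real"
  proof -
    have "integrable (lebesgue_on \<Omega>) (\<lambda>x. w x * w x)"
      by (rule integrable_continuous_mult[OF \<Omega>(1) K(1,2) locally_integrable_continuous w bounded_bilinear_mult]) (fact w)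
    moreover have "w \<in> borel_measurable (lebesgue_on \<Omega>)"
      using w(1) by (intro measurable_restrict_space1 measurable_completion) (simp add: borel_measurable_continuous_onI)
    ultimately show ?thesis by (simp add: square_integrable_def power2_eq_square)
  qed
  show "(\<integral>x. u x *\<^sub>R gradient \<phi> x \<partial>lebesgue_on \<Omega>) = - (\<integral>x. \<phi> x *\<^sub>R H x \<partial>lebesgue_on \<Omega>)"
  proof (rule euclidean_eqI)
    fix b :: 'a assume b: "b \<in> Basis"
    have sq1: "square_integrable (lebesgue_on \<Omega>) (\<lambda>x. gradient \<phi> x \<bullet> b)"
      by (rule sq) (auto intro!: continuous_intros smooth_gradient_continuous s\<phi> simp: K)
    have sq2: "square_integrable (lebesgue_on \<Omega>) (\<lambda>x. \<phi> x *\<^sub>R b)"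
    proof -
      have "square_integrable (lebesgue_on \<Omega>) \<phi>" by (rule sq) (auto intro: smooth_continuous s\<phi> simp: K)
      then show ?thesis using b by (auto simp: square_integrable_def)
    qed
    have c1: "(\<integral>x. w x *\<^sub>R gradient \<phi> x \<partial>lebesgue_on \<Omega>) \<bullet> b = (\<integral>x. w x \<bullet> (gradient \<phi> x \<bullet> b) \<partial>lebesgue_on \<Omega>)"
      if "locally_integrable \<Omega> w" for w
      using test_integrable(1)[OF \<Omega>(1) \<phi> that] by (subst integral_inner_left[symmetric]) auto
    have c2: "(\<integral>x. \<phi> x *\<^sub>R G x \<partial>lebesgue_on \<Omega>) \<bullet> b = (\<integral>x. G x \<bullet> (\<phi> x *\<^sub>R b) \<partial>lebesgue_on \<Omega>)"
      if "locally_integrable \<Omega> G" for G :: "'a \<Rightarrow> 'a"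
      using test_integrable(2)[OF \<Omega>(1) \<phi> that] by (subst integral_inner_left[symmetric]) auto
    have lF: "locally_integrable \<Omega> (F n)" "locally_integrable \<Omega> (G n)" for n
      using wg[of n] by (auto simp: has_weak_gradient_def)
    have "(\<integral>x. F n x \<bullet> (gradient \<phi> x \<bullet> b) \<partial>lebesgue_on \<Omega>) = - (\<integral>x. G n x \<bullet> (\<phi> x *\<^sub>R b) \<partial>lebesgue_on \<Omega>)" for n
      using wg[of n] \<phi> unfolding c1[OF lF(1), symmetric] c2[OF lF(2), symmetric] has_weak_gradient_def by simp
    then have "(\<lambda>n. \<integral>x. F n x \<bullet> (gradient \<phi> x \<bullet> b) \<partial>lebesgue_on \<Omega>) \<longlonglongrightarrow> - (\<integral>x. H x \<bullet> (\<phi> x *\<^sub>R b) \<partial>lebesgue_on \<Omega>)"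
      using tendsto_minus[OF l2_tendsto_inner_integral[OF G H sq2 limH]] by simp
    then have "(\<integral>x. u x \<bullet> (gradient \<phi> x \<bullet> b) \<partial>lebesgue_on \<Omega>) = - (\<integral>x. H x \<bullet> (\<phi> x *\<^sub>R b) \<partial>lebesgue_on \<Omega>)"
      using l2_tendsto_inner_integral[OF F u sq1 limu] LIMSEQ_unique by blast
    then show "(\<integral>x. u x *\<^sub>R gradient \<phi> x \<partial>lebesgue_on \<Omega>) \<bullet> b = - (\<integral>x. \<phi> x *\<^sub>R H x \<partial>lebesgue_on \<Omega>) \<bullet> b"
      by (simp add: c1[OF lu] c2[OF lH])
  qed
qed

section \<open>Cones of inward directions\<close>

text \<open>A uniform interior cone condition, with a ball of directions about \<open>e\<close>
  instead of an angle. \<open>\<kappa> < 1\<close> keeps these directions away from 0. The Lipschitz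
  boundary is used later only in this form.\<close>

definition inner_cone :: "'a::euclidean_space set \<Rightarrow> 'a \<Rightarrow> real \<Rightarrow> 'a \<Rightarrow> real \<Rightarrow> real \<Rightarrow> bool" where
  "inner_cone \<Omega> p r e \<kappa> \<delta> \<longleftrightarrow> 0 < r \<and> 0 < \<kappa> \<and> \<kappa> < 1 \<and> 0 < \<delta> \<and> norm e = 1 \<and>
     (\<forall>x \<in> closure \<Omega> \<inter> ball p r. \<forall>y \<in> ball e \<kappa>. \<forall>t. 0 < t \<and> t < \<delta> \<longrightarrow> x + t *\<^sub>R y \<in> \<Omega>)"

lemma inner_cone_interior:
  fixes \<Omega> :: "'a::euclidean_space set"
  assumes "open \<Omega>" "p \<in> \<Omega>"
  shows "\<exists>r e \<kappa> \<delta>. inner_cone \<Omega> p r e \<kappa> \<delta>"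
proof -
  obtain \<rho> where \<rho>: "\<rho> > 0" "ball p \<rho> \<subseteq> \<Omega>" using assms openE by blast
  obtain e :: 'a where e: "e \<in> Basis" using SOME_Basis by blast
  have "inner_cone \<Omega> p (\<rho> / 2) e (1 / 2) (\<rho> / 4)"
    unfolding inner_cone_def
  proof (intro conjI ballI allI impI)
    fix x y t assume x: "x \<in> closure \<Omega> \<inter> ball p (\<rho> / 2)" and y: "y \<in> ball e (1/2)" and t: "0 < t \<and> t < \<rho> / 4"
    have "norm y \<le> 3 / 2" using y e norm_triangle_ineq2[of y e] by (simp add: dist_norm norm_minus_commute)
    then have "norm (t *\<^sub>R y) \<le> t * (3 / 2)" using t by (simp add: mult_left_mono)
    also have "\<dots> < \<rho> / 2" using t \<rho> by simp
    finally have "dist p (x + t *\<^sub>R y) < \<rho>"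
      using x dist_triangle_le[of p x "x + t *\<^sub>R y" \<rho>] dist_triangle[of p "x + t *\<^sub>R y" x]
      by (simp add: dist_norm)
    then show "x + t *\<^sub>R y \<in> \<Omega>" using \<rho> by auto
  qed (use \<rho> e in auto)
  then show ?thesis by blast
qed

text \<open>A shift by \<open>t *\<^sub>R y\<close> with \<open>y\<close> near \<open>e\<close>
  raises the height above the graph: the coordinate along \<open>e\<close> grows by at least
  \<open>t * (1 - \<kappa>)\<close>, the graph function by at most
  \<open>t * (2 * L * \<kappa>)\<close>.\<close>

lemma inner_cone_frontier:
  fixes \<Omega> :: "'a::euclidean_space set"
  assumes \<Omega>: "open \<Omega>" "lipschitz_boundary \<Omega>" and p: "p \<in> frontier \<Omega>"
  shows "\<exists>r e \<kappa> \<delta>. inner_cone \<Omega> p r e \<kappa> \<delta>"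
proof -
  obtain r e \<psi> L where r: "r > 0" and e: "norm e = 1" and \<psi>: "L-lipschitz_on {y. y \<bullet> e = 0} \<psi>"
    and graph: "\<Omega> \<inter> ball p r = {x \<in> ball p r. x \<bullet> e > \<psi> (x - (x \<bullet> e) *\<^sub>R e)}"
    using assms unfolding lipschitz_boundary_def by blast
  have L: "L \<ge> 0" using \<psi> by (rule lipschitz_on_nonneg)
  define \<pi> where "\<pi> x = x - (x \<bullet> e) *\<^sub>R e" for x
  have ee: "e \<bullet> e = 1" using e by (simp add: dot_square_norm)
  have \<pi>0: "\<pi> x \<bullet> e = 0" for x by (simp add: \<pi>_def inner_diff_left ee)
  have \<pi>lin: "\<pi> x - \<pi> z = \<pi> (x - z)" "\<pi> (x + z) = \<pi> x + \<pi> z" "\<pi> (t *\<^sub>R x) = t *\<^sub>R \<pi> x" for x z t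
    by (simp_all add: \<pi>_def algebra_simps)
  have in_le: "\<bar>x \<bullet> e\<bar> \<le> norm x" for x using Cauchy_Schwarz_ineq2[of x e] e by simp
  have \<pi>norm: "norm (\<pi> x) \<le> 2 * norm x" for x
    using norm_triangle_ineq4[of x "(x \<bullet> e) *\<^sub>R e"] in_le[of x] e by (simp add: \<pi>_def)
  have \<psi>le: "\<bar>\<psi> (\<pi> x) - \<psi> (\<pi> z)\<bar> \<le> L * norm (\<pi> (x - z))" for x z
    using lipschitz_onD[OF \<psi>, of "\<pi> x" "\<pi> z"] \<pi>0 by (simp add: dist_norm \<pi>lin(1))
  \<comment> \<open>The strict inequality of the graph representation survives only as a weak one on
    the closure; the shift along the cone restores strictness.\<close>
  have cl: "x \<bullet> e \<ge> \<psi> (\<pi> x)" if x: "x \<in> closure \<Omega>" "x \<in> ball p r" for x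
  proof (rule ccontr)
    assume "\<not> ?thesis"
    then have neg: "\<psi> (\<pi> x) - x \<bullet> e > 0" by simp
    obtain \<epsilon> where \<epsilon>: "\<epsilon> > 0" "ball x \<epsilon> \<subseteq> ball p r" using openE[OF open_ball x(2)] by blast
    define \<eta> where "\<eta> = min \<epsilon> ((\<psi> (\<pi> x) - x \<bullet> e) / (1 + 2 * L))"
    have "(\<psi> (\<pi> x) - x \<bullet> e) / (1 + 2 * L) > 0" using neg L by (intro divide_pos_pos) auto
    then have "\<eta> > 0" using \<epsilon> by (simp add: \<eta>_def)
    then obtain z where z: "z \<in> \<Omega>" "dist z x < \<eta>" using x(1) closure_approachable by blast
    then have "z \<in> ball p r" using \<epsilon> by (auto simp: \<eta>_def dist_commute)
    then have "z \<in> \<Omega> \<inter> ball p r" using z by blast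
    then have gz: "z \<bullet> e > \<psi> (\<pi> z)" unfolding graph \<pi>_def by blast
    have "\<psi> (\<pi> x) - x \<bullet> e < (z \<bullet> e - x \<bullet> e) + (\<psi> (\<pi> x) - \<psi> (\<pi> z))" using gz by simp
    also have "z \<bullet> e - x \<bullet> e \<le> norm (z - x)" using in_le[of "z - x"] by (simp add: inner_diff_left)
    also have "\<psi> (\<pi> x) - \<psi> (\<pi> z) \<le> L * (2 * norm (x - z))"
      using \<psi>le[of x z] mult_left_mono[OF \<pi>norm[of "x - z"] L] by linarith
    also have "norm (z - x) + L * (2 * norm (x - z)) = (1 + 2 * L) * dist z x"
      by (simp add: dist_norm norm_minus_commute algebra_simps)
    also have "\<dots> \<le> (1 + 2 * L) * ((\<psi> (\<pi> x) - x \<bullet> e) / (1 + 2 * L))"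
      using z(2) L by (intro mult_left_mono) (auto simp: \<eta>_def)
    finally show False using L by simp
  qed
  \<comment> \<open>Chosen so that \<open>\<kappa> * (1 + 2 * L) < 1\<close>, where the factor 2
    bounds the norm of the projection \<open>\<pi>\<close>.\<close>
  define \<kappa> where "\<kappa> = 1 / (4 * (L + 1))"
  have \<kappa>: "\<kappa> > 0" "\<kappa> < 1" "\<kappa> * (1 + 2 * L) < 1" using L by (auto simp: \<kappa>_def field_simps)
  have "inner_cone \<Omega> p (r / 2) e \<kappa> (r / 4)"
    unfolding inner_cone_def
  proof (intro conjI ballI allI impI)
    fix x y t assume x: "x \<in> closure \<Omega> \<inter> ball p (r / 2)" and y: "y \<in> ball e \<kappa>" and t: "0 < t \<and> t < r / 4"
    define w where "w = y - e"
    have w: "norm w < \<kappa>" using y by (simp add: w_def dist_norm norm_minus_commute)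
    have "norm y \<le> 2" using w \<kappa>(2) norm_triangle_ineq[of e w] e by (simp add: w_def)
    then have "norm (t *\<^sub>R y) \<le> t * 2" using t by (simp add: mult_left_mono)
    also have "\<dots> < r / 2" using t by simp
    finally have "dist p (x + t *\<^sub>R y) < r"
      using x dist_triangle[of p "x + t *\<^sub>R y" x] by (simp add: dist_norm)
    moreover have "(x + t *\<^sub>R y) \<bullet> e > \<psi> (\<pi> (x + t *\<^sub>R y))"
    proof -
      have "\<pi> y = \<pi> w" by (simp add: w_def \<pi>_def inner_diff_left ee algebra_simps)
      then have "norm (\<pi> (t *\<^sub>R y)) \<le> t * (2 * norm w)"
        using \<pi>norm[of w] t by (simp add: \<pi>lin mult_left_mono)
      then have "L * norm (\<pi> (t *\<^sub>R y)) \<le> t * (2 * L * norm w)"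
        using mult_left_mono[OF _ L] by (fastforce simp: algebra_simps)
      then have "\<psi> (\<pi> (x + t *\<^sub>R y)) \<le> \<psi> (\<pi> x) + t * (2 * L * norm w)"
        using \<psi>le[of "x + t *\<^sub>R y" x] by simp
      also have "\<dots> \<le> x \<bullet> e + t * (2 * L * \<kappa>)"
        using cl[of x] x r w L t by (intro add_mono mult_left_mono) auto
      also have "\<dots> < x \<bullet> e + t * (1 - \<kappa>)"
        using t \<kappa>(3) by (intro add_strict_left_mono mult_strict_left_mono) (auto simp: algebra_simps)
      also have "\<dots> \<le> x \<bullet> e + t * (y \<bullet> e)"
      proof -
        have "y \<bullet> e = 1 + w \<bullet> e" by (simp add: w_def inner_diff_left ee)
        then have "1 - \<kappa> \<le> y \<bullet> e" using in_le[of w] w by linarith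
        then show ?thesis using t by (simp add: mult_left_mono)
      qed
      finally show ?thesis by (simp add: inner_add_left)
    qed
    ultimately have "x + t *\<^sub>R y \<in> \<Omega> \<inter> ball p r" unfolding graph by (simp add: \<pi>_def)
    then show "x + t *\<^sub>R y \<in> \<Omega>" by simp
  qed (use r e \<kappa> in auto)
  then show ?thesis by blast
qed

lemma inner_cone_exists:
  fixes \<Omega> :: "'a::euclidean_space set"
  assumes "open \<Omega>" "lipschitz_boundary \<Omega>" "p \<in> closure \<Omega>"
  shows "\<exists>r e \<kappa> \<delta>. inner_cone \<Omega> p r e \<kappa> \<delta>"
proof (cases "p \<in> \<Omega>")
  case False
  then have "p \<in> frontier \<Omega>" using assms by (simp add: frontier_def interior_open)
  then show ?thesis using inner_cone_frontier assms by blast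
qed (use inner_cone_interior assms in blast)

section \<open>Separation and packing of boundary points along cone directions\<close>

locale cone =
  fixes \<Omega> :: "'a::euclidean_space set" and p r e \<kappa> \<delta>
  assumes open_\<Omega>: "open \<Omega>" and cone: "inner_cone \<Omega> p r e \<kappa> \<delta>"
begin

lemma pos: "r > 0" "\<kappa> > 0" "\<kappa> < 1" "\<delta> > 0" "norm e = 1"
  using cone by (auto simp: inner_cone_def)

lemma shift_mem: "x \<in> closure \<Omega> \<Longrightarrow> x \<in> ball p r \<Longrightarrow> y \<in> ball e \<kappa> \<Longrightarrow> 0 < t \<Longrightarrow> t < \<delta> \<Longrightarrow> x + t *\<^sub>R y \<in> \<Omega>"
  using cone by (auto simp: inner_cone_def)

definition "K0 = 4 / \<kappa> + 1"

lemma K0: "K0 \<ge> 1" using pos by (simp add: K0_def)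

text \<open>Were \<open>s\<close> larger, \<open>(x1 - x2) / s\<close> would be a direction of the
  cone, and \<open>x1\<close> would lie in the open set \<open>\<Omega>\<close>.\<close>

lemma frontier_separation_aux:
  assumes x: "x1 \<in> frontier \<Omega>" "x2 \<in> frontier \<Omega>" "x2 \<in> ball p r"
    and y: "y \<in> ball e (\<kappa> / 2)" and s: "0 < s" "s < \<delta>" and le: "norm (x1 - x2 - s *\<^sub>R y) \<le> \<rho>"
  shows "s \<le> 2 * \<rho> / \<kappa>"
proof (rule ccontr)
  assume "\<not> ?thesis"
  then have lt: "\<rho> < s * (\<kappa> / 2)" using pos by (simp add: field_simps)
  define w where "w = (1 / s) *\<^sub>R (x1 - x2)"
  have sw: "s *\<^sub>R w = x1 - x2" using s by (simp add: w_def)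
  have "s * norm (w - y) = norm (s *\<^sub>R (w - y))" using s by simp
  also have "\<dots> = norm (x1 - x2 - s *\<^sub>R y)" by (simp add: scaleR_diff_right sw)
  finally have "s * norm (w - y) < s * (\<kappa> / 2)" using le lt by simp
  then have "dist w y < \<kappa> / 2" using s by (simp add: dist_norm)
  with y have "w \<in> ball e \<kappa>" using dist_triangle[of e w y] by (simp add: dist_commute)
  then have "x2 + s *\<^sub>R w \<in> \<Omega>" using shift_mem x s by (auto simp: frontier_def)
  then have "x1 \<in> \<Omega>" by (simp add: sw)
  then show False using x(1) open_\<Omega> by (simp add: frontier_def interior_open)
qed

text \<open>From \<open>x + s y\<close> the boundary point \<open>x\<close> can be recovered in a
  Lipschitz way, which replaces graph coordinates. The bounds
  \<open>\<bar>s\<bar> \<le> 2 * \<rho> / \<kappa>\<close> and \<open>norm y \<le> 2\<close> account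
  for \<open>4 / \<kappa>\<close> in \<open>K0\<close>, the error \<open>\<rho>\<close> itself for
  the 1.\<close>

lemma frontier_separation:
  assumes x: "x1 \<in> frontier \<Omega>" "x1 \<in> ball p r" "x2 \<in> frontier \<Omega>" "x2 \<in> ball p r"
    and y: "y \<in> ball e (\<kappa> / 2)" and s: "\<bar>s\<bar> < \<delta>" and le: "norm (x1 - x2 - s *\<^sub>R y) \<le> \<rho>"
  shows "dist x1 x2 \<le> K0 * \<rho>"
proof -
  have \<rho>: "\<rho> \<ge> 0" using le norm_ge_zero order.trans by blast
  have "\<bar>s\<bar> \<le> 2 * \<rho> / \<kappa>"
  proof -
    consider "s > 0" | "s = 0" | "s < 0" by linarith
    then show ?thesis
    proof cases
      case 1 then show ?thesis using frontier_separation_aux[OF x(1,3,4) y _ _ le] s by simp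
    next
      case 2 then show ?thesis using \<rho> pos by simp
    next
      case 3
      have "norm (x2 - x1 - (- s) *\<^sub>R y) \<le> \<rho>"
        using le norm_minus_cancel[of "x1 - x2 - s *\<^sub>R y"] by (simp add: algebra_simps)
      then show ?thesis using frontier_separation_aux[OF x(3,1,2) y, of "- s"] s 3 by simp
    qed
  qed
  moreover have "norm y \<le> 2"
    using y pos norm_triangle_ineq2[of y e] by (simp add: dist_norm norm_minus_commute)
  ultimately have "\<bar>s\<bar> * norm y \<le> (2 * \<rho> / \<kappa>) * 2" using \<rho> pos by (intro mult_mono) auto
  moreover have "dist x1 x2 \<le> norm (x1 - x2 - s *\<^sub>R y) + norm (s *\<^sub>R y)"
    using norm_triangle_ineq[of "x1 - x2 - s *\<^sub>R y" "s *\<^sub>R y"] by (simp add: dist_norm)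
  ultimately show ?thesis using le by (simp add: K0_def algebra_simps)
qed

text \<open>A ratio of volumes: \<open>3 ^ DIM('a)\<close> belongs to an enclosing ball of radius
  \<open>3 * \<rho>\<close>, 4 to the spacing and rounding of the number of translates, and the
  power of \<open>4 * K0\<close> to small balls of radius
  \<open>\<epsilon> / (4 * K0)\<close>.\<close>

definition "CP = 4 * 3 ^ DIM('a) * (4 * K0) ^ (DIM('a) - 1)"

lemma CP: "CP > 0" using K0 by (simp add: CP_def)

text \<open>Volume count: translating balls of radius comparable to \<open>\<epsilon>\<close> around separated boundary points in
  steps along \<open>e\<close> keeps them disjoint, by the separation lemma, and all of them stay in a ball of radius
  comparable to \<open>\<rho>\<close>.\<close>

lemma separated_card:
  assumes A: "A \<subseteq> frontier \<Omega> \<inter> ball p r" "\<And>x y. x \<in> A \<Longrightarrow> y \<in> A \<Longrightarrow> dist x y \<le> \<rho>"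
    and \<rho>: "\<rho> \<le> \<delta>" and \<epsilon>: "0 < \<epsilon>" "\<epsilon> < \<rho>"
    and P: "finite P" "P \<subseteq> A" "\<And>x y. x \<in> P \<Longrightarrow> y \<in> P \<Longrightarrow> x \<noteq> y \<Longrightarrow> \<epsilon> < dist x y"
  shows "real (card P) * \<epsilon> ^ (DIM('a) - 1) \<le> CP * \<rho> ^ (DIM('a) - 1)"
proof (cases "P = {}")
  case True
  then show ?thesis using \<epsilon> CP by simp
next
  case False
  then obtain x0 where x0: "x0 \<in> P" by blast
  \<comment> \<open>Small enough that two intersecting balls of radius \<open>\<eta>\<close> belong
    to boundary points closer than \<open>\<epsilon>\<close>, hence to the same point of
    \<open>P\<close>.\<close>
  define \<eta> where "\<eta> = \<epsilon> / (4 * K0)"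
  have \<eta>: "\<eta> > 0" "K0 * (2 * \<eta>) < \<epsilon>" "\<eta> < \<epsilon>" using K0 \<epsilon> by (auto simp: \<eta>_def field_simps)
  \<comment> \<open>The number of steps of length \<open>2 * \<eta>\<close> that fit into
    \<open>\<rho>\<close>.\<close>
  define m where "m = nat \<lfloor>\<rho> / (2 * \<eta>)\<rfloor>"
  have q: "\<rho> / (2 * \<eta>) \<ge> 1" 
  proof -
    have "2 * \<eta> \<le> K0 * (2 * \<eta>)" using K0 \<eta> by simp
    then have "2 * \<eta> \<le> \<rho>" using \<eta> \<epsilon> by linarith
    then show ?thesis using \<eta> by (simp add: field_simps)
  qed
  have mm: "real m = of_int \<lfloor>\<rho> / (2 * \<eta>)\<rfloor>" using q by (simp add: m_def)
  have m1: "real m \<le> \<rho> / (2 * \<eta>)" unfolding mm by linarith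
  have m2: "real m \<ge> \<rho> / (4 * \<eta>)"
  proof -
    have "real m \<ge> \<rho> / (2 * \<eta>) - 1" unfolding mm by linarith
    moreover have "real m \<ge> 1" using q by (simp add: mm)
    ultimately have "2 * real m \<ge> \<rho> / (2 * \<eta>)" by linarith
    then show ?thesis using \<eta> by (simp add: field_simps)
  qed
  define c where "c = (\<lambda>(x, k). x + (2 * \<eta> * real k) *\<^sub>R e)"
  define I where "I = P \<times> {1..m}"
  have finI: "finite I" using P by (simp add: I_def)
  have e_in: "e \<in> ball e (\<kappa> / 2)" using pos by simp
  have disj: "disjoint_family_on (\<lambda>i. ball (c i) \<eta>) I"
    unfolding disjoint_family_on_def
  proof (intro ballI impI)
    fix i j assume ij: "i \<in> I" "j \<in> I" "i \<noteq> j"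
    obtain x k x' l where i: "i = (x, k)" and j: "j = (x', l)" by (cases i, cases j)
    show "ball (c i) \<eta> \<inter> ball (c j) \<eta> = {}"
    proof (rule ccontr)
      assume "\<not> ?thesis"
      then obtain z where "dist (c i) z < \<eta>" "dist (c j) z < \<eta>" by auto
      then have d: "dist (c i) (c j) < 2 * \<eta>" using dist_triangle2[of "c i" "c j" z] by linarith
      define s where "s = 2 * \<eta> * (real l - real k)"
      have eq: "c i - c j = x - x' - s *\<^sub>R e" by (simp add: c_def i j s_def algebra_simps)
      have k: "1 \<le> k" "k \<le> m" "1 \<le> l" "l \<le> m" using ij i j by (auto simp: I_def)
      then have "\<bar>real l - real k\<bar> < real m" by linarith
      then have "\<bar>s\<bar> < 2 * \<eta> * real m" using \<eta> by (simp add: s_def abs_mult)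
      also have "\<dots> \<le> \<rho>" using m1 \<eta> by (simp add: field_simps)
      finally have s: "\<bar>s\<bar> < \<delta>" using \<rho> by simp
      have xP: "x \<in> P" "x' \<in> P" using ij i j by (auto simp: I_def)
      have "dist x x' \<le> K0 * (2 * \<eta>)"
        by (rule frontier_separation[OF _ _ _ _ e_in s]) (use xP P A d eq in \<open>auto simp: dist_norm\<close>)
      with \<eta> P(3)[OF xP] have "x = x'" by linarith
      then have "norm (s *\<^sub>R e) < 2 * \<eta>" using d eq by (simp add: dist_norm)
      then have "\<bar>real l - real k\<bar> < 1" using pos \<eta> by (simp add: s_def abs_mult)
      then have "k = l" by linarith
      with \<open>x = x'\<close> i j ij show False by simp
    qed
  qed
  have sub: "(\<Union>i\<in>I. ball (c i) \<eta>) \<subseteq> cball x0 (3 * \<rho>)"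
  proof
    fix z assume "z \<in> (\<Union>i\<in>I. ball (c i) \<eta>)"
    then obtain x k where xk: "x \<in> P" "k \<in> {1..m}" "dist (c (x, k)) z < \<eta>" by (auto simp: I_def)
    have "dist x (c (x, k)) = 2 * \<eta> * real k" using pos \<eta> by (simp add: c_def dist_norm)
    also have "\<dots> \<le> 2 * \<eta> * real m" using xk \<eta> by (intro mult_left_mono) auto
    also have "\<dots> \<le> \<rho>" using m1 \<eta> by (simp add: field_simps)
    finally have "dist x (c (x, k)) \<le> \<rho>" .
    moreover have "dist x0 x \<le> \<rho>" using A(2) P x0 xk by blast
    moreover have "\<eta> < \<rho>" using \<eta> \<epsilon> by simp
    ultimately have "dist x0 z \<le> 3 * \<rho>"
      using xk(3) dist_triangle[of x0 z x] dist_triangle[of x z "c (x, k)"] by linarith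
    then show "z \<in> cball x0 (3 * \<rho>)" by simp
  qed
  \<comment> \<open>The balls are disjoint and lie in a ball of radius \<open>3 * \<rho>\<close>. As
    \<open>m\<close> is of order \<open>\<rho> / \<eta>\<close>, one power cancels on each side,
    which leaves the dimension of the boundary.\<close>
  have "real (card P) * real m * (unit_ball_vol DIM('a) * \<eta> ^ DIM('a)) = (\<Sum>i\<in>I. measure lebesgue (ball (c i) \<eta>))"
    using \<eta> by (simp add: content_ball I_def measure_completion card_cartesian_product)
  also have "\<dots> = measure lebesgue (\<Union>i\<in>I. ball (c i) \<eta>)"
  proof (rule measure_finite_Union[symmetric, OF finI _ disj])
    show "emeasure lebesgue (ball (c i) \<eta>) \<noteq> \<infinity>" for i
      using emeasure_lborel_ball_finite[of "c i" \<eta>] by simp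
  qed auto
  also have "\<dots> \<le> measure lebesgue (cball x0 (3 * \<rho>))"
    by (rule measure_mono_fmeasurable[OF sub]) (use finI in auto)
  also have "\<dots> = unit_ball_vol DIM('a) * (3 * \<rho>) ^ DIM('a)"
    using \<epsilon> by (simp add: content_cball)
  finally have "real (card P) * real m * \<eta> ^ DIM('a) \<le> (3 * \<rho>) ^ DIM('a)"
    by (simp add: mult_ac mult_le_cancel_left_pos)
  moreover have "real (card P) * (\<rho> / (4 * \<eta>)) * \<eta> ^ DIM('a) \<le> real (card P) * real m * \<eta> ^ DIM('a)"
    using m2 \<eta> by (intro mult_right_mono mult_left_mono) auto
  ultimately have *: "real (card P) * (\<rho> / (4 * \<eta>)) * \<eta> ^ DIM('a) \<le> (3 * \<rho>) ^ DIM('a)" by linarith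
  obtain n where n: "DIM('a) = Suc n" using DIM_positive[where 'a='a] gr0_implies_Suc by blast
  have "real (card P) * \<eta> ^ n * \<rho> \<le> 4 * 3 ^ DIM('a) * \<rho> ^ n * \<rho>"
    using * \<eta> unfolding n by (simp add: field_simps power_mult_distrib)
  then have "real (card P) * \<eta> ^ n \<le> 4 * 3 ^ DIM('a) * \<rho> ^ n"
    using \<epsilon> by (simp add: mult_le_cancel_right)
  then have "real (card P) * \<eta> ^ n * (4 * K0) ^ n \<le> 4 * 3 ^ DIM('a) * \<rho> ^ n * (4 * K0) ^ n"
    using K0 by (intro mult_right_mono) auto
  moreover have "\<eta> * (4 * K0) = \<epsilon>" using K0 by (simp add: \<eta>_def)
  then have "\<eta> ^ n * (4 * K0) ^ n = \<epsilon> ^ n" by (simp only: power_mult_distrib[symmetric])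
  ultimately show ?thesis unfolding CP_def n by (simp add: ac_simps)
qed

text \<open>Take a separated subset of maximal cardinality: it exists because
  \<open>separated_card\<close> bounds all cardinalities, and by maximality its balls cover
  \<open>A\<close>.\<close>

lemma packing:
  assumes A: "A \<subseteq> frontier \<Omega> \<inter> ball p r" "\<And>x y. x \<in> A \<Longrightarrow> y \<in> A \<Longrightarrow> dist x y \<le> \<rho>"
    and \<rho>: "\<rho> \<le> \<delta>" and \<epsilon>: "0 < \<epsilon>" "\<epsilon> < \<rho>"
  shows "\<exists>P. finite P \<and> A \<subseteq> (\<Union>x\<in>P. cball x \<epsilon>) \<and> real (card P) * \<epsilon> ^ (DIM('a) - 1) \<le> CP * \<rho> ^ (DIM('a) - 1)"
proof -
  define Q where "Q P \<longleftrightarrow> finite P \<and> P \<subseteq> A \<and> (\<forall>x\<in>P. \<forall>y\<in>P. x \<noteq> y \<longrightarrow> \<epsilon> < dist x y)" for P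
  define N where "N = CP * \<rho> ^ (DIM('a) - 1) / \<epsilon> ^ (DIM('a) - 1)"
  have bd: "real (card P) * \<epsilon> ^ (DIM('a) - 1) \<le> CP * \<rho> ^ (DIM('a) - 1)" if "Q P" for P
    by (rule separated_card[OF A \<rho> \<epsilon>]) (use that in \<open>auto simp: Q_def\<close>)
  then have "card P \<le> nat \<lfloor>N\<rfloor>" if "Q P" for P
    using that \<epsilon> by (simp add: N_def le_nat_floor field_simps)
  then have bd2: "\<forall>P. Q P \<longrightarrow> card P < Suc (nat \<lfloor>N\<rfloor>)" by (simp add: less_Suc_eq_le)
  have "Q {}" by (simp add: Q_def)
  from ex_has_greatest_nat[of Q "{}" card, OF this bd2]
  obtain P where P: "Q P" "\<And>P'. Q P' \<Longrightarrow> card P' \<le> card P" by blast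
  have "A \<subseteq> (\<Union>x\<in>P. cball x \<epsilon>)"
  proof
    fix x assume x: "x \<in> A"
    show "x \<in> (\<Union>x\<in>P. cball x \<epsilon>)"
    proof (rule ccontr)
      assume nx: "x \<notin> (\<Union>x\<in>P. cball x \<epsilon>)"
      then have "x \<notin> P" using \<epsilon> by force
      moreover have "Q (insert x P)" using P(1) x nx by (force simp: Q_def dist_commute)
      ultimately show False using P(2)[of "insert x P"] P(1) by (simp add: Q_def)
    qed
  qed
  then show ?thesis using P(1) bd[OF P(1)] by (auto simp: Q_def)
qed

definition "CH = unit_ball_vol (real (DIM('a) - 1)) * CP"

lemma CH: "CH \<ge> 0" using CP by (simp add: CH_def)

lemma hausdorff_outer_small:
  assumes A: "A \<subseteq> frontier \<Omega> \<inter> ball p r" "\<And>x y. x \<in> A \<Longrightarrow> y \<in> A \<Longrightarrow> dist x y \<le> \<rho>"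
    and \<rho>: "0 < \<rho>" "\<rho> \<le> \<delta>"
  shows "hausdorff_outer (DIM('a) - 1) A \<le> ennreal (CH * \<rho> ^ (DIM('a) - 1))"
  using hausdorff_outer_covering[OF packing[OF A \<rho>(2)] \<rho>(1)] by (simp add: CH_def mult.assoc)

end

section \<open>The surface measure: measurable sets and finiteness\<close>

lemma
  fixes \<Omega> :: "'a::euclidean_space set"
  shows space_surface_measure: "space (surface_measure \<Omega>) = frontier \<Omega>"
    and sets_surface_measure: "A \<in> sets (surface_measure \<Omega>) \<longleftrightarrow> A \<subseteq> frontier \<Omega> \<and> A \<in> sets (hausdorff_measure (DIM('a) - 1))"
    and emeasure_surface_measure: "A \<in> sets (surface_measure \<Omega>) \<Longrightarrow> emeasure (surface_measure \<Omega>) A = hausdorff_outer (DIM('a) - 1) A"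
proof -
  have fr: "frontier \<Omega> \<in> sets (hausdorff_measure (DIM('a) - 1))"
    by (rule subsetD[OF borel_sets_hausdorff]) (simp add: borel_closed frontier_closed)
  show "space (surface_measure \<Omega>) = frontier \<Omega>" by (simp add: surface_measure_def space_restrict_space)
  show *: "A \<in> sets (surface_measure \<Omega>) \<longleftrightarrow> A \<subseteq> frontier \<Omega> \<and> A \<in> sets (hausdorff_measure (DIM('a) - 1))"
    unfolding surface_measure_def using fr by (subst sets_restrict_space_iff) auto
  show "A \<in> sets (surface_measure \<Omega>) \<Longrightarrow> emeasure (surface_measure \<Omega>) A = hausdorff_outer (DIM('a) - 1) A"
    using * fr unfolding surface_measure_def
    by (subst emeasure_restrict_space) (auto simp: emeasure_hausdorff_measure)
qed

lemma borel_measurable_surface: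
  fixes g :: "'a::euclidean_space \<Rightarrow> 'b::topological_space"
  assumes "g \<in> borel_measurable borel"
  shows "g \<in> borel_measurable (surface_measure \<Omega>)"
  unfolding surface_measure_def
proof (rule measurable_restrict_space1)
  show "g \<in> borel_measurable (hausdorff_measure (DIM('a) - 1))"
    using assms borel_sets_hausdorff[where 'a='a] by (auto simp: measurable_def)
qed

lemma finite_surface_measure:
  fixes \<Omega> :: "'a::euclidean_space set"
  assumes \<Omega>: "open \<Omega>" "bounded \<Omega>" "lipschitz_boundary \<Omega>"
  shows "finite_measure (surface_measure \<Omega>)"
proof
  have comp: "compact (frontier \<Omega>)" using \<Omega> by (simp add: compact_frontier_bounded)
  have "\<exists>\<rho>>0. hausdorff_outer (DIM('a) - 1) (frontier \<Omega> \<inter> ball p \<rho>) < \<infinity>" if p: "p \<in> frontier \<Omega>" for p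
  proof -
    obtain r e \<kappa> \<delta> where "inner_cone \<Omega> p r e \<kappa> \<delta>"
      using inner_cone_frontier[OF \<Omega>(1,3) p] by blast
    then interpret cone \<Omega> p r e \<kappa> \<delta> using \<Omega> by unfold_locales
    \<comment> \<open>Radius at most \<open>\<delta> / 2\<close> keeps distances inside the piece
      within the range of \<open>hausdorff_outer_small\<close>.\<close>
    define \<rho> where "\<rho> = min r (\<delta> / 2)"
    have "hausdorff_outer (DIM('a) - 1) (frontier \<Omega> \<inter> ball p \<rho>) \<le> ennreal (CH * \<delta> ^ (DIM('a) - 1))"
    proof (rule hausdorff_outer_small)
      fix x y assume "x \<in> frontier \<Omega> \<inter> ball p \<rho>" "y \<in> frontier \<Omega> \<inter> ball p \<rho>"
      then show "dist x y \<le> \<delta>" using dist_triangle3[of x y p] by (auto simp: \<rho>_def)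
    qed (use pos in \<open>auto simp: \<rho>_def\<close>)
    then show ?thesis using pos by (intro exI[of _ \<rho>]) (auto simp: \<rho>_def intro: le_less_trans)
  qed
  then obtain \<rho> where \<rho>: "\<And>p. p \<in> frontier \<Omega> \<Longrightarrow> \<rho> p > 0"
    "\<And>p. p \<in> frontier \<Omega> \<Longrightarrow> hausdorff_outer (DIM('a) - 1) (frontier \<Omega> \<inter> ball p (\<rho> p)) < \<infinity>" by metis
  obtain F where F: "F \<subseteq> frontier \<Omega>" "finite F" "frontier \<Omega> \<subseteq> (\<Union>p\<in>F. ball p (\<rho> p))"
  proof (rule compactE_image[OF comp, of "frontier \<Omega>" "\<lambda>p. ball p (\<rho> p)"])
    show "frontier \<Omega> \<subseteq> (\<Union>p\<in>frontier \<Omega>. ball p (\<rho> p))" using \<rho>(1) by force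
  qed (auto intro: that)
  have ms: "frontier \<Omega> \<inter> ball p (\<rho> p) \<in> sets (surface_measure \<Omega>)" for p
    unfolding sets_surface_measure
    by (intro conjI subsetD[OF borel_sets_hausdorff]) (auto intro!: borel_closed borel_open sets.Int simp: frontier_closed)
  have "frontier \<Omega> = (\<Union>p\<in>F. frontier \<Omega> \<inter> ball p (\<rho> p))" using F(3) by blast
  then have "emeasure (surface_measure \<Omega>) (space (surface_measure \<Omega>)) =
      emeasure (surface_measure \<Omega>) (\<Union>p\<in>F. frontier \<Omega> \<inter> ball p (\<rho> p))" by (simp add: space_surface_measure)
  also have "\<dots> \<le> (\<Sum>p\<in>F. emeasure (surface_measure \<Omega>) (frontier \<Omega> \<inter> ball p (\<rho> p)))"
    by (rule emeasure_subadditive_finite[OF F(2)]) (use ms in auto)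
  also have "\<dots> < \<infinity>"
    using F \<rho>(2) by (auto simp: emeasure_surface_measure[OF ms] less_top ennreal_sum_eq_top)
  finally show "emeasure (surface_measure \<Omega>) (space (surface_measure \<Omega>)) \<noteq> \<infinity>" by simp
qed

section \<open>Domination by Lebesgue measure and transport along cone directions\<close>

lemma cbox_diam:
  fixes u v :: "'a::euclidean_space"
  assumes "\<And>i. i \<in> Basis \<Longrightarrow> v \<bullet> i - u \<bullet> i = l" "a \<in> cbox u v" "b \<in> cbox u v"
  shows "norm (a - b) \<le> real DIM('a) * l"
proof -
  have "norm (a - b) \<le> (\<Sum>i\<in>Basis. \<bar>(a - b) \<bullet> i\<bar>)" by (rule norm_le_l1)
  also have "\<dots> \<le> (\<Sum>i\<in>(Basis :: 'a set). l)"
  proof (rule sum_mono)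
    fix i :: 'a assume i: "i \<in> Basis"
    then have "u \<bullet> i \<le> a \<bullet> i" "a \<bullet> i \<le> v \<bullet> i" "u \<bullet> i \<le> b \<bullet> i" "b \<bullet> i \<le> v \<bullet> i"
      using assms by (auto simp: mem_box)
    with assms(1)[OF i] show "\<bar>(a - b) \<bullet> i\<bar> \<le> l" by (auto simp: inner_diff_left abs_le_iff)
  qed
  finally show ?thesis by simp
qed

text \<open>A Borel measure that is controlled by Lebesgue measure on small cubes is controlled by it on
  all Borel sets, since open sets are unions of small non-overlapping dyadic cubes.\<close>

lemma measure_le_lborel_if_cubes:
  fixes \<mu> :: "'a::euclidean_space measure"
  assumes sets: "sets \<mu> = sets borel" and C: "C > 0" and \<tau>: "\<tau> > 0"
    and cube: "\<And>u v l. 0 < l \<Longrightarrow> l < \<tau> \<Longrightarrow> (\<And>i. i \<in> Basis \<Longrightarrow> v \<bullet> i - u \<bullet> i = l) \<Longrightarrow>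
       emeasure \<mu> (cbox u v) \<le> ennreal C * emeasure lborel (cbox u v)"
    and A: "A \<in> sets borel"
  shows "emeasure \<mu> A \<le> ennreal C * emeasure lborel A"
proof -
  have bopen: "emeasure \<mu> U \<le> ennreal C * emeasure lborel U" if U: "open U" "bounded U" for U
  proof -
    obtain R where R: "R > 0" "U \<subseteq> cball 0 R" using U(2) by (metis bounded_pos mem_cball_0 subsetI)
    \<comment> \<open>A cube rather than a general box, so that its dyadic parts have equal sides,
      as \<open>cube\<close> requires.\<close>
    define a b :: 'a where "a = - R *\<^sub>R One" and "b = R *\<^sub>R One"
    have ab: "a \<bullet> i = - R" "b \<bullet> i = R" if "i \<in> Basis" for i
      using that by (simp_all add: a_def b_def)
    have Uab: "U \<subseteq> cbox a b"
    proof
      fix x assume "x \<in> U"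
      then have "norm x \<le> R" using R by auto
      then have "\<bar>x \<bullet> i\<bar> \<le> R" if "i \<in> Basis" for i using Basis_le_norm[OF that, of x] by linarith
      then show "x \<in> cbox a b" using ab by (auto simp: mem_box abs_le_iff) (smt (verit))+
    qed
    have "box a b \<noteq> {}" using ab R by (auto simp: box_ne_empty)
    have "\<exists>\<epsilon>>0. x \<in> U \<longrightarrow> ball x \<epsilon> \<subseteq> U" for x using U(1) openE[of U x] by (cases "x \<in> U") (auto intro: zero_less_one)
    then obtain \<epsilon> where \<epsilon>: "\<And>x. \<epsilon> x > 0" "\<And>x. x \<in> U \<Longrightarrow> ball x (\<epsilon> x) \<subseteq> U" by metis
    \<comment> \<open>The gauge forces the cubes of the cover to be shorter than
      \<open>\<tau>\<close> and to stay inside \<open>U\<close>.\<close>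
    define g where "g x = ball x (min (\<tau> / 2) (\<epsilon> x))" for x
    have "gauge g" unfolding g_def using \<epsilon> \<tau> by (intro gauge_ball_dependent) auto
    obtain \<D> where \<D>: "countable \<D>"
        "\<And>K. K \<in> \<D> \<Longrightarrow> interior K \<noteq> {} \<and> (\<exists>c d. K = cbox c d)"
        "pairwise (\<lambda>A B. interior A \<inter> interior B = {}) \<D>"
        "\<And>K. K \<in> \<D> \<Longrightarrow> \<exists>x \<in> U \<inter> K. K \<subseteq> g x"
        "\<And>u v. cbox u v \<in> \<D> \<Longrightarrow> \<exists>n. \<forall>i \<in> Basis. v \<bullet> i - u \<bullet> i = (b \<bullet> i - a \<bullet> i) / 2^n"
        "U \<subseteq> \<Union>\<D>"
      by (rule covering_lemma[OF Uab \<open>box a b \<noteq> {}\<close> \<open>gauge g\<close>]) blast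
    have KU: "K \<subseteq> U" if "K \<in> \<D>" for K
      using \<D>(4)[OF that] \<epsilon>(2) by (fastforce simp: g_def)
    \<comment> \<open>Only the interiors of the cubes are disjoint; for Lebesgue measure a cube and
      its interior weigh the same.\<close>
    have K: "emeasure \<mu> K \<le> ennreal C * emeasure lborel (interior K)" if KD: "K \<in> \<D>" for K
    proof -
      obtain u v where uv: "K = cbox u v" using \<D>(2)[OF KD] by blast
      have ne: "box u v \<noteq> {}" using \<D>(2)[OF KD] by (simp add: uv interior_cbox)
      obtain n where n: "\<forall>i \<in> Basis. v \<bullet> i - u \<bullet> i = (b \<bullet> i - a \<bullet> i) / 2^n" using \<D>(5) KD uv by blast
      define l where "l = 2 * R / 2 ^ n"
      have l: "v \<bullet> i - u \<bullet> i = l" if "i \<in> Basis" for i using n ab that by (simp add: l_def)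
      have "l > 0" using R by (simp add: l_def)
      have "u \<in> K" "v \<in> K" using ne by (auto simp: uv mem_box box_ne_empty intro: less_imp_le)
      moreover obtain x where "K \<subseteq> ball x (min (\<tau> / 2) (\<epsilon> x))" using \<D>(4)[OF KD] by (auto simp: g_def)
      ultimately have "u \<in> ball x (\<tau> / 2)" "v \<in> ball x (\<tau> / 2)" by (auto simp: subset_eq)
      then have "dist u v < \<tau>" using dist_triangle3[of u v x] by auto
      obtain i :: 'a where i: "i \<in> Basis" using SOME_Basis by blast
      have "l = (v - u) \<bullet> i" using l[OF i] by (simp add: inner_diff_left)
      also have "\<dots> \<le> norm (v - u)" using Basis_le_norm[OF i, of "v - u"] by linarith
      finally have "l < \<tau>" using \<open>dist u v < \<tau>\<close> by (simp add: dist_norm norm_minus_commute)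
      have "emeasure \<mu> K \<le> ennreal C * emeasure lborel (cbox u v)"
        unfolding uv by (rule cube[OF \<open>l > 0\<close> \<open>l < \<tau>\<close> l])
      also have "emeasure lborel (cbox u v) = emeasure lborel (interior K)"
        by (simp add: uv interior_cbox emeasure_lborel_cbox_eq emeasure_lborel_box_eq)
      finally show ?thesis .
    qed
    define X where "X i = (if i \<in> to_nat_on \<D> ` \<D> then from_nat_into \<D> i else {})" for i
    have X: "X i \<in> \<D> \<or> X i = {}" for i using \<D>(1) by (auto simp: X_def)
    have inj: "i = j" if "X i = X j" "X i \<noteq> {}" for i j
    proof -
      have *: "i \<in> to_nat_on \<D> ` \<D>" "j \<in> to_nat_on \<D> ` \<D>" using that by (auto simp: X_def split: if_splits)
      then have "from_nat_into \<D> i = from_nat_into \<D> j" using that by (simp add: X_def)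
      then show ?thesis using * \<D>(1) by (metis imageE from_nat_into_to_nat_on)
    qed
    have UX: "(\<Union>i. X i) = U"
    proof
      show "(\<Union>i. X i) \<subseteq> U" using X KU by fastforce
      show "U \<subseteq> (\<Union>i. X i)"
      proof
        fix x assume "x \<in> U"
        then obtain K where "K \<in> \<D>" "x \<in> K" using \<D>(6) by blast
        then have "x \<in> X (to_nat_on \<D> K)" using \<D>(1) by (auto simp: X_def)
        then show "x \<in> (\<Union>i. X i)" by blast
      qed
    qed
    have Xb: "X i \<in> sets borel" for i
      using X[of i] \<D>(2)[of "X i"] by auto
    have disj: "disjoint_family (\<lambda>i. interior (X i))"
      unfolding disjoint_family_on_def
    proof (intro ballI impI)
      fix i j :: nat assume "i \<noteq> j"
      show "interior (X i) \<inter> interior (X j) = {}"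
      proof (cases "X i = {} \<or> X j = {}")
        case False
        then have "X i \<noteq> X j" using inj \<open>i \<noteq> j\<close> by blast
        moreover have "X i \<in> \<D>" "X j \<in> \<D>" using False X[of i] X[of j] by blast+
        ultimately show ?thesis using pairwiseD[OF \<D>(3)] by blast
      qed auto
    qed
    have "emeasure \<mu> (\<Union>i. X i) \<le> (\<Sum>i. emeasure \<mu> (X i))"
      using Xb sets by (intro emeasure_subadditive_countably) auto
    also have "\<dots> \<le> (\<Sum>i. ennreal C * emeasure lborel (interior (X i)))"
    proof (intro suminf_le allI)
      fix i show "emeasure \<mu> (X i) \<le> ennreal C * emeasure lborel (interior (X i))"
        using X[of i] K[of "X i"] by auto
    qed auto
    also have "\<dots> = ennreal C * emeasure lborel (\<Union>i. interior (X i))"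
      using disj by (subst ennreal_suminf_cmult, subst suminf_emeasure) auto
    also have "\<dots> \<le> ennreal C * emeasure lborel U"
    proof (intro mult_left_mono emeasure_mono)
      show "(\<Union>i. interior (X i)) \<subseteq> U" unfolding UX[symmetric] using interior_subset by blast
    qed (use U in auto)
    finally show ?thesis unfolding UX .
  qed
  have opn: "emeasure \<mu> U \<le> ennreal C * emeasure lborel U" if U: "open U" for U
  proof -
    have inc: "incseq (\<lambda>n. U \<inter> ball 0 (real n))" by (auto simp: incseq_def)
    have "(\<Union>n. U \<inter> ball 0 (real n)) = U"
      using reals_Archimedean2 by fastforce
    moreover have "range (\<lambda>n. U \<inter> ball 0 (real n)) \<subseteq> sets \<mu>" using U sets by (auto intro!: borel_open)
    ultimately have "emeasure \<mu> U = (SUP n. emeasure \<mu> (U \<inter> ball 0 (real n)))"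
      using SUP_emeasure_incseq[OF _ inc, of \<mu>] by simp
    also have "\<dots> \<le> ennreal C * emeasure lborel U"
    proof (rule SUP_least)
      fix n
      have "emeasure \<mu> (U \<inter> ball 0 (real n)) \<le> ennreal C * emeasure lborel (U \<inter> ball 0 (real n))"
        by (rule bopen) (use U in auto)
      also have "\<dots> \<le> ennreal C * emeasure lborel U" using U by (intro mult_left_mono emeasure_mono) auto
      finally show "emeasure \<mu> (U \<inter> ball 0 (real n)) \<le> ennreal C * emeasure lborel U" .
    qed
    finally show ?thesis .
  qed
  show ?thesis
  proof (rule ennreal_le_epsilon)
    fix e :: real assume e: "e > 0"
    have "A \<in> sets lebesgue" using A by simp
    \<comment> \<open>Outer regularity of Lebesgue measure; the excess \<open>e / C\<close> is
      multiplied by \<open>C\<close> below.\<close>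
    then obtain T where T: "open T" "A \<subseteq> T" "(T - A) \<in> lmeasurable" "emeasure lebesgue (T - A) < ennreal (e / C)"
      using sets_lebesgue_outer_open[of A "e / C"] e C by auto
    have "emeasure \<mu> A \<le> emeasure \<mu> T" using T A sets by (intro emeasure_mono) auto
    also have "\<dots> \<le> ennreal C * emeasure lborel T" by (rule opn[OF T(1)])
    also have "emeasure lborel T = emeasure lborel A + emeasure lborel (T - A)"
      using A T by (subst plus_emeasure) (auto simp: Un_absorb1)
    also have "\<dots> \<le> emeasure lborel A + ennreal (e / C)"
      using T(4) A T(1) by (intro add_left_mono) (simp add: less_imp_le)
    also have "ennreal C * (emeasure lborel A + ennreal (e / C)) = ennreal C * emeasure lborel A + ennreal e"
      using C e by (simp add: distrib_left flip: ennreal_mult)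
    finally show "emeasure \<mu> A \<le> ennreal C * emeasure lborel A + ennreal e" by (simp add: mult_left_mono)
  qed
qed

context cone
begin

lemma indicator_ball_measurable [measurable]: "(indicator (ball p r) :: 'a \<Rightarrow> ennreal) \<in> borel_measurable borel"
  by (intro borel_measurable_indicator borel_open open_ball)

text \<open>For a cube of side \<open>l\<close> and diameter at most
  \<open>\<rho> = DIM('a) * l\<close>: an interval of length \<open>4 * \<rho>\<close> times the
  measure bound for a boundary piece of diameter \<open>2 * K0 * \<rho>\<close>. The added 1 ensures
  positivity.\<close>

definition "CT = 4 * real DIM('a) * CH * (2 * K0 * real DIM('a)) ^ (DIM('a) - 1) + 1"

lemma CT: "CT > 0" using CH K0 by (simp add: CT_def add_nonneg_pos)

text \<open>By the separation lemma, the points \<open>(x, s)\<close> of boundary times line for which \<open>x + s y\<close> lies in a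
  small cube have \<open>x\<close> in a set, and \<open>s\<close> in an interval, of size comparable to the cube.\<close>

lemma transport_surface:
  assumes fin: "finite_measure (surface_measure \<Omega>)" and y: "y \<in> ball e (\<kappa> / 2)"
    and g: "g \<in> borel_measurable borel"
  shows "(\<integral>\<^sup>+x. indicator (ball p r) x * (\<integral>\<^sup>+s. indicator {0<..<\<delta>} s * g (x + s *\<^sub>R y) \<partial>lborel) \<partial>surface_measure \<Omega>)
     \<le> ennreal CT * (\<integral>\<^sup>+x. g x \<partial>lborel)"
proof -
  interpret fin: finite_measure "surface_measure \<Omega>" by fact
  have id: "(\<lambda>x. x) \<in> surface_measure \<Omega> \<rightarrow>\<^sub>M borel" by (rule borel_measurable_surface) simp
  define S where "S = density (distr (surface_measure \<Omega>) borel (\<lambda>x. x)) (indicator (ball p r))"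
  define T where "T = density lborel (indicator {0<..<\<delta>} :: real \<Rightarrow> ennreal)"
  have S_int: "(\<integral>\<^sup>+x. h x \<partial>S) = (\<integral>\<^sup>+x. indicator (ball p r) x * h x \<partial>surface_measure \<Omega>)"
    if h [measurable]: "h \<in> borel_measurable borel" for h
  proof -
    have "(\<integral>\<^sup>+x. h x \<partial>S) = (\<integral>\<^sup>+x. indicator (ball p r) x * h x \<partial>distr (surface_measure \<Omega>) borel (\<lambda>x. x))"
      unfolding S_def by (rule nn_integral_density) (auto intro!: borel_measurable_indicator)
    also have "\<dots> = (\<integral>\<^sup>+x. indicator (ball p r) x * h x \<partial>surface_measure \<Omega>)"
      by (rule nn_integral_distr[OF id])
        (simp add: measurable_distr_eq1 borel_measurable_times_ennreal indicator_ball_measurable h)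
    finally show ?thesis .
  qed
  have T_int: "(\<integral>\<^sup>+s. h s \<partial>T) = (\<integral>\<^sup>+s. indicator {0<..<\<delta>} s * h s \<partial>lborel)"
    if "h \<in> borel_measurable borel" for h
    unfolding T_def using that by (subst nn_integral_density) auto
  have [measurable_cong, simp]: "sets S = sets borel" "sets T = sets borel" by (auto simp: S_def T_def)
  have [simp]: "space S = UNIV" "space T = UNIV" by (auto simp: S_def T_def)
  interpret T: finite_measure T
    by rule (simp add: T_def emeasure_density indicator_inter_arith[symmetric] pos less_imp_le)
  define m where "m = (\<lambda>(x, s). x + s *\<^sub>R y)"
  have m [measurable]: "m \<in> S \<Otimes>\<^sub>M T \<rightarrow>\<^sub>M borel" unfolding m_def by measurable
  \<comment> \<open>Image of the product of boundary and line under
    \<open>(x, s) \<mapsto> x + s y\<close>; the aim is \<open>\<mu> \<le> CT\<close> times Lebesgue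
    measure.\<close>
  define \<mu> where "\<mu> = distr (S \<Otimes>\<^sub>M T) borel m"
  have \<mu>_int: "(\<integral>\<^sup>+x. h x \<partial>\<mu>) = (\<integral>\<^sup>+x. indicator (ball p r) x * (\<integral>\<^sup>+s. indicator {0<..<\<delta>} s * h (x + s *\<^sub>R y) \<partial>lborel) \<partial>surface_measure \<Omega>)"
    if h [measurable]: "h \<in> borel_measurable borel" for h
  proof -
    have "(\<integral>\<^sup>+x. h x \<partial>\<mu>) = (\<integral>\<^sup>+z. h (m z) \<partial>(S \<Otimes>\<^sub>M T))" unfolding \<mu>_def by (rule nn_integral_distr) measurable
    also have "\<dots> = (\<integral>\<^sup>+x. (\<integral>\<^sup>+s. h (m (x, s)) \<partial>T) \<partial>S)" by (rule T.nn_integral_fst[symmetric]) measurable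
    also have "\<dots> = (\<integral>\<^sup>+x. (\<integral>\<^sup>+s. indicator {0<..<\<delta>} s * h (x + s *\<^sub>R y) \<partial>lborel) \<partial>S)"
      unfolding m_def by (intro nn_integral_cong) (simp add: T_int)
    also have "\<dots> = (\<integral>\<^sup>+x. indicator (ball p r) x * (\<integral>\<^sup>+s. indicator {0<..<\<delta>} s * h (x + s *\<^sub>R y) \<partial>lborel) \<partial>surface_measure \<Omega>)"
      by (rule S_int) measurable
    finally show ?thesis .
  qed
  have y12: "norm y \<ge> 1 / 2"
    using y pos norm_triangle_ineq2[of e y] by (simp add: dist_norm)
  \<comment> \<open>Sides below \<open>\<tau>\<close> give
    \<open>2 * K0 * \<rho> \<le> \<delta>\<close>, the range in which
    \<open>hausdorff_outer_small\<close> holds.\<close>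
  define \<tau> where "\<tau> = \<delta> / (2 * K0 * real DIM('a))"
  have "\<tau> > 0" using pos K0 by (simp add: \<tau>_def)
  have cube: "emeasure \<mu> (cbox u v) \<le> ennreal CT * emeasure lborel (cbox u v)"
    if l: "0 < l" "l < \<tau>" and uv: "\<And>i. i \<in> Basis \<Longrightarrow> v \<bullet> i - u \<bullet> i = l" for u v l
  proof -
    define \<rho> where "\<rho> = real DIM('a) * l"
    have \<rho>: "\<rho> > 0" "2 * K0 * \<rho> \<le> \<delta>" using l K0 by (auto simp: \<rho>_def \<tau>_def field_simps)
    have "emeasure \<mu> (cbox u v) = (\<integral>\<^sup>+x. indicator (cbox u v) x \<partial>\<mu>)" by (simp add: \<mu>_def)
    also have "\<dots> = (\<integral>\<^sup>+x. indicator (ball p r) x * (\<integral>\<^sup>+s. indicator {0<..<\<delta>} s * indicator (cbox u v) (x + s *\<^sub>R y) \<partial>lborel) \<partial>surface_measure \<Omega>)"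
      by (rule \<mu>_int) measurable
    also have "\<dots> \<le> ennreal (4 * \<rho>) * ennreal (CH * (2 * K0 * \<rho>) ^ (DIM('a) - 1))"
    proof (cases "\<exists>x0\<in>frontier \<Omega> \<inter> ball p r. \<exists>s\<in>{0<..<\<delta>}. x0 + s *\<^sub>R y \<in> cbox u v")
      case False
      have "(\<integral>\<^sup>+x. indicator (ball p r) x * (\<integral>\<^sup>+s. indicator {0<..<\<delta>} s * indicator (cbox u v) (x + s *\<^sub>R y) \<partial>lborel) \<partial>surface_measure \<Omega>)
        = (\<integral>\<^sup>+x. 0 \<partial>surface_measure \<Omega>)"
      proof (rule nn_integral_cong)
        fix x assume x: "x \<in> space (surface_measure \<Omega>)"
        show "indicator (ball p r) x * (\<integral>\<^sup>+s. indicator {0<..<\<delta>} s * indicator (cbox u v) (x + s *\<^sub>R y) \<partial>lborel) = 0"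
        proof (cases "x \<in> ball p r")
          case True
          then have "indicator {0<..<\<delta>} s * indicator (cbox u v) (x + s *\<^sub>R y) = (0 :: ennreal)" for s
            using False x by (auto simp: space_surface_measure indicator_def)
          note z = this show ?thesis unfolding z by simp
        qed simp
      qed
      then show ?thesis by simp
    next
      case True
      then obtain x0 s0 where x0: "x0 \<in> frontier \<Omega>" "x0 \<in> ball p r" "0 < s0" "s0 < \<delta>" "x0 + s0 *\<^sub>R y \<in> cbox u v" by auto
      define A' where "A' = frontier \<Omega> \<inter> ball p r \<inter> cball x0 (K0 * \<rho>)"
      have A': "A' \<in> sets (surface_measure \<Omega>)"
        unfolding sets_surface_measure A'_def
        by (intro conjI subsetD[OF borel_sets_hausdorff]) (auto intro!: borel_closed borel_open sets.Int simp: frontier_closed)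
      have "(\<integral>\<^sup>+x. indicator (ball p r) x * (\<integral>\<^sup>+s. indicator {0<..<\<delta>} s * indicator (cbox u v) (x + s *\<^sub>R y) \<partial>lborel) \<partial>surface_measure \<Omega>)
        \<le> (\<integral>\<^sup>+x. ennreal (4 * \<rho>) * indicator A' x \<partial>surface_measure \<Omega>)"
      proof (rule nn_integral_mono)
        fix x assume "x \<in> space (surface_measure \<Omega>)"
        then have x: "x \<in> frontier \<Omega>" by (simp add: space_surface_measure)
        show "indicator (ball p r) x * (\<integral>\<^sup>+s. indicator {0<..<\<delta>} s * indicator (cbox u v) (x + s *\<^sub>R y) \<partial>lborel)
           \<le> ennreal (4 * \<rho>) * indicator A' x"
        proof (cases "x \<in> ball p r \<and> (\<exists>s\<in>{0<..<\<delta>}. x + s *\<^sub>R y \<in> cbox u v)")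
          case True
          then obtain s1 where s1: "0 < s1" "s1 < \<delta>" "x + s1 *\<^sub>R y \<in> cbox u v" and xb: "x \<in> ball p r" by auto
          have "norm (x0 - x - (s1 - s0) *\<^sub>R y) \<le> \<rho>"
            using cbox_diam[OF uv x0(5) s1(3)] by (simp add: \<rho>_def algebra_simps)
          then have "dist x0 x \<le> K0 * \<rho>"
            using x0 x xb y s1 by (intro frontier_separation[of x0 x y "s1 - s0"]) auto
          then have xA: "x \<in> A'" using x xb by (simp add: A'_def)
          have "(\<integral>\<^sup>+s. indicator {0<..<\<delta>} s * indicator (cbox u v) (x + s *\<^sub>R y) \<partial>lborel)
             \<le> (\<integral>\<^sup>+s. indicator {s1 - 2 * \<rho>..s1 + 2 * \<rho>} s \<partial>lborel)"
          proof (rule nn_integral_mono)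
            \<comment> \<open>Since \<open>norm y \<ge> 1 / 2\<close>, parameters that lead into the
              same cube differ by at most \<open>2 * \<rho>\<close>.\<close>
            fix s
            show "indicator {0<..<\<delta>} s * indicator (cbox u v) (x + s *\<^sub>R y) \<le> (indicator {s1 - 2 * \<rho>..s1 + 2 * \<rho>} s :: ennreal)"
            proof (cases "x + s *\<^sub>R y \<in> cbox u v")
              case True
              have "norm ((x + s *\<^sub>R y) - (x + s1 *\<^sub>R y)) \<le> \<rho>"
                unfolding \<rho>_def by (rule cbox_diam[OF uv True s1(3)])
              then have "\<bar>s - s1\<bar> * norm y \<le> \<rho>" by (simp flip: scaleR_diff_left)
              moreover have "\<bar>s - s1\<bar> * (1 / 2) \<le> \<bar>s - s1\<bar> * norm y" using y12 by (intro mult_left_mono) auto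
              ultimately have "\<bar>s - s1\<bar> * (1 / 2) \<le> \<rho>" by (rule order.trans[rotated])
              then have "\<bar>s - s1\<bar> \<le> 2 * \<rho>" by simp
              then show ?thesis by (auto simp: indicator_def)
            qed simp
          qed
          also have "\<dots> = ennreal (4 * \<rho>)" using \<rho> by simp
          finally show ?thesis using xA xb by simp
        next
          case False
          have "indicator (ball p r) x * (\<integral>\<^sup>+s. indicator {0<..<\<delta>} s * indicator (cbox u v) (x + s *\<^sub>R y) \<partial>lborel) = 0"
          proof (cases "x \<in> ball p r")
            case True
            then have "indicator {0<..<\<delta>} s * indicator (cbox u v) (x + s *\<^sub>R y) = (0 :: ennreal)" for s
              using False by (auto simp: indicator_def)
            note z = this show ?thesis unfolding z by simp
          qed simp
          then show ?thesis by (simp only: zero_le)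
        qed
      qed
      also have "\<dots> = ennreal (4 * \<rho>) * hausdorff_outer (DIM('a) - 1) A'"
        using A' by (simp add: nn_integral_cmult_indicator emeasure_surface_measure)
      also have "\<dots> \<le> ennreal (4 * \<rho>) * ennreal (CH * (2 * K0 * \<rho>) ^ (DIM('a) - 1))"
      proof (intro mult_left_mono hausdorff_outer_small)
        fix a b assume "a \<in> A'" "b \<in> A'"
        then show "dist a b \<le> 2 * K0 * \<rho>" using dist_triangle3[of a b x0] by (auto simp: A'_def)
      qed (use \<rho> K0 in \<open>auto simp: A'_def\<close>)
      finally show ?thesis .
    qed
    also have "\<dots> = ennreal (4 * \<rho> * (CH * (2 * K0 * \<rho>) ^ (DIM('a) - 1)))"
      using \<rho> CH K0 by (intro ennreal_mult[symmetric]) auto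
    also have "\<dots> \<le> ennreal (CT * l ^ DIM('a))"
    proof (rule ennreal_leI)
      obtain n where n: "DIM('a) = Suc n" using DIM_positive[where 'a='a] gr0_implies_Suc by blast
      have "4 * \<rho> * (CH * (2 * K0 * \<rho>) ^ (DIM('a) - 1)) = (CT - 1) * l ^ DIM('a)"
        unfolding CT_def \<rho>_def n by (simp add: power_mult_distrib)
      also have "\<dots> \<le> CT * l ^ DIM('a)" using l by (intro mult_right_mono) auto
      finally show "4 * \<rho> * (CH * (2 * K0 * \<rho>) ^ (DIM('a) - 1)) \<le> CT * l ^ DIM('a)" .
    qed
    also have "\<dots> = ennreal CT * emeasure lborel (cbox u v)"
    proof -
      have "u \<bullet> i \<le> v \<bullet> i" if "i \<in> Basis" for i using uv[OF that] l by linarith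
      then have "emeasure lborel (cbox u v) = ennreal (\<Prod>i\<in>Basis. (v - u) \<bullet> i)" by (simp add: emeasure_lborel_cbox_eq)
      also have "(\<Prod>i\<in>Basis. (v - u) \<bullet> i) = (\<Prod>i\<in>(Basis :: 'a set). l)"
        by (intro prod.cong) (auto simp: inner_diff_left uv)
      finally show ?thesis using CT l by (simp add: ennreal_mult')
    qed
    finally show ?thesis .
  qed
  have "\<mu> \<le> scale_measure (ennreal CT) lborel"
  proof (subst le_measure)
    show "sets \<mu> = sets (scale_measure (ennreal CT) lborel)" by (simp add: \<mu>_def)
    have "sets \<mu> = sets borel" by (simp add: \<mu>_def)
    from measure_le_lborel_if_cubes[OF this CT \<open>\<tau> > 0\<close> cube]
    show "\<forall>A\<in>sets \<mu>. emeasure \<mu> A \<le> emeasure (scale_measure (ennreal CT) lborel) A" by (simp add: \<mu>_def)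
  qed
  then have "(\<integral>\<^sup>+x. g x \<partial>\<mu>) \<le> (\<integral>\<^sup>+x. g x \<partial>scale_measure (ennreal CT) lborel)"
    by (intro nn_integral_mono_measure) (auto simp: \<mu>_def)
  also have "\<dots> = ennreal CT * (\<integral>\<^sup>+x. g x \<partial>lborel)" using g by (intro nn_integral_scale_measure) auto
  finally show ?thesis unfolding \<mu>_int[OF g] .
qed

text \<open>Tonelli's theorem and translation invariance of Lebesgue measure.\<close>

lemma transport_interior:
  assumes g [measurable]: "g \<in> borel_measurable borel"
    and h [measurable]: "h \<in> borel_measurable borel" and h1: "\<And>x. h x \<le> (1 :: ennreal)"
  shows "(\<integral>\<^sup>+x. h x * (\<integral>\<^sup>+s. indicator {0<..<\<delta>} s * g (x + s *\<^sub>R y) \<partial>lborel) \<partial>lborel)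
     \<le> ennreal \<delta> * (\<integral>\<^sup>+x. g x \<partial>lborel)"
proof -
  have "(\<integral>\<^sup>+x. h x * (\<integral>\<^sup>+s. indicator {0<..<\<delta>} s * g (x + s *\<^sub>R y) \<partial>lborel) \<partial>lborel)
     \<le> (\<integral>\<^sup>+x. (\<integral>\<^sup>+s. indicator {0<..<\<delta>} s * g (x + s *\<^sub>R y) \<partial>lborel) \<partial>lborel)"
    using mult_right_mono[OF h1] by (intro nn_integral_mono) auto
  also have "\<dots> = (\<integral>\<^sup>+s. (\<integral>\<^sup>+x. indicator {0<..<\<delta>} s * g (x + s *\<^sub>R y) \<partial>lborel) \<partial>lborel)"
    by (rule lborel_pair.Fubini'[symmetric]) measurable
  also have "\<dots> = (\<integral>\<^sup>+s. (\<integral>\<^sup>+x. g x \<partial>lborel) * indicator {0<..<\<delta>} s \<partial>lborel)"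
  proof (rule nn_integral_cong)
    fix s :: real
    have "(\<integral>\<^sup>+x. g x \<partial>lborel) = (\<integral>\<^sup>+x. g x \<partial>distr lborel borel ((+) (s *\<^sub>R y)))" by (simp add: lborel_distr_plus)
    also have "\<dots> = (\<integral>\<^sup>+x. g (x + s *\<^sub>R y) \<partial>lborel)" by (subst nn_integral_distr) (auto simp: add.commute)
    finally show "(\<integral>\<^sup>+x. indicator {0<..<\<delta>} s * g (x + s *\<^sub>R y) \<partial>lborel) = (\<integral>\<^sup>+x. g x \<partial>lborel) * indicator {0<..<\<delta>} s"
      by (simp add: nn_integral_cmult mult.commute)
  qed
  also have "\<dots> = (\<integral>\<^sup>+x. g x \<partial>lborel) * ennreal \<delta>" using pos by (simp add: nn_integral_cmult_indicator)
  finally show ?thesis by (simp add: mult.commute)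
qed

end

section \<open>Bulk and surface measure combined\<close>

text \<open>Both summands are measures on the Borel sets, so one sigma-algebra serves volume and
  boundary; on it the outer measure of the boundary part agrees with
  \<open>surface_measure\<close>.\<close>

definition domain_measure :: "'a::euclidean_space set \<Rightarrow> 'a measure" where
  "domain_measure \<Omega> = measure_of UNIV (sets borel)
     (\<lambda>A. emeasure lborel (A \<inter> \<Omega>) + hausdorff_outer (DIM('a) - 1) (A \<inter> frontier \<Omega>))"

lemma sets_domain_measure [simp, measurable_cong]: "sets (domain_measure \<Omega>) = sets borel"
  using sets.sigma_sets_eq[of borel] by (simp add: domain_measure_def)

lemma space_domain_measure [simp]: "space (domain_measure \<Omega>) = UNIV"
  by (simp add: domain_measure_def)

lemma borel_Int_frontier:
  fixes \<Omega> :: "'a::euclidean_space set"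
  shows "A \<in> sets borel \<Longrightarrow> A \<inter> frontier \<Omega> \<in> sets (surface_measure \<Omega>)"
  unfolding sets_surface_measure
  by (intro conjI subsetD[OF borel_sets_hausdorff]) (auto intro!: borel_closed sets.Int simp: frontier_closed)

lemma emeasure_domain_measure:
  fixes \<Omega> :: "'a::euclidean_space set"
  assumes \<Omega>: "open \<Omega>" and A: "A \<in> sets borel"
  shows "emeasure (domain_measure \<Omega>) A = emeasure lborel (A \<inter> \<Omega>) + emeasure (surface_measure \<Omega>) (A \<inter> frontier \<Omega>)"
proof -
  define \<nu> where "\<nu> A = emeasure lborel (A \<inter> \<Omega>) + hausdorff_outer (DIM('a) - 1) (A \<inter> frontier \<Omega>)" for A
  have \<nu>: "\<nu> A = emeasure lborel (A \<inter> \<Omega>) + emeasure (surface_measure \<Omega>) (A \<inter> frontier \<Omega>)" if "A \<in> sets borel" for A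
    using borel_Int_frontier[OF that] by (simp add: \<nu>_def emeasure_surface_measure)
  have "emeasure (measure_of UNIV (sets borel) \<nu>) A = \<nu> A"
  proof (rule emeasure_measure_of_sigma)
    show "sigma_algebra (UNIV :: 'a set) (sets borel)" using sets.sigma_algebra_axioms[of "borel :: 'a measure"] by simp
    show "positive (sets borel) \<nu>" by (simp add: positive_def \<nu>_def hausdorff_outer_empty)
    show "countably_additive (sets borel) \<nu>"
    proof (rule countably_additiveI)
      fix B :: "nat \<Rightarrow> 'a set" assume B: "range B \<subseteq> sets borel" "disjoint_family B" "(\<Union>i. B i) \<in> sets borel"
      have "(\<Sum>i. \<nu> (B i)) = (\<Sum>i. emeasure lborel (B i \<inter> \<Omega>)) + (\<Sum>i. emeasure (surface_measure \<Omega>) (B i \<inter> frontier \<Omega>))"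
        using B(1) by (subst suminf_add) (auto simp: \<nu> range_subsetD)
      also have "(\<Sum>i. emeasure lborel (B i \<inter> \<Omega>)) = emeasure lborel (\<Union>i. B i \<inter> \<Omega>)"
        using B \<Omega> by (intro suminf_emeasure) (auto simp: disjoint_family_on_def)
      also have "(\<Sum>i. emeasure (surface_measure \<Omega>) (B i \<inter> frontier \<Omega>)) = emeasure (surface_measure \<Omega>) (\<Union>i. B i \<inter> frontier \<Omega>)"
        using B(2) borel_Int_frontier[OF range_subsetD[OF B(1)]]
        by (intro suminf_emeasure) (auto simp: disjoint_family_on_def)
      also have "emeasure lborel (\<Union>i. B i \<inter> \<Omega>) + emeasure (surface_measure \<Omega>) (\<Union>i. B i \<inter> frontier \<Omega>) = \<nu> (\<Union>i. B i)"
        using B(3) by (simp add: \<nu>)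
      finally show "(\<Sum>i. \<nu> (B i)) = \<nu> (\<Union>i. B i)" .
    qed
  qed (rule A)
  then show ?thesis unfolding domain_measure_def \<nu>_def[abs_def, symmetric] by (simp add: \<nu> A)
qed

lemma nn_integral_domain_measure:
  fixes \<Omega> :: "'a::euclidean_space set"
  assumes \<Omega>: "open \<Omega>" and f: "f \<in> borel_measurable borel"
  shows "(\<integral>\<^sup>+x. f x \<partial>domain_measure \<Omega>) = (\<integral>\<^sup>+x. indicator \<Omega> x * f x \<partial>lborel) + (\<integral>\<^sup>+x. f x \<partial>surface_measure \<Omega>)"
  using f
proof (induction rule: borel_measurable_induct)
  case (cong f g)
  then have "f = g" by auto
  then show ?case using cong by simp
next
  case (set A)
  have "(\<integral>\<^sup>+x. indicator \<Omega> x * indicator A x \<partial>lborel) = (\<integral>\<^sup>+x. indicator (A \<inter> \<Omega>) x \<partial>lborel)"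
    by (intro nn_integral_cong) (auto simp: indicator_def)
  moreover have "(\<integral>\<^sup>+x. indicator A x \<partial>surface_measure \<Omega>) = (\<integral>\<^sup>+x. indicator (A \<inter> frontier \<Omega>) x \<partial>surface_measure \<Omega>)"
    by (intro nn_integral_cong) (auto simp: indicator_def space_surface_measure)
  ultimately show ?case
    using set borel_Int_frontier[OF set] \<Omega> by (simp add: emeasure_domain_measure)
next
  case (mult u c)
  note u = \<open>u \<in> borel_measurable borel\<close>
  note [measurable] = u borel_measurable_surface[OF u]
  have [measurable]: "\<Omega> \<in> sets borel" using \<Omega> by simp
  have "(\<integral>\<^sup>+x. indicator \<Omega> x * (c * u x) \<partial>lborel) = c * (\<integral>\<^sup>+x. indicator \<Omega> x * u x \<partial>lborel)"
    by (subst nn_integral_cmult[symmetric]) (auto simp: ac_simps)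
  then show ?case using mult by (simp add: nn_integral_cmult distrib_left)
next
  case (add u v)
  note u = \<open>u \<in> borel_measurable borel\<close> and v = \<open>v \<in> borel_measurable borel\<close>
  note [measurable] = u v borel_measurable_surface[OF u] borel_measurable_surface[OF v]
  have [measurable]: "\<Omega> \<in> sets borel" using \<Omega> by simp
  show ?case using add by (simp add: nn_integral_add distrib_left ac_simps)
next
  case (seq U)
  note [measurable] = seq(1) borel_measurable_surface[OF seq(1)]
  have [measurable]: "\<Omega> \<in> sets borel" using \<Omega> by simp
  have inc: "incseq (\<lambda>i x. indicator \<Omega> x * U i x)"
    using seq(3) by (auto simp: incseq_def le_fun_def intro!: mult_left_mono)
  have e: "indicator \<Omega> x * (SUP i. U i x) = (SUP i. indicator \<Omega> x * U i x)" for x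
    by (simp add: SUP_mult_left_ennreal)
  have "(\<integral>\<^sup>+x. (SUP i. U i x) \<partial>domain_measure \<Omega>) = (SUP i. \<integral>\<^sup>+x. U i x \<partial>domain_measure \<Omega>)"
    by (rule nn_integral_monotone_convergence_SUP[OF seq(3)]) measurable
  also have "\<dots> = (SUP i. (\<integral>\<^sup>+x. indicator \<Omega> x * U i x \<partial>lborel) + (\<integral>\<^sup>+x. U i x \<partial>surface_measure \<Omega>))"
    by (simp add: seq)
  also have "\<dots> = (SUP i. \<integral>\<^sup>+x. indicator \<Omega> x * U i x \<partial>lborel) + (SUP i. \<integral>\<^sup>+x. U i x \<partial>surface_measure \<Omega>)"
    using inc seq(3) by (intro ennreal_SUP_add) (auto simp: incseq_def le_fun_def intro!: nn_integral_mono)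
  also have "(SUP i. \<integral>\<^sup>+x. indicator \<Omega> x * U i x \<partial>lborel) = (\<integral>\<^sup>+x. (SUP i. indicator \<Omega> x * U i x) \<partial>lborel)"
    by (rule nn_integral_monotone_convergence_SUP[OF inc, symmetric]) measurable
  also have "(SUP i. \<integral>\<^sup>+x. U i x \<partial>surface_measure \<Omega>) = (\<integral>\<^sup>+x. (SUP i. U i x) \<partial>surface_measure \<Omega>)"
    by (rule nn_integral_monotone_convergence_SUP[OF seq(3), symmetric]) measurable
  finally show ?case by (simp add: e SUP_apply image_comp)
qed

lemma (in cone) transport:
  assumes fin: "finite_measure (surface_measure \<Omega>)" and y: "y \<in> ball e (\<kappa> / 2)"
    and g [measurable]: "g \<in> borel_measurable borel"
  shows "(\<integral>\<^sup>+x. indicator (ball p r) x * (\<integral>\<^sup>+s. indicator {0<..<\<delta>} s * g (x + s *\<^sub>R y) \<partial>lborel) \<partial>domain_measure \<Omega>)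
     \<le> ennreal (\<delta> + CT) * (\<integral>\<^sup>+x. indicator \<Omega> x * g x \<partial>lborel)"
proof -
  have [measurable]: "\<Omega> \<in> sets borel" using open_\<Omega> by simp
  \<comment> \<open>Points reached from the closure lie in \<open>\<Omega>\<close> by the cone
    property, so \<open>g\<close> may be cut off outside \<open>\<Omega>\<close> without changing
    the left-hand side.\<close>
  define h where "h x = indicator \<Omega> x * g x" for x
  have h [measurable]: "h \<in> borel_measurable borel" unfolding h_def by measurable
  define F where "F g x = indicator (ball p r) x * (\<integral>\<^sup>+s. indicator {0<..<\<delta>} s * g (x + s *\<^sub>R y) \<partial>lborel)" for g :: "'a \<Rightarrow> ennreal" and x
  have F [measurable]: "F g \<in> borel_measurable borel" if [measurable]: "g \<in> borel_measurable borel" for g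
  proof -
    have "(\<lambda>x. \<integral>\<^sup>+s. indicator {0<..<\<delta>} s * g (x + s *\<^sub>R y) \<partial>lborel) \<in> borel_measurable borel"
      by (rule lborel.borel_measurable_nn_integral) measurable
    then show ?thesis unfolding F_def by (intro borel_measurable_times_ennreal borel_measurable_indicator) auto
  qed
  have Fh: "F g x = F h x" if "x \<in> closure \<Omega>" for x
  proof (cases "x \<in> ball p r")
    case True
    have "indicator {0<..<\<delta>} s * g (x + s *\<^sub>R y) = indicator {0<..<\<delta>} s * h (x + s *\<^sub>R y)" for s
      using shift_mem[OF that True, of y s] y pos by (auto simp: h_def indicator_def)
    then show ?thesis by (simp add: F_def)
  qed (simp add: F_def)
  have "(\<integral>\<^sup>+x. F g x \<partial>domain_measure \<Omega>) = (\<integral>\<^sup>+x. indicator \<Omega> x * F g x \<partial>lborel) + (\<integral>\<^sup>+x. F g x \<partial>surface_measure \<Omega>)"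
    by (rule nn_integral_domain_measure[OF open_\<Omega> F[OF g]])
  also have "(\<integral>\<^sup>+x. indicator \<Omega> x * F g x \<partial>lborel) = (\<integral>\<^sup>+x. indicator \<Omega> x * F h x \<partial>lborel)"
    using closure_subset[of \<Omega>] by (intro nn_integral_cong) (auto simp: indicator_def Fh)
  also have "\<dots> = (\<integral>\<^sup>+x. (indicator \<Omega> x * indicator (ball p r) x) * (\<integral>\<^sup>+s. indicator {0<..<\<delta>} s * h (x + s *\<^sub>R y) \<partial>lborel) \<partial>lborel)"
    by (simp add: F_def mult.assoc)
  also have "\<dots> \<le> ennreal \<delta> * (\<integral>\<^sup>+x. h x \<partial>lborel)"
    by (rule transport_interior[OF h]) (auto simp: indicator_def)
  also have "(\<integral>\<^sup>+x. F g x \<partial>surface_measure \<Omega>) = (\<integral>\<^sup>+x. F h x \<partial>surface_measure \<Omega>)"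
    by (intro nn_integral_cong Fh) (auto simp: space_surface_measure frontier_def)
  also have "\<dots> \<le> ennreal CT * (\<integral>\<^sup>+x. h x \<partial>lborel)" unfolding F_def by (rule transport_surface[OF fin y h])
  finally show ?thesis
    using CT pos unfolding F_def h_def by (simp add: distrib_right add_mono less_imp_le)
qed

definition energy :: "'a::euclidean_space set \<Rightarrow> ('a \<Rightarrow> real) \<Rightarrow> ennreal" where
  "energy \<Omega> \<Phi> = (\<integral>\<^sup>+x. indicator \<Omega> x * ennreal ((norm (gradient \<Phi> x))\<^sup>2) \<partial>lborel)"

definition bulk :: "'a::euclidean_space set \<Rightarrow> ('a \<Rightarrow> real) \<Rightarrow> ennreal" where
  "bulk \<Omega> \<Phi> = (\<integral>\<^sup>+x. indicator \<Omega> x * ennreal ((\<Phi> x)\<^sup>2) \<partial>lborel)"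

lemma ennreal_square_add_le: "ennreal ((a + b)\<^sup>2) \<le> 2 * ennreal (a\<^sup>2) + 2 * ennreal (b\<^sup>2)"
proof -
  have "(a + b)\<^sup>2 \<le> 2 * a\<^sup>2 + 2 * b\<^sup>2" using sum_squares_bound[of a b] by (simp add: power2_sum)
  then have "ennreal ((a + b)\<^sup>2) \<le> ennreal (2 * a\<^sup>2 + 2 * b\<^sup>2)" by (rule ennreal_leI)
  also have "\<dots> = 2 * ennreal (a\<^sup>2) + 2 * ennreal (b\<^sup>2)"
    by (simp add: ennreal_mult)
  finally show ?thesis .
qed

lemma emeasure_domain_measure_finite:
  fixes \<Omega> :: "'a::euclidean_space set"
  assumes "open \<Omega>" "bounded \<Omega>" "finite_measure (surface_measure \<Omega>)"
  shows "emeasure (domain_measure \<Omega>) A < \<infinity>"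
proof -
  interpret finite_measure "surface_measure \<Omega>" by fact
  have "emeasure (domain_measure \<Omega>) A \<le> emeasure (domain_measure \<Omega>) UNIV"
    by (rule emeasure_mono) auto
  also have "\<dots> = emeasure lborel \<Omega> + emeasure (surface_measure \<Omega>) (frontier \<Omega>)"
    using assms(1) by (simp add: emeasure_domain_measure)
  also have "\<dots> < \<infinity>"
    using emeasure_bounded_finite[OF assms(2)] emeasure_finite[of "frontier \<Omega>"] by (simp add: less_top[symmetric])
  finally show ?thesis .
qed

lemma AE_domain_measure:
  fixes \<Omega> :: "'a::euclidean_space set"
  assumes "open \<Omega>"
  shows "AE x in domain_measure \<Omega>. x \<in> closure \<Omega>"
proof (rule AE_I)
  show "{x \<in> space (domain_measure \<Omega>). x \<notin> closure \<Omega>} \<subseteq> - closure \<Omega>" by auto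
  have "- closure \<Omega> \<inter> \<Omega> = {}" "- closure \<Omega> \<inter> frontier \<Omega> = {}"
    using closure_subset[of \<Omega>] by (auto simp: frontier_def)
  then show "emeasure (domain_measure \<Omega>) (- closure \<Omega>) = 0"
    using assms by (subst emeasure_domain_measure) (auto intro!: borel_open)
qed auto

lemma nn_integral_affine:
  fixes g :: "'a::euclidean_space \<Rightarrow> ennreal"
  assumes [measurable]: "g \<in> borel_measurable borel" and t: "t > 0"
  shows "(\<integral>\<^sup>+y. g (x + t *\<^sub>R y) \<partial>lborel) = ennreal (1 / t ^ DIM('a)) * (\<integral>\<^sup>+y. g y \<partial>lborel)"
proof -
  have "(\<integral>\<^sup>+y. g y \<partial>lborel) = (\<integral>\<^sup>+y. ennreal (t ^ DIM('a)) * g y \<partial>distr lborel borel (\<lambda>y. x + t *\<^sub>R y))"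
    using t by (subst lborel_affine[of t x], simp) (subst nn_integral_density, auto)
  also have "\<dots> = ennreal (t ^ DIM('a)) * (\<integral>\<^sup>+y. g (x + t *\<^sub>R y) \<partial>lborel)"
    by (subst nn_integral_distr) (auto simp: nn_integral_cmult)
  finally have "ennreal (1 / t ^ DIM('a)) * (\<integral>\<^sup>+y. g y \<partial>lborel) =
     (ennreal (1 / t ^ DIM('a)) * ennreal (t ^ DIM('a))) * (\<integral>\<^sup>+y. g (x + t *\<^sub>R y) \<partial>lborel)"
    by (simp add: mult.assoc)
  also have "ennreal (1 / t ^ DIM('a)) * ennreal (t ^ DIM('a)) = 1"
    using t by (simp flip: ennreal_mult)
  finally show ?thesis by simp
qed

section \<open>Averages over cones: approximation, regularity and local inequalities\<close>

locale trace_cone = cone +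
  assumes bounded_\<Omega>: "bounded \<Omega>" and fin: "finite_measure (surface_measure \<Omega>)" and p_in: "p \<in> closure \<Omega>"
begin

definition "CM = \<delta> + CT"

lemma CM: "CM > 0" using CT pos by (simp add: CM_def)

text \<open>Half the radius of the cone: a direction in \<open>D\<close> may be perturbed by up to
  \<open>\<kappa> / 2\<close> and still points into \<open>\<Omega>\<close>.
  \<open>avg_lipschitz\<close> depends on this.\<close>

definition "D = ball e (\<kappa> / 2)"

definition "V = measure lborel D"

lemma V: "V > 0" using pos by (simp add: V_def D_def content_ball)

definition Dm :: "'a measure" where "Dm = density lborel (indicator D)"

lemma sets_Dm [simp, measurable_cong]: "sets Dm = sets borel" by (simp add: Dm_def)
lemma space_Dm [simp]: "space Dm = UNIV" by (simp add: Dm_def)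

lemma emeasure_Dm: "emeasure Dm UNIV = ennreal V"
proof -
  have "emeasure Dm UNIV = (\<integral>\<^sup>+x. indicator D x \<partial>lborel)"
    unfolding Dm_def D_def by (subst emeasure_density) (auto intro!: borel_measurable_indicator)
  also have "\<dots> = emeasure lborel D" by (simp add: D_def)
  also have "\<dots> = ennreal V" using emeasure_lborel_ball_finite[of e "\<kappa> / 2"]
    by (simp add: V_def D_def emeasure_eq_ennreal_measure less_top)
  finally show ?thesis .
qed

sublocale Dm: finite_measure Dm
  by rule (simp add: emeasure_Dm)

lemma measure_Dm: "measure Dm UNIV = V" using V by (simp add: measure_def emeasure_Dm)

lemma Dm_int:
  "h \<in> borel_measurable borel \<Longrightarrow> (\<integral>\<^sup>+y. h y \<partial>Dm) = (\<integral>\<^sup>+y. indicator D y * h y \<partial>lborel)"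
  unfolding Dm_def D_def by (rule nn_integral_density) (auto intro!: borel_measurable_indicator)

lemma Dm_continuous_square_integrable:
  fixes g :: "'a \<Rightarrow> real"
  assumes g: "continuous_on UNIV g"
  shows "square_integrable Dm g"
proof (rule square_integrableI_nn)
  have [measurable]: "g \<in> borel_measurable borel" using g by (rule borel_measurable_continuous_onI)
  then show "g \<in> borel_measurable Dm" by simp
  have "compact (g ` cball e (\<kappa> / 2))" by (intro compact_continuous_image continuous_on_subset[OF g]) auto
  then obtain B where B: "\<And>y. y \<in> cball e (\<kappa> / 2) \<Longrightarrow> norm (g y) \<le> B"
    by (meson compact_imp_bounded bounded_iff imageI)
  have "(\<integral>\<^sup>+y. ennreal ((norm (g y))\<^sup>2) \<partial>Dm) = (\<integral>\<^sup>+y. indicator D y * ennreal ((norm (g y))\<^sup>2) \<partial>lborel)"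
    by (rule Dm_int) measurable
  also have "\<dots> \<le> (\<integral>\<^sup>+y. ennreal (B\<^sup>2) * indicator D y \<partial>lborel)"
  proof (rule nn_integral_mono)
    fix y show "indicator D y * ennreal ((norm (g y))\<^sup>2) \<le> ennreal (B\<^sup>2) * indicator D y"
    proof (cases "y \<in> D")
      case True
      then have "norm (g y) \<le> B" using B[of y] by (auto simp: D_def)
      then have "(norm (g y))\<^sup>2 \<le> B\<^sup>2" by (intro power_mono) auto
      then show ?thesis using True by (simp add: ennreal_leI)
    qed simp
  qed
  also have "\<dots> < \<infinity>" using emeasure_lborel_ball_finite[of e "\<kappa> / 2"]
    by (subst nn_integral_cmult_indicator) (auto simp: D_def ennreal_mult_less_top)
  finally show "(\<integral>\<^sup>+y. ennreal ((norm (g y))\<^sup>2) \<partial>Dm) < \<infinity>" .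
qed

text \<open>Jensen's inequality for the square, obtained from \<open>l1_le_l2\<close>.\<close>

lemma average_square_le:
  assumes g: "continuous_on UNIV g"
  shows "ennreal (((\<integral>y. g y \<partial>Dm) / V)\<^sup>2) \<le> ennreal (1 / V) * (\<integral>\<^sup>+y. ennreal ((g y)\<^sup>2) \<partial>Dm)"
proof -
  have sq: "square_integrable Dm g" by (rule Dm_continuous_square_integrable[OF g])
  have "\<bar>\<integral>y. g y \<partial>Dm\<bar> \<le> (\<integral>y. norm (g y) \<partial>Dm)" using integral_norm_bound[of Dm g] by simp
  also have "\<dots> \<le> sqrt V * l2_norm Dm g"
    using l1_le_l2[OF Dm.finite_measure_axioms sq] by (simp add: measure_Dm)
  finally have "(\<integral>y. g y \<partial>Dm)\<^sup>2 \<le> (sqrt V * l2_norm Dm g)\<^sup>2"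
    by (rule power2_le_iff_abs_le[THEN iffD2, rotated]) (use V in simp)
  also have "\<dots> = V * (l2_norm Dm g)\<^sup>2" using V by (simp add: power_mult_distrib)
  finally have "((\<integral>y. g y \<partial>Dm) / V)\<^sup>2 \<le> (1 / V) * (l2_norm Dm g)\<^sup>2"
    using V by (simp add: power_divide field_simps power2_eq_square)
  then have "ennreal (((\<integral>y. g y \<partial>Dm) / V)\<^sup>2) \<le> ennreal (1 / V) * ennreal ((l2_norm Dm g)\<^sup>2)"
    using V by (subst ennreal_mult[symmetric]) (auto intro: ennreal_leI)
  then show ?thesis using nn_integral_l2_norm[OF sq] by simp
qed

text \<open>Mean of \<open>\<Phi>\<close> over \<open>x + t D\<close>. For
  \<open>0 < t < \<delta>\<close> this ball lies in \<open>\<Omega>\<close> whenever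
  \<open>x\<close> is a point of the closure near \<open>p\<close>, boundary points included; a
  one-sided mollification that reaches up to the boundary.\<close>

definition avg :: "real \<Rightarrow> ('a \<Rightarrow> real) \<Rightarrow> 'a \<Rightarrow> real" where
  "avg t \<Phi> x = (\<integral>y. \<Phi> (x + t *\<^sub>R y) \<partial>Dm) / V"

lemma smooth_shift_continuous: "smooth \<Phi> \<Longrightarrow> continuous_on UNIV (\<lambda>y. \<Phi> (x + t *\<^sub>R y))"
  by (intro continuous_on_compose2[OF smooth_continuous[of \<Phi> UNIV]] continuous_intros) auto

lemma smooth_shift_integrable: "smooth \<Phi> \<Longrightarrow> integrable Dm (\<lambda>y. \<Phi> (x + t *\<^sub>R y))"
  by (intro l2_imp_integrable Dm.finite_measure_axioms Dm_continuous_square_integrable smooth_shift_continuous)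

lemma avg_measurable:
  assumes "smooth \<Phi>" shows "avg t \<Phi> \<in> borel_measurable borel"
proof -
  have [measurable]: "\<Phi> \<in> borel_measurable borel" by (rule smooth_measurable[OF assms])
  have "(\<lambda>x. \<integral>y. \<Phi> (x + t *\<^sub>R y) \<partial>Dm) \<in> borel_measurable borel"
    by (rule Dm.borel_measurable_lebesgue_integral) measurable
  then show ?thesis unfolding avg_def by simp
qed

lemma avg_lincomb:
  assumes "smooth \<Phi>" "smooth \<Psi>"
  shows "avg t (\<lambda>x. \<Phi> x + c * \<Psi> x) x = avg t \<Phi> x + c * avg t \<Psi> x"
  using smooth_shift_integrable[OF assms(1)] smooth_shift_integrable[OF assms(2)]
  by (simp add: avg_def add_divide_distrib)

lemma avg_deviation:
  assumes "smooth \<Phi>"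
  shows "ennreal ((\<Phi> x - avg t \<Phi> x)\<^sup>2) \<le> ennreal (1 / V) * (\<integral>\<^sup>+y. ennreal ((\<Phi> (x + t *\<^sub>R y) - \<Phi> x)\<^sup>2) \<partial>Dm)"
proof -
  have "(\<integral>y. \<Phi> (x + t *\<^sub>R y) - \<Phi> x \<partial>Dm) = (\<integral>y. \<Phi> (x + t *\<^sub>R y) \<partial>Dm) - \<Phi> x * V"
    using smooth_shift_integrable[OF assms, of x t] by (simp add: measure_Dm)
  then have "(\<integral>y. \<Phi> (x + t *\<^sub>R y) - \<Phi> x \<partial>Dm) / V = avg t \<Phi> x - \<Phi> x"
    using V by (simp add: avg_def diff_divide_distrib)
  then show ?thesis
    using average_square_le[of "\<lambda>y. \<Phi> (x + t *\<^sub>R y) - \<Phi> x"] smooth_shift_continuous[OF assms, of x t]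
    by (simp add: power2_commute continuous_intros)
qed

text \<open>Substituting \<open>z = x + t y\<close> turns the mean over directions into an integral
  over \<open>\<Omega>\<close> and costs the factor \<open>1 / t ^ DIM('a)\<close>. It makes point
  values of means admissible functionals.\<close>

lemma avg_bound:
  assumes \<Phi>: "smooth \<Phi>" and t: "0 < t" "t < \<delta>" and x: "x \<in> closure \<Omega>" "x \<in> ball p r"
  shows "ennreal ((avg t \<Phi> x)\<^sup>2) \<le> ennreal (1 / (V * t ^ DIM('a))) * bulk \<Omega> \<Phi>"
proof -
  have [measurable]: "\<Phi> \<in> borel_measurable borel" by (rule smooth_measurable[OF \<Phi>])
  have [measurable]: "\<Omega> \<in> sets borel" using open_\<Omega> by simp
  have "ennreal ((avg t \<Phi> x)\<^sup>2) \<le> ennreal (1 / V) * (\<integral>\<^sup>+y. ennreal ((\<Phi> (x + t *\<^sub>R y))\<^sup>2) \<partial>Dm)"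
    unfolding avg_def by (rule average_square_le[OF smooth_shift_continuous[OF \<Phi>]])
  also have "(\<integral>\<^sup>+y. ennreal ((\<Phi> (x + t *\<^sub>R y))\<^sup>2) \<partial>Dm) = (\<integral>\<^sup>+y. indicator D y * ennreal ((\<Phi> (x + t *\<^sub>R y))\<^sup>2) \<partial>lborel)"
    by (rule Dm_int) measurable
  also have "\<dots> \<le> (\<integral>\<^sup>+y. indicator \<Omega> (x + t *\<^sub>R y) * ennreal ((\<Phi> (x + t *\<^sub>R y))\<^sup>2) \<partial>lborel)"
    using shift_mem[OF x _ t] pos by (intro nn_integral_mono mult_right_mono) (auto simp: indicator_def D_def)
  also have "\<dots> = ennreal (1 / t ^ DIM('a)) * bulk \<Omega> \<Phi>"
    unfolding bulk_def by (rule nn_integral_affine[OF _ t(1)]) measurable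
  also have "ennreal (1 / V) * (ennreal (1 / t ^ DIM('a)) * bulk \<Omega> \<Phi>) = ennreal (1 / (V * t ^ DIM('a))) * bulk \<Omega> \<Phi>"
    using V t by (simp add: ennreal_mult[symmetric] mult.assoc[symmetric])
  finally show ?thesis by (simp add: mult_left_mono)
qed

text \<open>The segment from \<open>x + t y\<close> to \<open>x' + t y\<close> stays in
  \<open>\<Omega>\<close> even though \<open>\<Omega>\<close> may fail to be convex: its points are
  \<open>x + t z\<close> with \<open>z\<close> at distance at most \<open>\<kappa> / 2\<close> from
  \<open>y\<close>.\<close>

lemma avg_lipschitz:
  assumes \<Phi>: "smooth \<Phi>" and t: "0 < t" "t < \<delta>" and x: "x \<in> closure \<Omega>" "x \<in> ball p r"
    and x': "dist x x' \<le> t * (\<kappa> / 2)"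
  shows "ennreal ((avg t \<Phi> x' - avg t \<Phi> x)\<^sup>2) \<le> ennreal ((dist x x')\<^sup>2 / (V * t ^ DIM('a))) * energy \<Omega> \<Phi>"
proof -
  have [measurable]: "\<Phi> \<in> borel_measurable borel" "gradient \<Phi> \<in> borel_measurable borel" by (rule smooth_measurable[OF \<Phi>])+
  have [measurable]: "\<Omega> \<in> sets borel" "D \<in> sets borel" using open_\<Omega> by (auto simp: D_def)
  define h where "h = x' - x"
  define G where "G z = ennreal ((norm (gradient \<Phi> z))\<^sup>2)" for z
  have [measurable]: "G \<in> borel_measurable borel" unfolding G_def by measurable
  have "avg t \<Phi> x' - avg t \<Phi> x = (\<integral>y. \<Phi> (x' + t *\<^sub>R y) - \<Phi> (x + t *\<^sub>R y) \<partial>Dm) / V"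
    using smooth_shift_integrable[OF \<Phi>] by (simp add: avg_def diff_divide_distrib)
  then have "ennreal ((avg t \<Phi> x' - avg t \<Phi> x)\<^sup>2) \<le> ennreal (1 / V) * (\<integral>\<^sup>+y. ennreal ((\<Phi> (x' + t *\<^sub>R y) - \<Phi> (x + t *\<^sub>R y))\<^sup>2) \<partial>Dm)"
    using average_square_le[of "\<lambda>y. \<Phi> (x' + t *\<^sub>R y) - \<Phi> (x + t *\<^sub>R y)"] smooth_shift_continuous[OF \<Phi>]
    by (simp add: continuous_intros)
  also have "(\<integral>\<^sup>+y. ennreal ((\<Phi> (x' + t *\<^sub>R y) - \<Phi> (x + t *\<^sub>R y))\<^sup>2) \<partial>Dm)
     = (\<integral>\<^sup>+y. indicator D y * ennreal ((\<Phi> (x' + t *\<^sub>R y) - \<Phi> (x + t *\<^sub>R y))\<^sup>2) \<partial>lborel)"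
    by (rule Dm_int) measurable
  also have "\<dots> \<le> (\<integral>\<^sup>+y. ennreal ((norm h)\<^sup>2) * (\<integral>\<^sup>+s. indicator \<Omega> ((x + s *\<^sub>R h) + t *\<^sub>R y) * G ((x + s *\<^sub>R h) + t *\<^sub>R y) * indicator {0..1} s \<partial>lborel) \<partial>lborel)"
  proof (rule nn_integral_mono)
    fix y
    show "indicator D y * ennreal ((\<Phi> (x' + t *\<^sub>R y) - \<Phi> (x + t *\<^sub>R y))\<^sup>2) \<le> ennreal ((norm h)\<^sup>2) * (\<integral>\<^sup>+s. indicator \<Omega> ((x + s *\<^sub>R h) + t *\<^sub>R y) * G ((x + s *\<^sub>R h) + t *\<^sub>R y) * indicator {0..1} s \<partial>lborel)"
    proof (cases "y \<in> D")
      case True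
      have "indicator D y * ennreal ((\<Phi> (x' + t *\<^sub>R y) - \<Phi> (x + t *\<^sub>R y))\<^sup>2) = ennreal ((\<Phi> ((x + t *\<^sub>R y) + 1 *\<^sub>R h) - \<Phi> (x + t *\<^sub>R y))\<^sup>2)"
        using True by (simp add: h_def algebra_simps)
      also have "\<dots> \<le> ennreal ((norm h)\<^sup>2) * (\<integral>\<^sup>+s. G ((x + t *\<^sub>R y) + s *\<^sub>R h) * indicator {0..1} s \<partial>lborel)"
        using smooth_segment[OF \<Phi>, of 1 "x + t *\<^sub>R y" h] by (simp add: G_def)
      also have "(\<integral>\<^sup>+s. G ((x + t *\<^sub>R y) + s *\<^sub>R h) * indicator {0..1} s \<partial>lborel)
         = (\<integral>\<^sup>+s. indicator \<Omega> ((x + s *\<^sub>R h) + t *\<^sub>R y) * G ((x + s *\<^sub>R h) + t *\<^sub>R y) * indicator {0..1} s \<partial>lborel)"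
      proof (rule nn_integral_cong)
        fix s :: real
        show "G ((x + t *\<^sub>R y) + s *\<^sub>R h) * indicator {0..1} s = indicator \<Omega> ((x + s *\<^sub>R h) + t *\<^sub>R y) * G ((x + s *\<^sub>R h) + t *\<^sub>R y) * indicator {0..1} s"
        proof (cases "s \<in> {0..1}")
          case s: True
          have "norm ((s / t) *\<^sub>R h) \<le> \<kappa> / 2"
          proof -
            have "s * norm h \<le> 1 * norm h" using s by (intro mult_right_mono) auto
            also have "\<dots> \<le> t * (\<kappa> / 2)" using x' by (simp add: h_def dist_norm norm_minus_commute)
            finally show ?thesis using t s by (simp add: field_simps)
          qed
          moreover have "dist e y < \<kappa> / 2" using True by (simp add: D_def)
          moreover have "dist e (y + (s / t) *\<^sub>R h) \<le> dist e y + norm ((s / t) *\<^sub>R h)"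
            using dist_triangle[of e "y + (s / t) *\<^sub>R h" y] by (simp add: dist_norm)
          ultimately have "dist e (y + (s / t) *\<^sub>R h) < \<kappa>" by linarith
          then have "y + (s / t) *\<^sub>R h \<in> ball e \<kappa>" by simp
          then have "x + t *\<^sub>R (y + (s / t) *\<^sub>R h) \<in> \<Omega>" by (rule shift_mem[OF x _ t])
          then have "(x + s *\<^sub>R h) + t *\<^sub>R y \<in> \<Omega>" using t by (simp add: algebra_simps)
          then show ?thesis by (simp add: algebra_simps)
        qed simp
      qed
      finally show ?thesis .
    qed simp
  qed
  also have "\<dots> = ennreal ((norm h)\<^sup>2) * (\<integral>\<^sup>+y. (\<integral>\<^sup>+s. indicator \<Omega> ((x + s *\<^sub>R h) + t *\<^sub>R y) * G ((x + s *\<^sub>R h) + t *\<^sub>R y) * indicator {0..1} s \<partial>lborel) \<partial>lborel)"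
    by (rule nn_integral_cmult) measurable
  also have "(\<integral>\<^sup>+y. (\<integral>\<^sup>+s. indicator \<Omega> ((x + s *\<^sub>R h) + t *\<^sub>R y) * G ((x + s *\<^sub>R h) + t *\<^sub>R y) * indicator {0..1} s \<partial>lborel) \<partial>lborel)
     = (\<integral>\<^sup>+s. (\<integral>\<^sup>+y. indicator \<Omega> ((x + s *\<^sub>R h) + t *\<^sub>R y) * G ((x + s *\<^sub>R h) + t *\<^sub>R y) * indicator {0..1} s \<partial>lborel) \<partial>lborel)"
    by (rule lborel_pair.Fubini'[symmetric]) measurable
  also have "\<dots> = (\<integral>\<^sup>+(s::real). (ennreal (1 / t ^ DIM('a)) * energy \<Omega> \<Phi>) * indicator {0..1} s \<partial>lborel)"
  proof (rule nn_integral_cong)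
    fix s :: real
    have "(\<integral>\<^sup>+y. indicator \<Omega> ((x + s *\<^sub>R h) + t *\<^sub>R y) * G ((x + s *\<^sub>R h) + t *\<^sub>R y) \<partial>lborel) = ennreal (1 / t ^ DIM('a)) * energy \<Omega> \<Phi>"
      unfolding energy_def G_def[symmetric] by (rule nn_integral_affine[OF _ t(1)]) measurable
    then show "(\<integral>\<^sup>+y. indicator \<Omega> ((x + s *\<^sub>R h) + t *\<^sub>R y) * G ((x + s *\<^sub>R h) + t *\<^sub>R y) * indicator {0..1} s \<partial>lborel) = (ennreal (1 / t ^ DIM('a)) * energy \<Omega> \<Phi>) * indicator {0..1} s"
      by (subst nn_integral_multc) auto
  qed
  also have "\<dots> = ennreal (1 / t ^ DIM('a)) * energy \<Omega> \<Phi>"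
    by (subst nn_integral_cmult_indicator) auto
  also have "ennreal (1 / V) * (ennreal ((norm h)\<^sup>2) * (ennreal (1 / t ^ DIM('a)) * energy \<Omega> \<Phi>))
     = ennreal ((dist x x')\<^sup>2 / (V * t ^ DIM('a))) * energy \<Omega> \<Phi>"
  proof -
    have "ennreal (1 / V) * (ennreal ((norm h)\<^sup>2) * ennreal (1 / t ^ DIM('a))) = ennreal ((1 / V) * ((norm h)\<^sup>2 * (1 / t ^ DIM('a))))"
    proof -
      have "ennreal ((norm h)\<^sup>2 * (1 / t ^ DIM('a))) = ennreal ((norm h)\<^sup>2) * ennreal (1 / t ^ DIM('a))"
        using t by (intro ennreal_mult) auto
      moreover have "ennreal ((1 / V) * ((norm h)\<^sup>2 * (1 / t ^ DIM('a)))) = ennreal (1 / V) * ennreal ((norm h)\<^sup>2 * (1 / t ^ DIM('a)))"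
        using V t by (intro ennreal_mult) auto
      ultimately show ?thesis by simp
    qed
    also have "(1 / V) * ((norm h)\<^sup>2 * (1 / t ^ DIM('a))) = (dist x x')\<^sup>2 / (V * t ^ DIM('a))"
      by (simp add: h_def dist_norm norm_minus_commute)
    finally show ?thesis by (metis mult.assoc)
  qed
  finally show ?thesis by (simp add: mult_left_mono)
qed

text \<open>The one estimate behind all inequalities on the domain. The deviation is bounded by
  gradients along segments \<open>x + s y\<close>; after exchanging the integrals,
  \<open>transport\<close> absorbs the integration over \<open>x\<close>, boundary points included.
  The factor \<open>4 * t\<close> is \<open>(norm y)^2 * t\<close> with
  \<open>norm y \<le> 2\<close>.\<close>

lemma avg_approximation:
  assumes \<Phi>: "smooth \<Phi>" and t: "0 < t" "t < \<delta>"
  shows "(\<integral>\<^sup>+x. indicator (ball p r) x * ennreal ((\<Phi> x - avg t \<Phi> x)\<^sup>2) \<partial>domain_measure \<Omega>) \<le> ennreal (4 * t * CM) * energy \<Omega> \<Phi>"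
proof -
  interpret m: finite_measure "domain_measure \<Omega>"
    by rule (use emeasure_domain_measure_finite[OF open_\<Omega> bounded_\<Omega> fin] in \<open>simp add: less_top\<close>)
  interpret P: pair_sigma_finite "domain_measure \<Omega>" Dm ..
  have [measurable]: "\<Phi> \<in> borel_measurable borel" "gradient \<Phi> \<in> borel_measurable borel" by (rule smooth_measurable[OF \<Phi>])+
  have [measurable]: "\<Omega> \<in> sets borel" "D \<in> sets borel" using open_\<Omega> by (auto simp: D_def)
  define G where "G z = ennreal ((norm (gradient \<Phi> z))\<^sup>2)" for z
  have G [measurable]: "G \<in> borel_measurable borel" unfolding G_def by measurable
  define B where "B = (indicator (ball p r) :: 'a \<Rightarrow> ennreal)"
  have B [measurable]: "B \<in> borel_measurable borel" unfolding B_def by (rule indicator_ball_measurable)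
  have "(\<integral>\<^sup>+x. B x * ennreal ((\<Phi> x - avg t \<Phi> x)\<^sup>2) \<partial>domain_measure \<Omega>)
     \<le> (\<integral>\<^sup>+x. B x * (ennreal (1 / V) * (\<integral>\<^sup>+y. ennreal ((\<Phi> (x + t *\<^sub>R y) - \<Phi> x)\<^sup>2) \<partial>Dm)) \<partial>domain_measure \<Omega>)"
    by (intro nn_integral_mono mult_left_mono avg_deviation[OF \<Phi>]) auto
  also have "\<dots> = (\<integral>\<^sup>+x. (\<integral>\<^sup>+y. ennreal (1 / V) * (B x * ennreal ((\<Phi> (x + t *\<^sub>R y) - \<Phi> x)\<^sup>2)) \<partial>Dm) \<partial>domain_measure \<Omega>)"
    by (intro nn_integral_cong) (simp add: nn_integral_cmult ac_simps)
  also have "\<dots> = (\<integral>\<^sup>+y. (\<integral>\<^sup>+x. ennreal (1 / V) * (B x * ennreal ((\<Phi> (x + t *\<^sub>R y) - \<Phi> x)\<^sup>2)) \<partial>domain_measure \<Omega>) \<partial>Dm)"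
    by (rule P.Fubini'[symmetric]) measurable
  also have "\<dots> = (\<integral>\<^sup>+y. indicator D y * (\<integral>\<^sup>+x. ennreal (1 / V) * (B x * ennreal ((\<Phi> (x + t *\<^sub>R y) - \<Phi> x)\<^sup>2)) \<partial>domain_measure \<Omega>) \<partial>lborel)"
    by (rule Dm_int) (rule m.borel_measurable_nn_integral, measurable)
  also have "\<dots> \<le> (\<integral>\<^sup>+y. (ennreal (1 / V) * (ennreal (4 * t) * (ennreal CM * energy \<Omega> \<Phi>))) * indicator D y \<partial>lborel)"
  proof (rule nn_integral_mono)
    fix y
    show "indicator D y * (\<integral>\<^sup>+x. ennreal (1 / V) * (B x * ennreal ((\<Phi> (x + t *\<^sub>R y) - \<Phi> x)\<^sup>2)) \<partial>domain_measure \<Omega>)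
       \<le> (ennreal (1 / V) * (ennreal (4 * t) * (ennreal CM * energy \<Omega> \<Phi>))) * indicator D y"
    proof (cases "y \<in> D")
      case True
      have ny: "(norm y)\<^sup>2 \<le> 4"
      proof -
        have "norm y \<le> 2" using True pos norm_triangle_ineq2[of y e] by (simp add: D_def dist_norm norm_minus_commute)
        then have "(norm y)\<^sup>2 \<le> 2\<^sup>2" by (intro power_mono) auto
        then show ?thesis by simp
      qed
      have "(\<integral>\<^sup>+x. ennreal (1 / V) * (B x * ennreal ((\<Phi> (x + t *\<^sub>R y) - \<Phi> x)\<^sup>2)) \<partial>domain_measure \<Omega>)
         \<le> (\<integral>\<^sup>+x. ennreal (1 / V) * (ennreal (4 * t) * (B x * (\<integral>\<^sup>+s. indicator {0<..<\<delta>} s * G (x + s *\<^sub>R y) \<partial>lborel))) \<partial>domain_measure \<Omega>)"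
      proof (rule nn_integral_mono, rule mult_left_mono)
        fix x
        have "ennreal ((\<Phi> (x + t *\<^sub>R y) - \<Phi> x)\<^sup>2) \<le> ennreal ((norm y)\<^sup>2 * t) * (\<integral>\<^sup>+s. G (x + s *\<^sub>R y) * indicator {0..t} s \<partial>lborel)"
          using smooth_segment[OF \<Phi>, of t x y] t by (simp add: G_def)
        also have "\<dots> \<le> ennreal (4 * t) * (\<integral>\<^sup>+s. indicator {0<..<\<delta>} s * G (x + s *\<^sub>R y) \<partial>lborel)"
        proof (intro mult_mono ennreal_leI nn_integral_mono_AE)
          show "AE s in lborel. G (x + s *\<^sub>R y) * indicator {0..t} s \<le> indicator {0<..<\<delta>} s * G (x + s *\<^sub>R y)"
            using AE_lborel_singleton[of "0::real"] by eventually_elim (use t in \<open>auto simp: indicator_def\<close>)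
        qed (use t ny in auto)
        finally show "B x * ennreal ((\<Phi> (x + t *\<^sub>R y) - \<Phi> x)\<^sup>2) \<le> ennreal (4 * t) * (B x * (\<integral>\<^sup>+s. indicator {0<..<\<delta>} s * G (x + s *\<^sub>R y) \<partial>lborel))"
          by (subst mult.left_commute) (rule mult_left_mono, auto)
      qed simp
      also have "\<dots> = ennreal (1 / V) * (ennreal (4 * t) * (\<integral>\<^sup>+x. B x * (\<integral>\<^sup>+s. indicator {0<..<\<delta>} s * G (x + s *\<^sub>R y) \<partial>lborel) \<partial>domain_measure \<Omega>))"
      proof -
        have "(\<lambda>x. \<integral>\<^sup>+s. indicator {0<..<\<delta>} s * G (x + s *\<^sub>R y) \<partial>lborel) \<in> borel_measurable borel"
          by (rule lborel.borel_measurable_nn_integral) measurable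
        then show ?thesis using B by (simp add: nn_integral_cmult)
      qed
      also have "\<dots> \<le> ennreal (1 / V) * (ennreal (4 * t) * (ennreal CM * energy \<Omega> \<Phi>))"
        using transport[OF fin, of y G] True G unfolding B_def D_def CM_def energy_def G_def[symmetric]
        by (intro mult_left_mono) auto
      finally show ?thesis using True by simp
    qed simp
  qed
  also have "\<dots> = (ennreal (1 / V) * (ennreal (4 * t) * (ennreal CM * energy \<Omega> \<Phi>))) * emeasure lborel D"
    by (rule nn_integral_cmult_indicator) measurable
  also have "emeasure lborel D = ennreal V"
    using emeasure_lborel_ball_finite[of e "\<kappa> / 2"] by (simp add: V_def D_def emeasure_eq_ennreal_measure less_top)
  also have "(ennreal (1 / V) * (ennreal (4 * t) * (ennreal CM * energy \<Omega> \<Phi>))) * ennreal V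
      = (ennreal (1 / V) * ennreal V) * (ennreal (4 * t) * ennreal CM) * energy \<Omega> \<Phi>"
    by (simp add: ac_simps)
  also have "\<dots> = ennreal (4 * t * CM) * energy \<Omega> \<Phi>"
    using V t CM by (simp flip: ennreal_mult)
  finally show ?thesis unfolding B_def .
qed

end

lemma domain_measurable: "f \<in> borel_measurable borel \<Longrightarrow> f \<in> borel_measurable (domain_measure \<Omega>)"
  by (simp cong: measurable_cong_sets)

lemma nn_integral_two_add:
  assumes "f \<in> borel_measurable M" "A \<in> sets M"
  shows "(\<integral>\<^sup>+x. 2 * f x + K * indicator A x \<partial>M) = 2 * (\<integral>\<^sup>+x. f x \<partial>M) + K * emeasure M A"
  using assms by (simp add: nn_integral_add nn_integral_cmult nn_integral_cmult_indicator)

lemma nn_integral_two_add_const: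
  assumes "f \<in> borel_measurable M"
  shows "(\<integral>\<^sup>+x. 2 * f x + K \<partial>M) = 2 * (\<integral>\<^sup>+x. f x \<partial>M) + K * emeasure M (space M)"
  using assms by (simp add: nn_integral_add nn_integral_cmult)

lemma ennreal_lincomb:
  assumes "a \<ge> 0" "b \<ge> 0" "c \<ge> 0" "d \<ge> 0"
  shows "ennreal a + (ennreal 2 * ennreal b + ennreal 2 * (ennreal c * ennreal d)) = ennreal (a + (2 * b + 2 * (c * d)))"
proof -
  have "ennreal (2 * b) = ennreal 2 * ennreal b" "ennreal (2 * (c * d)) = ennreal 2 * (ennreal c * ennreal d)"
    using assms by (simp_all add: ennreal_mult del: ennreal_numeral)
  moreover have "ennreal (a + (2 * b + 2 * (c * d))) = ennreal a + (ennreal (2 * b) + ennreal (2 * (c * d)))"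
    using assms by (simp add: ennreal_plus del: ennreal_numeral)
  ultimately show ?thesis by simp
qed

context trace_cone
begin

lemma deviation_measurable:
  "smooth \<Phi> \<Longrightarrow> (\<lambda>x. indicator (ball p r) x * ennreal ((\<Phi> x - avg t \<Phi> x)\<^sup>2)) \<in> borel_measurable (domain_measure \<Omega>)"
  by (intro domain_measurable borel_measurable_times_ennreal indicator_ball_measurable measurable_compose[OF _ measurable_ennreal]
      borel_measurable_power borel_measurable_diff avg_measurable smooth_measurable)

lemma m_finite: "emeasure (domain_measure \<Omega>) A < \<infinity>"
  by (rule emeasure_domain_measure_finite[OF open_\<Omega> bounded_\<Omega> fin])

lemma p_ball: "p \<in> ball p r" using pos by simp

text \<open>For a fixed \<open>t\<close>, \<open>\<Phi>\<close> is close to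
  \<open>avg t \<Phi>\<close> by \<open>avg_approximation\<close>, and this mean differs little from
  its value at \<open>p\<close> by \<open>avg_lipschitz\<close>; that value is the constant.\<close>

lemma local_poincare:
  "\<exists>\<rho>>0. \<exists>C>0. \<forall>\<Phi>. smooth \<Phi> \<longrightarrow>
     (\<exists>c. (\<integral>\<^sup>+x. indicator (ball p \<rho>) x * ennreal ((\<Phi> x - c)\<^sup>2) \<partial>domain_measure \<Omega>) \<le> ennreal C * energy \<Omega> \<Phi>)"
proof -
  define t where "t = \<delta> / 2"
  have t: "0 < t" "t < \<delta>" using pos by (auto simp: t_def)
  define \<rho> where "\<rho> = min r (t * (\<kappa> / 2))"
  have \<rho>: "\<rho> > 0" using pos t by (simp add: \<rho>_def)
  define M where "M = measure (domain_measure \<Omega>) (ball p \<rho>)"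
  have M: "emeasure (domain_measure \<Omega>) (ball p \<rho>) = ennreal M"
    using m_finite[of "ball p \<rho>"] by (simp add: M_def emeasure_eq_ennreal_measure less_top)
  define CL where "CL = \<rho>\<^sup>2 / (V * t ^ DIM('a))"
  have CL: "CL \<ge> 0" using V t by (simp add: CL_def)
  \<comment> \<open>Each 2 stems from \<open>(a + b)^2 \<le> 2 * a^2 + 2 * b^2\<close>; the 1
    ensures positivity.\<close>
  define C where "C = 2 * (4 * t * CM) + 2 * (CL * M) + 1"
  have C: "C > 0" using t CM CL by (simp add: C_def M_def add_nonneg_pos)
  have "(\<integral>\<^sup>+x. indicator (ball p \<rho>) x * ennreal ((\<Phi> x - avg t \<Phi> p)\<^sup>2) \<partial>domain_measure \<Omega>) \<le> ennreal C * energy \<Omega> \<Phi>"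
    if \<Phi>: "smooth \<Phi>" for \<Phi>
  proof -
    have [measurable]: "\<Phi> \<in> borel_measurable borel" "avg t \<Phi> \<in> borel_measurable borel"
      by (rule smooth_measurable[OF \<Phi>] avg_measurable[OF \<Phi>])+
    note [measurable] = indicator_ball_measurable
    have "(\<integral>\<^sup>+x. indicator (ball p \<rho>) x * ennreal ((\<Phi> x - avg t \<Phi> p)\<^sup>2) \<partial>domain_measure \<Omega>)
      \<le> (\<integral>\<^sup>+x. 2 * (indicator (ball p r) x * ennreal ((\<Phi> x - avg t \<Phi> x)\<^sup>2)) + (2 * (ennreal CL * energy \<Omega> \<Phi>)) * indicator (ball p \<rho>) x \<partial>domain_measure \<Omega>)"
    proof (rule nn_integral_mono)
      fix x
      show "indicator (ball p \<rho>) x * ennreal ((\<Phi> x - avg t \<Phi> p)\<^sup>2) \<le>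
        2 * (indicator (ball p r) x * ennreal ((\<Phi> x - avg t \<Phi> x)\<^sup>2)) + (2 * (ennreal CL * energy \<Omega> \<Phi>)) * indicator (ball p \<rho>) x"
      proof (cases "x \<in> ball p \<rho>")
        case True
        then have d: "dist p x \<le> t * (\<kappa> / 2)" "x \<in> ball p r" "dist p x \<le> \<rho>" by (auto simp: \<rho>_def)
        have "(dist p x)\<^sup>2 \<le> \<rho>\<^sup>2" using d by (intro power_mono) auto
        then have "(dist p x)\<^sup>2 / (V * t ^ DIM('a)) \<le> CL" unfolding CL_def
          using V t by (intro divide_right_mono) auto
        then have "ennreal ((avg t \<Phi> x - avg t \<Phi> p)\<^sup>2) \<le> ennreal CL * energy \<Omega> \<Phi>"
          using avg_lipschitz[OF \<Phi> t p_in p_ball d(1)] by (meson ennreal_leI mult_right_mono order.trans zero_le)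
        moreover have "ennreal ((\<Phi> x - avg t \<Phi> p)\<^sup>2) \<le> 2 * ennreal ((\<Phi> x - avg t \<Phi> x)\<^sup>2) + 2 * ennreal ((avg t \<Phi> x - avg t \<Phi> p)\<^sup>2)"
          using ennreal_square_add_le[of "\<Phi> x - avg t \<Phi> x" "avg t \<Phi> x - avg t \<Phi> p"] by simp
        ultimately have "ennreal ((\<Phi> x - avg t \<Phi> p)\<^sup>2) \<le> 2 * ennreal ((\<Phi> x - avg t \<Phi> x)\<^sup>2) + 2 * (ennreal CL * energy \<Omega> \<Phi>)"
          by (meson add_left_mono mult_left_mono order.trans zero_le)
        then show ?thesis using True d(2) by simp
      qed simp
    qed
    also have "\<dots> = 2 * (\<integral>\<^sup>+x. indicator (ball p r) x * ennreal ((\<Phi> x - avg t \<Phi> x)\<^sup>2) \<partial>domain_measure \<Omega>)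
        + (2 * (ennreal CL * energy \<Omega> \<Phi>)) * ennreal M"
      unfolding M[symmetric] by (rule nn_integral_two_add[OF deviation_measurable[OF \<Phi>]]) simp
    also have "\<dots> \<le> 2 * (ennreal (4 * t * CM) * energy \<Omega> \<Phi>) + (2 * (ennreal CL * energy \<Omega> \<Phi>)) * ennreal M"
      by (intro add_right_mono mult_left_mono avg_approximation \<Phi> t) auto
    also have "\<dots> = (ennreal 2 * ennreal (4 * t * CM) + ennreal 2 * (ennreal CL * ennreal M)) * energy \<Omega> \<Phi>"
      by (simp add: distrib_right distrib_left ac_simps)
    also have "ennreal 2 * ennreal (4 * t * CM) + ennreal 2 * (ennreal CL * ennreal M) = ennreal (2 * (4 * t * CM) + 2 * (CL * M))"
    proof -
      have "ennreal 0 + (ennreal 2 * ennreal (4 * t * CM) + ennreal 2 * (ennreal CL * ennreal M))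
          = ennreal (0 + (2 * (4 * t * CM) + 2 * (CL * M)))"
        using t CM CL by (intro ennreal_lincomb) (auto simp: M_def)
      then show ?thesis by (simp only: ennreal_0 add_0)
    qed
    also have "\<dots> * energy \<Omega> \<Phi> \<le> ennreal C * energy \<Omega> \<Phi>"
      by (intro mult_right_mono ennreal_leI) (auto simp: C_def)
    finally show ?thesis .
  qed
  then show ?thesis using \<rho> C by blast
qed

end

text \<open>Admissible functionals are linear and bounded in \<open>L\<^sup>2(\<Omega>)\<close>; finitely many of them control the
  compact remainder in Ehrling's inequality.\<close>

definition admissible :: "'a::euclidean_space set \<Rightarrow> (('a \<Rightarrow> real) \<Rightarrow> real) \<Rightarrow> bool" where
  "admissible \<Omega> l \<longleftrightarrow>
     (\<forall>\<Phi> \<Psi> c. smooth \<Phi> \<longrightarrow> smooth \<Psi> \<longrightarrow> l (\<lambda>x. \<Phi> x + c * \<Psi> x) = l \<Phi> + c * l \<Psi>) \<and>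
     (\<exists>C\<ge>0. \<forall>\<Phi>. smooth \<Phi> \<longrightarrow> ennreal ((l \<Phi>)\<^sup>2) \<le> ennreal C * bulk \<Omega> \<Phi>)"

context trace_cone
begin

lemma admissible_avg:
  assumes "0 < t" "t < \<delta>" "x \<in> closure \<Omega>" "x \<in> ball p r"
  shows "admissible \<Omega> (\<lambda>\<Phi>. avg t \<Phi> x)"
  unfolding admissible_def
proof (intro conjI allI impI exI)
  show "0 \<le> 1 / (V * t ^ DIM('a))" using V assms by simp
qed (use assms in \<open>auto intro: avg_bound avg_lincomb\<close>)

text \<open>A small \<open>t\<close> makes the deviation from the means at most a fraction of
  \<open>\<epsilon>\<close> times the energy. For this fixed \<open>t\<close> the means are
  Lipschitz in \<open>x\<close> relative to the energy, so their values on a finite net control them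
  everywhere.\<close>

lemma local_ehrling:
  assumes \<epsilon>: "\<epsilon> > 0"
  shows "\<exists>F K. finite F \<and> (\<forall>l\<in>F. admissible \<Omega> l) \<and> K \<ge> 0 \<and> (\<forall>\<Phi>. smooth \<Phi> \<longrightarrow>
     (\<integral>\<^sup>+x. indicator (ball p (r / 2)) x * ennreal ((\<Phi> x)\<^sup>2) \<partial>domain_measure \<Omega>)
       \<le> ennreal \<epsilon> * energy \<Omega> \<Phi> + ennreal (K * (\<Sum>l\<in>F. (l \<Phi>)\<^sup>2)))"
proof -
  define M where "M = measure (domain_measure \<Omega>) UNIV"
  have M: "emeasure (domain_measure \<Omega>) UNIV = ennreal M" and M0: "M \<ge> 0"
    using m_finite[of UNIV] by (simp_all add: M_def emeasure_eq_ennreal_measure less_top)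
  \<comment> \<open>The 16 yields \<open>2 * (4 * t * CM) \<le> \<epsilon> / 2\<close>: the 2 comes
    from the square of a sum, \<open>4 * t * CM\<close> from
    \<open>avg_approximation\<close>.\<close>
  define t where "t = min (\<delta> / 2) (\<epsilon> / (16 * CM))"
  have t: "0 < t" "t < \<delta>" "2 * (4 * t * CM) \<le> \<epsilon> / 2" using pos CM \<epsilon> by (auto simp: t_def min_def field_simps)
  define W where "W = V * t ^ DIM('a)"
  have W: "W > 0" using V t by (simp add: W_def)
  \<comment> \<open>Mesh of the net. By \<open>\<eta> \<le> 1\<close> its square is at most
    \<open>\<eta>\<close>, so a bound linear in \<open>\<epsilon>\<close> is enough;
    \<open>M + 1\<close> avoids division by 0.\<close>
  define \<eta> where "\<eta> = min (min 1 (t * (\<kappa> / 2))) (\<epsilon> * W / (8 * (M + 1)))"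
  have \<eta>: "\<eta> > 0" "\<eta> \<le> 1" "\<eta> \<le> t * (\<kappa> / 2)" "\<eta> \<le> \<epsilon> * W / (8 * (M + 1))"
  proof -
    show "\<eta> > 0" using pos t W \<epsilon> M0 by (simp add: \<eta>_def)
    show "\<eta> \<le> 1" "\<eta> \<le> t * (\<kappa> / 2)" "\<eta> \<le> \<epsilon> * W / (8 * (M + 1))"
      unfolding \<eta>_def by (meson min.cobounded1 min.cobounded2 order.trans)+
  qed
  have \<eta>2: "4 * (\<eta>\<^sup>2 / W) * M \<le> \<epsilon> / 2"
  proof -
    have "\<eta>\<^sup>2 \<le> \<eta> * 1" unfolding power2_eq_square using \<eta> by (intro mult_left_mono) auto
    then have "\<eta>\<^sup>2 / W \<le> (\<epsilon> * W / (8 * (M + 1))) / W" using \<eta>(4) W by (intro divide_right_mono) auto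
    also have "\<dots> = \<epsilon> / (8 * (M + 1))" using W by simp
    finally have "4 * (\<eta>\<^sup>2 / W) * M \<le> 4 * (\<epsilon> / (8 * (M + 1))) * M" using M0 by (intro mult_right_mono mult_left_mono) auto
    also have "\<dots> \<le> \<epsilon> / 2" using M0 \<epsilon> by (simp add: field_simps)
    finally show ?thesis .
  qed
  define S where "S = closure \<Omega> \<inter> cball p (r / 2)"
  have "compact S" unfolding S_def using bounded_\<Omega> by (intro compact_Int) (auto simp: compact_closure)
  obtain X where X: "finite X" "X \<subseteq> S" "S \<subseteq> (\<Union>x\<in>X. ball x \<eta>)"
  proof (rule compactE_image[OF \<open>compact S\<close>, of S "\<lambda>x. ball x \<eta>"])
    show "S \<subseteq> (\<Union>x\<in>S. ball x \<eta>)" using \<eta>(1) by auto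
  qed (auto intro: that)
  have XB: "x \<in> closure \<Omega>" "x \<in> ball p r" if "x \<in> X" for x using that X pos by (auto simp: S_def)
  define F where "F = (\<lambda>x \<Phi>. avg t \<Phi> x) ` X"
  have finF: "finite F" using X by (simp add: F_def)
  have adm: "admissible \<Omega> l" if "l \<in> F" for l using that XB t by (auto simp: F_def intro: admissible_avg)
  have "(\<integral>\<^sup>+x. indicator (ball p (r / 2)) x * ennreal ((\<Phi> x)\<^sup>2) \<partial>domain_measure \<Omega>)
       \<le> ennreal \<epsilon> * energy \<Omega> \<Phi> + ennreal ((4 * M) * (\<Sum>l\<in>F. (l \<Phi>)\<^sup>2))" if \<Phi>: "smooth \<Phi>" for \<Phi>
  proof -
    have [measurable]: "\<Phi> \<in> borel_measurable borel" "avg t \<Phi> \<in> borel_measurable borel"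
      by (rule smooth_measurable[OF \<Phi>] avg_measurable[OF \<Phi>])+
    note [measurable] = indicator_ball_measurable
    define A where "A = (\<Sum>l\<in>F. (l \<Phi>)\<^sup>2)"
    have A0: "A \<ge> 0" unfolding A_def by (intro sum_nonneg) auto
    define Q where "Q = 4 * ennreal A + 4 * (ennreal (\<eta>\<^sup>2 / W) * energy \<Omega> \<Phi>)"
    have avgx: "ennreal ((avg t \<Phi> x)\<^sup>2) \<le> 2 * ennreal A + 2 * (ennreal (\<eta>\<^sup>2 / W) * energy \<Omega> \<Phi>)"
      if x: "x \<in> closure \<Omega>" "x \<in> ball p (r / 2)" for x
    proof -
      have "x \<in> S" using x by (simp add: S_def)
      then obtain z where z: "z \<in> X" "dist z x < \<eta>" using X(3) by auto
      have "(avg t \<Phi> z)\<^sup>2 \<le> A" unfolding A_def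
        using finF z by (intro member_le_sum[of "\<lambda>\<Phi>. avg t \<Phi> z" F "\<lambda>l. (l \<Phi>)\<^sup>2"]) (auto simp: F_def)
      then have 1: "ennreal ((avg t \<Phi> z)\<^sup>2) \<le> ennreal A" by (rule ennreal_leI)
      have "dist z x \<le> t * (\<kappa> / 2)" using z \<eta> by linarith
      from avg_lipschitz[OF \<Phi> t(1,2) XB[OF z(1)] this]
      have 2: "ennreal ((avg t \<Phi> x - avg t \<Phi> z)\<^sup>2) \<le> ennreal (\<eta>\<^sup>2 / W) * energy \<Omega> \<Phi>"
      proof (rule order.trans, intro mult_right_mono ennreal_leI)
        have "(dist z x)\<^sup>2 \<le> \<eta>\<^sup>2" using z by (intro power_mono) auto
        then show "(dist z x)\<^sup>2 / (V * t ^ DIM('a)) \<le> \<eta>\<^sup>2 / W" unfolding W_def[symmetric] using W by (intro divide_right_mono) auto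
      qed simp
      have "ennreal ((avg t \<Phi> x)\<^sup>2) \<le> 2 * ennreal ((avg t \<Phi> z)\<^sup>2) + 2 * ennreal ((avg t \<Phi> x - avg t \<Phi> z)\<^sup>2)"
        using ennreal_square_add_le[of "avg t \<Phi> z" "avg t \<Phi> x - avg t \<Phi> z"] by simp
      also have "\<dots> \<le> 2 * ennreal A + 2 * (ennreal (\<eta>\<^sup>2 / W) * energy \<Omega> \<Phi>)"
        by (intro add_mono mult_left_mono 1 2) auto
      finally show ?thesis .
    qed
    have "(\<integral>\<^sup>+x. indicator (ball p (r / 2)) x * ennreal ((\<Phi> x)\<^sup>2) \<partial>domain_measure \<Omega>)
      \<le> (\<integral>\<^sup>+x. 2 * (indicator (ball p r) x * ennreal ((\<Phi> x - avg t \<Phi> x)\<^sup>2)) + Q \<partial>domain_measure \<Omega>)"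
    proof (rule nn_integral_mono_AE, use AE_domain_measure[OF open_\<Omega>] in eventually_elim)
      fix x assume cl: "x \<in> closure \<Omega>"
      show "indicator (ball p (r / 2)) x * ennreal ((\<Phi> x)\<^sup>2) \<le> 2 * (indicator (ball p r) x * ennreal ((\<Phi> x - avg t \<Phi> x)\<^sup>2)) + Q"
      proof (cases "x \<in> ball p (r / 2)")
        case True
        then have xr: "x \<in> ball p r" using pos by auto
        have "ennreal ((\<Phi> x)\<^sup>2) \<le> 2 * ennreal ((\<Phi> x - avg t \<Phi> x)\<^sup>2) + 2 * ennreal ((avg t \<Phi> x)\<^sup>2)"
          using ennreal_square_add_le[of "\<Phi> x - avg t \<Phi> x" "avg t \<Phi> x"] by simp
        also have "\<dots> \<le> 2 * ennreal ((\<Phi> x - avg t \<Phi> x)\<^sup>2) + 2 * (2 * ennreal A + 2 * (ennreal (\<eta>\<^sup>2 / W) * energy \<Omega> \<Phi>))"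
          by (intro add_left_mono mult_left_mono avgx[OF cl True]) auto
        also have "2 * (2 * ennreal A + 2 * (ennreal (\<eta>\<^sup>2 / W) * energy \<Omega> \<Phi>)) = Q"
          by (simp add: Q_def distrib_left mult.assoc[symmetric])
        finally show ?thesis using True xr by simp
      qed simp
    qed
    also have "\<dots> = 2 * (\<integral>\<^sup>+x. indicator (ball p r) x * ennreal ((\<Phi> x - avg t \<Phi> x)\<^sup>2) \<partial>domain_measure \<Omega>) + Q * ennreal M"
      unfolding nn_integral_two_add_const[OF deviation_measurable[OF \<Phi>]] by (simp add: M)
    also have "\<dots> \<le> 2 * (ennreal (4 * t * CM) * energy \<Omega> \<Phi>) + Q * ennreal M"
      by (intro add_right_mono mult_left_mono avg_approximation \<Phi> t(1,2)) auto
    also have "\<dots> = (ennreal 2 * ennreal (4 * t * CM) + ennreal 4 * (ennreal (\<eta>\<^sup>2 / W) * ennreal M)) * energy \<Omega> \<Phi> + ennreal 4 * (ennreal M * ennreal A)"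
      by (simp add: Q_def distrib_right distrib_left ac_simps)
    also have "ennreal 2 * ennreal (4 * t * CM) + ennreal 4 * (ennreal (\<eta>\<^sup>2 / W) * ennreal M) = ennreal (2 * (4 * t * CM) + 4 * (\<eta>\<^sup>2 / W) * M)"
    proof -
      have "ennreal (2 * (4 * t * CM)) = ennreal 2 * ennreal (4 * t * CM)"
        using t CM by (intro ennreal_mult) auto
      moreover have "ennreal (4 * (\<eta>\<^sup>2 / W) * M) = ennreal 4 * (ennreal (\<eta>\<^sup>2 / W) * ennreal M)"
        using W M0 by (subst mult.assoc, subst ennreal_mult, simp, simp, subst ennreal_mult, simp, simp, simp)
      moreover have "ennreal (2 * (4 * t * CM) + 4 * (\<eta>\<^sup>2 / W) * M) = ennreal (2 * (4 * t * CM)) + ennreal (4 * (\<eta>\<^sup>2 / W) * M)"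
        using t CM W M0 by (intro ennreal_plus) auto
      ultimately show ?thesis by simp
    qed
    also have "\<dots> \<le> ennreal \<epsilon>" using t(3) \<eta>2 by (intro ennreal_leI) linarith
    also have "ennreal 4 * (ennreal M * ennreal A) = ennreal ((4 * M) * A)"
      using M0 A0 by (simp add: ennreal_mult mult.assoc)
    finally show ?thesis unfolding A_def by (simp add: add_right_mono mult_right_mono)
  qed
  then show ?thesis using finF adm M0 by (intro exI[of _ F] exI[of _ "4 * M"]) auto
qed

end

section \<open>Global inequalities of Ehrling and Poincare on a connected Lipschitz domain\<close>

locale lipschitz_domain =
  fixes \<Omega> :: "'a::euclidean_space set"
  assumes open_\<Omega>: "open \<Omega>" and connected_\<Omega>: "connected \<Omega>" and nonempty_\<Omega>: "\<Omega> \<noteq> {}"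
    and bounded_\<Omega>: "bounded \<Omega>" and lipschitz_\<Omega>: "lipschitz_boundary \<Omega>"
begin

lemma finite_surface: "finite_measure (surface_measure \<Omega>)"
  by (rule finite_surface_measure[OF open_\<Omega> bounded_\<Omega> lipschitz_\<Omega>])

abbreviation "m \<equiv> domain_measure \<Omega>"

lemma m_finite: "emeasure m A < \<infinity>"
  by (rule emeasure_domain_measure_finite[OF open_\<Omega> bounded_\<Omega> finite_surface])

lemma trace_cone_exists: "p \<in> closure \<Omega> \<Longrightarrow> \<exists>r e \<kappa> \<delta>. trace_cone \<Omega> p r e \<kappa> \<delta>"
  using inner_cone_exists[OF open_\<Omega> lipschitz_\<Omega>, of p] open_\<Omega> bounded_\<Omega> finite_surface
  by (auto simp: trace_cone_def cone_def trace_cone_axioms_def)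

lemma compact_cl: "compact (closure \<Omega>)" using bounded_\<Omega> by (simp add: compact_closure)

lemma ehrling:
  assumes \<epsilon>: "\<epsilon> > 0"
  shows "\<exists>F K. finite F \<and> (\<forall>l\<in>F. admissible \<Omega> l) \<and> K \<ge> 0 \<and> (\<forall>\<Phi>. smooth \<Phi> \<longrightarrow>
     (\<integral>\<^sup>+x. ennreal ((\<Phi> x)\<^sup>2) \<partial>m) \<le> ennreal \<epsilon> * energy \<Omega> \<Phi> + ennreal (K * (\<Sum>l\<in>F. (l \<Phi>)\<^sup>2)))"
proof -
  define EH where "EH p \<rho> \<epsilon> F K \<longleftrightarrow> finite F \<and> (\<forall>l\<in>F. admissible \<Omega> l) \<and> K \<ge> 0 \<and> (\<forall>\<Phi>. smooth \<Phi> \<longrightarrow>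
     (\<integral>\<^sup>+x. indicator (ball p \<rho>) x * ennreal ((\<Phi> x)\<^sup>2) \<partial>m)
       \<le> ennreal \<epsilon> * energy \<Omega> \<Phi> + ennreal (K * (\<Sum>l\<in>F. (l \<Phi>)\<^sup>2)))"
    for p \<rho> \<epsilon> and F :: "(('a \<Rightarrow> real) \<Rightarrow> real) set" and K
  \<comment> \<open>The radius must not depend on \<open>\<epsilon>\<close>: the local inequalities
    are used with \<open>\<epsilon> / N\<close>, where \<open>N\<close> is known only after the
    cover has been chosen.\<close>
  have "\<exists>\<rho>>0. \<forall>\<epsilon>>0. \<exists>F K. EH p \<rho> \<epsilon> F K" if p: "p \<in> closure \<Omega>" for p
  proof -
    obtain r e \<kappa> \<delta> where "trace_cone \<Omega> p r e \<kappa> \<delta>" using trace_cone_exists[OF p] by blast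
    then interpret trace_cone \<Omega> p r e \<kappa> \<delta> .
    show ?thesis using local_ehrling pos unfolding EH_def by (intro exI[of _ "r / 2"]) auto
  qed
  then obtain \<rho> where \<rho>: "\<And>p. p \<in> closure \<Omega> \<Longrightarrow> \<rho> p > 0"
    "\<And>p \<epsilon>. p \<in> closure \<Omega> \<Longrightarrow> \<epsilon> > 0 \<Longrightarrow> \<exists>F K. EH p (\<rho> p) \<epsilon> F K" by metis
  obtain P where P: "P \<subseteq> closure \<Omega>" "finite P" "closure \<Omega> \<subseteq> (\<Union>p\<in>P. ball p (\<rho> p))"
  proof (rule compactE_image[OF compact_cl, of "closure \<Omega>" "\<lambda>p. ball p (\<rho> p)"])
    show "closure \<Omega> \<subseteq> (\<Union>p\<in>closure \<Omega>. ball p (\<rho> p))" using \<rho>(1) by force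
  qed (auto intro: that)
  define N where "N = real (card P) + 1"
  have N: "N > 0" by (simp add: N_def add_nonneg_pos)
  have "\<exists>F K. EH p (\<rho> p) (\<epsilon> / N) F K" if "p \<in> P" for p
    by (rule \<rho>(2)) (use P(1) that \<epsilon> N in auto)
  then obtain F K where EH: "\<And>p. p \<in> P \<Longrightarrow> EH p (\<rho> p) (\<epsilon> / N) (F p) (K p)" by metis
  have FK: "finite (F p)" "\<And>l. l \<in> F p \<Longrightarrow> admissible \<Omega> l" "K p \<ge> 0"
    "\<And>\<Phi>. smooth \<Phi> \<Longrightarrow> (\<integral>\<^sup>+x. indicator (ball p (\<rho> p)) x * ennreal ((\<Phi> x)\<^sup>2) \<partial>m)
       \<le> ennreal (\<epsilon> / N) * energy \<Omega> \<Phi> + ennreal (K p * (\<Sum>l\<in>F p. (l \<Phi>)\<^sup>2))" if "p \<in> P" for p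
    using EH[OF that] unfolding EH_def by blast+
  define F' where "F' = (\<Union>p\<in>P. F p)"
  define K' where "K' = (\<Sum>p\<in>P. K p)"
  have K': "K' \<ge> 0" unfolding K'_def using FK(3) by (rule sum_nonneg)
  have finF': "finite F'" using P FK by (simp add: F'_def)
  have "(\<integral>\<^sup>+x. ennreal ((\<Phi> x)\<^sup>2) \<partial>m) \<le> ennreal \<epsilon> * energy \<Omega> \<Phi> + ennreal (K' * (\<Sum>l\<in>F'. (l \<Phi>)\<^sup>2))" if \<Phi>: "smooth \<Phi>" for \<Phi>
  proof -
    have [measurable]: "\<Phi> \<in> borel_measurable borel" by (rule smooth_measurable[OF \<Phi>])
    have [measurable]: "(indicator (ball p (\<rho> p)) :: 'a \<Rightarrow> ennreal) \<in> borel_measurable borel" for p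
      by (intro borel_measurable_indicator borel_open open_ball)
    define A where "A = (\<Sum>l\<in>F'. (l \<Phi>)\<^sup>2)"
    have "(\<integral>\<^sup>+x. ennreal ((\<Phi> x)\<^sup>2) \<partial>m) \<le> (\<integral>\<^sup>+x. (\<Sum>p\<in>P. indicator (ball p (\<rho> p)) x * ennreal ((\<Phi> x)\<^sup>2)) \<partial>m)"
    proof (rule nn_integral_mono_AE, use AE_domain_measure[OF open_\<Omega>] in eventually_elim)
      fix x assume "x \<in> closure \<Omega>"
      then obtain p where p: "p \<in> P" "x \<in> ball p (\<rho> p)" using P by blast
      have "ennreal ((\<Phi> x)\<^sup>2) = indicator (ball p (\<rho> p)) x * ennreal ((\<Phi> x)\<^sup>2)" using p by simp
      also have "\<dots> \<le> (\<Sum>p\<in>P. indicator (ball p (\<rho> p)) x * ennreal ((\<Phi> x)\<^sup>2))"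
        by (rule member_le_sum[OF p(1) _ P(2)]) auto
      finally show "ennreal ((\<Phi> x)\<^sup>2) \<le> (\<Sum>p\<in>P. indicator (ball p (\<rho> p)) x * ennreal ((\<Phi> x)\<^sup>2))" .
    qed
    also have "\<dots> = (\<Sum>p\<in>P. \<integral>\<^sup>+x. indicator (ball p (\<rho> p)) x * ennreal ((\<Phi> x)\<^sup>2) \<partial>m)"
      by (rule nn_integral_sum) measurable
    also have "\<dots> \<le> (\<Sum>p\<in>P. ennreal (\<epsilon> / N) * energy \<Omega> \<Phi> + ennreal (K p * A))"
    proof (rule sum_mono)
      fix p assume p: "p \<in> P"
      have "(\<Sum>l\<in>F p. (l \<Phi>)\<^sup>2) \<le> A" unfolding A_def
        using p finF' by (intro sum_mono2) (auto simp: F'_def)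
      then have "K p * (\<Sum>l\<in>F p. (l \<Phi>)\<^sup>2) \<le> K p * A" using FK(3)[OF p] by (rule mult_left_mono)
      then show "(\<integral>\<^sup>+x. indicator (ball p (\<rho> p)) x * ennreal ((\<Phi> x)\<^sup>2) \<partial>m) \<le> ennreal (\<epsilon> / N) * energy \<Omega> \<Phi> + ennreal (K p * A)"
        using FK(4)[OF p \<Phi>] by (meson add_left_mono ennreal_leI order.trans)
    qed
    also have "\<dots> = of_nat (card P) * (ennreal (\<epsilon> / N) * energy \<Omega> \<Phi>) + (\<Sum>p\<in>P. ennreal (K p * A))"
      by (simp add: sum.distrib)
    also have "(\<Sum>p\<in>P. ennreal (K p * A)) = ennreal (K' * A)"
      unfolding K'_def sum_distrib_right
      by (rule sum_ennreal) (use FK(3) in \<open>auto intro!: mult_nonneg_nonneg sum_nonneg simp: A_def\<close>)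
    also have "of_nat (card P) * (ennreal (\<epsilon> / N) * energy \<Omega> \<Phi>) = ennreal (real (card P) * (\<epsilon> / N)) * energy \<Omega> \<Phi>"
    proof -
      have "ennreal (real (card P) * (\<epsilon> / N)) = of_nat (card P) * ennreal (\<epsilon> / N)"
        using \<epsilon> N by (subst ennreal_mult) (auto simp: ennreal_of_nat_eq_real_of_nat)
      then show ?thesis by (simp only: mult.assoc)
    qed
    also have "\<dots> \<le> ennreal \<epsilon> * energy \<Omega> \<Phi>"
    proof (intro mult_right_mono ennreal_leI)
      show "real (card P) * (\<epsilon> / N) \<le> \<epsilon>" using \<epsilon> N by (simp add: field_simps N_def)
    qed simp
    finally show ?thesis unfolding A_def by (simp add: add_right_mono)
  qed
  then show ?thesis using finF' K' FK(2) by (intro exI[of _ F'] exI[of _ K']) (auto simp: F'_def)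
qed

definition poincare_on :: "'a set \<Rightarrow> bool" where
  "poincare_on S \<longleftrightarrow> S \<in> sets borel \<and> (\<exists>C\<ge>0. \<forall>\<Phi>. smooth \<Phi> \<longrightarrow>
     (\<exists>c. (\<integral>\<^sup>+x. indicator S x * ennreal ((\<Phi> x - c)\<^sup>2) \<partial>m) \<le> ennreal C * energy \<Omega> \<Phi>))"

text \<open>Two mean values compare through the overlap of their domains.\<close>

lemma poincare_on_Un:
  assumes S: "poincare_on S" and T: "poincare_on T" and ov: "emeasure m (S \<inter> T) > 0"
  shows "poincare_on (S \<union> T)"
proof -
  have [measurable]: "S \<in> sets borel" "T \<in> sets borel" using S T by (auto simp: poincare_on_def)
  obtain C where C: "C \<ge> 0" "\<And>\<Phi>. smooth \<Phi> \<Longrightarrow> \<exists>c. (\<integral>\<^sup>+x. indicator S x * ennreal ((\<Phi> x - c)\<^sup>2) \<partial>m) \<le> ennreal C * energy \<Omega> \<Phi>"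
    using S by (auto simp: poincare_on_def)
  obtain C' where C': "C' \<ge> 0" "\<And>\<Phi>. smooth \<Phi> \<Longrightarrow> \<exists>c. (\<integral>\<^sup>+x. indicator T x * ennreal ((\<Phi> x - c)\<^sup>2) \<partial>m) \<le> ennreal C' * energy \<Omega> \<Phi>"
    using T by (auto simp: poincare_on_def)
  define \<mu> where "\<mu> = measure m (S \<inter> T)"
  have \<mu>: "emeasure m (S \<inter> T) = ennreal \<mu>" using m_finite[of "S \<inter> T"] by (simp add: \<mu>_def emeasure_eq_ennreal_measure less_top)
  have \<mu>0: "\<mu> > 0" using ov by (simp add: \<mu>)
  define M where "M = measure m T"
  have M: "emeasure m T = ennreal M" using m_finite[of T] by (simp add: M_def emeasure_eq_ennreal_measure less_top)
  have M0: "M \<ge> 0" by (simp add: M_def)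
  define K where "K = 2 * C + 2 * C'"
  have K0: "K \<ge> 0" using C C' by (simp add: K_def)
  define CC where "CC = C + (2 * C' + 2 * ((1 / \<mu> * K) * M))"
  have "\<exists>c. (\<integral>\<^sup>+x. indicator (S \<union> T) x * ennreal ((\<Phi> x - c)\<^sup>2) \<partial>m) \<le> ennreal CC * energy \<Omega> \<Phi>" if \<Phi>: "smooth \<Phi>" for \<Phi>
  proof -
    have [measurable]: "\<Phi> \<in> borel_measurable borel" by (rule smooth_measurable[OF \<Phi>])
    obtain c where c: "(\<integral>\<^sup>+x. indicator S x * ennreal ((\<Phi> x - c)\<^sup>2) \<partial>m) \<le> ennreal C * energy \<Omega> \<Phi>" using C \<Phi> by blast
    obtain c' where c': "(\<integral>\<^sup>+x. indicator T x * ennreal ((\<Phi> x - c')\<^sup>2) \<partial>m) \<le> ennreal C' * energy \<Omega> \<Phi>" using C' \<Phi> by blast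
    define d where "d = ennreal ((c' - c)\<^sup>2)"
    have "d * ennreal \<mu> = (\<integral>\<^sup>+x. d * indicator (S \<inter> T) x \<partial>m)"
      by (simp add: nn_integral_cmult_indicator \<mu>)
    also have "\<dots> \<le> (\<integral>\<^sup>+x. 2 * (indicator S x * ennreal ((\<Phi> x - c)\<^sup>2)) + 2 * (indicator T x * ennreal ((\<Phi> x - c')\<^sup>2)) \<partial>m)"
    proof (rule nn_integral_mono)
      fix x
      have "d \<le> 2 * ennreal ((\<Phi> x - c)\<^sup>2) + 2 * ennreal ((\<Phi> x - c')\<^sup>2)"
        using ennreal_square_add_le[of "\<Phi> x - c" "- (\<Phi> x - c')"] unfolding d_def power2_minus by simp
      then show "d * indicator (S \<inter> T) x \<le> 2 * (indicator S x * ennreal ((\<Phi> x - c)\<^sup>2)) + 2 * (indicator T x * ennreal ((\<Phi> x - c')\<^sup>2))"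
        by (auto simp: indicator_def)
    qed
    also have "\<dots> = 2 * (\<integral>\<^sup>+x. indicator S x * ennreal ((\<Phi> x - c)\<^sup>2) \<partial>m) + 2 * (\<integral>\<^sup>+x. indicator T x * ennreal ((\<Phi> x - c')\<^sup>2) \<partial>m)"
      by (subst nn_integral_add, measurable, subst (1 2) nn_integral_cmult) auto
    also have "\<dots> \<le> 2 * (ennreal C * energy \<Omega> \<Phi>) + 2 * (ennreal C' * energy \<Omega> \<Phi>)"
      by (intro add_mono mult_left_mono c c') auto
    also have "\<dots> = (ennreal 2 * ennreal C + ennreal 2 * ennreal C') * energy \<Omega> \<Phi>"
      by (simp add: distrib_right mult.assoc)
    also have "ennreal 2 * ennreal C + ennreal 2 * ennreal C' = ennreal K"
      using C C' by (simp add: K_def ennreal_mult)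
    finally have "d * ennreal \<mu> \<le> ennreal K * energy \<Omega> \<Phi>" .
    then have "ennreal (1 / \<mu>) * (d * ennreal \<mu>) \<le> ennreal (1 / \<mu>) * (ennreal K * energy \<Omega> \<Phi>)" by (rule mult_left_mono) simp
    moreover have "ennreal (1 / \<mu>) * (d * ennreal \<mu>) = (ennreal (1 / \<mu>) * ennreal \<mu>) * d" by (simp add: ac_simps)
    moreover have "ennreal (1 / \<mu>) * ennreal \<mu> = 1" using \<mu>0 by (simp flip: ennreal_mult)
    moreover have "ennreal (1 / \<mu>) * (ennreal K * energy \<Omega> \<Phi>) = ennreal (1 / \<mu> * K) * energy \<Omega> \<Phi>"
      using \<mu>0 K0 by (subst ennreal_mult) (auto simp: mult.assoc)
    ultimately have d: "d \<le> ennreal (1 / \<mu> * K) * energy \<Omega> \<Phi>" by simp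
    have "(\<integral>\<^sup>+x. indicator (S \<union> T) x * ennreal ((\<Phi> x - c)\<^sup>2) \<partial>m)
      \<le> (\<integral>\<^sup>+x. indicator S x * ennreal ((\<Phi> x - c)\<^sup>2) + (2 * (indicator T x * ennreal ((\<Phi> x - c')\<^sup>2)) + (2 * d) * indicator T x) \<partial>m)"
    proof (rule nn_integral_mono)
      fix x
      have "ennreal ((\<Phi> x - c)\<^sup>2) \<le> 2 * ennreal ((\<Phi> x - c')\<^sup>2) + 2 * d"
        using ennreal_square_add_le[of "\<Phi> x - c'" "c' - c"] by (simp add: d_def)
      then show "indicator (S \<union> T) x * ennreal ((\<Phi> x - c)\<^sup>2) \<le>
        indicator S x * ennreal ((\<Phi> x - c)\<^sup>2) + (2 * (indicator T x * ennreal ((\<Phi> x - c')\<^sup>2)) + (2 * d) * indicator T x)"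
        by (cases "x \<in> S"; cases "x \<in> T") auto
    qed
    also have "\<dots> = (\<integral>\<^sup>+x. indicator S x * ennreal ((\<Phi> x - c)\<^sup>2) \<partial>m)
        + (2 * (\<integral>\<^sup>+x. indicator T x * ennreal ((\<Phi> x - c')\<^sup>2) \<partial>m) + (2 * d) * ennreal M)"
      by (subst nn_integral_add, measurable, subst nn_integral_two_add) (auto simp: M)
    also have "\<dots> \<le> ennreal C * energy \<Omega> \<Phi> + (2 * (ennreal C' * energy \<Omega> \<Phi>) + (2 * (ennreal (1 / \<mu> * K) * energy \<Omega> \<Phi>)) * ennreal M)"
      by (intro add_mono mult_left_mono mult_right_mono c c' d) auto
    also have "\<dots> = (ennreal C + (ennreal 2 * ennreal C' + ennreal 2 * (ennreal (1 / \<mu> * K) * ennreal M))) * energy \<Omega> \<Phi>"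
      by (simp add: distrib_right distrib_left ac_simps)
    also have "ennreal C + (ennreal 2 * ennreal C' + ennreal 2 * (ennreal (1 / \<mu> * K) * ennreal M)) = ennreal CC"
      unfolding CC_def using C C' \<mu>0 K0 M0 by (intro ennreal_lincomb) auto
    finally show ?thesis by blast
  qed
  moreover have "CC \<ge> 0" using C C' \<mu>0 K0 M0 by (simp add: CC_def)
  ultimately have "\<exists>C\<ge>0. \<forall>\<Phi>. smooth \<Phi> \<longrightarrow>
     (\<exists>c. (\<integral>\<^sup>+x. indicator (S \<union> T) x * ennreal ((\<Phi> x - c)\<^sup>2) \<partial>m) \<le> ennreal C * energy \<Omega> \<Phi>)" by blast
  then show ?thesis unfolding poincare_on_def by simp
qed

lemma m_open_pos:
  assumes "open U" "x \<in> U" "x \<in> closure \<Omega>"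
  shows "emeasure m U > 0"
proof -
  have "U \<inter> \<Omega> \<noteq> {}" using assms by (metis open_Int_closure_eq_empty disjoint_iff)
  then have "emeasure lborel (U \<inter> \<Omega>) > 0"
  proof -
    have "U \<inter> \<Omega> \<notin> null_sets lborel"
      using open_not_negligible[of "U \<inter> \<Omega>"] assms open_\<Omega> \<open>U \<inter> \<Omega> \<noteq> {}\<close>
      by (auto simp: negligible_iff_null_sets dest: null_sets_completionI)
    then show ?thesis using assms open_\<Omega> by (auto simp: null_sets_def zero_less_iff_neq_zero)
  qed
  then show ?thesis using assms open_\<Omega> by (simp add: emeasure_domain_measure add_pos_nonneg)
qed

lemma poincare_on_local: "p \<in> closure \<Omega> \<Longrightarrow> \<exists>\<rho>>0. poincare_on (ball p \<rho>)"
proof -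
  assume p: "p \<in> closure \<Omega>"
  obtain r e \<kappa> \<delta> where "trace_cone \<Omega> p r e \<kappa> \<delta>" using trace_cone_exists[OF p] by blast
  then interpret trace_cone \<Omega> p r e \<kappa> \<delta> .
  obtain \<rho> C where "\<rho> > 0" "C > 0" "\<forall>\<Phi>. smooth \<Phi> \<longrightarrow>
     (\<exists>c. (\<integral>\<^sup>+x. indicator (ball p \<rho>) x * ennreal ((\<Phi> x - c)\<^sup>2) \<partial>m) \<le> ennreal C * energy \<Omega> \<Phi>)"
    using local_poincare by blast
  then have "\<rho> > 0" "poincare_on (ball p \<rho>)"
    unfolding poincare_on_def by (auto intro!: exI[of _ C])
  then show ?thesis by blast
qed

text \<open>Connectedness of the closure: the property of being joined to \<open>p0\<close> by an
  open set with a Poincare inequality is locally constant, because neighbouring sets overlap in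
  positive measure. Compactness then leaves finitely many sets.\<close>

lemma poincare_on_closure: "\<exists>S. poincare_on S \<and> closure \<Omega> \<subseteq> S"
proof -
  obtain p0 where p0: "p0 \<in> \<Omega>" using nonempty_\<Omega> by blast
  then have p0c: "p0 \<in> closure \<Omega>" using closure_subset by blast
  \<comment> \<open>All these sets contain \<open>p0\<close>, so the members of the finite subcover
    overlap and can be merged one after another.\<close>
  define Q where "Q q \<longleftrightarrow> (\<exists>W. open W \<and> p0 \<in> W \<and> q \<in> W \<and> poincare_on W)" for q
  have conn: "connected (closure \<Omega>)" using connected_\<Omega> by (rule connected_imp_connected_closure)
  have "Q q" if q: "q \<in> closure \<Omega>" for q
  proof (rule connected_induction_simple[OF conn, where P = Q and a = p0 and b = q])
    show "p0 \<in> closure \<Omega>" "q \<in> closure \<Omega>" by fact+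
    show "Q p0" using poincare_on_local[OF p0c] unfolding Q_def by (metis open_ball centre_in_ball)
    fix a assume a: "a \<in> closure \<Omega>"
    obtain \<rho> where \<rho>: "\<rho> > 0" "poincare_on (ball a \<rho>)" using poincare_on_local[OF a] by blast
    show "\<exists>T. openin (top_of_set (closure \<Omega>)) T \<and> a \<in> T \<and> (\<forall>x\<in>T. \<forall>y\<in>T. Q x \<longrightarrow> Q y)"
    proof (intro exI[of _ "closure \<Omega> \<inter> ball a \<rho>"] conjI ballI impI)
      show "openin (top_of_set (closure \<Omega>)) (closure \<Omega> \<inter> ball a \<rho>)" by (simp add: openin_open_Int)
      show "a \<in> closure \<Omega> \<inter> ball a \<rho>" using a \<rho> by simp
      fix x y assume x: "x \<in> closure \<Omega> \<inter> ball a \<rho>" and y: "y \<in> closure \<Omega> \<inter> ball a \<rho>" and "Q x"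
      then obtain W where W: "open W" "p0 \<in> W" "x \<in> W" "poincare_on W" by (auto simp: Q_def)
      have "emeasure m (W \<inter> ball a \<rho>) > 0"
        by (rule m_open_pos[of _ x]) (use W x in auto)
      then have "poincare_on (W \<union> ball a \<rho>)" by (rule poincare_on_Un[OF W(4) \<rho>(2)])
      then show "Q y" unfolding Q_def using W y by (intro exI[of _ "W \<union> ball a \<rho>"]) auto
    qed
  qed
  then obtain W where W: "\<And>q. q \<in> closure \<Omega> \<Longrightarrow> open (W q) \<and> p0 \<in> W q \<and> q \<in> W q \<and> poincare_on (W q)"
    unfolding Q_def by metis
  obtain F where F: "F \<subseteq> closure \<Omega>" "finite F" "closure \<Omega> \<subseteq> (\<Union>q\<in>F. W q)"
  proof (rule compactE_image[OF compact_cl, of "closure \<Omega>" W])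
    show "closure \<Omega> \<subseteq> (\<Union>q\<in>closure \<Omega>. W q)" using W by blast
  qed (use W that in auto)
  have "F \<noteq> {}" using F(3) p0c by auto
  from F(2) this F(1) have "poincare_on (\<Union>q\<in>F. W q) \<and> open (\<Union>q\<in>F. W q) \<and> p0 \<in> (\<Union>q\<in>F. W q)"
  proof (induction rule: finite_ne_induct)
    case (singleton x)
    then show ?case using W by auto
  next
    case (insert x F)
    then have IH: "poincare_on (\<Union>q\<in>F. W q)" "open (\<Union>q\<in>F. W q)" "p0 \<in> (\<Union>q\<in>F. W q)" by auto
    have x: "open (W x)" "p0 \<in> W x" "poincare_on (W x)" using W insert by auto
    have "emeasure m (W x \<inter> (\<Union>q\<in>F. W q)) > 0"
      by (rule m_open_pos[of _ p0]) (use IH x p0c in auto)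
    then have "poincare_on (W x \<union> (\<Union>q\<in>F. W q))" by (rule poincare_on_Un[OF x(3) IH(1)])
    then show ?case using IH x by (auto intro!: open_Un)
  qed
  with F(3) show ?thesis by blast
qed

lemma poincare:
  obtains C where "C \<ge> 0" "\<And>\<Phi>. smooth \<Phi> \<Longrightarrow> \<exists>c. (\<integral>\<^sup>+x. ennreal ((\<Phi> x - c)\<^sup>2) \<partial>m) \<le> ennreal C * energy \<Omega> \<Phi>"
proof -
  obtain S where S: "poincare_on S" "closure \<Omega> \<subseteq> S" using poincare_on_closure by blast
  obtain C where C: "C \<ge> 0" "\<And>\<Phi>. smooth \<Phi> \<Longrightarrow> \<exists>c. (\<integral>\<^sup>+x. indicator S x * ennreal ((\<Phi> x - c)\<^sup>2) \<partial>m) \<le> ennreal C * energy \<Omega> \<Phi>"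
    using S by (auto simp: poincare_on_def)
  have eq: "(\<integral>\<^sup>+x. indicator S x * ennreal ((\<Phi> x - c)\<^sup>2) \<partial>m) = (\<integral>\<^sup>+x. ennreal ((\<Phi> x - c)\<^sup>2) \<partial>m)" for \<Phi> c
    by (rule nn_integral_cong_AE, use AE_domain_measure[OF open_\<Omega>] in eventually_elim) (use S in auto)
  show ?thesis using C unfolding eq by (rule that)
qed

text \<open>\<open>N\<close> is the part of the measure on which \<open>\<Phi>\<close> is
  controlled: the volume gives the trace inequality, a boundary piece gives Friedrichs' inequality.
  The constant \<open>c\<close> of Poincare's inequality is estimated by averaging
  \<open>c^2\<close> over \<open>N\<close>.\<close>

lemma poincare_part:
  assumes sub: "\<And>f. f \<in> borel_measurable borel \<Longrightarrow> (\<integral>\<^sup>+x. f x \<partial>N) \<le> (\<integral>\<^sup>+x. f x \<partial>m)"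
    and meas: "\<And>f :: 'a \<Rightarrow> ennreal. f \<in> borel_measurable borel \<Longrightarrow> f \<in> borel_measurable N"
    and pos: "emeasure N (space N) > 0"
  obtains C where "C \<ge> 0" "\<And>\<Phi>. smooth \<Phi> \<Longrightarrow>
     (\<integral>\<^sup>+x. ennreal ((\<Phi> x)\<^sup>2) \<partial>m) \<le> ennreal C * (energy \<Omega> \<Phi> + (\<integral>\<^sup>+x. ennreal ((\<Phi> x)\<^sup>2) \<partial>N))"
proof -
  obtain C where C: "C \<ge> 0" "\<And>\<Phi>. smooth \<Phi> \<Longrightarrow> \<exists>c. (\<integral>\<^sup>+x. ennreal ((\<Phi> x - c)\<^sup>2) \<partial>m) \<le> ennreal C * energy \<Omega> \<Phi>"
    using poincare by metis
  define M where "M = measure m UNIV"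
  have M: "emeasure m UNIV = ennreal M" using m_finite[of UNIV] by (simp add: M_def emeasure_eq_ennreal_measure less_top)
  have M0: "M \<ge> 0" by (simp add: M_def)
  have "emeasure N (space N) \<le> ennreal M"
    using sub[of "\<lambda>_. 1"] by (simp add: M)
  then have Nfin: "emeasure N (space N) < \<infinity>" using le_less_trans by fastforce
  define \<mu> where "\<mu> = measure N (space N)"
  have \<mu>: "emeasure N (space N) = ennreal \<mu>" using Nfin by (simp add: \<mu>_def emeasure_eq_ennreal_measure less_top)
  have \<mu>0: "\<mu> > 0" using pos by (simp add: \<mu>)
  define K where "K = 2 * C + 2"
  define CC where "CC = 2 * C + 2 * ((1 / \<mu> * K) * M)"
  have "(\<integral>\<^sup>+x. ennreal ((\<Phi> x)\<^sup>2) \<partial>m) \<le> ennreal CC * (energy \<Omega> \<Phi> + (\<integral>\<^sup>+x. ennreal ((\<Phi> x)\<^sup>2) \<partial>N))" if \<Phi>: "smooth \<Phi>" for \<Phi>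
  proof -
    have [measurable]: "\<Phi> \<in> borel_measurable borel" by (rule smooth_measurable[OF \<Phi>])
    obtain c where c: "(\<integral>\<^sup>+x. ennreal ((\<Phi> x - c)\<^sup>2) \<partial>m) \<le> ennreal C * energy \<Omega> \<Phi>" using C \<Phi> by blast
    define R where "R = energy \<Omega> \<Phi> + (\<integral>\<^sup>+x. ennreal ((\<Phi> x)\<^sup>2) \<partial>N)"
    have ER: "energy \<Omega> \<Phi> \<le> R" "(\<integral>\<^sup>+x. ennreal ((\<Phi> x)\<^sup>2) \<partial>N) \<le> R" by (auto simp: R_def)
    define d where "d = ennreal (c\<^sup>2)"
    have m0: "(\<lambda>x. ennreal ((\<Phi> x - c)\<^sup>2)) \<in> borel_measurable borel" "(\<lambda>x. ennreal ((\<Phi> x)\<^sup>2)) \<in> borel_measurable borel"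
      by measurable
    note m1 = m0[THEN meas]
    have "d * ennreal \<mu> = (\<integral>\<^sup>+x. d \<partial>N)" by (simp add: \<mu>)
    also have "\<dots> \<le> (\<integral>\<^sup>+x. 2 * ennreal ((\<Phi> x - c)\<^sup>2) + 2 * ennreal ((\<Phi> x)\<^sup>2) \<partial>N)"
    proof (rule nn_integral_mono)
      fix x show "d \<le> 2 * ennreal ((\<Phi> x - c)\<^sup>2) + 2 * ennreal ((\<Phi> x)\<^sup>2)"
        using ennreal_square_add_le[of "- (\<Phi> x - c)" "\<Phi> x"] unfolding d_def power2_minus by simp
    qed
    also have "\<dots> = 2 * (\<integral>\<^sup>+x. ennreal ((\<Phi> x - c)\<^sup>2) \<partial>N) + 2 * (\<integral>\<^sup>+x. ennreal ((\<Phi> x)\<^sup>2) \<partial>N)"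
      using m1 by (simp add: nn_integral_add nn_integral_cmult)
    also have "\<dots> \<le> 2 * (ennreal C * R) + 2 * R"
      using order.trans[OF order.trans[OF sub c] mult_left_mono[OF ER(1)]] ER(2)
      by (intro add_mono mult_left_mono) auto
    also have "\<dots> = (ennreal 2 * ennreal C + ennreal 2) * R" by (simp add: distrib_right mult.assoc)
    also have "ennreal 2 * ennreal C + ennreal 2 = ennreal K" using C by (simp add: K_def ennreal_mult)
    finally have "d * ennreal \<mu> \<le> ennreal K * R" .
    then have "ennreal (1 / \<mu>) * (d * ennreal \<mu>) \<le> ennreal (1 / \<mu>) * (ennreal K * R)" by (rule mult_left_mono) simp
    moreover have "ennreal (1 / \<mu>) * (d * ennreal \<mu>) = (ennreal (1 / \<mu>) * ennreal \<mu>) * d" by (simp add: ac_simps)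
    moreover have "ennreal (1 / \<mu>) * ennreal \<mu> = 1" using \<mu>0 by (simp flip: ennreal_mult)
    moreover have "ennreal (1 / \<mu>) * (ennreal K * R) = ennreal (1 / \<mu> * K) * R"
      using \<mu>0 C by (subst ennreal_mult) (auto simp: mult.assoc K_def)
    ultimately have d: "d \<le> ennreal (1 / \<mu> * K) * R" by simp
    have "(\<integral>\<^sup>+x. ennreal ((\<Phi> x)\<^sup>2) \<partial>m) \<le> (\<integral>\<^sup>+x. 2 * ennreal ((\<Phi> x - c)\<^sup>2) + 2 * d \<partial>m)"
    proof (rule nn_integral_mono)
      fix x show "ennreal ((\<Phi> x)\<^sup>2) \<le> 2 * ennreal ((\<Phi> x - c)\<^sup>2) + 2 * d"
        using ennreal_square_add_le[of "\<Phi> x - c" c] by (simp add: d_def)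
    qed
    also have "\<dots> = 2 * (\<integral>\<^sup>+x. ennreal ((\<Phi> x - c)\<^sup>2) \<partial>m) + (2 * d) * ennreal M"
      by (subst nn_integral_two_add_const, measurable) (simp add: M)
    also have "\<dots> \<le> 2 * (ennreal C * R) + (2 * (ennreal (1 / \<mu> * K) * R)) * ennreal M"
      using order.trans[OF c mult_left_mono[OF ER(1)]]
      by (intro add_mono mult_left_mono mult_right_mono d) auto
    also have "\<dots> = (ennreal 2 * ennreal C + ennreal 2 * (ennreal (1 / \<mu> * K) * ennreal M)) * R"
      by (simp add: distrib_right distrib_left ac_simps)
    also have "ennreal 2 * ennreal C + ennreal 2 * (ennreal (1 / \<mu> * K) * ennreal M) = ennreal CC"
      using ennreal_lincomb[of 0 C "1 / \<mu> * K" M] C \<mu>0 M0 by (simp add: CC_def K_def del: ennreal_numeral)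
    finally show ?thesis by (simp add: R_def)
  qed
  moreover have "CC \<ge> 0" using C \<mu>0 M0 by (simp add: CC_def K_def)
  ultimately show ?thesis using that by blast
qed

end

section \<open>Compactness and traces\<close>

lemma complete_measurable_AE:
  assumes "complete_measure M" and f: "f \<in> borel_measurable M" and ae: "AE x in M. f x = g x"
  shows "g \<in> borel_measurable M"
proof (rule measurableI)
  interpret complete_measure M by fact
  fix A :: "'b set" assume A: "A \<in> sets borel"
  have "f -` A \<inter> space M \<in> sets M" using f A by (rule measurable_sets)
  moreover have "AE x in M. x \<in> f -` A \<inter> space M \<longleftrightarrow> x \<in> g -` A \<inter> space M"
    using ae by eventually_elim auto
  ultimately show "g -` A \<inter> space M \<in> sets M" by (intro in_sets_AE[of "f -` A \<inter> space M" "g -` A \<inter> space M"]) auto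
qed auto

lemma complete_measure_restrict:
  assumes "complete_measure M" "S \<in> sets M"
  shows "complete_measure (restrict_space M S)"
proof
  interpret complete_measure M by fact
  fix A B assume "B \<subseteq> A" "A \<in> null_sets (restrict_space M S)"
  then have "A \<in> null_sets M" "A \<subseteq> S" using assms by (auto simp: null_sets_restrict_space)
  then have "B \<in> sets M" "B \<subseteq> S" using complete2[OF \<open>B \<subseteq> A\<close>] \<open>B \<subseteq> A\<close> by auto
  then show "B \<in> sets (restrict_space M S)" using assms by (subst sets_restrict_space_iff) auto
qed

lemma complete_surface_measure: "complete_measure (surface_measure (\<Omega> :: 'a::euclidean_space set))"
  unfolding surface_measure_def
  by (intro complete_measure_restrict complete_measure_hausdorff subsetD[OF borel_sets_hausdorff])
     (simp add: borel_closed frontier_closed)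

lemma complete_lebesgue_on: "S \<in> sets lebesgue \<Longrightarrow> complete_measure (lebesgue_on S)"
  by (intro complete_measure_restrict completion.complete_measure_axioms)

lemma smooth_const: "smooth (\<lambda>_ :: 'a::euclidean_space. c)"
  unfolding smooth_def
  by (intro exI[of _ "\<lambda>bs x. if bs = [] then c else 0"]) auto

lemma ennreal_norm_square_add_le:
  fixes a b :: "'a::real_inner"
  shows "ennreal ((norm (a - b))\<^sup>2) \<le> 2 * ennreal ((norm a)\<^sup>2) + 2 * ennreal ((norm b)\<^sup>2)"
proof -
  have "ennreal ((norm (a - b))\<^sup>2) \<le> ennreal ((norm a + norm b)\<^sup>2)"
    by (intro ennreal_leI power_mono norm_triangle_ineq4) auto
  also have "\<dots> \<le> 2 * ennreal ((norm a)\<^sup>2) + 2 * ennreal ((norm b)\<^sup>2)" by (rule ennreal_square_add_le)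
  finally show ?thesis .
qed

lemma energy_diff_le:
  assumes "open \<Omega>" "smooth \<Phi>" "smooth \<Psi>"
  shows "energy \<Omega> (\<lambda>x. \<Phi> x - \<Psi> x) \<le> 2 * energy \<Omega> \<Phi> + 2 * energy \<Omega> \<Psi>"
proof -
  have [measurable]: "gradient \<Phi> \<in> borel_measurable borel" "gradient \<Psi> \<in> borel_measurable borel" "\<Omega> \<in> sets borel"
    using assms by (auto intro: smooth_measurable)
  have "energy \<Omega> (\<lambda>x. \<Phi> x - \<Psi> x) \<le> (\<integral>\<^sup>+x. 2 * (indicator \<Omega> x * ennreal ((norm (gradient \<Phi> x))\<^sup>2)) + 2 * (indicator \<Omega> x * ennreal ((norm (gradient \<Psi> x))\<^sup>2)) \<partial>lborel)"
    unfolding energy_def smooth_diff(2)[OF assms(2,3)]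
    by (intro nn_integral_mono) (auto simp: indicator_def ennreal_norm_square_add_le)
  also have "\<dots> = 2 * energy \<Omega> \<Phi> + 2 * energy \<Omega> \<Psi>"
    unfolding energy_def by (simp add: nn_integral_add nn_integral_cmult)
  finally show ?thesis .
qed

context lipschitz_domain
begin

text \<open>Diagonal argument: along a subsequence all functionals from countably many Ehrling
  inequalities converge, and the inequality with a small parameter makes the functions Cauchy in the
  volume and on the boundary together.\<close>

lemma compact_sequence:
  assumes \<Phi>: "\<And>k. smooth (\<Phi> k)" and B: "\<And>k. bulk \<Omega> (\<Phi> k) \<le> ennreal B" "\<And>k. energy \<Omega> (\<Phi> k) \<le> ennreal B" "B \<ge> 0"
  obtains s :: "nat \<Rightarrow> nat" where "strict_mono s"
    "\<And>\<epsilon>. \<epsilon> > 0 \<Longrightarrow> \<exists>N. \<forall>i\<ge>N. \<forall>j\<ge>N. (\<integral>\<^sup>+x. ennreal ((\<Phi> (s i) x - \<Phi> (s j) x)\<^sup>2) \<partial>m) \<le> ennreal \<epsilon>"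
proof -
  define EH where "EH n F K \<longleftrightarrow> finite F \<and> (\<forall>l\<in>F. admissible \<Omega> l) \<and> K \<ge> 0 \<and> (\<forall>\<Phi>. smooth \<Phi> \<longrightarrow>
     (\<integral>\<^sup>+x. ennreal ((\<Phi> x)\<^sup>2) \<partial>m) \<le> ennreal (1 / real (Suc n)) * energy \<Omega> \<Phi> + ennreal (K * (\<Sum>l\<in>F. (l \<Phi>)\<^sup>2)))"
    for n and F :: "(('a \<Rightarrow> real) \<Rightarrow> real) set" and K
  have "\<exists>F K. EH n F K" for n unfolding EH_def by (rule ehrling) simp
  then obtain F K where FK: "\<And>n. EH n (F n) (K n)" by metis
  define S where "S = (\<Union>n. F n)"
  have cS: "countable S" unfolding S_def using FK by (auto simp: EH_def intro: countable_finite)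
  have adm: "admissible \<Omega> l" if "l \<in> S" for l using that FK by (auto simp: S_def EH_def)
  have "\<exists>c>0. \<forall>k. \<bar>l (\<Phi> k)\<bar> \<le> c" if l: "l \<in> S" for l
  proof -
    obtain C where C: "C \<ge> 0" "\<And>\<Phi>. smooth \<Phi> \<Longrightarrow> ennreal ((l \<Phi>)\<^sup>2) \<le> ennreal C * bulk \<Omega> \<Phi>"
      using adm[OF l] by (auto simp: admissible_def)
    have "\<bar>l (\<Phi> k)\<bar> \<le> sqrt (C * B) + 1" for k
    proof -
      have "ennreal ((l (\<Phi> k))\<^sup>2) \<le> ennreal C * ennreal B"
        using C(2)[OF \<Phi>[of k]] B(1)[of k] by (meson mult_left_mono order.trans zero_le)
      also have "\<dots> = ennreal (C * B)" using C B by (simp add: ennreal_mult)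
      finally have "(l (\<Phi> k))\<^sup>2 \<le> C * B" using C B by simp
      then have "\<bar>l (\<Phi> k)\<bar> \<le> sqrt (C * B)" using real_sqrt_le_mono by fastforce
      then show ?thesis by simp
    qed
    moreover have "sqrt (C * B) + 1 > 0" using C B by (simp add: add_nonneg_pos)
    ultimately show ?thesis by blast
  qed
  then obtain c where c: "\<And>l. l \<in> S \<Longrightarrow> c l > 0" "\<And>l k. l \<in> S \<Longrightarrow> \<bar>l (\<Phi> k)\<bar> \<le> c l" by metis
  \<comment> \<open>Each functional is divided by its own bound, since the diagonal lemma asks for
    one bound for all of them.\<close>
  have "norm (l (\<Phi> k) / c l) \<le> 1" if "l \<in> S" for l k using c(1)[OF that] c(2)[OF that, of k] by simp
  then obtain s :: "nat \<Rightarrow> nat" where s: "strict_mono s" "\<And>l. l \<in> S \<Longrightarrow> \<exists>L. (\<lambda>n. l (\<Phi> (s n)) / c l) \<longlonglongrightarrow> L"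
    using function_convergent_subsequence[OF cS, of "\<lambda>k l. l (\<Phi> k) / c l" 1] by metis
  have cau: "Cauchy (\<lambda>n. l (\<Phi> (s n)))" if l: "l \<in> S" for l
  proof -
    obtain L where "(\<lambda>n. l (\<Phi> (s n)) / c l) \<longlonglongrightarrow> L" using s(2)[OF l] by blast
    from tendsto_mult_left[OF this, of "c l"] have "(\<lambda>n. l (\<Phi> (s n))) \<longlonglongrightarrow> c l * L"
      using c(1)[OF l] by simp
    then show ?thesis by (rule LIMSEQ_imp_Cauchy)
  qed
  show ?thesis
  proof (rule that[OF s(1)])
    fix \<epsilon> :: real assume \<epsilon>: "\<epsilon> > 0"
    \<comment> \<open>The energy of a difference is at most \<open>4 * B\<close>. The other half of
      \<open>\<epsilon>\<close> is reserved for the functionals and determines \<open>\<eta>\<close>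
      below.\<close>
    obtain n where n: "4 * B / real (Suc n) \<le> \<epsilon> / 2"
    proof -
      obtain n :: nat where "8 * B / \<epsilon> < real n" using reals_Archimedean2 by blast
      then have "4 * B \<le> \<epsilon> / 2 * real (Suc n)" using \<epsilon> by (simp add: field_simps)
      then have "4 * B / real (Suc n) \<le> \<epsilon> / 2" by (simp add: pos_divide_le_eq)
      then show ?thesis by (rule that)
    qed
    have EH: "finite (F n)" "K n \<ge> 0" "\<And>\<Phi>. smooth \<Phi> \<Longrightarrow>
     (\<integral>\<^sup>+x. ennreal ((\<Phi> x)\<^sup>2) \<partial>m) \<le> ennreal (1 / real (Suc n)) * energy \<Omega> \<Phi> + ennreal (K n * (\<Sum>l\<in>F n. (l \<Phi>)\<^sup>2))"
      using FK[of n] unfolding EH_def by blast+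
    have FS: "l \<in> S" if "l \<in> F n" for l using that by (auto simp: S_def)
    define Q where "Q = K n * real (card (F n)) + 1"
    have Q: "Q > 0" using EH(2) by (simp add: Q_def add_nonneg_pos)
    define \<eta> where "\<eta> = sqrt (\<epsilon> / 2 / Q)"
    have \<eta>: "\<eta> > 0" "\<eta>\<^sup>2 = \<epsilon> / 2 / Q" using \<epsilon> Q by (auto simp: \<eta>_def)
    have "\<exists>N. \<forall>i\<ge>N. \<forall>j\<ge>N. \<bar>l (\<Phi> (s i)) - l (\<Phi> (s j))\<bar> < \<eta>" if "l \<in> F n" for l
      using cau[OF FS[OF that]] \<eta>(1) unfolding Cauchy_def dist_real_def by blast
    then obtain N where N: "\<And>l i j. l \<in> F n \<Longrightarrow> i \<ge> N l \<Longrightarrow> j \<ge> N l \<Longrightarrow> \<bar>l (\<Phi> (s i)) - l (\<Phi> (s j))\<bar> < \<eta>" by metis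
    define N0 where "N0 = Max (insert 0 (N ` F n))"
    have N0: "N l \<le> N0" if "l \<in> F n" for l using that EH(1) unfolding N0_def by (intro Max_ge) auto
    show "\<exists>N. \<forall>i\<ge>N. \<forall>j\<ge>N. (\<integral>\<^sup>+x. ennreal ((\<Phi> (s i) x - \<Phi> (s j) x)\<^sup>2) \<partial>m) \<le> ennreal \<epsilon>"
    proof (intro exI[of _ N0] allI impI)
      fix i j assume ij: "N0 \<le> i" "N0 \<le> j"
      define \<Psi> where "\<Psi> x = \<Phi> (s i) x - \<Phi> (s j) x" for x
      have s\<Psi>: "smooth \<Psi>" unfolding \<Psi>_def by (intro smooth_diff \<Phi>)
      have l\<Psi>: "l \<Psi> = l (\<Phi> (s i)) - l (\<Phi> (s j))" if "l \<in> F n" for l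
      proof -
        have "l (\<lambda>x. \<Phi> (s i) x + (-1) * \<Phi> (s j) x) = l (\<Phi> (s i)) + (-1) * l (\<Phi> (s j))"
          using adm[OF FS[OF that]] \<Phi> unfolding admissible_def by blast
        then show ?thesis by (simp add: \<Psi>_def[abs_def])
      qed
      have "energy \<Omega> \<Psi> \<le> 2 * energy \<Omega> (\<Phi> (s i)) + 2 * energy \<Omega> (\<Phi> (s j))"
        unfolding \<Psi>_def by (rule energy_diff_le[OF open_\<Omega> \<Phi> \<Phi>])
      also have "\<dots> \<le> 2 * ennreal B + 2 * ennreal B" by (intro add_mono mult_left_mono B) auto
      also have "\<dots> = ennreal (4 * B)" using B(3) by (simp add: ennreal_mult distrib_right[symmetric])
      finally have e: "energy \<Omega> \<Psi> \<le> ennreal (4 * B)" .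
      have "(\<Sum>l\<in>F n. (l \<Psi>)\<^sup>2) \<le> (\<Sum>l\<in>F n. \<eta>\<^sup>2)"
      proof (rule sum_mono)
        fix l assume l: "l \<in> F n"
        have "\<bar>l \<Psi>\<bar> \<le> \<eta>" unfolding l\<Psi>[OF l] using N[OF l] N0[OF l] ij by (meson less_imp_le order.trans)
        then show "(l \<Psi>)\<^sup>2 \<le> \<eta>\<^sup>2" using power_mono[of "\<bar>l \<Psi>\<bar>" \<eta> 2] by simp
      qed
      then have "K n * (\<Sum>l\<in>F n. (l \<Psi>)\<^sup>2) \<le> K n * (real (card (F n)) * \<eta>\<^sup>2)"
        using EH(2) by (intro mult_left_mono) auto
      also have "\<dots> \<le> Q * \<eta>\<^sup>2" by (simp add: Q_def algebra_simps)
      also have "\<dots> = \<epsilon> / 2" using Q \<eta> by simp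
      finally have k: "K n * (\<Sum>l\<in>F n. (l \<Psi>)\<^sup>2) \<le> \<epsilon> / 2" .
      have "(\<integral>\<^sup>+x. ennreal ((\<Psi> x)\<^sup>2) \<partial>m) \<le> ennreal (1 / real (Suc n)) * energy \<Omega> \<Psi> + ennreal (K n * (\<Sum>l\<in>F n. (l \<Psi>)\<^sup>2))"
        by (rule EH(3)[OF s\<Psi>])
      also have "\<dots> \<le> ennreal (1 / real (Suc n)) * ennreal (4 * B) + ennreal (\<epsilon> / 2)"
        by (intro add_mono mult_left_mono e ennreal_leI k) auto
      also have "ennreal (1 / real (Suc n)) * ennreal (4 * B) = ennreal (4 * B / real (Suc n))"
        using B(3) by (simp add: ennreal_mult[symmetric] del: of_nat_Suc)
      also have "\<dots> + ennreal (\<epsilon> / 2) = ennreal (4 * B / real (Suc n) + \<epsilon> / 2)"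
        using B(3) \<epsilon> by (intro ennreal_plus[symmetric]) auto
      also have "\<dots> \<le> ennreal \<epsilon>" using n by (intro ennreal_leI) linarith
      finally show "(\<integral>\<^sup>+x. ennreal ((\<Phi> (s i) x - \<Phi> (s j) x)\<^sup>2) \<partial>m) \<le> ennreal \<epsilon>" by (simp add: \<Psi>_def)
    qed
  qed
qed

abbreviation "L \<equiv> lebesgue_on \<Omega>"
abbreviation "\<sigma> \<equiv> surface_measure \<Omega>"

lemma finite_L: "finite_measure L"
  using open_\<Omega> bounded_\<Omega> by (intro finite_measure_lebesgue_on bounded_set_imp_lmeasurable) auto

lemma nn_integral_L: "f \<in> borel_measurable borel \<Longrightarrow> (\<integral>\<^sup>+x. f x \<partial>L) = (\<integral>\<^sup>+x. indicator \<Omega> x * f x \<partial>lborel)"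
  using open_\<Omega> by (subst nn_integral_restrict_space) (auto simp: nn_integral_completion mult.commute)

lemma borel_measurable_L: "f \<in> borel_measurable borel \<Longrightarrow> f \<in> borel_measurable L"
  by (intro measurable_restrict_space1 measurable_completion) simp

lemma square_integrable_continuous:
  fixes w :: "'a \<Rightarrow> 'b::euclidean_space"
  assumes w: "continuous_on UNIV w"
  shows "square_integrable L w" "square_integrable \<sigma> w"
proof -
  have wm: "w \<in> borel_measurable borel" using w by (rule borel_measurable_continuous_onI)
  have "compact (w ` closure \<Omega>)" by (intro compact_continuous_image continuous_on_subset[OF w] compact_cl) auto
  then obtain B where B: "\<And>x. x \<in> closure \<Omega> \<Longrightarrow> norm (w x) \<le> B" by (meson compact_imp_bounded bounded_iff imageI)
  have *: "square_integrable M w" if "finite_measure M" "w \<in> borel_measurable M" "space M \<subseteq> closure \<Omega>" for M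
  proof -
    interpret finite_measure M by fact
    have "integrable M (\<lambda>x. (norm (w x))\<^sup>2)"
      by (rule integrable_const_bound[of _ "B\<^sup>2"]) (use that B in \<open>auto intro!: AE_I2 power_mono\<close>)
    then show ?thesis using that by (simp add: square_integrable_def)
  qed
  show "square_integrable L w"
    using closure_subset by (intro * finite_L borel_measurable_L wm) (auto simp: space_restrict_space)
  show "square_integrable \<sigma> w"
    by (intro * finite_surface borel_measurable_surface wm) (auto simp: space_surface_measure frontier_def)
qed

lemma smooth_square_integrable:
  assumes "smooth \<Phi>"
  shows "square_integrable L \<Phi>" "square_integrable L (gradient \<Phi>)" "square_integrable \<sigma> \<Phi>"
  using assms by (auto intro!: square_integrable_continuous smooth_continuous smooth_gradient_continuous)

lemma bulk_l2: "smooth \<Phi> \<Longrightarrow> bulk \<Omega> \<Phi> = ennreal ((l2_norm L \<Phi>)\<^sup>2)"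
  using nn_integral_l2_norm[OF smooth_square_integrable(1), of \<Phi>] smooth_measurable(1)[of \<Phi>]
  by (simp add: bulk_def nn_integral_L)

lemma energy_l2: "smooth \<Phi> \<Longrightarrow> energy \<Omega> \<Phi> = ennreal ((l2_norm L (gradient \<Phi>))\<^sup>2)"
  using nn_integral_l2_norm[OF smooth_square_integrable(2), of \<Phi>] smooth_measurable(2)[of \<Phi>]
  by (simp add: energy_def nn_integral_L)

lemma m_l2: "smooth \<Phi> \<Longrightarrow> (\<integral>\<^sup>+x. ennreal ((\<Phi> x)\<^sup>2) \<partial>m) = ennreal ((l2_norm L \<Phi>)\<^sup>2 + (l2_norm \<sigma> \<Phi>)\<^sup>2)"
  using nn_integral_l2_norm[OF smooth_square_integrable(3), of \<Phi>] smooth_measurable(1)[of \<Phi>]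
  by (simp add: nn_integral_domain_measure[OF open_\<Omega>] flip: bulk_def) (simp add: bulk_l2)

lemma l2_le_from_squares:
  assumes "ennreal (a\<^sup>2 + b\<^sup>2) \<le> ennreal C * (ennreal (x\<^sup>2) + ennreal (y\<^sup>2))" "C \<ge> 0" "a \<ge> 0" "b \<ge> 0" "x \<ge> 0" "y \<ge> 0"
  shows "a \<le> sqrt C * (x + y)" "b \<le> sqrt C * (x + y)"
proof -
  have "ennreal C * (ennreal (x\<^sup>2) + ennreal (y\<^sup>2)) = ennreal (C * (x\<^sup>2 + y\<^sup>2))"
    using assms by (simp add: ennreal_mult ennreal_plus)
  then have "ennreal (a\<^sup>2 + b\<^sup>2) \<le> ennreal (C * (x\<^sup>2 + y\<^sup>2))" using assms(1) by (simp only:)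
  then have *: "a\<^sup>2 + b\<^sup>2 \<le> C * (x\<^sup>2 + y\<^sup>2)" using assms by (subst (asm) ennreal_le_iff) auto
  also have "\<dots> \<le> C * (x + y)\<^sup>2" using assms by (intro mult_left_mono) (auto simp: power2_sum)
  also have "\<dots> = (sqrt C * (x + y))\<^sup>2" using assms by (simp add: power_mult_distrib)
  finally have **: "a\<^sup>2 + b\<^sup>2 \<le> (sqrt C * (x + y))\<^sup>2" .
  have nn: "0 \<le> sqrt C * (x + y)" using assms by simp
  have "a\<^sup>2 \<le> (sqrt C * (x + y))\<^sup>2" "b\<^sup>2 \<le> (sqrt C * (x + y))\<^sup>2" using ** zero_le_power2[of a] zero_le_power2[of b] by linarith+
  then show "a \<le> sqrt C * (x + y)" "b \<le> sqrt C * (x + y)" using nn by (auto intro: power2_le_imp_le)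
qed

lemma trace_inequality:
  obtains C where "C \<ge> 0" "\<And>\<Phi>. smooth \<Phi> \<Longrightarrow> l2_norm \<sigma> \<Phi> \<le> C * (l2_norm L (gradient \<Phi>) + l2_norm L \<Phi>)"
proof -
  define N where "N = restrict_space lborel \<Omega>"
  have Nint: "(\<integral>\<^sup>+x. f x \<partial>N) = (\<integral>\<^sup>+x. indicator \<Omega> x * f x \<partial>lborel)" for f
    unfolding N_def using open_\<Omega> by (subst nn_integral_restrict_space) (auto simp: mult.commute)
  have "emeasure N (space N) = emeasure lborel \<Omega>"
    using open_\<Omega> by (simp add: N_def space_restrict_space emeasure_restrict_space)
  moreover have "\<Omega> \<notin> null_sets lborel" using open_not_negligible[OF open_\<Omega> nonempty_\<Omega>]
    by (auto simp: negligible_iff_null_sets dest: null_sets_completionI)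
  ultimately have "emeasure N (space N) > 0" using open_\<Omega> by (auto simp: null_sets_def zero_less_iff_neq_zero)
  moreover have "f \<in> borel_measurable N" if "f \<in> borel_measurable borel" for f :: "'a \<Rightarrow> ennreal"
    unfolding N_def using that by (intro measurable_restrict_space1) simp
  moreover have "(\<integral>\<^sup>+x. f x \<partial>N) \<le> (\<integral>\<^sup>+x. f x \<partial>m)" if "f \<in> borel_measurable borel" for f
    unfolding Nint using that by (simp add: nn_integral_domain_measure[OF open_\<Omega>])
  ultimately obtain C where C: "C \<ge> 0" "\<And>\<Phi>. smooth \<Phi> \<Longrightarrow>
     (\<integral>\<^sup>+x. ennreal ((\<Phi> x)\<^sup>2) \<partial>m) \<le> ennreal C * (energy \<Omega> \<Phi> + (\<integral>\<^sup>+x. ennreal ((\<Phi> x)\<^sup>2) \<partial>N))"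
    using poincare_part[of N] by metis
  show ?thesis
  proof (rule that)
    fix \<Phi> :: "'a \<Rightarrow> real" assume \<Phi>: "smooth \<Phi>"
    have "ennreal ((l2_norm L \<Phi>)\<^sup>2 + (l2_norm \<sigma> \<Phi>)\<^sup>2) \<le> ennreal C * (ennreal ((l2_norm L (gradient \<Phi>))\<^sup>2) + ennreal ((l2_norm L \<Phi>)\<^sup>2))"
      using C(2)[OF \<Phi>] unfolding Nint bulk_def[symmetric] m_l2[OF \<Phi>] energy_l2[OF \<Phi>] bulk_l2[OF \<Phi>] .
    then show "l2_norm \<sigma> \<Phi> \<le> sqrt C * (l2_norm L (gradient \<Phi>) + l2_norm L \<Phi>)"
      by (rule l2_le_from_squares(2)) (use C in auto)
  qed (use C in simp)
qed

lemma friedrichs_inequality: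
  assumes G: "G1 \<in> sets \<sigma>" "emeasure \<sigma> G1 > 0"
  obtains C where "C \<ge> 0" "\<And>\<Phi>. smooth \<Phi> \<Longrightarrow> l2_norm L \<Phi> \<le> C * (l2_norm L (gradient \<Phi>) + l2_norm (restrict_space \<sigma> G1) \<Phi>)"
    "\<And>\<Phi>. smooth \<Phi> \<Longrightarrow> l2_norm \<sigma> \<Phi> \<le> C * (l2_norm L (gradient \<Phi>) + l2_norm (restrict_space \<sigma> G1) \<Phi>)"
proof -
  define N where "N = restrict_space \<sigma> G1"
  have "emeasure N (space N) = emeasure \<sigma> G1"
    using G sets.sets_into_space[OF G(1)] by (simp add: N_def space_restrict_space emeasure_restrict_space Int_absorb2)
  then have "emeasure N (space N) > 0" using G by simp
  moreover have meas: "f \<in> borel_measurable N" if "f \<in> borel_measurable borel" for f :: "'a \<Rightarrow> ennreal"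
    unfolding N_def using that by (intro measurable_restrict_space1 borel_measurable_surface)
  moreover have "(\<integral>\<^sup>+x. f x \<partial>N) \<le> (\<integral>\<^sup>+x. f x \<partial>m)" if "f \<in> borel_measurable borel" for f
  proof -
    have "(\<integral>\<^sup>+x. f x \<partial>N) \<le> (\<integral>\<^sup>+x. f x \<partial>\<sigma>)"
      unfolding N_def using G by (subst nn_integral_restrict_space) (auto intro!: nn_integral_mono simp: indicator_def)
    also have "\<dots> \<le> (\<integral>\<^sup>+x. f x \<partial>m)" using that by (simp add: nn_integral_domain_measure[OF open_\<Omega>])
    finally show ?thesis .
  qed
  ultimately obtain C where C: "C \<ge> 0" "\<And>\<Phi>. smooth \<Phi> \<Longrightarrow>
     (\<integral>\<^sup>+x. ennreal ((\<Phi> x)\<^sup>2) \<partial>m) \<le> ennreal C * (energy \<Omega> \<Phi> + (\<integral>\<^sup>+x. ennreal ((\<Phi> x)\<^sup>2) \<partial>N))"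
    using poincare_part[of N] by metis
  have *: "ennreal ((l2_norm L \<Phi>)\<^sup>2 + (l2_norm \<sigma> \<Phi>)\<^sup>2) \<le> ennreal C * (ennreal ((l2_norm L (gradient \<Phi>))\<^sup>2) + ennreal ((l2_norm N \<Phi>)\<^sup>2))"
    if \<Phi>: "smooth \<Phi>" for \<Phi>
  proof -
    have "square_integrable N \<Phi>" unfolding N_def
      by (rule square_integrable_restrict[OF smooth_square_integrable(3)[OF \<Phi>] G(1)])
    from nn_integral_l2_norm[OF this] show ?thesis
      using C(2)[OF \<Phi>] unfolding m_l2[OF \<Phi>] energy_l2[OF \<Phi>] by simp
  qed
  show ?thesis
    by (rule that[of "sqrt C"]; (unfold N_def[symmetric])?; (rule l2_le_from_squares[OF *])?) (use C in auto)
qed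

lemma compact_sequence_l2:
  assumes \<Phi>: "\<And>k. smooth (\<Phi> k)" and B: "\<And>k. l2_norm L (\<Phi> k) \<le> B" "\<And>k. l2_norm L (gradient (\<Phi> k)) \<le> B"
  obtains s :: "nat \<Rightarrow> nat" where "strict_mono s"
    "\<And>\<epsilon>. \<epsilon> > 0 \<Longrightarrow> \<exists>N. \<forall>i\<ge>N. \<forall>j\<ge>N. l2_norm \<sigma> (\<lambda>x. \<Phi> (s i) x - \<Phi> (s j) x) \<le> \<epsilon>"
proof -
  have bd: "bulk \<Omega> (\<Phi> k) \<le> ennreal (B\<^sup>2)" "energy \<Omega> (\<Phi> k) \<le> ennreal (B\<^sup>2)" for k
    unfolding bulk_l2[OF \<Phi>] energy_l2[OF \<Phi>] by (intro ennreal_leI power_mono B l2_norm_nonneg)+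
  obtain s :: "nat \<Rightarrow> nat" where s: "strict_mono s"
    "\<And>\<epsilon>. \<epsilon> > 0 \<Longrightarrow> \<exists>N. \<forall>i\<ge>N. \<forall>j\<ge>N. (\<integral>\<^sup>+x. ennreal ((\<Phi> (s i) x - \<Phi> (s j) x)\<^sup>2) \<partial>m) \<le> ennreal \<epsilon>"
    by (rule compact_sequence[where \<Phi> = \<Phi> and B = "B\<^sup>2"]) (use \<Phi> bd in auto)
  show ?thesis
  proof (rule that[OF s(1)])
    fix \<epsilon> :: real assume \<epsilon>: "\<epsilon> > 0"
    then obtain N where N: "\<forall>i\<ge>N. \<forall>j\<ge>N. (\<integral>\<^sup>+x. ennreal ((\<Phi> (s i) x - \<Phi> (s j) x)\<^sup>2) \<partial>m) \<le> ennreal (\<epsilon>\<^sup>2)"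
      using s(2)[of "\<epsilon>\<^sup>2"] by auto
    have "l2_norm \<sigma> (\<lambda>x. \<Phi> (s i) x - \<Phi> (s j) x) \<le> \<epsilon>" if ij: "i \<ge> N" "j \<ge> N" for i j
    proof -
      have "ennreal ((l2_norm L (\<lambda>x. \<Phi> (s i) x - \<Phi> (s j) x))\<^sup>2 + (l2_norm \<sigma> (\<lambda>x. \<Phi> (s i) x - \<Phi> (s j) x))\<^sup>2) \<le> ennreal (\<epsilon>\<^sup>2)"
        using N[rule_format, OF ij] unfolding m_l2[OF smooth_diff(1)[OF \<Phi> \<Phi>]] .
      then have "(l2_norm L (\<lambda>x. \<Phi> (s i) x - \<Phi> (s j) x))\<^sup>2 + (l2_norm \<sigma> (\<lambda>x. \<Phi> (s i) x - \<Phi> (s j) x))\<^sup>2 \<le> \<epsilon>\<^sup>2"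
        by (subst (asm) ennreal_le_iff) auto
      then have "(l2_norm \<sigma> (\<lambda>x. \<Phi> (s i) x - \<Phi> (s j) x))\<^sup>2 \<le> \<epsilon>\<^sup>2"
        using zero_le_power2[of "l2_norm L (\<lambda>x. \<Phi> (s i) x - \<Phi> (s j) x)"] by linarith
      then show ?thesis by (rule power2_le_imp_le) (use \<epsilon> in simp)
    qed
    then show "\<exists>N. \<forall>i\<ge>N. \<forall>j\<ge>N. l2_norm \<sigma> (\<lambda>x. \<Phi> (s i) x - \<Phi> (s j) x) \<le> \<epsilon>"
      by (intro exI[of _ N] allI impI)
  qed
qed

text \<open>\<open>approx \<Phi> u G g\<close>: a sequence of smooth functions that converges to \<open>u\<close>, with gradients converging to
  \<open>G\<close> and boundary values to \<open>g\<close>; it yields the weak gradient and the trace simultaneously.\<close>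

definition approx :: "(nat \<Rightarrow> 'a \<Rightarrow> real) \<Rightarrow> ('a \<Rightarrow> real) \<Rightarrow> ('a \<Rightarrow> 'a) \<Rightarrow> ('a \<Rightarrow> real) \<Rightarrow> bool" where
  "approx \<Phi> u G g \<longleftrightarrow> (\<forall>n. smooth (\<Phi> n)) \<and>
     square_integrable L u \<and> square_integrable L G \<and> square_integrable \<sigma> g \<and>
     (\<lambda>n. l2_norm L (\<lambda>x. \<Phi> n x - u x)) \<longlonglongrightarrow> 0 \<and>
     (\<lambda>n. l2_norm L (\<lambda>x. gradient (\<Phi> n) x - G x)) \<longlonglongrightarrow> 0 \<and>
     (\<lambda>n. l2_norm \<sigma> (\<lambda>x. \<Phi> n x - g x)) \<longlonglongrightarrow> 0"

lemma approxD:
  assumes "approx \<Phi> u G g"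
  shows "smooth (\<Phi> n)" "square_integrable L u" "square_integrable L G" "square_integrable \<sigma> g"
     "(\<lambda>n. l2_norm L (\<lambda>x. \<Phi> n x - u x)) \<longlonglongrightarrow> 0"
     "(\<lambda>n. l2_norm L (\<lambda>x. gradient (\<Phi> n) x - G x)) \<longlonglongrightarrow> 0"
     "(\<lambda>n. l2_norm \<sigma> (\<lambda>x. \<Phi> n x - g x)) \<longlonglongrightarrow> 0"
  using assms by (auto simp: approx_def)

lemma approx_has_weak_gradient:
  assumes "approx \<Phi> u G g"
  shows "has_weak_gradient \<Omega> u G"
proof (rule has_weak_gradient_limit[OF open_\<Omega> bounded_\<Omega>])
  note a = approxD[OF assms]
  show "has_weak_gradient \<Omega> (\<Phi> n) (gradient (\<Phi> n))" for n by (rule has_weak_gradient_smooth[OF open_\<Omega> a(1)])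
  show "square_integrable L (\<Phi> n)" "square_integrable L (gradient (\<Phi> n))" for n
    by (rule smooth_square_integrable[OF a(1)])+
qed (rule approxD[OF assms])+

text \<open>The choice in \<open>weak_gradient\<close> promises local integrability only; square
  integrability is inherited from \<open>G\<close> by uniqueness.\<close>

lemma has_weak_gradient_someI:
  assumes "has_weak_gradient \<Omega> u G" "square_integrable L G"
  shows "has_weak_gradient \<Omega> u (weak_gradient \<Omega> u)" "AE x in L. weak_gradient \<Omega> u x = G x"
    "square_integrable L (weak_gradient \<Omega> u)"
proof -
  show 1: "has_weak_gradient \<Omega> u (weak_gradient \<Omega> u)"
    unfolding weak_gradient_def by (rule someI[of _ G]) (rule assms)
  have 2: "AE x in L. G x = weak_gradient \<Omega> u x" by (rule weak_gradient_unique[OF open_\<Omega> assms(1) 1])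
  then show "AE x in L. weak_gradient \<Omega> u x = G x" by eventually_elim simp
  have "complete_measure L" using open_\<Omega> by (intro complete_lebesgue_on) auto
  then have "weak_gradient \<Omega> u \<in> borel_measurable L"
    using complete_measurable_AE[OF _ square_integrable_measurable[OF assms(2)] 2] by blast
  then show "square_integrable L (weak_gradient \<Omega> u)" by (rule square_integrable_cong_AE[OF assms(2) _ 2])
qed

text \<open>\<open>H1_norm\<close> hides a new choice of gradient for each difference; with the
  difference of the given gradients in its place, limits can be taken.\<close>

lemma H1_norm_smooth_diff:
  assumes \<Phi>: "smooth \<Phi>" and u: "has_weak_gradient \<Omega> u G" "square_integrable L G"
  shows "H1_norm \<Omega> (\<lambda>x. \<Phi> x - u x) = sqrt ((l2_norm L (\<lambda>x. \<Phi> x - u x))\<^sup>2 + (l2_norm L (\<lambda>x. gradient \<Phi> x - G x))\<^sup>2)"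
proof -
  have wg: "has_weak_gradient \<Omega> (\<lambda>x. \<Phi> x - u x) (\<lambda>x. gradient \<Phi> x - G x)"
    using has_weak_gradient_lincomb[OF open_\<Omega> has_weak_gradient_smooth[OF open_\<Omega> \<Phi>] u(1), of "-1"] by simp
  have sq: "square_integrable L (\<lambda>x. gradient \<Phi> x - G x)"
    by (rule square_integrable_diff[OF smooth_square_integrable(2)[OF \<Phi>] u(2)])
  note w = has_weak_gradient_someI[OF wg sq]
  have "l2_norm L (weak_gradient \<Omega> (\<lambda>x. \<Phi> x - u x)) = l2_norm L (\<lambda>x. gradient \<Phi> x - G x)"
    by (rule l2_norm_cong_AE[OF square_integrable_measurable[OF w(3)] square_integrable_measurable[OF sq] w(2)])
  then show ?thesis by (simp add: H1_norm_def)
qed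

lemma approx_H1:
  assumes "approx \<Phi> u G g"
  shows "u \<in> H1 \<Omega>" "has_trace \<Omega> u g" "AE x in L. weak_gradient \<Omega> u x = G x" "square_integrable L (weak_gradient \<Omega> u)"
proof -
  note a = approxD[OF assms] and wg = approx_has_weak_gradient[OF assms]
  show "u \<in> H1 \<Omega>" unfolding H1_def using a wg by blast
  show "AE x in L. weak_gradient \<Omega> u x = G x" "square_integrable L (weak_gradient \<Omega> u)"
    by (rule has_weak_gradient_someI[OF wg a(3)])+
  have "(\<lambda>n. sqrt ((l2_norm L (\<lambda>x. \<Phi> n x - u x))\<^sup>2 + (l2_norm L (\<lambda>x. gradient (\<Phi> n) x - G x))\<^sup>2)) \<longlonglongrightarrow> sqrt (0\<^sup>2 + 0\<^sup>2)"
    by (intro tendsto_intros a)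
  then have "(\<lambda>n. H1_norm \<Omega> (\<lambda>x. \<Phi> n x - u x)) \<longlonglongrightarrow> 0"
    by (simp add: H1_norm_smooth_diff[OF a(1) wg a(3)])
  then show "has_trace \<Omega> u g" unfolding has_trace_def using a by blast
qed

lemma has_trace_approx:
  assumes u: "u \<in> H1 \<Omega>" and g: "has_trace \<Omega> u g"
  shows "\<exists>\<Phi>. approx \<Phi> u (weak_gradient \<Omega> u) g"
proof -
  obtain G where "has_weak_gradient \<Omega> u G" "square_integrable L G" "square_integrable L u" using u by (auto simp: H1_def)
  note w = has_weak_gradient_someI[OF this(1,2)] this(3)
  obtain \<Phi> where \<Phi>: "\<And>n. smooth (\<Phi> n)" "(\<lambda>n. H1_norm \<Omega> (\<lambda>x. \<Phi> n x - u x)) \<longlonglongrightarrow> 0"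
    "(\<lambda>n. l2_norm \<sigma> (\<lambda>x. \<Phi> n x - g x)) \<longlonglongrightarrow> 0" and sg: "square_integrable \<sigma> g"
    using g by (auto simp: has_trace_def)
  note H = H1_norm_smooth_diff[OF \<Phi>(1) w(1,3)]
  have "(\<lambda>n. l2_norm L (\<lambda>x. \<Phi> n x - u x)) \<longlonglongrightarrow> 0"
    by (rule tendsto_sandwich[OF _ _ tendsto_const \<Phi>(2)]) (auto simp: H intro!: always_eventually real_le_rsqrt)
  moreover have "(\<lambda>n. l2_norm L (\<lambda>x. gradient (\<Phi> n) x - weak_gradient \<Omega> u x)) \<longlonglongrightarrow> 0"
    by (rule tendsto_sandwich[OF _ _ tendsto_const \<Phi>(2)]) (auto simp: H intro!: always_eventually real_le_rsqrt)
  ultimately show ?thesis unfolding approx_def using \<Phi> w sg by blast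
qed

lemma approx_lincomb:
  assumes "approx \<Phi> u G g" "approx \<Psi> v H h"
  shows "approx (\<lambda>n x. \<Phi> n x + c * \<Psi> n x) (\<lambda>x. u x + c * v x) (\<lambda>x. G x + c *\<^sub>R H x) (\<lambda>x. g x + c * h x)"
proof -
  note a = approxD[OF assms(1)] and b = approxD[OF assms(2)]
  have gen: "(\<lambda>n. l2_norm M (\<lambda>x. (P n x + c *\<^sub>R Q n x) - (p x + c *\<^sub>R q x))) \<longlonglongrightarrow> 0"
    if P: "\<And>n. square_integrable M (P n)" "square_integrable M p" "(\<lambda>n. l2_norm M (\<lambda>x. P n x - p x)) \<longlonglongrightarrow> 0"
     and Q: "\<And>n. square_integrable M (Q n)" "square_integrable M q" "(\<lambda>n. l2_norm M (\<lambda>x. Q n x - q x)) \<longlonglongrightarrow> 0"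
    for M :: "'a measure" and P Q :: "nat \<Rightarrow> 'a \<Rightarrow> 'c::euclidean_space" and p q
  proof (rule tendsto_sandwich[OF _ _ tendsto_const])
    show "(\<lambda>n. l2_norm M (\<lambda>x. P n x - p x) + \<bar>c\<bar> * l2_norm M (\<lambda>x. Q n x - q x)) \<longlonglongrightarrow> 0"
      using tendsto_add[OF P(3) tendsto_mult_left[OF Q(3), of "\<bar>c\<bar>"]] by simp
    have "l2_norm M (\<lambda>x. (P n x + c *\<^sub>R Q n x) - (p x + c *\<^sub>R q x)) \<le> l2_norm M (\<lambda>x. P n x - p x) + \<bar>c\<bar> * l2_norm M (\<lambda>x. Q n x - q x)" for n
    proof -
      have "(\<lambda>x. (P n x + c *\<^sub>R Q n x) - (p x + c *\<^sub>R q x)) = (\<lambda>x. (P n x - p x) + c *\<^sub>R (Q n x - q x))"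
        by (auto simp: algebra_simps)
      then show ?thesis
        using l2_norm_triangle[OF square_integrable_diff[OF P(1)[of n] P(2)] square_integrable_scaleR[OF square_integrable_diff[OF Q(1)[of n] Q(2)], of c]]
        by (simp add: l2_norm_scaleR)
    qed
    then show "\<forall>\<^sub>F n in sequentially. l2_norm M (\<lambda>x. (P n x + c *\<^sub>R Q n x) - (p x + c *\<^sub>R q x)) \<le> l2_norm M (\<lambda>x. P n x - p x) + \<bar>c\<bar> * l2_norm M (\<lambda>x. Q n x - q x)"
      by simp
  qed simp
  note sa = smooth_square_integrable[OF a(1)] and sb = smooth_square_integrable[OF b(1)]
  show ?thesis
    unfolding approx_def
    using gen[OF sa(1) a(2,5) sb(1) b(2,5)] gen[OF sa(2) a(3,6) sb(2) b(3,6)] gen[OF sa(3) a(4,7) sb(3) b(4,7)]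
      smooth_lincomb[OF a(1) b(1)] gradient_lincomb[OF a(1) b(1)]
      square_integrable_add[OF a(2) square_integrable_cmult[OF b(2)]]
      square_integrable_add[OF a(3) square_integrable_scaleR[OF b(3)]]
      square_integrable_add[OF a(4) square_integrable_cmult[OF b(4)]]
    by simp
qed

lemma approx_norms:
  assumes "approx \<Phi> u G g"
  shows "(\<lambda>n. l2_norm L (\<Phi> n)) \<longlonglongrightarrow> l2_norm L u" "(\<lambda>n. l2_norm L (gradient (\<Phi> n))) \<longlonglongrightarrow> l2_norm L G"
    "(\<lambda>n. l2_norm \<sigma> (\<Phi> n)) \<longlonglongrightarrow> l2_norm \<sigma> g"
  using approxD[OF assms] smooth_square_integrable[OF approxD(1)[OF assms]] by (auto intro: l2_norm_tendsto)

text \<open>The difference of the two sequences tends to 0 together with its gradients, and the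
  trace inequality forces the boundary values to do the same. Hence the choice in
  \<open>boundary_trace\<close> is immaterial.\<close>

lemma approx_trace_unique:
  assumes "approx \<Phi> u G g" "approx \<Psi> u H h"
  shows "AE x in \<sigma>. g x = h x"
proof -
  obtain C where C: "C \<ge> 0" "\<And>\<Phi>. smooth \<Phi> \<Longrightarrow> l2_norm \<sigma> \<Phi> \<le> C * (l2_norm L (gradient \<Phi>) + l2_norm L \<Phi>)"
    using trace_inequality by blast
  define \<Theta> where "\<Theta> n x = \<Phi> n x + (-1) * \<Psi> n x" for n x
  have a: "approx \<Theta> (\<lambda>x. u x + (-1) * u x) (\<lambda>x. G x + (-1) *\<^sub>R H x) (\<lambda>x. g x + (-1) * h x)"
    unfolding \<Theta>_def[abs_def] by (rule approx_lincomb[OF assms])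
  have "AE x in L. G x = H x"
    by (rule weak_gradient_unique[OF open_\<Omega> approx_has_weak_gradient[OF assms(1)] approx_has_weak_gradient[OF assms(2)]])
  then have "AE x in L. G x + (-1) *\<^sub>R H x = 0" by eventually_elim simp
  then have "l2_norm L (\<lambda>x. G x + (-1) *\<^sub>R H x) = l2_norm L (\<lambda>x. 0 :: 'a)"
    by (intro l2_norm_cong_AE square_integrable_measurable[OF approxD(3)[OF a]]) auto
  then have G0: "l2_norm L (\<lambda>x. G x + (-1) *\<^sub>R H x) = 0" by simp
  note n = approx_norms[OF a]
  have "l2_norm \<sigma> (\<lambda>x. g x + (-1) * h x) \<le> C * (l2_norm L (\<lambda>x. G x + (-1) *\<^sub>R H x) + l2_norm L (\<lambda>x. u x + (-1) * u x))"
    using C(2)[OF approxD(1)[OF a]] by (intro LIMSEQ_le[OF n(3) tendsto_mult_left[OF tendsto_add[OF n(2) n(1)]]]) auto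
  also have "\<dots> = 0" unfolding G0 by simp
  finally have "l2_norm \<sigma> (\<lambda>x. g x + (-1) * h x) = 0" by (simp add: antisym)
  from l2_norm_eq_0[OF approxD(4)[OF a] this] show ?thesis by simp
qed

definition near :: "('a \<Rightarrow> real) \<Rightarrow> ('a \<Rightarrow> real) \<Rightarrow> ('a \<Rightarrow> 'a) \<Rightarrow> ('a \<Rightarrow> real) \<Rightarrow> real \<Rightarrow> bool" where
  "near \<Phi> u G g \<epsilon> \<longleftrightarrow> smooth \<Phi> \<and> l2_norm L (\<lambda>x. \<Phi> x - u x) < \<epsilon> \<and>
     l2_norm L (\<lambda>x. gradient \<Phi> x - G x) < \<epsilon> \<and> l2_norm \<sigma> (\<lambda>x. \<Phi> x - g x) < \<epsilon>"

lemma approx_near: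
  assumes "approx \<Phi> u G g" "\<epsilon> > 0"
  shows "\<exists>\<Psi>. near \<Psi> u G g \<epsilon>"
proof -
  note a = approxD[OF assms(1)] and p = assms(2)
  have "\<forall>\<^sub>F n in sequentially. near (\<Phi> n) u G g \<epsilon>"
    unfolding near_def
    by (intro eventually_conj order_tendstoD(2)[OF a(5) p] order_tendstoD(2)[OF a(6) p] order_tendstoD(2)[OF a(7) p] always_eventually allI a(1))
  then show ?thesis using eventually_happens'[OF sequentially_bot] by blast
qed

text \<open>A diagonal sequence: \<open>\<Psi> k\<close> is taken within \<open>1 / (k + 1)\<close>
  of the triple with index \<open>k\<close>.\<close>

lemma approx_closed:
  assumes a: "\<And>k. approx (\<Phi> k) (u k) (G k) (g k)"
    and u: "square_integrable L u'" "(\<lambda>k. l2_norm L (\<lambda>x. u k x - u' x)) \<longlonglongrightarrow> 0"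
    and G: "square_integrable L G'" "(\<lambda>k. l2_norm L (\<lambda>x. G k x - G' x)) \<longlonglongrightarrow> 0"
    and g: "square_integrable \<sigma> g'" "(\<lambda>k. l2_norm \<sigma> (\<lambda>x. g k x - g' x)) \<longlonglongrightarrow> 0"
  shows "\<exists>\<Psi>. approx \<Psi> u' G' g'"
proof -
  have "\<exists>\<Psi>. near \<Psi> (u k) (G k) (g k) (inverse (real (Suc k)))" for k
    by (rule approx_near[OF a]) simp
  then obtain \<Psi> where near: "\<And>k. near (\<Psi> k) (u k) (G k) (g k) (inverse (real (Suc k)))" by metis
  have n: "smooth (\<Psi> k)" "l2_norm L (\<lambda>x. \<Psi> k x - u k x) < inverse (real (Suc k))"
    "l2_norm L (\<lambda>x. gradient (\<Psi> k) x - G k x) < inverse (real (Suc k))"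
    "l2_norm \<sigma> (\<lambda>x. \<Psi> k x - g k x) < inverse (real (Suc k))" for k
    using near[of k] unfolding near_def by blast+
  have gen: "(\<lambda>k. l2_norm M (\<lambda>x. P k x - q x)) \<longlonglongrightarrow> 0"
    if P: "\<And>k. square_integrable M (P k)" "\<And>k. square_integrable M (Q k)" "square_integrable M q"
     and le: "\<And>k. l2_norm M (\<lambda>x. P k x - Q k x) < inverse (real (Suc k))" and lim: "(\<lambda>k. l2_norm M (\<lambda>x. Q k x - q x)) \<longlonglongrightarrow> 0"
    for M :: "'a measure" and P Q :: "nat \<Rightarrow> 'a \<Rightarrow> 'c::euclidean_space" and q
  proof (rule tendsto_sandwich[OF _ _ tendsto_const])
    show "(\<lambda>k. inverse (real (Suc k)) + l2_norm M (\<lambda>x. Q k x - q x)) \<longlonglongrightarrow> 0"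
      using tendsto_add[OF LIMSEQ_inverse_real_of_nat lim] by simp
    have "l2_norm M (\<lambda>x. P k x - q x) \<le> inverse (real (Suc k)) + l2_norm M (\<lambda>x. Q k x - q x)" for k
      using l2_norm_triangle_diff[OF P(1)[of k] P(2)[of k] P(3)] le[of k] by linarith
    then show "\<forall>\<^sub>F k in sequentially. l2_norm M (\<lambda>x. P k x - q x) \<le> inverse (real (Suc k)) + l2_norm M (\<lambda>x. Q k x - q x)"
      by simp
  qed simp
  note s = approxD[OF a] and ss = smooth_square_integrable[OF n(1)]
  show ?thesis
    unfolding approx_def
    by (intro exI[of _ \<Psi>] conjI allI n(1) u(1) G(1) g(1) gen[OF ss(1) s(2) u(1) n(2) u(2)]
        gen[OF ss(2) s(3) G(1) n(3) G(2)] gen[OF ss(3) s(4) g(1) n(4) g(2)])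
qed

end

section \<open>The space \<open>V0\<close>: norm equivalence, completeness and compactness of
  traces\<close>

locale mixed_domain = lipschitz_domain +
  fixes \<Gamma>\<^sub>1 assumes \<Gamma>\<^sub>1: "\<Gamma>\<^sub>1 \<in> sets (surface_measure \<Omega>)" "emeasure (surface_measure \<Omega>) \<Gamma>\<^sub>1 > 0"
begin

abbreviation "V \<equiv> V0 \<Omega> \<Gamma>\<^sub>1"
abbreviation "D \<equiv> weak_gradient \<Omega>"
abbreviation "T \<equiv> boundary_trace \<Omega>"

lemma AE_restrict: "(AE x in restrict_space \<sigma> \<Gamma>\<^sub>1. P x) \<longleftrightarrow> (AE x in \<sigma>. x \<in> \<Gamma>\<^sub>1 \<longrightarrow> P x)"
  using \<Gamma>\<^sub>1 by (subst AE_restrict_space_iff) auto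

text \<open>\<open>V0\<close> asks for some trace that vanishes on \<open>\<Gamma>\<^sub>1\<close>;
  by uniqueness the chosen trace \<open>T v\<close> vanishes there as well.\<close>

lemma V0_approx:
  assumes "v \<in> V"
  obtains \<Phi> where "approx \<Phi> v (D v) (T v)" "AE x in \<sigma>. x \<in> \<Gamma>\<^sub>1 \<longrightarrow> T v x = 0"
proof -
  obtain g where g: "v \<in> H1 \<Omega>" "has_trace \<Omega> v g" "AE x in \<sigma>. x \<in> \<Gamma>\<^sub>1 \<longrightarrow> g x = 0"
    using assms AE_restrict unfolding V0_def by auto
  have t: "has_trace \<Omega> v (T v)" unfolding boundary_trace_def using g(2) by (rule someI[where P = "has_trace \<Omega> v"])
  obtain \<Phi> where \<Phi>: "approx \<Phi> v (D v) (T v)" using has_trace_approx[OF g(1) t] by blast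
  obtain \<Psi> where \<Psi>: "approx \<Psi> v (D v) g" using has_trace_approx[OF g(1,2)] by blast
  have "AE x in \<sigma>. x \<in> \<Gamma>\<^sub>1 \<longrightarrow> T v x = 0"
    using approx_trace_unique[OF \<Phi> \<Psi>] g(3) by eventually_elim simp
  with \<Phi> show ?thesis by (rule that)
qed

lemma approx_V0:
  assumes a: "approx \<Phi> u G g" and z: "AE x in \<sigma>. x \<in> \<Gamma>\<^sub>1 \<longrightarrow> g x = 0"
  shows "u \<in> V" "AE x in L. D u x = G x" "AE x in \<sigma>. T u x = g x"
proof -
  note h = approx_H1[OF a]
  show V: "u \<in> V" unfolding V0_def using h(1,2) z AE_restrict by blast
  show "AE x in L. D u x = G x" by (rule h)
  obtain \<Psi> where \<Psi>: "approx \<Psi> u (D u) (T u)" using V0_approx[OF V] by blast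
  show "AE x in \<sigma>. T u x = g x" by (rule approx_trace_unique[OF \<Psi> a])
qed

lemma V0_square_integrable:
  assumes "v \<in> V" shows "square_integrable L v" "square_integrable L (D v)" "square_integrable \<sigma> (T v)"
  using V0_approx[OF assms] approxD by metis+

lemma V0_lincomb:
  assumes "u \<in> V" "v \<in> V"
  shows "(\<lambda>x. u x + c * v x) \<in> V" "AE x in L. D (\<lambda>x. u x + c * v x) x = D u x + c *\<^sub>R D v x"
    "AE x in \<sigma>. T (\<lambda>x. u x + c * v x) x = T u x + c * T v x"
proof -
  obtain \<Phi> where \<Phi>: "approx \<Phi> u (D u) (T u)" "AE x in \<sigma>. x \<in> \<Gamma>\<^sub>1 \<longrightarrow> T u x = 0" using V0_approx[OF assms(1)] by blast
  obtain \<Psi> where \<Psi>: "approx \<Psi> v (D v) (T v)" "AE x in \<sigma>. x \<in> \<Gamma>\<^sub>1 \<longrightarrow> T v x = 0" using V0_approx[OF assms(2)] by blast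
  have z: "AE x in \<sigma>. x \<in> \<Gamma>\<^sub>1 \<longrightarrow> T u x + c * T v x = 0" using \<Phi>(2) \<Psi>(2) by eventually_elim simp
  from approx_V0[OF approx_lincomb[OF \<Phi>(1) \<Psi>(1)] z]
  show "(\<lambda>x. u x + c * v x) \<in> V" "AE x in L. D (\<lambda>x. u x + c * v x) x = D u x + c *\<^sub>R D v x"
    "AE x in \<sigma>. T (\<lambda>x. u x + c * v x) x = T u x + c * T v x" .
qed

lemma V0_zero: "(\<lambda>_. 0) \<in> V"
proof (rule approx_V0(1))
  have "gradient (\<lambda>_ :: 'a. 0 :: real) x = 0" for x
    by (rule has_derivative_gradient_unique) simp
  then show "approx (\<lambda>_ _. 0) (\<lambda>_. 0) (\<lambda>_. 0) (\<lambda>_. 0)"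
    unfolding approx_def by (auto simp: smooth_const intro: square_integrable_const finite_L finite_surface)
qed simp

text \<open>Friedrichs' inequality is applied to the approximants. They need not vanish on
  \<open>\<Gamma>\<^sub>1\<close>, but their norms there tend to 0.\<close>

lemma V0_bound:
  obtains C where "C \<ge> 0" "\<And>v. v \<in> V \<Longrightarrow> l2_norm L v \<le> C * V0_norm \<Omega> v" "\<And>v. v \<in> V \<Longrightarrow> l2_norm \<sigma> (T v) \<le> C * V0_norm \<Omega> v"
proof -
  let ?N = "restrict_space \<sigma> \<Gamma>\<^sub>1"
  obtain C where C: "C \<ge> 0" "\<And>\<Phi>. smooth \<Phi> \<Longrightarrow> l2_norm L \<Phi> \<le> C * (l2_norm L (gradient \<Phi>) + l2_norm ?N \<Phi>)"
    "\<And>\<Phi>. smooth \<Phi> \<Longrightarrow> l2_norm \<sigma> \<Phi> \<le> C * (l2_norm L (gradient \<Phi>) + l2_norm ?N \<Phi>)"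
    using friedrichs_inequality[OF \<Gamma>\<^sub>1] by blast
  have "l2_norm L v \<le> C * V0_norm \<Omega> v \<and> l2_norm \<sigma> (T v) \<le> C * V0_norm \<Omega> v" if v: "v \<in> V" for v
  proof -
    obtain \<Phi> where \<Phi>: "approx \<Phi> v (D v) (T v)" "AE x in \<sigma>. x \<in> \<Gamma>\<^sub>1 \<longrightarrow> T v x = 0" using V0_approx[OF v] by blast
    note a = approxD[OF \<Phi>(1)] and n = approx_norms[OF \<Phi>(1)]
    have "(\<lambda>n. l2_norm ?N (\<lambda>x. \<Phi> n x - T v x)) \<longlonglongrightarrow> 0"
      by (rule tendsto_sandwich[OF _ _ tendsto_const a(7)])
        (use square_integrable_restrict(2)[OF square_integrable_diff[OF smooth_square_integrable(3)[OF a(1)] a(4)] \<Gamma>\<^sub>1(1)] in auto)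
    then have "(\<lambda>n. l2_norm ?N (\<Phi> n)) \<longlonglongrightarrow> l2_norm ?N (T v)"
      by (intro l2_norm_tendsto square_integrable_restrict(1)[OF _ \<Gamma>\<^sub>1(1)] smooth_square_integrable(3) a)
    moreover have "l2_norm ?N (T v) = l2_norm ?N (\<lambda>_. 0 :: real)"
      using \<Phi>(2) AE_restrict[of "\<lambda>x. T v x = 0"]
      by (intro l2_norm_cong_AE square_integrable_measurable[OF square_integrable_restrict(1)[OF _ \<Gamma>\<^sub>1(1)]] a
          square_integrable_const[OF finite_surface]) auto
    ultimately have N: "(\<lambda>n. l2_norm ?N (\<Phi> n)) \<longlonglongrightarrow> 0" by simp
    have lim: "(\<lambda>n. C * (l2_norm L (gradient (\<Phi> n)) + l2_norm ?N (\<Phi> n))) \<longlonglongrightarrow> C * (V0_norm \<Omega> v + 0)"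
      unfolding V0_norm_def by (intro tendsto_intros n N)
    have "l2_norm L v \<le> C * (V0_norm \<Omega> v + 0)" by (rule LIMSEQ_le[OF n(1) lim]) (use C a in auto)
    moreover have "l2_norm \<sigma> (T v) \<le> C * (V0_norm \<Omega> v + 0)" by (rule LIMSEQ_le[OF n(3) lim]) (use C a in auto)
    ultimately show ?thesis by simp
  qed
  with C(1) show ?thesis by (intro that[of C]) auto
qed

lemma V0_diff:
  assumes "u \<in> V" "v \<in> V"
  shows "(\<lambda>x. u x - v x) \<in> V" "V0_norm \<Omega> (\<lambda>x. u x - v x) = l2_norm L (\<lambda>x. D u x - D v x)"
    "l2_norm \<sigma> (T (\<lambda>x. u x - v x)) = l2_norm \<sigma> (\<lambda>x. T u x - T v x)"
proof -
  have e: "(\<lambda>x. u x - v x) = (\<lambda>x. u x + (-1) * v x)" by simp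
  note l = V0_lincomb[OF assms, of "-1"] and su = V0_square_integrable[OF assms(1)] and sv = V0_square_integrable[OF assms(2)]
  show V: "(\<lambda>x. u x - v x) \<in> V" unfolding e by (rule l)
  note s = V0_square_integrable[OF V]
  have "AE x in L. D (\<lambda>x. u x - v x) x = D u x - D v x" unfolding e using l(2) by eventually_elim simp
  then show "V0_norm \<Omega> (\<lambda>x. u x - v x) = l2_norm L (\<lambda>x. D u x - D v x)" unfolding V0_norm_def
    by (intro l2_norm_cong_AE square_integrable_measurable[OF s(2)] square_integrable_measurable[OF square_integrable_diff[OF su(2) sv(2)]])
  have "AE x in \<sigma>. T (\<lambda>x. u x - v x) x = T u x - T v x" unfolding e using l(3) by eventually_elim simp
  then show "l2_norm \<sigma> (T (\<lambda>x. u x - v x)) = l2_norm \<sigma> (\<lambda>x. T u x - T v x)"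
    by (intro l2_norm_cong_AE square_integrable_measurable[OF s(3)] square_integrable_measurable[OF square_integrable_diff[OF su(3) sv(3)]])
qed

text \<open>By \<open>V0_bound\<close>, Cauchy gradients make functions and traces Cauchy too, and
  \<open>approx_closed\<close> shows that the limit triple is again approximable. The boundary
  condition passes to the limit along a subsequence that converges almost everywhere.\<close>

lemma V0_complete:
  assumes v: "\<And>k. v k \<in> V" and cau: "\<And>\<epsilon>. \<epsilon> > 0 \<Longrightarrow> \<exists>N. \<forall>i\<ge>N. \<forall>j\<ge>N. l2_norm L (\<lambda>x. D (v i) x - D (v j) x) < \<epsilon>"
  obtains u where "u \<in> V" "(\<lambda>k. l2_norm L (\<lambda>x. D (v k) x - D u x)) \<longlonglongrightarrow> 0" "(\<lambda>k. l2_norm \<sigma> (\<lambda>x. T (v k) x - T u x)) \<longlonglongrightarrow> 0"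
proof -
  obtain C where C: "C \<ge> 0" "\<And>v. v \<in> V \<Longrightarrow> l2_norm L v \<le> C * V0_norm \<Omega> v" "\<And>v. v \<in> V \<Longrightarrow> l2_norm \<sigma> (T v) \<le> C * V0_norm \<Omega> v"
    using V0_bound by blast
  note s = V0_square_integrable[OF v]
  have le: "l2_norm L (\<lambda>x. v i x - v j x) \<le> C * l2_norm L (\<lambda>x. D (v i) x - D (v j) x)"
    "l2_norm \<sigma> (\<lambda>x. T (v i) x - T (v j) x) \<le> C * l2_norm L (\<lambda>x. D (v i) x - D (v j) x)" for i j
    using C(2,3)[OF V0_diff(1)[OF v v]] V0_diff(2,3)[OF v v] by metis+
  have small: "\<exists>N. \<forall>i\<ge>N. \<forall>j\<ge>N. C * l2_norm L (\<lambda>x. D (v i) x - D (v j) x) < \<epsilon>" if e: "\<epsilon> > 0" for \<epsilon>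
  proof -
    obtain N where N: "\<forall>i\<ge>N. \<forall>j\<ge>N. l2_norm L (\<lambda>x. D (v i) x - D (v j) x) < \<epsilon> / (C + 1)" using cau[of "\<epsilon> / (C + 1)"] e C by auto
    have "C * l2_norm L (\<lambda>x. D (v i) x - D (v j) x) < \<epsilon>" if "i \<ge> N" "j \<ge> N" for i j
    proof -
      have "C * l2_norm L (\<lambda>x. D (v i) x - D (v j) x) \<le> (C + 1) * l2_norm L (\<lambda>x. D (v i) x - D (v j) x)"
        by (intro mult_right_mono) auto
      also have "\<dots> < \<epsilon>" using N that C by (simp add: field_simps)
      finally show ?thesis .
    qed
    then show ?thesis by blast
  qed
  obtain u where u: "square_integrable L u" "(\<lambda>n. l2_norm L (\<lambda>x. v n x - u x)) \<longlonglongrightarrow> 0"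
  proof (rule l2_complete[OF finite_L s(1)])
    fix \<epsilon> :: real assume "\<epsilon> > 0"
    then show "\<exists>N. \<forall>i\<ge>N. \<forall>j\<ge>N. l2_norm L (\<lambda>x. v i x - v j x) < \<epsilon>" using small[of \<epsilon>] le(1) by (meson le_less_trans)
  qed (use that in auto)
  obtain G where G: "square_integrable L G" "(\<lambda>n. l2_norm L (\<lambda>x. D (v n) x - G x)) \<longlonglongrightarrow> 0"
    using l2_complete[OF finite_L s(2) cau] by blast
  obtain g where g: "square_integrable \<sigma> g" "(\<lambda>n. l2_norm \<sigma> (\<lambda>x. T (v n) x - g x)) \<longlonglongrightarrow> 0"
  proof (rule l2_complete[OF finite_surface s(3)])
    fix \<epsilon> :: real assume "\<epsilon> > 0"
    then show "\<exists>N. \<forall>i\<ge>N. \<forall>j\<ge>N. l2_norm \<sigma> (\<lambda>x. T (v i) x - T (v j) x) < \<epsilon>" using small[of \<epsilon>] le(2) by (meson le_less_trans)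
  qed (use that in auto)
  have "\<exists>\<Phi>. approx \<Phi> (v k) (D (v k)) (T (v k)) \<and> (AE x in \<sigma>. x \<in> \<Gamma>\<^sub>1 \<longrightarrow> T (v k) x = 0)" for k
    using V0_approx[OF v] by metis
  then obtain \<Phi> where \<Phi>: "\<And>k. approx (\<Phi> k) (v k) (D (v k)) (T (v k))" "\<And>k. AE x in \<sigma>. x \<in> \<Gamma>\<^sub>1 \<longrightarrow> T (v k) x = 0" by metis
  obtain \<Psi> where \<Psi>: "approx \<Psi> u G g" using approx_closed[OF \<Phi>(1) u G g] by blast
  obtain r where r: "strict_mono r" "AE x in \<sigma>. (\<lambda>n. T (v (r n)) x) \<longlonglongrightarrow> g x"
    using l2_tendsto_AE_subseq[OF finite_surface s(3) g] by blast
  have "AE x in \<sigma>. \<forall>k. x \<in> \<Gamma>\<^sub>1 \<longrightarrow> T (v k) x = 0" unfolding AE_all_countable using \<Phi>(2) by blast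
  with r(2) have z: "AE x in \<sigma>. x \<in> \<Gamma>\<^sub>1 \<longrightarrow> g x = 0"
    by eventually_elim (auto simp: LIMSEQ_const_iff)
  note A = approx_V0[OF \<Psi> z] and t = V0_square_integrable[OF approx_V0(1)[OF \<Psi> z]]
  have "l2_norm L (\<lambda>x. D (v k) x - D u x) = l2_norm L (\<lambda>x. D (v k) x - G x)" for k
    by (rule l2_norm_cong_AE) (use A(2) square_integrable_measurable[OF square_integrable_diff[OF s(2)[of k] t(2)]]
       square_integrable_measurable[OF square_integrable_diff[OF s(2)[of k] G(1)]] in auto)
  moreover have "l2_norm \<sigma> (\<lambda>x. T (v k) x - T u x) = l2_norm \<sigma> (\<lambda>x. T (v k) x - g x)" for k
    by (rule l2_norm_cong_AE) (use A(3) square_integrable_measurable[OF square_integrable_diff[OF s(3)[of k] t(3)]]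
       square_integrable_measurable[OF square_integrable_diff[OF s(3)[of k] g(1)]] in auto)
  ultimately show ?thesis using that[OF A(1)] G(2) g(2) by simp
qed

text \<open>Each \<open>v k\<close> is exchanged for a smooth function within
  \<open>1 / (k + 1)\<close>, so that \<open>compact_sequence_l2\<close> applies.\<close>

lemma V0_trace_compact:
  assumes v: "\<And>k. v k \<in> V" and B: "\<And>k. V0_norm \<Omega> (v k) \<le> B"
  obtains s :: "nat \<Rightarrow> nat" and g where "strict_mono s" "square_integrable \<sigma> g"
    "(\<lambda>k. l2_norm \<sigma> (\<lambda>x. T (v (s k)) x - g x)) \<longlonglongrightarrow> 0"
proof -
  obtain C where C: "C \<ge> 0" "\<And>v. v \<in> V \<Longrightarrow> l2_norm L v \<le> C * V0_norm \<Omega> v"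
    using V0_bound by metis
  note sv = V0_square_integrable[OF v]
  have "\<exists>\<Phi>. near \<Phi> (v k) (D (v k)) (T (v k)) (inverse (real (Suc k)))" for k
    by (rule V0_approx[OF v[of k]]) (rule approx_near, auto)
  then obtain \<Phi> where near: "\<And>k. near (\<Phi> k) (v k) (D (v k)) (T (v k)) (inverse (real (Suc k)))" by metis
  have \<Phi>: "smooth (\<Phi> k)" "l2_norm L (\<lambda>x. \<Phi> k x - v k x) < inverse (real (Suc k))"
    "l2_norm L (\<lambda>x. gradient (\<Phi> k) x - D (v k) x) < inverse (real (Suc k))"
    "l2_norm \<sigma> (\<lambda>x. \<Phi> k x - T (v k) x) < inverse (real (Suc k))" for k
    using near[of k] unfolding near_def by blast+
  note ss = smooth_square_integrable[OF \<Phi>(1)]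
  have inv1: "inverse (real (Suc k)) \<le> 1" for k by (simp add: inverse_le_1_iff)
  have B0: "B \<ge> 0" using B[of 0] l2_norm_nonneg[of L "D (v 0)"] unfolding V0_norm_def by linarith
  have b1: "l2_norm L (\<Phi> k) \<le> C * B + B + 1" for k
  proof -
    have "l2_norm L (v k) \<le> C * B" using C(2)[OF v[of k]] mult_left_mono[OF B[of k] C(1)] by linarith
    then show ?thesis using l2_norm_le_add_diff[OF ss(1)[of k] sv(1)[of k]] \<Phi>(2)[of k] inv1[of k] B0 by linarith
  qed
  have b2: "l2_norm L (gradient (\<Phi> k)) \<le> C * B + B + 1" for k
    using l2_norm_le_add_diff[OF ss(2)[of k] sv(2)[of k]] \<Phi>(3)[of k] inv1[of k] B[of k] mult_nonneg_nonneg[OF C(1) B0]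
    unfolding V0_norm_def by linarith
  obtain s :: "nat \<Rightarrow> nat" where s: "strict_mono s"
    "\<And>\<epsilon>. \<epsilon> > 0 \<Longrightarrow> \<exists>N. \<forall>i\<ge>N. \<forall>j\<ge>N. l2_norm \<sigma> (\<lambda>x. \<Phi> (s i) x - \<Phi> (s j) x) \<le> \<epsilon>"
    by (rule compact_sequence_l2[OF \<Phi>(1) b1 b2]) (rule that)
  obtain g where g: "square_integrable \<sigma> g" "(\<lambda>k. l2_norm \<sigma> (\<lambda>x. \<Phi> (s k) x - g x)) \<longlonglongrightarrow> 0"
  proof (rule l2_complete[OF finite_surface, of "\<lambda>k. \<Phi> (s k)"])
    fix \<epsilon> :: real assume "\<epsilon> > 0"
    then obtain N where "\<forall>i\<ge>N. \<forall>j\<ge>N. l2_norm \<sigma> (\<lambda>x. \<Phi> (s i) x - \<Phi> (s j) x) \<le> \<epsilon> / 2" using s(2)[of "\<epsilon> / 2"] by auto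
    then show "\<exists>N. \<forall>i\<ge>N. \<forall>j\<ge>N. l2_norm \<sigma> (\<lambda>x. \<Phi> (s i) x - \<Phi> (s j) x) < \<epsilon>"
      using \<open>\<epsilon> > 0\<close> by (intro exI[of _ N]) fastforce
  qed (use ss that in auto)
  have "(\<lambda>k. l2_norm \<sigma> (\<lambda>x. T (v (s k)) x - g x)) \<longlonglongrightarrow> 0"
  proof (rule tendsto_sandwich[OF _ _ tendsto_const])
    show "(\<lambda>k. inverse (real (Suc k)) + l2_norm \<sigma> (\<lambda>x. \<Phi> (s k) x - g x)) \<longlonglongrightarrow> 0"
      using tendsto_add[OF LIMSEQ_inverse_real_of_nat g(2)] by simp
    have "l2_norm \<sigma> (\<lambda>x. T (v (s k)) x - g x) \<le> inverse (real (Suc k)) + l2_norm \<sigma> (\<lambda>x. \<Phi> (s k) x - g x)" for k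
    proof -
      have "k \<le> s k" by (rule seq_suble[OF s(1)])
      then have "inverse (real (Suc (s k))) \<le> inverse (real (Suc k))" by (intro le_imp_inverse_le) auto
      then show ?thesis
        using l2_norm_triangle_diff[OF sv(3)[of "s k"] ss(3)[of "s k"] g(1)] \<Phi>(4)[of "s k"] l2_norm_diff_commute[of \<sigma> "T (v (s k))" "\<Phi> (s k)"]
        by linarith
    qed
    then show "\<forall>\<^sub>F k in sequentially. l2_norm \<sigma> (\<lambda>x. T (v (s k)) x - g x) \<le> inverse (real (Suc k)) + l2_norm \<sigma> (\<lambda>x. \<Phi> (s k) x - g x)" by simp
  qed simp
  with s(1) g(1) show ?thesis by (rule that)
qed

end

section \<open>Clarke calculus\<close>

definition quot :: "(real \<Rightarrow> real) \<Rightarrow> real \<Rightarrow> real \<Rightarrow> real \<Rightarrow> real" where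
  "quot \<phi> s y t = (\<phi> (y + t * s) - \<phi> y) / t"

abbreviation clarke_filter :: "real \<Rightarrow> (real \<times> real) filter" where
  "clarke_filter r \<equiv> nhds r \<times>\<^sub>F at_right 0"

lemma eventually_clarke_filter:
  "eventually P (clarke_filter r) \<longleftrightarrow> (\<exists>\<eta>>0. \<forall>y t. \<bar>y - r\<bar> < \<eta> \<longrightarrow> 0 < t \<longrightarrow> t < \<eta> \<longrightarrow> P (y, t))"
proof
  assume "eventually P (clarke_filter r)"
  then obtain Pf Pg where P: "eventually Pf (nhds r)" "eventually Pg (at_right 0)" "\<And>x y. Pf x \<Longrightarrow> Pg y \<Longrightarrow> P (x, y)"
    unfolding eventually_prod_filter by blast
  obtain d where d: "d > 0" "\<And>y. dist y r < d \<Longrightarrow> Pf y" using P(1) unfolding eventually_nhds_metric by blast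
  obtain b where b: "b > 0" "\<And>t. 0 < t \<Longrightarrow> t < b \<Longrightarrow> Pg t"
    using P(2) unfolding eventually_at_right_field by blast
  show "\<exists>\<eta>>0. \<forall>y t. \<bar>y - r\<bar> < \<eta> \<longrightarrow> 0 < t \<longrightarrow> t < \<eta> \<longrightarrow> P (y, t)"
    using d b P(3) by (intro exI[of _ "min d b"]) (auto simp: dist_real_def)
next
  assume "\<exists>\<eta>>0. \<forall>y t. \<bar>y - r\<bar> < \<eta> \<longrightarrow> 0 < t \<longrightarrow> t < \<eta> \<longrightarrow> P (y, t)"
  then obtain \<eta> where \<eta>: "\<eta> > 0" "\<And>y t. \<bar>y - r\<bar> < \<eta> \<Longrightarrow> 0 < t \<Longrightarrow> t < \<eta> \<Longrightarrow> P (y, t)" by blast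
  show "eventually P (clarke_filter r)"
    unfolding eventually_prod_filter
  proof (intro exI conjI allI impI)
    show "eventually (\<lambda>y. \<bar>y - r\<bar> < \<eta>) (nhds r)" using \<eta>(1) unfolding eventually_nhds_metric dist_real_def by blast
    show "eventually (\<lambda>t. 0 < t \<and> t < \<eta>) (at_right 0)" using \<eta>(1) unfolding eventually_at_right_field by blast
  qed (use \<eta> in auto)
qed

lemma clarke_filter_nontrivial: "clarke_filter r \<noteq> bot"
  by (simp add: prod_filter_eq_bot)

lemma locally_lipschitz_continuous:
  assumes "locally_lipschitz \<phi>" shows "continuous_on UNIV \<phi>"
proof (rule continuous_at_imp_continuous_on, rule ballI)
  fix r
  obtain \<epsilon> L where "\<epsilon> > 0" "L-lipschitz_on (cball r \<epsilon>) \<phi>" using assms unfolding locally_lipschitz_def by blast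
  then have "continuous_on (cball r \<epsilon>) \<phi>" "r \<in> interior (cball r \<epsilon>)" by (auto intro: lipschitz_on_continuous_on)
  then show "isCont \<phi> r" by (rule continuous_on_interior)
qed

lemma quot_bound:
  assumes "locally_lipschitz \<phi>"
  obtains B where "eventually (\<lambda>(y, t). \<bar>quot \<phi> s y t\<bar> \<le> B) (clarke_filter r)"
proof -
  obtain \<epsilon> L where \<epsilon>: "\<epsilon> > 0" and L: "L-lipschitz_on (cball r \<epsilon>) \<phi>" using assms unfolding locally_lipschitz_def by blast
  have L0: "L \<ge> 0" using L by (rule lipschitz_on_nonneg)
  \<comment> \<open>Keeps both \<open>y\<close> and \<open>y + t * s\<close> within
    \<open>\<epsilon>\<close> of \<open>r\<close>.\<close>
  define \<eta> where "\<eta> = \<epsilon> / (1 + \<bar>s\<bar>)"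
  have \<eta>: "\<eta> > 0" using \<epsilon> by (simp add: \<eta>_def add_pos_nonneg)
  have "\<bar>quot \<phi> s y t\<bar> \<le> L * \<bar>s\<bar>" if y: "\<bar>y - r\<bar> < \<eta>" and t: "0 < t" "t < \<eta>" for y t
  proof -
    have e: "\<eta> * (1 + \<bar>s\<bar>) = \<epsilon>" by (simp add: \<eta>_def add_pos_nonneg)
    have ts: "\<bar>t * s\<bar> \<le> \<eta> * \<bar>s\<bar>" using t by (simp add: abs_mult mult_right_mono)
    have "\<eta> \<le> \<epsilon>" "\<eta> + \<eta> * \<bar>s\<bar> = \<epsilon>" using e \<eta> mult_nonneg_nonneg[of \<eta> "\<bar>s\<bar>"] by (auto simp: algebra_simps)
    then have "y \<in> cball r \<epsilon>" "y + t * s \<in> cball r \<epsilon>"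
      using y ts unfolding mem_cball dist_real_def by linarith+
    then have "\<bar>\<phi> (y + t * s) - \<phi> y\<bar> \<le> L * \<bar>t * s\<bar>"
      using lipschitz_onD[OF L, of "y + t * s" y] by (simp add: dist_real_def)
    then show ?thesis using t by (simp add: quot_def abs_mult divide_le_eq ac_simps)
  qed
  then have "eventually (\<lambda>(y, t). \<bar>quot \<phi> s y t\<bar> \<le> L * \<bar>s\<bar>) (clarke_filter r)"
    unfolding eventually_clarke_filter using \<eta> by auto
  then show ?thesis by (rule that)
qed

text \<open>Difference quotients are bounded near \<open>r\<close>, so the upper limit is finite and
  \<open>real_of_ereal\<close> loses nothing.\<close>

lemma clarke_deriv_Limsup:
  assumes "locally_lipschitz \<phi>"
  shows "ereal (clarke_deriv \<phi> r s) = Limsup (clarke_filter r) (\<lambda>(y, t). ereal (quot \<phi> s y t))"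
proof -
  let ?l = "Limsup (clarke_filter r) (\<lambda>(y, t). ereal (quot \<phi> s y t))"
  obtain B where B: "eventually (\<lambda>(y, t). \<bar>quot \<phi> s y t\<bar> \<le> B) (clarke_filter r)" using quot_bound[OF assms] by blast
  have "?l \<le> ereal B"
    by (rule Limsup_bounded) (use B in \<open>auto elim!: eventually_mono\<close>)
  moreover have "ereal (- B) \<le> ?l"
    by (rule le_Limsup[OF clarke_filter_nontrivial]) (use B in \<open>auto elim!: eventually_mono\<close>)
  ultimately have "\<bar>?l\<bar> \<noteq> \<infinity>" by (cases ?l) auto
  then show ?thesis unfolding clarke_deriv_def quot_def by (simp add: ereal_real')
qed

lemma clarke_deriv_less:
  assumes "locally_lipschitz \<phi>" "clarke_deriv \<phi> r s < c"
  obtains \<eta> where "\<eta> > 0" "\<And>y t. \<bar>y - r\<bar> < \<eta> \<Longrightarrow> 0 < t \<Longrightarrow> t < \<eta> \<Longrightarrow> quot \<phi> s y t < c"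
proof -
  have "Limsup (clarke_filter r) (\<lambda>(y, t). ereal (quot \<phi> s y t)) < ereal c"
    unfolding clarke_deriv_Limsup[OF assms(1), symmetric] using assms(2) by simp
  from Limsup_lessD[OF this] show ?thesis unfolding eventually_clarke_filter using that by auto
qed

lemma clarke_deriv_le:
  assumes "locally_lipschitz \<phi>" "\<eta> > 0" "\<And>y t. \<bar>y - r\<bar> < \<eta> \<Longrightarrow> 0 < t \<Longrightarrow> t < \<eta> \<Longrightarrow> quot \<phi> s y t \<le> c"
  shows "clarke_deriv \<phi> r s \<le> c"
proof -
  have "Limsup (clarke_filter r) (\<lambda>(y, t). ereal (quot \<phi> s y t)) \<le> ereal c"
    by (rule Limsup_bounded) (use assms(2,3) in \<open>auto simp: eventually_clarke_filter\<close>)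
  then show ?thesis unfolding clarke_deriv_Limsup[OF assms(1), symmetric] by simp
qed

lemma clarke_deriv_zero: "locally_lipschitz \<phi> \<Longrightarrow> clarke_deriv \<phi> r 0 = 0"
  using clarke_deriv_Limsup[of \<phi> r 0] clarke_filter_nontrivial[of r]
  by (simp add: quot_def case_prod_unfold Limsup_const zero_ereal_def)

lemma clarke_deriv_scale_le:
  assumes \<phi>: "locally_lipschitz \<phi>" and a: "a > 0"
  shows "clarke_deriv \<phi> r (a * s) \<le> a * clarke_deriv \<phi> r s"
proof (rule field_le_epsilon)
  fix e :: real assume e: "e > 0"
  define c where "c = clarke_deriv \<phi> r s + e / a"
  have "clarke_deriv \<phi> r s < c" using e a by (simp add: c_def)
  then obtain \<eta> where \<eta>: "\<eta> > 0" "\<And>y t. \<bar>y - r\<bar> < \<eta> \<Longrightarrow> 0 < t \<Longrightarrow> t < \<eta> \<Longrightarrow> quot \<phi> s y t < c"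
    using clarke_deriv_less[OF \<phi>] by blast
  have "clarke_deriv \<phi> r (a * s) \<le> a * c"
  proof (rule clarke_deriv_le[OF \<phi>, of "min \<eta> (\<eta> / a)"])
    fix y t assume y: "\<bar>y - r\<bar> < min \<eta> (\<eta> / a)" and t: "0 < t" "t < min \<eta> (\<eta> / a)"
    have "quot \<phi> s y (t * a) < c" using \<eta>(2)[of y "t * a"] y t a by (simp add: field_simps)
    moreover have "quot \<phi> (a * s) y t = a * quot \<phi> s y (t * a)" using a t by (simp add: quot_def mult.assoc)
    ultimately show "quot \<phi> (a * s) y t \<le> a * c" using a by simp
  qed (use \<eta> a in auto)
  also have "a * c = a * clarke_deriv \<phi> r s + e" using a by (simp add: c_def distrib_left)
  finally show "clarke_deriv \<phi> r (a * s) \<le> a * clarke_deriv \<phi> r s + e" .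
qed

lemma clarke_deriv_scale:
  assumes \<phi>: "locally_lipschitz \<phi>" and a: "a > 0"
  shows "clarke_deriv \<phi> r (a * s) = a * clarke_deriv \<phi> r s"
proof (rule antisym[OF clarke_deriv_scale_le[OF assms]])
  have "clarke_deriv \<phi> r ((1 / a) * (a * s)) \<le> (1 / a) * clarke_deriv \<phi> r (a * s)"
    by (rule clarke_deriv_scale_le[OF \<phi>]) (use a in simp)
  then show "a * clarke_deriv \<phi> r s \<le> clarke_deriv \<phi> r (a * s)" using a by (simp add: field_simps)
qed

lemma clarke_deriv_sum_nonneg:
  assumes \<phi>: "locally_lipschitz \<phi>"
  shows "0 \<le> clarke_deriv \<phi> r 1 + clarke_deriv \<phi> r (- 1)"
proof (rule field_le_epsilon)
  fix e :: real assume e: "e > 0"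
  obtain \<eta> where \<eta>: "\<eta> > 0" "\<And>y t. \<bar>y - r\<bar> < \<eta> \<Longrightarrow> 0 < t \<Longrightarrow> t < \<eta> \<Longrightarrow> quot \<phi> 1 y t < clarke_deriv \<phi> r 1 + e / 2"
    using clarke_deriv_less[OF \<phi>, of r 1 "clarke_deriv \<phi> r 1 + e / 2"] e by auto
  obtain \<eta>' where \<eta>': "\<eta>' > 0" "\<And>y t. \<bar>y - r\<bar> < \<eta>' \<Longrightarrow> 0 < t \<Longrightarrow> t < \<eta>' \<Longrightarrow> quot \<phi> (- 1) y t < clarke_deriv \<phi> r (- 1) + e / 2"
    using clarke_deriv_less[OF \<phi>, of r "- 1" "clarke_deriv \<phi> r (- 1) + e / 2"] e by auto
  define t where "t = min \<eta> \<eta>' / 2"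
  have t: "0 < t" "t < \<eta>" "t < \<eta>'" using \<eta>(1) \<eta>'(1) by (auto simp: t_def)
  have "quot \<phi> 1 r t < clarke_deriv \<phi> r 1 + e / 2" using \<eta> t by simp
  moreover have "quot \<phi> (- 1) (r + t) t < clarke_deriv \<phi> r (- 1) + e / 2" using \<eta>' t by simp
  moreover have "quot \<phi> 1 r t + quot \<phi> (- 1) (r + t) t = 0" by (simp add: quot_def flip: add_divide_distrib)
  ultimately show "0 \<le> clarke_deriv \<phi> r 1 + clarke_deriv \<phi> r (- 1) + e" by linarith
qed

lemma clarke_deriv_eq:
  assumes \<phi>: "locally_lipschitz \<phi>"
  shows "clarke_deriv \<phi> r s = (if s \<ge> 0 then s * clarke_deriv \<phi> r 1 else - s * clarke_deriv \<phi> r (- 1))"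
proof -
  consider "s > 0" | "s = 0" | "s < 0" by linarith
  then show ?thesis
  proof cases
    case 1 then show ?thesis using clarke_deriv_scale[OF \<phi> 1, of r 1] by simp
  next
    case 2 then show ?thesis using clarke_deriv_zero[OF \<phi>] by simp
  next
    case 3 then show ?thesis using clarke_deriv_scale[OF \<phi>, of "- s" r "- 1"] by simp
  qed
qed

text \<open>On the line the two extreme slopes, \<open>clarke_deriv \<phi> r 1\<close> and the
  negative of \<open>clarke_deriv \<phi> r (- 1)\<close>, belong to the generalized gradient
  themselves, so a bound for the gradient is a bound for the derivative.\<close>

lemma clarke_deriv_abs_le:
  assumes \<phi>: "locally_lipschitz \<phi>" and K: "\<And>\<zeta>. \<zeta> \<in> clarke_gradient \<phi> r \<Longrightarrow> \<bar>\<zeta>\<bar> \<le> K"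
  shows "\<bar>clarke_deriv \<phi> r s\<bar> \<le> K * \<bar>s\<bar>"
proof -
  let ?p = "clarke_deriv \<phi> r 1" and ?q = "clarke_deriv \<phi> r (- 1)"
  have "?p * s \<le> clarke_deriv \<phi> r s" "- ?q * s \<le> clarke_deriv \<phi> r s" for s
  proof -
    have pq: "0 \<le> ?p + ?q" by (rule clarke_deriv_sum_nonneg[OF \<phi>])
    have "0 \<le> s * (?p + ?q)" if "s \<ge> 0" using pq that by simp
    moreover have "0 \<le> - s * (?p + ?q)" if "\<not> s \<ge> 0" using pq that by (simp add: mult_nonpos_nonneg)
    ultimately show "?p * s \<le> clarke_deriv \<phi> r s" "- ?q * s \<le> clarke_deriv \<phi> r s"
      unfolding clarke_deriv_eq[OF \<phi>, of r s] by (auto simp: algebra_simps)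
  qed
  then have "?p \<in> clarke_gradient \<phi> r" "- ?q \<in> clarke_gradient \<phi> r" by (auto simp: clarke_gradient_def)
  from K[OF this(1)] K[OF this(2)] have "\<bar>?p\<bar> \<le> K" "\<bar>?q\<bar> \<le> K" by auto
  then show ?thesis unfolding clarke_deriv_eq[OF \<phi>, of r s]
    by (simp add: abs_mult mult.commute[of _ "\<bar>s\<bar>"] mult_left_mono)
qed

text \<open>A mean value inequality by bisection (\<open>Bolzano\<close>): the upper limit is
  uniform in the base point, so every short interval containing \<open>x\<close> has slope below
  \<open>K + e\<close>.\<close>

lemma increment_le_clarke:
  assumes \<phi>: "locally_lipschitz \<phi>" and ab: "a \<le> b" and K: "\<And>x. a \<le> x \<Longrightarrow> x \<le> b \<Longrightarrow> clarke_deriv \<phi> x 1 \<le> K"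
  shows "\<phi> b - \<phi> a \<le> K * (b - a)"
proof -
  have "\<phi> b - \<phi> a \<le> (K + e) * (b - a)" if e: "e > 0" for e
    using ab
  proof (rule Bolzano[of a b "\<lambda>u v. \<phi> v - \<phi> u \<le> (K + e) * (v - u)"])
    show "\<phi> w - \<phi> u \<le> (K + e) * (w - u)"
      if "\<phi> v - \<phi> u \<le> (K + e) * (v - u)" "\<phi> w - \<phi> v \<le> (K + e) * (w - v)" for u v w
      using that by (simp add: algebra_simps)
    fix x assume x: "a \<le> x" "x \<le> b"
    have "clarke_deriv \<phi> x 1 < K + e" using K[OF x] e by simp
    then obtain \<eta> where \<eta>: "\<eta> > 0" "\<And>y t. \<bar>y - x\<bar> < \<eta> \<Longrightarrow> 0 < t \<Longrightarrow> t < \<eta> \<Longrightarrow> quot \<phi> 1 y t < K + e"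
      using clarke_deriv_less[OF \<phi>] by blast
    have "\<phi> v - \<phi> u \<le> (K + e) * (v - u)" if uv: "u \<le> x" "x \<le> v" "v - u < \<eta>" for u v
    proof (cases "u = v")
      case False
      have "quot \<phi> 1 u (v - u) < K + e" using \<eta>(2)[of u "v - u"] uv False by auto
      then show ?thesis using uv False by (simp add: quot_def field_simps)
    qed simp
    then show "\<exists>d>0. \<forall>u v. u \<le> x \<and> x \<le> v \<and> v - u < d \<longrightarrow> \<phi> v - \<phi> u \<le> (K + e) * (v - u)" using \<eta>(1) by blast
  qed
  then have main: "\<phi> b - \<phi> a \<le> K * (b - a) + e * (b - a)" if "e > 0" for e
    using that by (simp add: distrib_right)
  show ?thesis
  proof (cases "a = b")
    case False
    show ?thesis
    proof (rule field_le_epsilon)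
      fix d :: real assume "d > 0"
      then show "\<phi> b - \<phi> a \<le> K * (b - a) + d"
        using main[of "d / (b - a)"] False ab by simp
    qed
  qed simp
qed

text \<open>Reflecting the line reduces this to \<open>increment_le_clarke\<close>.\<close>

lemma decrement_le_clarke:
  assumes \<phi>: "locally_lipschitz \<phi>" and ab: "a \<le> b" and K: "\<And>x. a \<le> x \<Longrightarrow> x \<le> b \<Longrightarrow> clarke_deriv \<phi> x (- 1) \<le> K"
  shows "\<phi> a - \<phi> b \<le> K * (b - a)"
proof -
  define \<psi> where "\<psi> x = \<phi> (- x)" for x
  have \<psi>: "locally_lipschitz \<psi>"
    unfolding locally_lipschitz_def
  proof
    fix r
    obtain \<epsilon> L where *: "\<epsilon> > 0" "L-lipschitz_on (cball (- r) \<epsilon>) \<phi>" using \<phi> unfolding locally_lipschitz_def by blast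
    have "L-lipschitz_on (cball r \<epsilon>) \<psi>"
    proof (rule lipschitz_onI)
      fix x y assume "x \<in> cball r \<epsilon>" "y \<in> cball r \<epsilon>"
      then show "dist (\<psi> x) (\<psi> y) \<le> L * dist x y"
        using lipschitz_onD[OF *(2), of "- x" "- y"] by (auto simp: \<psi>_def dist_real_def abs_minus_commute)
    qed (rule lipschitz_on_nonneg[OF *(2)])
    with *(1) show "\<exists>\<epsilon>>0. \<exists>L. L-lipschitz_on (cball r \<epsilon>) \<psi>" by blast
  qed
  have "clarke_deriv \<psi> x 1 \<le> clarke_deriv \<phi> (- x) (- 1)" for x
  proof (rule field_le_epsilon)
    fix e :: real assume e: "e > 0"
    obtain \<eta> where \<eta>: "\<eta> > 0" "\<And>y t. \<bar>y - (- x)\<bar> < \<eta> \<Longrightarrow> 0 < t \<Longrightarrow> t < \<eta> \<Longrightarrow> quot \<phi> (- 1) y t < clarke_deriv \<phi> (- x) (- 1) + e"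
      using clarke_deriv_less[OF \<phi>, of "- x" "- 1" "clarke_deriv \<phi> (- x) (- 1) + e"] e by auto
    show "clarke_deriv \<psi> x 1 \<le> clarke_deriv \<phi> (- x) (- 1) + e"
    proof (rule clarke_deriv_le[OF \<psi> \<eta>(1)])
      fix y t assume "\<bar>y - x\<bar> < \<eta>" "0 < t" "t < \<eta>"
      then have "quot \<phi> (- 1) (- y) t < clarke_deriv \<phi> (- x) (- 1) + e" by (intro \<eta>(2)) auto
      then show "quot \<psi> 1 y t \<le> clarke_deriv \<phi> (- x) (- 1) + e" by (simp add: quot_def \<psi>_def)
    qed
  qed
  then have "clarke_deriv \<psi> x 1 \<le> K" if "- b \<le> x" "x \<le> - a" for x
    using K[of "- x"] that by (meson minus_le_iff le_minus_iff order.trans)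
  from increment_le_clarke[of \<psi> "- b" "- a" K, OF \<psi> _ this] show ?thesis using ab by (simp add: \<psi>_def)
qed

text \<open>For \<open>r \<noteq> b\<close> the derivative in the direction of \<open>b\<close> is
  nonpositive, but at \<open>b\<close> itself the condition carries no information. Monotonicity is
  therefore derived on intervals that stop short of \<open>b\<close>, and continuity closes the
  gap.\<close>

lemma minimum_at_attractor:
  assumes \<phi>: "locally_lipschitz \<phi>" and d: "\<And>r. clarke_deriv \<phi> r (b - r) \<le> 0"
  shows "\<phi> b \<le> \<phi> r"
proof -
  have cont: "(\<phi> \<longlongrightarrow> \<phi> b) (at b within S)" for S
    using locally_lipschitz_continuous[OF \<phi>] by (meson UNIV_I continuous_on_def filterlim_mono order_refl at_le subset_UNIV)
  consider "b < r" | "b = r" | "r < b" by linarith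
  then show ?thesis
  proof cases
    case 1
    have neg: "clarke_deriv \<phi> x (- 1) \<le> 0" if "b < x" for x
      using d[of x] that unfolding clarke_deriv_eq[OF \<phi>, of x "b - x"] by (simp add: mult_le_0_iff)
    have "\<phi> b' \<le> \<phi> r" if "b < b'" "b' \<le> r" for b'
      using decrement_le_clarke[OF \<phi> that(2), of 0] neg that by fastforce
    then have "\<forall>\<^sub>F x in at_right b. \<phi> x \<le> \<phi> r"
      unfolding eventually_at_right_field using 1 by (intro exI[of _ r]) auto
    then show ?thesis by (intro tendsto_upperbound[OF cont]) auto
  next
    case 3
    have neg: "clarke_deriv \<phi> x 1 \<le> 0" if "x < b" for x
      using d[of x] that unfolding clarke_deriv_eq[OF \<phi>, of x "b - x"] by (simp add: mult_le_0_iff)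
    have "\<phi> b' \<le> \<phi> r" if "b' < b" "r \<le> b'" for b'
      using increment_le_clarke[OF \<phi> that(2), of 0] neg that by fastforce
    then have "\<forall>\<^sub>F x in at_left b. \<phi> x \<le> \<phi> r"
      unfolding eventually_at_left_field using 3 by (intro exI[of _ r]) auto
    then show ?thesis by (intro tendsto_upperbound[OF cont]) auto
  qed simp
qed

text \<open>Mean value inequalities on the segment between \<open>u\<close> and \<open>v\<close>,
  all of whose points have modulus at most \<open>M\<close>.\<close>

lemma growth_from_clarke:
  assumes \<phi>: "locally_lipschitz \<phi>" and c: "c1 \<ge> 0" "\<And>r s. \<bar>clarke_deriv \<phi> r s\<bar> \<le> (c0 + c1 * \<bar>r\<bar>) * \<bar>s\<bar>"
    and M: "\<bar>u\<bar> \<le> M" "\<bar>v\<bar> \<le> M"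
  shows "\<bar>\<phi> v - \<phi> u\<bar> \<le> (c0 + c1 * M) * \<bar>v - u\<bar>"
proof -
  have K: "clarke_deriv \<phi> x s \<le> c0 + c1 * M" if "\<bar>x\<bar> \<le> M" "s = 1 \<or> s = -1" for x s
    using c(2)[of x s] that mult_left_mono[OF that(1) c(1)] by auto
  have main: "\<bar>\<phi> b - \<phi> a\<bar> \<le> (c0 + c1 * M) * (b - a)" if "a \<le> b" "\<bar>a\<bar> \<le> M" "\<bar>b\<bar> \<le> M" for a b
    using increment_le_clarke[OF \<phi> that(1), of "c0 + c1 * M"] decrement_le_clarke[OF \<phi> that(1), of "c0 + c1 * M"] K that
    by (simp add: abs_le_iff)
  show ?thesis using main[of u v] main[of v u] M by (cases "u \<le> v") (auto simp: abs_minus_commute)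
qed

text \<open>Rounding \<open>g\<close> down to a grid leaves countably many values, for which
  measurability in \<open>x\<close> at fixed \<open>r\<close> suffices; continuity in
  \<open>r\<close> then passes to the limit.\<close>

lemma measurable_superposition:
  fixes j :: "'x \<Rightarrow> real \<Rightarrow> real"
  assumes j: "\<And>r. (\<lambda>x. j x r) \<in> borel_measurable M" and cont: "\<And>x. continuous_on UNIV (j x)"
    and g [measurable]: "g \<in> borel_measurable M"
  shows "(\<lambda>x. j x (g x)) \<in> borel_measurable M"
proof (rule borel_measurable_LIMSEQ_real)
  define a where "a n x = real_of_int \<lfloor>real (Suc n) * g x\<rfloor> / real (Suc n)" for n x
  show "(\<lambda>x. j x (a n x)) \<in> borel_measurable M" for n
    unfolding a_def
    by (rule measurable_compose_countable[of "\<lambda>i x. j x (real_of_int i / real (Suc n))" M borel "\<lambda>x. \<lfloor>real (Suc n) * g x\<rfloor>"])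
       (use j in measurable)
  fix x
  have "(\<lambda>n. a n x) \<longlonglongrightarrow> g x"
  proof (rule LIMSEQ_I)
    fix e :: real assume e: "e > 0"
    obtain N where N: "inverse (real (Suc N)) < e" using reals_Archimedean[OF e] by blast
    have "norm (a n x - g x) < e" if n: "n \<ge> N" for n
    proof -
      have "\<bar>real_of_int \<lfloor>real (Suc n) * g x\<rfloor> - real (Suc n) * g x\<bar> \<le> 1" by linarith
      then have "\<bar>real_of_int \<lfloor>real (Suc n) * g x\<rfloor> - real (Suc n) * g x\<bar> / real (Suc n) \<le> 1 / real (Suc n)"
        by (rule divide_right_mono) simp
      moreover have "a n x - g x = (real_of_int \<lfloor>real (Suc n) * g x\<rfloor> - real (Suc n) * g x) / real (Suc n)"
        unfolding a_def diff_divide_distrib by (simp del: of_nat_Suc)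
      ultimately have "\<bar>a n x - g x\<bar> \<le> 1 / real (Suc n)" by (simp add: abs_divide del: of_nat_Suc)
      also have "\<dots> \<le> inverse (real (Suc N))" using n by (simp add: inverse_eq_divide frac_le)
      finally show ?thesis using N by simp
    qed
    then show "\<exists>N. \<forall>n\<ge>N. norm (a n x - g x) < e" by blast
  qed
  then show "(\<lambda>n. j x (a n x)) \<longlonglongrightarrow> j x (g x)"
    using continuous_on_tendsto_compose[OF cont, of "\<lambda>n. a n x" "g x"] by simp
qed

text \<open>By continuity, rational increments suffice in the upper limit; this makes the generalized
  directional derivative a countable limit, hence measurable.\<close>

definition ratbox :: "nat \<Rightarrow> (real \<times> real) set" where
  "ratbox n = {(y, t). y \<in> \<rat> \<and> t \<in> \<rat> \<and> \<bar>y\<bar> < 1 / real (Suc n) \<and> 0 < t \<and> t < 1 / real (Suc n)}"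

lemma countable_ratbox: "countable (ratbox n)"
  by (rule countable_subset[of _ "\<rat> \<times> \<rat>"]) (auto simp: ratbox_def countable_rat)

lemma rational_sequence:
  obtains q :: "nat \<Rightarrow> real" where "\<And>k. q k \<in> \<rat>" "q \<longlonglongrightarrow> y"
proof -
  have "\<exists>q\<in>\<rat>. y < q \<and> q < y + 1 / real (Suc k)" for k by (rule Rats_dense_in_real) simp
  then obtain q where q: "\<And>k. q k \<in> \<rat>" "\<And>k. y < q k \<and> q k < y + 1 / real (Suc k)" by metis
  have "q \<longlonglongrightarrow> y"
  proof (rule tendsto_sandwich[OF _ _ tendsto_const])
    show "(\<lambda>k. y + 1 / real (Suc k)) \<longlonglongrightarrow> y"
      using tendsto_add[OF tendsto_const[of y] LIMSEQ_inverse_real_of_nat] by (simp add: inverse_eq_divide)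
  qed (use q(2) in \<open>auto intro!: always_eventually less_imp_le\<close>)
  with q(1) show ?thesis by (rule that)
qed

lemma clarke_deriv_countable:
  assumes \<phi>: "locally_lipschitz \<phi>"
  shows "clarke_deriv \<phi> r s = real_of_ereal (INF n. SUP (y, t)\<in>ratbox n. ereal (quot \<phi> s (r + y) t))"
proof -
  define S where "S n = (SUP (y, t)\<in>ratbox n. ereal (quot \<phi> s (r + y) t))" for n
  let ?l = "Limsup (clarke_filter r) (\<lambda>(y, t). ereal (quot \<phi> s y t))"
  have cont: "continuous_on UNIV \<phi>" by (rule locally_lipschitz_continuous[OF \<phi>])
  have "?l = (INF n. S n)"
  proof (rule antisym)
    show "?l \<le> (INF n. S n)"
    proof (rule INF_greatest)
      fix n :: nat
      have "ereal (quot \<phi> s y t) \<le> S n" if y: "\<bar>y - r\<bar> < 1 / real (Suc n)" and t: "0 < t" "t < 1 / real (Suc n)" for y t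
      proof -
        obtain q where q: "\<And>k. q k \<in> \<rat>" "q \<longlonglongrightarrow> y - r" using rational_sequence[of "y - r"] by blast
        obtain p where p: "\<And>k. p k \<in> \<rat>" "p \<longlonglongrightarrow> t" using rational_sequence[of t] by blast
        have "(\<lambda>k. quot \<phi> s (r + q k) (p k)) \<longlonglongrightarrow> quot \<phi> s (r + (y - r)) t"
          unfolding quot_def using t q(2) p(2)
          by (intro tendsto_intros continuous_on_tendsto_compose[OF cont]) auto
        then have lim: "(\<lambda>k. ereal (quot \<phi> s (r + q k) (p k))) \<longlonglongrightarrow> ereal (quot \<phi> s y t)" by simp
        have "\<forall>\<^sub>F k in sequentially. \<bar>q k\<bar> < 1 / real (Suc n) \<and> 0 < p k \<and> p k < 1 / real (Suc n)"
          by (intro eventually_conj order_tendstoD(2)[OF tendsto_rabs[OF q(2)] y] order_tendstoD(1)[OF p(2) t(1)] order_tendstoD(2)[OF p(2) t(2)])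
        then have "\<forall>\<^sub>F k in sequentially. ereal (quot \<phi> s (r + q k) (p k)) \<le> S n"
        proof eventually_elim
          fix k assume "\<bar>q k\<bar> < 1 / real (Suc n) \<and> 0 < p k \<and> p k < 1 / real (Suc n)"
          then have "(q k, p k) \<in> ratbox n" using q(1) p(1) by (auto simp: ratbox_def)
          then show "ereal (quot \<phi> s (r + q k) (p k)) \<le> S n" unfolding S_def by (rule SUP_upper2) simp
        qed
        then show ?thesis by (intro tendsto_upperbound[OF lim]) auto
      qed
      then have "eventually (\<lambda>(y, t). ereal (quot \<phi> s y t) \<le> S n) (clarke_filter r)"
        unfolding eventually_clarke_filter by (intro exI[of _ "1 / real (Suc n)"]) auto
      then show "?l \<le> S n" by (intro Limsup_bounded) (auto elim!: eventually_mono)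
    qed
    show "(INF n. S n) \<le> ?l"
    proof (rule dense_ge)
      fix C assume "?l < C"
      from Limsup_lessD[OF this] obtain \<eta> where \<eta>: "\<eta> > 0"
        "\<And>y t. \<bar>y - r\<bar> < \<eta> \<Longrightarrow> 0 < t \<Longrightarrow> t < \<eta> \<Longrightarrow> ereal (quot \<phi> s y t) < C"
        unfolding eventually_clarke_filter by auto
      obtain n where n: "1 / real (Suc n) < \<eta>" using reals_Archimedean[OF \<eta>(1)] by (auto simp: inverse_eq_divide)
      have "S n \<le> C" unfolding S_def
      proof (rule SUP_least, clarify)
        fix y t assume "(y, t) \<in> ratbox n"
        then have "\<bar>(r + y) - r\<bar> < \<eta>" "0 < t" "t < \<eta>" using n by (auto simp: ratbox_def)
        then show "ereal (quot \<phi> s (r + y) t) \<le> C" using \<eta>(2) less_imp_le by blast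
      qed
      then show "(INF n. S n) \<le> C" by (rule INF_lower2[OF UNIV_I])
    qed
  qed
  then have "ereal (clarke_deriv \<phi> r s) = (INF n. S n)" using clarke_deriv_Limsup[OF \<phi>] by simp
  then show ?thesis unfolding S_def by (metis real_of_ereal.simps(1))
qed

lemma clarke_deriv_measurable:
  fixes j :: "'x \<Rightarrow> real \<Rightarrow> real"
  assumes j: "\<And>r. (\<lambda>x. j x r) \<in> borel_measurable M" and lip: "\<And>x. locally_lipschitz (j x)"
    and u [measurable]: "u \<in> borel_measurable M" and v [measurable]: "v \<in> borel_measurable M"
  shows "(\<lambda>x. clarke_deriv (j x) (u x) (v x)) \<in> borel_measurable M"
proof -
  note cont = locally_lipschitz_continuous[OF lip]
  have q: "(\<lambda>x. quot (j x) (v x) (u x + y) t) \<in> borel_measurable M" for y t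
    unfolding quot_def by (intro borel_measurable_divide borel_measurable_diff measurable_superposition[OF j cont]) measurable
  have "(\<lambda>x. INF n. SUP p\<in>ratbox n. ereal (quot (j x) (v x) (u x + fst p) (snd p))) \<in> borel_measurable M"
    using q countable_ratbox by (intro borel_measurable_INF borel_measurable_SUP) auto
  then show ?thesis unfolding clarke_deriv_countable[OF lip] by (simp add: case_prod_unfold)
qed

text \<open>Only an upper limit is controlled, so the quotients may oscillate; their positive excess
  over the generalized derivative still vanishes. This excess is what dominated convergence is
  applied to.\<close>

lemma quot_sequence_limit:
  assumes \<phi>: "locally_lipschitz \<phi>"
  shows "(\<lambda>k. max 0 (quot \<phi> s r (1 / real (Suc k)) - clarke_deriv \<phi> r s)) \<longlonglongrightarrow> 0"
proof (rule LIMSEQ_I)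
  fix e :: real assume e: "e > 0"
  obtain \<eta> where \<eta>: "\<eta> > 0" "\<And>y t. \<bar>y - r\<bar> < \<eta> \<Longrightarrow> 0 < t \<Longrightarrow> t < \<eta> \<Longrightarrow> quot \<phi> s y t < clarke_deriv \<phi> r s + e"
    using clarke_deriv_less[OF \<phi>, of r s "clarke_deriv \<phi> r s + e"] e by auto
  obtain N where N: "1 / real (Suc N) < \<eta>" using reals_Archimedean[OF \<eta>(1)] by (auto simp: inverse_eq_divide)
  have "norm (max 0 (quot \<phi> s r (1 / real (Suc k)) - clarke_deriv \<phi> r s) - 0) < e" if "k \<ge> N" for k
  proof -
    have "1 / real (Suc k) \<le> 1 / real (Suc N)" using that by (simp add: frac_le)
    then have "quot \<phi> s r (1 / real (Suc k)) < clarke_deriv \<phi> r s + e" using \<eta> N by (intro \<eta>(2)) auto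
    then show ?thesis using e by simp
  qed
  then show "\<exists>N. \<forall>k\<ge>N. norm (max 0 (quot \<phi> s r (1 / real (Suc k)) - clarke_deriv \<phi> r s) - 0) < e" by blast
qed

section \<open>Minimisation over the space of admissible functions\<close>

text \<open>Fatou's lemma, with a convergent bound \<open>c\<close> in place of a lower limit so
  that all quantities stay real.\<close>

lemma integral_le_limit:
  fixes F :: "nat \<Rightarrow> 'x \<Rightarrow> real"
  assumes F: "\<And>k. integrable M (F k)" "\<And>k x. 0 \<le> F k x" and g: "integrable M g" "\<And>x. 0 \<le> g x"
    and lim: "AE x in M. (\<lambda>k. F k x) \<longlonglongrightarrow> g x" and c: "\<And>k. (\<integral>x. F k x \<partial>M) \<le> c k" "c \<longlonglongrightarrow> l"
  shows "(\<integral>x. g x \<partial>M) \<le> l"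
proof -
  have [measurable]: "F k \<in> borel_measurable M" for k using F(1) by auto
  have "ennreal (\<integral>x. g x \<partial>M) = (\<integral>\<^sup>+x. ennreal (g x) \<partial>M)" using g by (intro nn_integral_eq_integral[symmetric]) auto
  also have "\<dots> \<le> (\<integral>\<^sup>+x. liminf (\<lambda>k. ennreal (F k x)) \<partial>M)"
  proof (rule nn_integral_mono_AE, use lim in eventually_elim)
    fix x assume "(\<lambda>k. F k x) \<longlonglongrightarrow> g x"
    then have "(\<lambda>k. ennreal (F k x)) \<longlonglongrightarrow> ennreal (g x)" by simp
    then show "ennreal (g x) \<le> liminf (\<lambda>k. ennreal (F k x))" by (simp add: lim_imp_Liminf)
  qed
  also have "\<dots> \<le> liminf (\<lambda>k. \<integral>\<^sup>+x. ennreal (F k x) \<partial>M)" by (rule nn_integral_liminf) simp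
  also have "\<dots> \<le> liminf (\<lambda>k. ennreal (c k))"
  proof (rule Liminf_mono, rule always_eventually, rule allI)
    fix k
    have "(\<integral>\<^sup>+x. ennreal (F k x) \<partial>M) = ennreal (\<integral>x. F k x \<partial>M)" using F by (intro nn_integral_eq_integral) auto
    then show "(\<integral>\<^sup>+x. ennreal (F k x) \<partial>M) \<le> ennreal (c k)" using c(1)[of k] by (simp add: ennreal_leI)
  qed
  also have "\<dots> = ennreal l"
  proof (rule lim_imp_Liminf)
    show "(\<lambda>k. ennreal (c k)) \<longlonglongrightarrow> ennreal l" using c(2) by simp
  qed simp
  finally have "ennreal (\<integral>x. g x \<partial>M) \<le> ennreal l" .
  moreover have "0 \<le> c k" for k using order_trans[OF Bochner_Integration.integral_nonneg[of M "F k"] c(1)] F(2) by simp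
  then have "0 \<le> l" by (intro LIMSEQ_le_const[OF c(2)]) auto
  ultimately show ?thesis by (subst (asm) ennreal_le_iff)
qed

context mixed_domain
begin

lemma V0_norm_nonneg: "0 \<le> V0_norm \<Omega> v"
  by (simp add: V0_norm_def)

lemma V0_lincomb_form:
  assumes "u \<in> V" "v \<in> V"
  shows "(V0_norm \<Omega> (\<lambda>x. u x + t * v x))\<^sup>2 = (V0_norm \<Omega> u)\<^sup>2 + 2 * t * dirichlet_form \<Omega> u v + t\<^sup>2 * (V0_norm \<Omega> v)\<^sup>2"
proof -
  note s = V0_square_integrable(2)[OF assms(1)] V0_square_integrable(2)[OF assms(2)]
  have "V0_norm \<Omega> (\<lambda>x. u x + t * v x) = l2_norm L (\<lambda>x. D u x + t *\<^sub>R D v x)" unfolding V0_norm_def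
    by (intro l2_norm_cong_AE V0_lincomb(2)[OF assms] square_integrable_measurable
        V0_square_integrable(2)[OF V0_lincomb(1)[OF assms]] square_integrable_add square_integrable_scaleR s)
  then show ?thesis using integral_norm_add_power2[OF s, of t] by (simp add: V0_norm_def dirichlet_form_def)
qed

definition quadratic :: "(('a \<Rightarrow> real) \<Rightarrow> real) \<Rightarrow> ('a \<Rightarrow> real) \<Rightarrow> real" where
  "quadratic f v = (V0_norm \<Omega> v)\<^sup>2 / 2 - f v"

lemma V0_dual_lincomb:
  assumes "f \<in> V0_dual \<Omega> \<Gamma>\<^sub>1" "u \<in> V" "v \<in> V"
  shows "f (\<lambda>x. u x + t * v x) = f u + t * f v"
proof -
  have "(\<lambda>x. t * v x) \<in> V" using V0_lincomb(1)[OF V0_zero assms(3), of t] by simp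
  then show ?thesis using assms by (simp add: V0_dual_def)
qed

lemma V0_dual_bound:
  assumes "f \<in> V0_dual \<Omega> \<Gamma>\<^sub>1"
  obtains C where "C \<ge> 0" "\<And>v. v \<in> V \<Longrightarrow> \<bar>f v\<bar> \<le> C * V0_norm \<Omega> v"
proof -
  obtain C where C: "\<And>v. v \<in> V \<Longrightarrow> \<bar>f v\<bar> \<le> C * V0_norm \<Omega> v" using assms unfolding V0_dual_def by blast
  have "\<bar>f v\<bar> \<le> max C 0 * V0_norm \<Omega> v" if "v \<in> V" for v
    using C[OF that] mult_right_mono[of C "max C 0" "V0_norm \<Omega> v"] V0_norm_nonneg by fastforce
  then show ?thesis using that[of "max C 0"] by simp
qed

lemma quadratic_lincomb:
  assumes "f \<in> V0_dual \<Omega> \<Gamma>\<^sub>1" "u \<in> V" "v \<in> V"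
  shows "quadratic f (\<lambda>x. u x + t * v x) = quadratic f u + t * (dirichlet_form \<Omega> u v - f v) + t\<^sup>2 / 2 * (V0_norm \<Omega> v)\<^sup>2"
  unfolding quadratic_def V0_lincomb_form[OF assms(2,3)] V0_dual_lincomb[OF assms] by (simp add: field_simps)

lemma quadratic_bounded_below:
  assumes f: "f \<in> V0_dual \<Omega> \<Gamma>\<^sub>1"
  obtains c where "\<And>w. w \<in> V \<Longrightarrow> c \<le> quadratic f w"
proof -
  obtain C where C: "C \<ge> 0" "\<And>v. v \<in> V \<Longrightarrow> \<bar>f v\<bar> \<le> C * V0_norm \<Omega> v" using V0_dual_bound[OF f] by blast
  have "- (C\<^sup>2 / 2) \<le> quadratic f w" if "w \<in> V" for w
    using C(2)[OF that] zero_le_power2[of "V0_norm \<Omega> w - C"] unfolding quadratic_def power2_diff by (simp add: abs_le_iff field_simps)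
  then show ?thesis by (rule that)
qed

text \<open>Parallelogram identity. With \<open>d = v - u\<close>, the values at \<open>v\<close>
  and at the midpoint both come from \<open>quadratic_lincomb\<close>, for \<open>t = 1\<close> and
  \<open>t = 1 / 2\<close>. The ball about \<open>g\<close> is convex, so the midpoint stays in
  it.\<close>

lemma quadratic_midpoint:
  assumes f: "f \<in> V0_dual \<Omega> \<Gamma>\<^sub>1" and u: "u \<in> V" and v: "v \<in> V" and g: "square_integrable \<sigma> g"
    and near: "l2_norm \<sigma> (\<lambda>x. T u x - g x) \<le> \<epsilon>" "l2_norm \<sigma> (\<lambda>x. T v x - g x) \<le> \<epsilon>"
  obtains w where "w \<in> V" "l2_norm \<sigma> (\<lambda>x. T w x - g x) \<le> \<epsilon>"
    "quadratic f w = (quadratic f u + quadratic f v) / 2 - (l2_norm L (\<lambda>x. D u x - D v x))\<^sup>2 / 8"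
proof -
  define d where "d x = v x + (-1) * u x" for x
  define w where "w x = u x + (1 / 2) * d x" for x
  have d: "d \<in> V" "AE x in \<sigma>. T d x = T v x + (-1) * T u x"
    unfolding d_def[abs_def] by (rule V0_lincomb[OF v u])+
  have w: "w \<in> V" "AE x in \<sigma>. T w x = T u x + (1 / 2) * T d x"
    unfolding w_def[abs_def] by (rule V0_lincomb[OF u d(1)])+
  note su = V0_square_integrable(3)[OF u] and sv = V0_square_integrable(3)[OF v] and sw = V0_square_integrable(3)[OF w(1)]
  note sq = square_integrable_diff[OF su g] square_integrable_diff[OF sv g]
  have n: "V0_norm \<Omega> d = l2_norm L (\<lambda>x. D u x - D v x)"
    using V0_diff(2)[OF v u] l2_norm_diff_commute[of L "D u" "D v"] by (simp add: d_def[abs_def])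
  have "(\<lambda>x. u x + 1 * d x) = v" by (simp add: d_def)
  then have "quadratic f v = quadratic f u + (dirichlet_form \<Omega> u d - f d) + (V0_norm \<Omega> d)\<^sup>2 / 2"
    using quadratic_lincomb[OF f u d(1), of 1] by simp
  moreover have "quadratic f w = quadratic f u + (dirichlet_form \<Omega> u d - f d) / 2 + (V0_norm \<Omega> d)\<^sup>2 / 8"
    using quadratic_lincomb[OF f u d(1), of "1 / 2"] by (simp add: w_def[abs_def] power2_eq_square)
  ultimately have "quadratic f w = (quadratic f u + quadratic f v) / 2 - (l2_norm L (\<lambda>x. D u x - D v x))\<^sup>2 / 8"
    unfolding n by (simp add: field_simps)
  moreover have "l2_norm \<sigma> (\<lambda>x. T w x - g x) \<le> \<epsilon>"
  proof -
    have "AE x in \<sigma>. T w x - g x = (1 / 2) * (T u x - g x) + (1 / 2) * (T v x - g x)"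
      using w(2) d(2) by eventually_elim (simp add: field_simps)
    then have "l2_norm \<sigma> (\<lambda>x. T w x - g x) = l2_norm \<sigma> (\<lambda>x. (1 / 2) * (T u x - g x) + (1 / 2) * (T v x - g x))"
      by (intro l2_norm_cong_AE square_integrable_measurable square_integrable_add square_integrable_cmult square_integrable_diff su sv sw g)
    also have "\<dots> \<le> l2_norm \<sigma> (\<lambda>x. (1 / 2) * (T u x - g x)) + l2_norm \<sigma> (\<lambda>x. (1 / 2) * (T v x - g x))"
      by (intro l2_norm_triangle square_integrable_cmult sq)
    also have "\<dots> \<le> \<epsilon>" using near unfolding l2_norm_cmult by simp
    finally show ?thesis .
  qed
  ultimately show ?thesis using w(1) that by blast
qed

lemma quadratic_tendsto:
  assumes f: "f \<in> V0_dual \<Omega> \<Gamma>\<^sub>1" and w: "\<And>k. w k \<in> V" and u: "u \<in> V"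
    and lim: "(\<lambda>k. l2_norm L (\<lambda>x. D (w k) x - D u x)) \<longlonglongrightarrow> 0"
  shows "(\<lambda>k. quadratic f (w k)) \<longlonglongrightarrow> quadratic f u"
proof -
  obtain C where C: "C \<ge> 0" "\<And>v. v \<in> V \<Longrightarrow> \<bar>f v\<bar> \<le> C * V0_norm \<Omega> v" using V0_dual_bound[OF f] by blast
  have "(\<lambda>k. f (w k) - f u) \<longlonglongrightarrow> 0"
  proof (rule Lim_null_comparison)
    show "(\<lambda>k. C * l2_norm L (\<lambda>x. D (w k) x - D u x)) \<longlonglongrightarrow> 0" using tendsto_mult_left[OF lim, of C] by simp
    have "norm (f (w k) - f u) \<le> C * l2_norm L (\<lambda>x. D (w k) x - D u x)" for k
      using V0_dual_lincomb[OF f w[of k] u, of "-1"] C(2)[OF V0_diff(1)[OF w[of k] u]] V0_diff(2)[OF w[of k] u] by simp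
    then show "\<forall>\<^sub>F k in sequentially. norm (f (w k) - f u) \<le> C * l2_norm L (\<lambda>x. D (w k) x - D u x)" by simp
  qed
  then have "(\<lambda>k. f (w k)) \<longlonglongrightarrow> f u" by (simp add: LIM_zero_iff)
  moreover have "(\<lambda>k. V0_norm \<Omega> (w k)) \<longlonglongrightarrow> V0_norm \<Omega> u" unfolding V0_norm_def
    by (rule l2_norm_tendsto[OF V0_square_integrable(2)[OF w] V0_square_integrable(2)[OF u] lim])
  ultimately show ?thesis unfolding quadratic_def by (intro tendsto_intros) auto
qed

text \<open>Closed convex neighbourhoods of \<open>g\<close> in trace space replace weak compactness: near-minimisers
  of the quadratic part over functions with trace close to \<open>g\<close> form a Cauchy sequence by the
  parallelogram identity.\<close>

lemma quadratic_limit: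
  assumes f: "f \<in> V0_dual \<Omega> \<Gamma>\<^sub>1" and v: "\<And>k. v k \<in> V" and g: "square_integrable \<sigma> g"
    and lim: "(\<lambda>k. l2_norm \<sigma> (\<lambda>x. T (v k) x - g x)) \<longlonglongrightarrow> 0" and B: "\<And>k. quadratic f (v k) \<le> B"
  obtains u where "u \<in> V" "AE x in \<sigma>. T u x = g x" "\<And>e. e > 0 \<Longrightarrow> \<forall>\<^sub>F k in sequentially. quadratic f u \<le> quadratic f (v k) + e"
proof -
  obtain c where below: "\<And>w. w \<in> V \<Longrightarrow> c \<le> quadratic f w" using quadratic_bounded_below[OF f] by blast
  define e where "e N = inverse (real (Suc N))" for N
  have e: "e N > 0" "e \<longlonglongrightarrow> 0" "N \<le> M \<Longrightarrow> e M \<le> e N" for N M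
    using LIMSEQ_inverse_real_of_nat by (auto simp: e_def[abs_def] intro: le_imp_inverse_le)
  \<comment> \<open>Nested sets, each of which eventually contains \<open>v k\<close>. Their infima
    \<open>d N\<close> increase and stay below \<open>B\<close>, so they converge to some
    \<open>l\<close>.\<close>
  define W where "W N = {w \<in> V. l2_norm \<sigma> (\<lambda>x. T w x - g x) \<le> e N}" for N
  have vW: "\<forall>\<^sub>F k in sequentially. v k \<in> W N" for N
    using order_tendstoD(2)[OF lim e(1)[of N]] by eventually_elim (simp add: W_def v)
  define d where "d N = Inf (quadratic f ` W N)" for N
  have bdd: "bdd_below (quadratic f ` W N)" for N using below by (intro bdd_belowI2[of _ c]) (auto simp: W_def)
  have ne: "W N \<noteq> {}" for N using eventually_happens'[OF sequentially_bot vW[of N]] by blast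
  have d_le: "d N \<le> quadratic f w" if "w \<in> W N" for w N unfolding d_def using bdd that by (intro cInf_lower) auto
  have d_v: "\<forall>\<^sub>F k in sequentially. d N \<le> quadratic f (v k)" for N using vW[of N] by eventually_elim (rule d_le)
  have dB: "d N \<le> B" for N using eventually_happens'[OF sequentially_bot d_v[of N]] B order_trans by blast
  have mono: "incseq d"
  proof (rule incseq_SucI)
    fix N
    have "W (Suc N) \<subseteq> W N" using e(3)[of N "Suc N"] unfolding W_def by auto
    then show "d N \<le> d (Suc N)" unfolding d_def using ne bdd by (intro cInf_superset_mono image_mono) auto
  qed
  obtain l where l: "d \<longlonglongrightarrow> l" "\<And>N. d N \<le> l" using incseq_convergent[OF mono, of B] dB by blast
  have "\<exists>w\<in>W N. quadratic f w < d N + e N" for N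
    using cInf_lessD[of "quadratic f ` W N" "d N + e N"] ne[of N] e(1)[of N] by (auto simp: d_def)
  then obtain w where w: "\<And>N. w N \<in> W N" "\<And>N. quadratic f (w N) < d N + e N" by metis
  have wV: "w N \<in> V" and wg: "l2_norm \<sigma> (\<lambda>x. T (w N) x - g x) \<le> e N" for N using w(1)[of N] by (auto simp: W_def)
  \<comment> \<open>The midpoint of \<open>w i\<close> and \<open>w j\<close> still belongs to
    \<open>W N\<close>, so its value is at least \<open>d N\<close>, while both given values are
    below \<open>l + e N\<close>; the gap bounds the distance.\<close>
  have close: "(l2_norm L (\<lambda>x. D (w i) x - D (w j) x))\<^sup>2 \<le> 8 * (l + e N - d N)" if ij: "i \<ge> N" "j \<ge> N" for i j N
  proof -
    have le: "e i \<le> e N" "e j \<le> e N" using e(3) ij by blast+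
    obtain z where z: "z \<in> V" "l2_norm \<sigma> (\<lambda>x. T z x - g x) \<le> e N"
      "quadratic f z = (quadratic f (w i) + quadratic f (w j)) / 2 - (l2_norm L (\<lambda>x. D (w i) x - D (w j) x))\<^sup>2 / 8"
      using quadratic_midpoint[OF f wV wV g order_trans[OF wg le(1)] order_trans[OF wg le(2)]] by blast
    have "d N \<le> quadratic f z" using z(1,2) by (intro d_le) (simp add: W_def)
    then show ?thesis using w(2)[of i] w(2)[of j] l(2)[of i] l(2)[of j] le unfolding z(3) by argo
  qed
  have to0: "(\<lambda>N. 8 * (l + e N - d N)) \<longlonglongrightarrow> 8 * (l + 0 - l)" by (intro tendsto_intros e(2) l(1))
  obtain u where u: "u \<in> V" "(\<lambda>k. l2_norm L (\<lambda>x. D (w k) x - D u x)) \<longlonglongrightarrow> 0" "(\<lambda>k. l2_norm \<sigma> (\<lambda>x. T (w k) x - T u x)) \<longlonglongrightarrow> 0"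
  proof (rule V0_complete[OF wV])
    fix \<epsilon> :: real assume p: "\<epsilon> > 0"
    have "\<forall>\<^sub>F N in sequentially. 8 * (l + e N - d N) < \<epsilon>\<^sup>2" by (rule order_tendstoD(2)[OF to0]) (use p in simp)
    then obtain N where N: "8 * (l + e N - d N) < \<epsilon>\<^sup>2" using eventually_happens'[OF sequentially_bot] by blast
    have "l2_norm L (\<lambda>x. D (w i) x - D (w j) x) < \<epsilon>" if "i \<ge> N" "j \<ge> N" for i j
      by (rule power2_less_imp_less) (use le_less_trans[OF close[OF that] N] p in auto)
    then show "\<exists>N. \<forall>i\<ge>N. \<forall>j\<ge>N. l2_norm L (\<lambda>x. D (w i) x - D (w j) x) < \<epsilon>" by blast
  qed (rule that)
  have "(\<lambda>k. l2_norm \<sigma> (\<lambda>x. T (w k) x - g x)) \<longlonglongrightarrow> 0"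
    by (rule tendsto_sandwich[OF _ _ tendsto_const e(2)]) (use wg in auto)
  then have ae: "AE x in \<sigma>. T u x = g x"
    by (rule l2_tendsto_unique[OF V0_square_integrable(3)[OF wV] V0_square_integrable(3)[OF u(1)] g u(3)])
  have "quadratic f u \<le> l + 0"
  proof (rule LIMSEQ_le[OF quadratic_tendsto[OF f wV u(1,2)]])
    show "(\<lambda>k. l + e k) \<longlonglongrightarrow> l + 0" by (intro tendsto_intros e(2))
    show "\<exists>N. \<forall>n\<ge>N. quadratic f (w n) \<le> l + e n" using w(2) l(2) by (meson add_right_mono less_imp_le order_trans)
  qed
  then have ul: "quadratic f u \<le> l" by simp
  have "\<forall>\<^sub>F k in sequentially. quadratic f u \<le> quadratic f (v k) + \<epsilon>" if p: "\<epsilon> > 0" for \<epsilon>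
  proof -
    \<comment> \<open>The values at \<open>v k\<close> are eventually at least \<open>d N\<close>,
      and \<open>d N\<close> comes as close to \<open>l\<close> as desired.\<close>
    obtain N where N: "l - \<epsilon> < d N"
      using eventually_happens'[OF sequentially_bot order_tendstoD(1)[OF l(1), of "l - \<epsilon>"]] p by auto
    show ?thesis using d_v[of N] by eventually_elim (use N ul in linarith)
  qed
  with u(1) ae show ?thesis by (rule that)
qed

text \<open>The direct method, with \<open>J\<close> controlled through traces: a bounded sequence
  has convergent traces along a subsequence, and \<open>quadratic_limit\<close> supplies a function
  with the limit trace that is no worse in the quadratic part. Lower semicontinuity is phrased with
  a convergent bound, as in \<open>integral_le_limit\<close>.\<close>

lemma minimiser_exists:
  assumes f: "f \<in> V0_dual \<Omega> \<Gamma>\<^sub>1" and J0: "\<And>v. v \<in> V \<Longrightarrow> 0 \<le> J v"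
    and lsc: "\<And>v u c l. (\<And>k. v k \<in> V) \<Longrightarrow> u \<in> V \<Longrightarrow> (\<lambda>k::nat. l2_norm \<sigma> (\<lambda>x. T (v k) x - T u x)) \<longlonglongrightarrow> 0 \<Longrightarrow>
        (\<And>k. J (v k) \<le> c k) \<Longrightarrow> c \<longlonglongrightarrow> l \<Longrightarrow> J u \<le> l"
  obtains u where "u \<in> V" "\<And>v. v \<in> V \<Longrightarrow> quadratic f u + J u \<le> quadratic f v + J v"
proof -
  obtain C where C: "C \<ge> 0" "\<And>v. v \<in> V \<Longrightarrow> \<bar>f v\<bar> \<le> C * V0_norm \<Omega> v" using V0_dual_bound[OF f] by blast
  obtain c where below: "\<And>w. w \<in> V \<Longrightarrow> c \<le> quadratic f w" using quadratic_bounded_below[OF f] by blast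
  define E where "E v = quadratic f v + J v" for v
  define m where "m = Inf (E ` V)"
  have bdd: "bdd_below (E ` V)" using below J0 unfolding E_def by (intro bdd_belowI2[of _ c]) fastforce
  have m: "m \<le> E v" if "v \<in> V" for v unfolding m_def using bdd that by (intro cInf_lower) auto
  have "\<exists>v\<in>V. E v < m + inverse (real (Suc k))" for k
    using cInf_lessD[of "E ` V" "m + inverse (real (Suc k))"] V0_zero by (auto simp: m_def)
  then obtain v where v: "\<And>k. v k \<in> V" "\<And>k. E (v k) < m + inverse (real (Suc k))" by metis
  have qB: "quadratic f (v k) \<le> m + 1" for k
  proof -
    have "inverse (real (Suc k)) \<le> 1" by (simp add: inverse_le_1_iff)
    then show ?thesis using v(2)[of k] J0[OF v(1)[of k]] by (simp add: E_def)
  qed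
  define b where "b = \<bar>m + 1\<bar>"
  have bm: "m + 1 \<le> b" "0 \<le> b" by (auto simp: b_def)
  \<comment> \<open>Coercivity: a value at most \<open>m + 1\<close> gives
    \<open>?n\<^sup>2 / 2 \<le> b + C * ?n\<close>, which fails beyond this bound.\<close>
  have nB: "V0_norm \<Omega> (v k) \<le> 1 + 2 * b + 2 * C" for k
  proof (rule ccontr)
    let ?n = "V0_norm \<Omega> (v k)"
    assume "\<not> ?n \<le> 1 + 2 * b + 2 * C"
    then have n: "?n > 1 + 2 * b + 2 * C" by simp
    have "f (v k) \<le> C * ?n" using C(2)[OF v(1)[of k]] by (simp add: abs_le_iff)
    moreover have "?n\<^sup>2 / 2 - f (v k) \<le> b" using qB[of k] bm by (simp add: quadratic_def)
    ultimately have "?n * ?n \<le> 2 * b + 2 * (C * ?n)" unfolding power2_eq_square by argo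
    moreover have "(1 + 2 * b + 2 * C) * ?n \<le> ?n * ?n" using n by (intro mult_right_mono V0_norm_nonneg) auto
    moreover have "2 * b * 1 \<le> 2 * b * ?n" using n C bm by (intro mult_left_mono) auto
    moreover have "?n > 0" using n C bm by linarith
    ultimately show False by (simp add: distrib_right)
  qed
  obtain s :: "nat \<Rightarrow> nat" and g where s: "strict_mono s" "square_integrable \<sigma> g"
    "(\<lambda>k. l2_norm \<sigma> (\<lambda>x. T (v (s k)) x - g x)) \<longlonglongrightarrow> 0"
    by (rule V0_trace_compact[OF v(1) nB]) (rule that)
  obtain u where u: "u \<in> V" "AE x in \<sigma>. T u x = g x"
    "\<And>e. e > 0 \<Longrightarrow> \<forall>\<^sub>F k in sequentially. quadratic f u \<le> quadratic f (v (s k)) + e"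
    by (rule quadratic_limit[OF f v(1) s(2,3) qB]) (rule that)
  have "l2_norm \<sigma> (\<lambda>x. T (v (s k)) x - T u x) = l2_norm \<sigma> (\<lambda>x. T (v (s k)) x - g x)" for k
  proof (rule l2_norm_cong_AE)
    show "AE x in \<sigma>. T (v (s k)) x - T u x = T (v (s k)) x - g x" using u(2) by eventually_elim simp
  qed (intro square_integrable_measurable square_integrable_diff V0_square_integrable(3) v u s)+
  with s(3) have tr: "(\<lambda>k. l2_norm \<sigma> (\<lambda>x. T (v (s k)) x - T u x)) \<longlonglongrightarrow> 0" by simp
  have "E u \<le> m + e" if e: "e > 0" for e
  proof -
    obtain K where K: "\<And>k. k \<ge> K \<Longrightarrow> quadratic f u \<le> quadratic f (v (s k)) + e"
      using u(3)[OF e] unfolding eventually_sequentially by blast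
    \<comment> \<open>Near-minimality of the sequence and the lower bound for its quadratic part
      combine to a convergent upper bound for \<open>J\<close>; lower semicontinuity carries it to
      \<open>u\<close>. Dropping the first \<open>K\<close> terms makes the bound hold at every
      index.\<close>
    have "J u \<le> m + 0 - quadratic f u + e"
    proof (rule lsc[of "\<lambda>k. v (s (k + K))" u "\<lambda>k. m + inverse (real (Suc k)) - quadratic f u + e"])
      show "(\<lambda>k. l2_norm \<sigma> (\<lambda>x. T (v (s (k + K))) x - T u x)) \<longlonglongrightarrow> 0" by (rule LIMSEQ_ignore_initial_segment[OF tr])
      show "(\<lambda>k. m + inverse (real (Suc k)) - quadratic f u + e) \<longlonglongrightarrow> m + 0 - quadratic f u + e"
        by (intro tendsto_intros LIMSEQ_inverse_real_of_nat)
      fix k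
      have "k \<le> s (k + K)" using seq_suble[OF s(1), of "k + K"] by simp
      then have "inverse (real (Suc (s (k + K)))) \<le> inverse (real (Suc k))" by (intro le_imp_inverse_le) auto
      then show "J (v (s (k + K))) \<le> m + inverse (real (Suc k)) - quadratic f u + e"
        using v(2)[of "s (k + K)"] K[of "k + K", OF le_add2] unfolding E_def by linarith
    qed (use v u in auto)
    then show ?thesis by (simp add: E_def)
  qed
  then have "E u \<le> m" by (rule field_le_epsilon)
  with m u(1) show ?thesis using that[of u] unfolding E_def by (meson order_trans)
qed

end

section \<open>Existence of a solution of the hemivariational inequality\<close>

lemma square_integrable_mult_integrable:
  fixes f g :: "'x \<Rightarrow> real"
  assumes "square_integrable M f" "square_integrable M g"
  shows "integrable M (\<lambda>x. \<bar>f x\<bar> * \<bar>g x\<bar>)"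
  using integrable_abs[OF inner_integrable[OF assms]] by (simp add: abs_mult)

context mixed_domain
begin

text \<open>Here the properties of \<open>j\<close> hold at every point, and the consequences of (c)
  and (d), a bound for the generalized derivative and the minimum at \<open>b\<close>, are already
  extracted.\<close>

theorem hemivariational_inequality:
  fixes j :: "'a \<Rightarrow> real \<Rightarrow> real"
  assumes \<Gamma>\<^sub>3: "\<Gamma>\<^sub>3 \<in> sets \<sigma>" and j: "\<And>r. (\<lambda>x. j x r) \<in> borel_measurable (restrict_space \<sigma> \<Gamma>\<^sub>3)"
    and lip: "\<And>x. locally_lipschitz (j x)" and c: "c\<^sub>0 \<ge> 0" "c\<^sub>1 \<ge> 0"
    and growth: "\<And>x r s. \<bar>clarke_deriv (j x) r s\<bar> \<le> (c\<^sub>0 + c\<^sub>1 * \<bar>r\<bar>) * \<bar>s\<bar>"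
    and min: "\<And>x r. j x b \<le> j x r" and f: "f \<in> V0_dual \<Omega> \<Gamma>\<^sub>1" and \<alpha>: "\<alpha> > 0"
  shows "\<exists>u\<in>V. \<forall>v\<in>V. integrable (restrict_space \<sigma> \<Gamma>\<^sub>3) (\<lambda>x. clarke_deriv (j x) (T u x) (T v x)) \<and>
    dirichlet_form \<Omega> u v + \<alpha> * (\<integral>x. clarke_deriv (j x) (T u x) (T v x) \<partial>restrict_space \<sigma> \<Gamma>\<^sub>3) \<ge> f v"
proof -
  define M where "M = restrict_space \<sigma> \<Gamma>\<^sub>3"
  have fin: "finite_measure M" unfolding M_def
    by (rule finite_measure_restrict_space[OF finite_surface]) (use \<Gamma>\<^sub>3 sets.sets_into_space in blast)
  have jM: "(\<lambda>x. j x r) \<in> borel_measurable M" for r using j by (simp add: M_def)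
  note cont = locally_lipschitz_continuous[OF lip]
  have AE_M: "AE x in M. P x" if "AE x in \<sigma>. P x" for P
    unfolding M_def using that \<Gamma>\<^sub>3 by (subst AE_restrict_space_iff) auto
  have sqM: "square_integrable M h" "l2_norm M h \<le> l2_norm \<sigma> h" if "square_integrable \<sigma> h" for h :: "'a \<Rightarrow> real"
    unfolding M_def by (rule square_integrable_restrict[OF that \<Gamma>\<^sub>3])+
  \<comment> \<open>Subtracting the minimum makes the integrand nonnegative for Fatou's lemma and
    gives it an integrable bound along traces; \<open>j x b\<close> by itself may fail to be
    integrable.\<close>
  define F where "F x r = j x r - j x b" for x r
  have F0: "0 \<le> F x r" for x r using min by (simp add: F_def)
  have meas: "(\<lambda>x. F x (h x)) \<in> borel_measurable M" if "h \<in> borel_measurable M" for h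
    unfolding F_def by (intro borel_measurable_diff measurable_superposition[OF jM cont that] jM)
  have F_int: "integrable M (\<lambda>x. F x (h x))" if h: "square_integrable M h" for h
  proof (rule Bochner_Integration.integrable_bound)
    define P where "P = c\<^sub>0 + c\<^sub>1 * \<bar>b\<bar>"
    have P: "P \<ge> 0" using c by (simp add: P_def)
    show "integrable M (\<lambda>x. P * \<bar>b\<bar> + (P + c\<^sub>1 * \<bar>b\<bar>) * \<bar>h x\<bar> + c\<^sub>1 * (\<bar>h x\<bar> * \<bar>h x\<bar>))"
      by (intro Bochner_Integration.integrable_add integrable_mult_right integrable_abs l2_imp_integrable[OF fin h]
          square_integrable_mult_integrable[OF h h] finite_measure.integrable_const[OF fin])
    show "(\<lambda>x. F x (h x)) \<in> borel_measurable M" by (rule meas[OF square_integrable_measurable[OF h]])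
    have "norm (F x (h x)) \<le> norm (P * \<bar>b\<bar> + (P + c\<^sub>1 * \<bar>b\<bar>) * \<bar>h x\<bar> + c\<^sub>1 * (\<bar>h x\<bar> * \<bar>h x\<bar>))" for x
    proof -
      have "\<bar>F x (h x)\<bar> \<le> (c\<^sub>0 + c\<^sub>1 * (\<bar>b\<bar> + \<bar>h x\<bar>)) * \<bar>h x - b\<bar>"
        unfolding F_def by (rule growth_from_clarke[OF lip c(2) growth]) auto
      also have "\<dots> \<le> (c\<^sub>0 + c\<^sub>1 * (\<bar>b\<bar> + \<bar>h x\<bar>)) * (\<bar>b\<bar> + \<bar>h x\<bar>)" using c by (intro mult_left_mono) auto
      also have "\<dots> = P * \<bar>b\<bar> + (P + c\<^sub>1 * \<bar>b\<bar>) * \<bar>h x\<bar> + c\<^sub>1 * (\<bar>h x\<bar> * \<bar>h x\<bar>)" by (simp add: P_def algebra_simps)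
      finally show ?thesis by simp
    qed
    then show "AE x in M. norm (F x (h x)) \<le> norm (P * \<bar>b\<bar> + (P + c\<^sub>1 * \<bar>b\<bar>) * \<bar>h x\<bar> + c\<^sub>1 * (\<bar>h x\<bar> * \<bar>h x\<bar>))" by simp
  qed
  define J where "J v = \<alpha> * (\<integral>x. F x (T v x) \<partial>M)" for v
  have TM: "square_integrable M (T v)" if "v \<in> V" for v by (rule sqM[OF V0_square_integrable(3)[OF that]])
  note Tm = square_integrable_measurable[OF TM]
  obtain u where u: "u \<in> V" and opt: "\<And>v. v \<in> V \<Longrightarrow> quadratic f u + J u \<le> quadratic f v + J v"
  proof (rule minimiser_exists[OF f, of J])
    show "0 \<le> J v" for v unfolding J_def using \<alpha> F0 by (intro mult_nonneg_nonneg Bochner_Integration.integral_nonneg) auto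
    fix v :: "nat \<Rightarrow> 'a \<Rightarrow> real" and u and e :: "nat \<Rightarrow> real" and l
    assume v: "\<And>k. v k \<in> V" and u: "u \<in> V" and lim: "(\<lambda>k. l2_norm \<sigma> (\<lambda>x. T (v k) x - T u x)) \<longlonglongrightarrow> 0"
      and e: "\<And>k. J (v k) \<le> e k" "e \<longlonglongrightarrow> l"
    note sq = V0_square_integrable(3)
    \<comment> \<open>Convergence almost everywhere along a subsequence suffices, because the bounds
      \<open>e\<close> keep their limit along it.\<close>
    obtain r where r: "strict_mono r" "AE x in \<sigma>. (\<lambda>k. T (v (r k)) x) \<longlonglongrightarrow> T u x"
      by (rule l2_tendsto_AE_subseq[OF finite_surface sq[OF v] sq[OF u] lim])
    have "(\<integral>x. F x (T u x) \<partial>M) \<le> l / \<alpha>"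
    proof (rule integral_le_limit[of M "\<lambda>k x. F x (T (v (r k)) x)"])
      show "AE x in M. (\<lambda>k. F x (T (v (r k)) x)) \<longlonglongrightarrow> F x (T u x)"
        using AE_M[OF r(2)]
      proof eventually_elim
        fix x assume "(\<lambda>k. T (v (r k)) x) \<longlonglongrightarrow> T u x"
        then show "(\<lambda>k. F x (T (v (r k)) x)) \<longlonglongrightarrow> F x (T u x)"
          unfolding F_def by (intro tendsto_intros continuous_on_tendsto_compose[OF cont]) auto
      qed
      show "(\<integral>x. F x (T (v (r k)) x) \<partial>M) \<le> e (r k) / \<alpha>" for k
        using e(1)[of "r k"] \<alpha> by (simp add: J_def pos_le_divide_eq mult.commute)
      show "(\<lambda>k. e (r k) / \<alpha>) \<longlonglongrightarrow> l / \<alpha>"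
        using LIMSEQ_subseq_LIMSEQ[OF e(2) r(1)] \<alpha> by (intro tendsto_divide) (auto simp: o_def)
    qed (use F0 F_int[OF TM[OF v]] F_int[OF TM[OF u]] in auto)
    then show "J u \<le> l" using \<alpha> by (simp add: J_def pos_le_divide_eq mult.commute)
  qed (rule that)
  have "integrable M (\<lambda>x. clarke_deriv (j x) (T u x) (T v x)) \<and>
      dirichlet_form \<Omega> u v + \<alpha> * (\<integral>x. clarke_deriv (j x) (T u x) (T v x) \<partial>M) \<ge> f v" if v: "v \<in> V" for v
  proof -
    define C where "C x = clarke_deriv (j x) (T u x) (T v x)" for x
    \<comment> \<open>Bounds the generalized derivative and, since \<open>t k \<le> 1\<close>, all
      difference quotients; it is integrable because traces are square integrable.\<close>
    define H where "H x = c\<^sub>0 * \<bar>T v x\<bar> + c\<^sub>1 * (\<bar>T u x\<bar> * \<bar>T v x\<bar>) + c\<^sub>1 * (\<bar>T v x\<bar> * \<bar>T v x\<bar>)" for x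
    have H: "integrable M H" unfolding H_def
      by (intro Bochner_Integration.integrable_add integrable_mult_right integrable_abs l2_imp_integrable[OF fin TM]
          square_integrable_mult_integrable TM u v)
    have Hnn: "0 \<le> H x" for x unfolding H_def using c by (intro add_nonneg_nonneg mult_nonneg_nonneg) auto
    have Cm [measurable]: "C \<in> borel_measurable M"
      unfolding C_def by (rule clarke_deriv_measurable[OF jM lip Tm[OF u] Tm[OF v]])
    have CH: "\<bar>C x\<bar> \<le> H x" for x
    proof -
      have "0 \<le> c\<^sub>1 * (\<bar>T v x\<bar> * \<bar>T v x\<bar>)" using c by simp
      then show ?thesis using growth[of x "T u x" "T v x"] unfolding C_def H_def by (simp add: algebra_simps)
    qed
    have CI: "integrable M C" by (rule Bochner_Integration.integrable_bound[OF H]) (use CH Hnn in auto)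
    define t where "t k = 1 / real (Suc k)" for k
    have t: "0 < t k" "t k \<le> 1" for k by (auto simp: t_def)
    define q where "q k x = quot (j x) (T v x) (T u x) (t k)" for k x
    have qH: "\<bar>q k x\<bar> \<le> H x" for k x
    proof -
      have "\<bar>t k * T v x\<bar> \<le> \<bar>T v x\<bar>" using t[of k] by (simp add: abs_mult mult_left_le_one_le)
      then have "\<bar>T u x + t k * T v x\<bar> \<le> \<bar>T u x\<bar> + \<bar>T v x\<bar>" by linarith
      then have "\<bar>j x (T u x + t k * T v x) - j x (T u x)\<bar> \<le> (c\<^sub>0 + c\<^sub>1 * (\<bar>T u x\<bar> + \<bar>T v x\<bar>)) * \<bar>T u x + t k * T v x - T u x\<bar>"
        by (intro growth_from_clarke[OF lip c(2) growth]) auto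
      also have "\<dots> = t k * H x" using t[of k] by (simp add: H_def abs_mult algebra_simps)
      finally show ?thesis using t[of k] by (simp add: q_def quot_def abs_mult divide_le_eq mult.commute)
    qed
    have qF: "q k x = (F x (T u x + t k * T v x) - F x (T u x)) / t k" for k x
      by (simp add: q_def quot_def F_def)
    have shift: "square_integrable M (\<lambda>x. T u x + t k * T v x)" for k
      by (intro square_integrable_add square_integrable_cmult TM u v)
    have qI: "integrable M (q k)" for k unfolding qF[abs_def]
      by (intro integrable_divide Bochner_Integration.integrable_diff F_int shift TM u)
    have J_shift: "J (\<lambda>x. u x + t k * v x) = J u + \<alpha> * t k * (\<integral>x. q k x \<partial>M)" for k
    proof -
      have "(\<integral>x. F x (T (\<lambda>x. u x + t k * v x) x) \<partial>M) = (\<integral>x. F x (T u x + t k * T v x) \<partial>M)"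
      proof (rule integral_cong_AE)
        show "AE x in M. F x (T (\<lambda>x. u x + t k * v x) x) = F x (T u x + t k * T v x)"
          using AE_M[OF V0_lincomb(3)[OF u v, of "t k"]] by eventually_elim simp
      qed (intro meas Tm V0_lincomb(1)[OF u v] square_integrable_measurable[OF shift])+
      also have "\<dots> = (\<integral>x. F x (T u x) + t k * q k x \<partial>M)"
        by (rule Bochner_Integration.integral_cong) (use t(1)[of k] in \<open>auto simp: qF\<close>)
      also have "\<dots> = (\<integral>x. F x (T u x) \<partial>M) + t k * (\<integral>x. q k x \<partial>M)"
        using F_int[OF TM[OF u]] qI[of k] by simp
      finally show ?thesis by (simp add: J_def algebra_simps)
    qed
    \<comment> \<open>The quotients need not converge. They are at most \<open>C\<close> plus their
      positive excess, whose integral \<open>R k\<close> tends to 0.\<close>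
    define R where "R k = (\<integral>x. max 0 (q k x - C x) \<partial>M)" for k
    have RI: "integrable M (\<lambda>x. max 0 (q k x - C x))" for k
      using qI[of k] CI by (intro integrable_max) auto
    have R: "R \<longlonglongrightarrow> (\<integral>x. 0 \<partial>M)" unfolding R_def[abs_def]
    proof (rule integral_dominated_convergence)
      show "integrable M (\<lambda>x. 2 * H x)" using H by simp
      show "(\<lambda>x. max 0 (q k x - C x)) \<in> borel_measurable M" for k using RI[of k] by auto
      show "AE x in M. (\<lambda>k. max 0 (q k x - C x)) \<longlonglongrightarrow> 0"
        unfolding q_def C_def t_def by (intro AE_I2 quot_sequence_limit lip)
      have "norm (max 0 (q k x - C x)) \<le> 2 * H x" for k x
        using qH[of k x] CH[of x] Hnn[of x] unfolding abs_le_iff by (auto simp: max_def)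
      then show "AE x in M. norm (max 0 (q k x - C x)) \<le> 2 * H x" for k by simp
    qed simp
    have ineq: "0 \<le> (dirichlet_form \<Omega> u v - f v) + t k / 2 * (V0_norm \<Omega> v)\<^sup>2 + \<alpha> * ((\<integral>x. C x \<partial>M) + R k)" for k
    proof -
      have "0 \<le> t k * (dirichlet_form \<Omega> u v - f v) + (t k)\<^sup>2 / 2 * (V0_norm \<Omega> v)\<^sup>2 + \<alpha> * t k * (\<integral>x. q k x \<partial>M)"
        using opt[OF V0_lincomb(1)[OF u v], of "t k"] quadratic_lincomb[OF f u v, of "t k"] J_shift[of k] by simp
      also have "\<dots> = t k * ((dirichlet_form \<Omega> u v - f v) + t k / 2 * (V0_norm \<Omega> v)\<^sup>2 + \<alpha> * (\<integral>x. q k x \<partial>M))"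
        by (simp add: algebra_simps power2_eq_square)
      finally have 1: "0 \<le> (dirichlet_form \<Omega> u v - f v) + t k / 2 * (V0_norm \<Omega> v)\<^sup>2 + \<alpha> * (\<integral>x. q k x \<partial>M)"
        using t(1)[of k] by (simp add: zero_le_mult_iff)
      have "(\<integral>x. q k x \<partial>M) \<le> (\<integral>x. C x + max 0 (q k x - C x) \<partial>M)"
        by (intro integral_mono Bochner_Integration.integrable_add qI CI RI) auto
      also have "\<dots> = (\<integral>x. C x \<partial>M) + R k" unfolding R_def by (intro Bochner_Integration.integral_add CI RI)
      finally have "\<alpha> * (\<integral>x. q k x \<partial>M) \<le> \<alpha> * ((\<integral>x. C x \<partial>M) + R k)" using \<alpha> by (intro mult_left_mono) auto
      with 1 show ?thesis by linarith
    qed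
    have "t \<longlonglongrightarrow> 0" using LIMSEQ_inverse_real_of_nat by (simp add: t_def[abs_def] inverse_eq_divide)
    then have "(\<lambda>k. (dirichlet_form \<Omega> u v - f v) + t k / 2 * (V0_norm \<Omega> v)\<^sup>2 + \<alpha> * ((\<integral>x. C x \<partial>M) + R k))
        \<longlonglongrightarrow> (dirichlet_form \<Omega> u v - f v) + 0 / 2 * (V0_norm \<Omega> v)\<^sup>2 + \<alpha> * ((\<integral>x. C x \<partial>M) + (\<integral>x. 0 \<partial>M))"
      by (intro tendsto_intros R) auto
    from LIMSEQ_le_const[OF this, of 0] ineq
    have "0 \<le> (dirichlet_form \<Omega> u v - f v) + \<alpha> * (\<integral>x. C x \<partial>M)" by simp
    with CI show ?thesis unfolding C_def by simp
  qed
  with u show ?thesis unfolding M_def by blast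
qed

end

lemma locally_lipschitz_zero: "locally_lipschitz (\<lambda>_. 0)"
  unfolding locally_lipschitz_def by (intro allI exI[of _ 1] conjI exI[of _ 0] lipschitz_onI) auto

lemma clarke_deriv_const_zero: "clarke_deriv (\<lambda>_. 0) r s = 0"
proof -
  have "ereal (clarke_deriv (\<lambda>_. 0) r s) = ereal 0"
    unfolding clarke_deriv_Limsup[OF locally_lipschitz_zero] quot_def
    using clarke_filter_nontrivial[of r] by (simp add: case_prod_unfold Limsup_const zero_ereal_def)
  then show ?thesis by simp
qed

text \<open>Integrability belongs to the claim, since the integral of a nonintegrable function is 0
  by convention and the inequality alone would then lose its meaning.\<close>

theorem theorem4:
  fixes \<Omega> \<Gamma>\<^sub>1 \<Gamma>\<^sub>2 \<Gamma>\<^sub>3 :: "(real ^ 'n) set"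
    and j :: "real ^ 'n \<Rightarrow> real \<Rightarrow> real"
    and f :: "(real ^ 'n \<Rightarrow> real) \<Rightarrow> real"
    and \<alpha> :: real
  assumes domain: "open \<Omega>" "connected \<Omega>" "\<Omega> \<noteq> {}" "bounded \<Omega>" "lipschitz_boundary \<Omega>"
    and portions: "\<Gamma>\<^sub>1 \<union> \<Gamma>\<^sub>2 \<union> \<Gamma>\<^sub>3 = frontier \<Omega>"
      "\<Gamma>\<^sub>1 \<inter> \<Gamma>\<^sub>2 = {}" "\<Gamma>\<^sub>1 \<inter> \<Gamma>\<^sub>3 = {}" "\<Gamma>\<^sub>2 \<inter> \<Gamma>\<^sub>3 = {}"
      "\<Gamma>\<^sub>1 \<in> sets (surface_measure \<Omega>)" "\<Gamma>\<^sub>2 \<in> sets (surface_measure \<Omega>)"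
      "\<Gamma>\<^sub>3 \<in> sets (surface_measure \<Omega>)"
      "emeasure (surface_measure \<Omega>) \<Gamma>\<^sub>1 > 0" "emeasure (surface_measure \<Omega>) \<Gamma>\<^sub>2 > 0"
      "emeasure (surface_measure \<Omega>) \<Gamma>\<^sub>3 > 0"
    and a: "\<forall>r. (\<lambda>x. j x r) \<in> borel_measurable (restrict_space (surface_measure \<Omega>) \<Gamma>\<^sub>3)"
    and b: "AE x in restrict_space (surface_measure \<Omega>) \<Gamma>\<^sub>3. locally_lipschitz (j x)"
    and c: "\<exists>c\<^sub>0 c\<^sub>1. c\<^sub>0 \<ge> 0 \<and> c\<^sub>1 \<ge> 0 \<and>
      (AE x in restrict_space (surface_measure \<Omega>) \<Gamma>\<^sub>3.
         \<forall>r. \<forall>\<zeta> \<in> clarke_gradient (j x) r. \<bar>\<zeta>\<bar> \<le> c\<^sub>0 + c\<^sub>1 * \<bar>r\<bar>)"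
    and d: "\<exists>b. AE x in restrict_space (surface_measure \<Omega>) \<Gamma>\<^sub>3.
      \<forall>r. clarke_deriv (j x) r (b - r) \<le> 0"
    and f: "f \<in> V0_dual \<Omega> \<Gamma>\<^sub>1"
    and \<alpha>: "\<alpha> > 0"
  shows "\<exists>u \<in> V0 \<Omega> \<Gamma>\<^sub>1. \<forall>v \<in> V0 \<Omega> \<Gamma>\<^sub>1.
    integrable (restrict_space (surface_measure \<Omega>) \<Gamma>\<^sub>3)
      (\<lambda>x. clarke_deriv (j x) (boundary_trace \<Omega> u x) (boundary_trace \<Omega> v x)) \<and>
    dirichlet_form \<Omega> u v +
      \<alpha> * (\<integral>x. clarke_deriv (j x) (boundary_trace \<Omega> u x) (boundary_trace \<Omega> v x)
            \<partial>restrict_space (surface_measure \<Omega>) \<Gamma>\<^sub>3) \<ge> f v"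
proof -
  interpret mixed_domain \<Omega> \<Gamma>\<^sub>1 by unfold_locales (use domain portions in auto)
  let ?M = "restrict_space (surface_measure \<Omega>) \<Gamma>\<^sub>3"
  have complete: "complete_measure ?M" by (rule complete_measure_restrict[OF complete_surface_measure portions(7)])
  obtain c\<^sub>0 c\<^sub>1 where c01: "c\<^sub>0 \<ge> 0" "c\<^sub>1 \<ge> 0"
    and grad: "AE x in ?M. \<forall>r. \<forall>\<zeta> \<in> clarke_gradient (j x) r. \<bar>\<zeta>\<bar> \<le> c\<^sub>0 + c\<^sub>1 * \<bar>r\<bar>" using c by blast
  obtain \<beta> where \<beta>: "AE x in ?M. \<forall>r. clarke_deriv (j x) r (\<beta> - r) \<le> 0" using d by blast
  \<comment> \<open>Off a null set \<open>j x\<close> is replaced by the zero function, so that the hypotheses hold everywhere;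
    completeness of the surface measure keeps measurability.\<close>
  define good where "good x \<longleftrightarrow> locally_lipschitz (j x) \<and>
    (\<forall>r s. \<bar>clarke_deriv (j x) r s\<bar> \<le> (c\<^sub>0 + c\<^sub>1 * \<bar>r\<bar>) * \<bar>s\<bar>) \<and> (\<forall>r. j x \<beta> \<le> j x r)" for x
  have ae: "AE x in ?M. good x"
    using b grad \<beta>
  proof eventually_elim
    fix x assume "locally_lipschitz (j x)" "\<forall>r. \<forall>\<zeta> \<in> clarke_gradient (j x) r. \<bar>\<zeta>\<bar> \<le> c\<^sub>0 + c\<^sub>1 * \<bar>r\<bar>"
      "\<forall>r. clarke_deriv (j x) r (\<beta> - r) \<le> 0"
    then show "good x" unfolding good_def
      by (intro conjI allI clarke_deriv_abs_le minimum_at_attractor[of "j x" \<beta>]) auto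
  qed
  define i where "i x = (if good x then j x else (\<lambda>_. 0))" for x
  have ij: "AE x in ?M. i x = j x" using ae by eventually_elim (simp add: i_def)
  have i_meas: "(\<lambda>x. i x r) \<in> borel_measurable ?M" for r
  proof (rule complete_measurable_AE[OF complete])
    show "(\<lambda>x. j x r) \<in> borel_measurable ?M" using a by blast
    show "AE x in ?M. j x r = i x r" using ij by eventually_elim simp
  qed
  have i_lip: "locally_lipschitz (i x)" for x by (auto simp: i_def good_def locally_lipschitz_zero)
  have i_growth: "\<bar>clarke_deriv (i x) r s\<bar> \<le> (c\<^sub>0 + c\<^sub>1 * \<bar>r\<bar>) * \<bar>s\<bar>" for x r s
    using c01 by (auto simp: i_def good_def clarke_deriv_const_zero)
  have i_min: "i x \<beta> \<le> i x r" for x r by (auto simp: i_def good_def)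
  obtain u where u: "u \<in> V" and ineq: "\<And>v. v \<in> V \<Longrightarrow> integrable ?M (\<lambda>x. clarke_deriv (i x) (T u x) (T v x)) \<and>
      dirichlet_form \<Omega> u v + \<alpha> * (\<integral>x. clarke_deriv (i x) (T u x) (T v x) \<partial>?M) \<ge> f v"
    using hemivariational_inequality[OF portions(7) i_meas i_lip c01 i_growth i_min f \<alpha>] by blast
  have "integrable ?M (\<lambda>x. clarke_deriv (j x) (T u x) (T v x)) \<and>
      dirichlet_form \<Omega> u v + \<alpha> * (\<integral>x. clarke_deriv (j x) (T u x) (T v x) \<partial>?M) \<ge> f v" if v: "v \<in> V" for v
  proof -
    have eq: "AE x in ?M. clarke_deriv (i x) (T u x) (T v x) = clarke_deriv (j x) (T u x) (T v x)"
      using ij by eventually_elim simp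
    have mi: "(\<lambda>x. clarke_deriv (i x) (T u x) (T v x)) \<in> borel_measurable ?M" using ineq[OF v] by auto
    \<comment> \<open>Completeness again: the integrand for \<open>j\<close> agrees almost
      everywhere with a measurable one.\<close>
    note mj = complete_measurable_AE[OF complete mi eq]
    show ?thesis using ineq[OF v] integrable_cong_AE[OF mi mj eq] integral_cong_AE[OF mi mj eq] by simp
  qed
  with u show ?thesis by blast
qed

end
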